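(* Let $m,n,N$ be positive integers, let $U$ be any $\mathfrak{gl}_m$-module and let $V$ be any $\mathfrak{gl}_n$-module (over $\mathbb{C}$). Let $U\boxtimes V$ be the $\mathfrak{gl}_{m+n}$-module parabolically induced from the $\mathfrak{gl}_m\oplus\mathfrak{gl}_n$-module $U\otimes V$, let $\mathfrak{q}\subset\mathfrak{gl}_{m+n}$ be the span of the matrix units $E_{ab}$ with $a\in\{m+1,\ldots,m+n\}$ and $b\in\{1,\ldots,m\}$, and let $$\mathcal{E}_N(U\boxtimes V)_{\mathfrak{q}}=\mathcal{E}_N(U\boxtimes V)\,/\,\mathfrak{q}\cdot\mathcal{E}_N(U\boxtimes V)$$ be the space of $\mathfrak{q}$-coinvariants, with its commuting actions of $\mathfrak{gl}_m\oplus\mathfrak{gl}_n$ and of the degenerate affine Hecke algebra $\mathfrak{H}_N$. Then the bimodule $\mathcal{E}_N(U\boxtimes V)_{\mathfrak{q}}$ of $\mathfrak{gl}_m\oplus\mathfrak{gl}_n$ and $\mathfrak{H}_N$ is equivalent (isomorphic) to $$\bigoplus_{K=0}^{N}\operatorname{Ind}_{\mathfrak{H}_{K,N-K}}^{\mathfrak{H}_N}\ \mathcal{E}_K(U)\otimes\mathcal{E}_{N-K}^{\,-m}(V)\,.$$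
   Context: All algebras and vector spaces are over $\mathbb{C}$. $\mathfrak{S}_N$ is the symmetric group, $\sigma_{pq}\in\mathfrak{S}_N$ is the transposition of $p$ and $q$, and $\sigma_p=\sigma_{p,p+1}$. Degenerate affine Hecke algebra: $\mathfrak{H}_N$ is the associative algebra generated by the group algebra $\mathbb{C}\mathfrak{S}_N$ and pairwise commuting elements $u_1,\ldots,u_N$ subject to $\sigma_p u_q=u_q\sigma_p$ for $q\neq p,p+1$, and $\sigma_p u_p=u_{p+1}\sigma_p-1$ ($p=1,\ldots,N-1$). Put $z_p=u_p-\sigma_{1p}-\ldots-\sigma_{p-1,p}$ for $p=1,\ldots,N$; the algebra $\mathfrak{H}_N$ is generated by $\mathfrak{S}_N$ and $z_1,\ldots,z_N$. By convention $\mathfrak{H}_0=\mathbb{C}$. Functor $\mathcal{E}_N$: for a positive integer $k$ and a $\mathfrak{gl}_k$-module $M$, $\mathcal{E}_N(M)=(\mathbb{C}^k)^{\otimes N}\otimes M$ as a $\mathfrak{gl}_k$-module (diagonal action, $\mathbb{C}^k$ being the natural module). The algebra $\mathfrak{H}_N$ acts on it, commuting with $\mathfrak{gl}_k$, as follows: $\mathfrak{S}_N$ permutes the $N$ tensor factors $\mathbb{C}^k$, and $z_p$ acts as $\sum_{a,b=1}^k E_{ab}^{(p)}\otimes E_{ba}$, where $E_{ab}$ are the matrix units and $E_{ab}^{(p)}$ is $E_{ab}$ acting on the $p$-th tensor factor $\mathbb{C}^k$. For $N=0$, $\mathcal{E}_0(M)=M$. For $f\in\mathbb{C}$, $\mathcal{E}_N^{\,f}(M)$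 is the same space with the same $\mathfrak{gl}_k$-action, but with the action of $\mathfrak{H}_N$ pulled back through the automorphism of $\mathfrak{H}_N$ which is identical on $\mathbb{C}\mathfrak{S}_N$ and maps $u_p\mapsto u_p+f$ for all $p$. Parabolic induction: $\mathfrak{gl}_m\oplus\mathfrak{gl}_n\subset\mathfrak{gl}_{m+n}$ is the block diagonal subalgebra: $\mathfrak{gl}_m$ is spanned by $E_{ab}$ with $1\le a,b\le m$ and $\mathfrak{gl}_n$ by $E_{ab}$ with $m+1\le a,b\le m+n$. With $\mathfrak{q}$ as in the claim (an Abelian subalgebra), $\mathfrak{p}$ is the subalgebra spanned by all matrix units not in $\mathfrak{q}$, so $\mathfrak{gl}_{m+n}=\mathfrak{p}\oplus\mathfrak{q}$. Extend the action of $\mathfrak{gl}_m\oplus\mathfrak{gl}_n$ on $U\otimes V$ to $\mathfrak{p}$ by letting $E_{ab}$ with $a\le m<b$ act as zero; then $U\boxtimes V$ is the $\mathfrak{gl}_{m+n}$-module induced from this $\mathfrak{p}$-module, i.e. $\mathrm{U}(\mathfrak{gl}_{m+n})\otimes_{\mathrm{U}(\mathfrak{p})}(U\otimes V)$. Here $\mathcal{E}_N(U\boxtimes V)=(\mathbb{C}^{m+n})^{\otimes N}\otimes(U\boxtimes V)$ is formed using $\mathfrak{gl}_{m+n}$. Since the actions of $\mathfrak{H}_N$ and $\mathfrak{gl}_{m+n}$ on it commute and $\mathfrak{gl}_m\oplus\mathfrak{gl}_n$ normalizes $\mathfrak{q}$, both $\mathfrak{H}_N$ and $\mathfrak{gl}_m\oplus\mathfrak{gl}_n$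 act on the quotient. Induction: for $0\le K\le N$, let $\mathfrak{S}_{K,N-K}\cong\mathfrak{S}_K\times\mathfrak{S}_{N-K}$ be the subgroup of $\mathfrak{S}_N$ preserving $\{1,\ldots,K\}$. The subalgebra $\mathfrak{H}_{K,N-K}\subset\mathfrak{H}_N$ generated by $\mathfrak{S}_{K,N-K}$ and $u_1,\ldots,u_N$ is naturally identified with $\mathfrak{H}_K\otimes\mathfrak{H}_{N-K}$ (the generator $u_p$ of the second factor corresponding to $u_{K+p}$). $\operatorname{Ind}_{\mathfrak{H}_{K,N-K}}^{\mathfrak{H}_N}$ is the functor $\mathfrak{H}_N\otimes_{\mathfrak{H}_{K,N-K}}(-)$; $\mathfrak{gl}_m$ and $\mathfrak{gl}_n$ act through $\mathcal{E}_K(U)$ and $\mathcal{E}_{N-K}^{\,-m}(V)$ respectively. *)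

theory Defs
  imports
    Complex_Main
    "HOL-Library.FuncSet"
    "HOL-Library.Poly_Mapping"
    "HOL-Combinatorics.Permutations"
    "HOL-Algebra.Module"
    "HOL-Algebra.QuotRing"
begin

section \<open>Complex vector spaces, quotients, tensor products\<close>

text \<open>
  Vector spaces are modules in the sense of \<open>HOL-Algebra\<close> over the ring record of the complex
  numbers.  Such a record also has fields \<open>mult\<close> and \<open>one\<close>; they are meaningful only for
  algebras, and are never referred to for a mere vector space.
\<close>

definition CC :: "complex ring"
  where "CC = \<lparr>carrier = UNIV, monoid.mult = (*), one = 1, zero = 0, add = (+)\<rparr>"

definition linear_maps ::
    "(complex, 'a, 'm) module_scheme \<Rightarrow> (complex, 'b, 'n) module_scheme \<Rightarrow> ('a \<Rightarrow> 'b) set"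
  where "linear_maps X Y = {h \<in> carrier X \<rightarrow> carrier Y.
    (\<forall>x \<in> carrier X. \<forall>y \<in> carrier X. h (x \<oplus>\<^bsub>X\<^esub> y) = h x \<oplus>\<^bsub>Y\<^esub> h y) \<and>
    (\<forall>c. \<forall>x \<in> carrier X. h (c \<odot>\<^bsub>X\<^esub> x) = c \<odot>\<^bsub>Y\<^esub> h x)}"

definition subspace_gen :: "(complex, 'a, 'm) module_scheme \<Rightarrow> 'a set \<Rightarrow> 'a set"
  where "subspace_gen X S = \<Inter> {W. submodule W CC X \<and> S \<subseteq> W}"

text \<open>
  The map \<open>x + W \<mapsto> F x + W\<close> on cosets.  It is given as a union over all representatives, so
  that no choice is involved when \<open>F\<close> preserves \<open>W\<close>.
\<close>

definition quot_map ::
    "(complex, 'a, 'm) module_scheme \<Rightarrow> 'a set \<Rightarrow> ('a \<Rightarrow> 'a) \<Rightarrow> 'a set \<Rightarrow> 'a set"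
  where "quot_map X W F C = (\<Union>x\<in>C. W +>\<^bsub>X\<^esub> F x)"

definition quot :: "(complex, 'a, 'm) module_scheme \<Rightarrow> 'a set \<Rightarrow> (complex, 'a set) module"
  where "quot X W = ring.extend (X Quot W)
    (module.fields (\<lambda>c. quot_map X W (\<lambda>x. c \<odot>\<^bsub>X\<^esub> x)))"

definition scale :: "complex \<Rightarrow> ('x \<Rightarrow>\<^sub>0 complex) \<Rightarrow> ('x \<Rightarrow>\<^sub>0 complex)"
  where "scale c f = Poly_Mapping.map (\<lambda>z. c * z) f"

definition basis :: "'x \<Rightarrow> ('x \<Rightarrow>\<^sub>0 complex)"
  where "basis x = Poly_Mapping.single x 1"

definition free_space :: "'x set \<Rightarrow> (complex, 'x \<Rightarrow>\<^sub>0 complex) module"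
  where "free_space S = \<lparr>carrier = {f. Poly_Mapping.keys f \<subseteq> S},
    monoid.mult = undefined, one = undefined, zero = 0, add = (+), smult = scale\<rparr>"

definition lin_ext :: "('x \<Rightarrow> ('y \<Rightarrow>\<^sub>0 complex)) \<Rightarrow> ('x \<Rightarrow>\<^sub>0 complex) \<Rightarrow> ('y \<Rightarrow>\<^sub>0 complex)"
  where "lin_ext h f = (\<Sum>x\<in>Poly_Mapping.keys f. scale (Poly_Mapping.lookup f x) (h x))"

definition bilinear_relators ::
    "(complex, 'a, 'm) module_scheme \<Rightarrow> (complex, 'b, 'n) module_scheme \<Rightarrow> ('a \<times> 'b \<Rightarrow>\<^sub>0 complex) set"
  where "bilinear_relators X Y =
    {basis (x \<oplus>\<^bsub>X\<^esub> x', y) - basis (x, y) - basis (x', y) | x x' y.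
       x \<in> carrier X \<and> x' \<in> carrier X \<and> y \<in> carrier Y} \<union>
    {basis (x, y \<oplus>\<^bsub>Y\<^esub> y') - basis (x, y) - basis (x, y') | x y y'.
       x \<in> carrier X \<and> y \<in> carrier Y \<and> y' \<in> carrier Y} \<union>
    {basis (c \<odot>\<^bsub>X\<^esub> x, y) - scale c (basis (x, y)) | c x y. x \<in> carrier X \<and> y \<in> carrier Y} \<union>
    {basis (x, c \<odot>\<^bsub>Y\<^esub> y) - scale c (basis (x, y)) | c x y. x \<in> carrier X \<and> y \<in> carrier Y}"

definition tensor_ker ::
    "(complex, 'a, 'm) module_scheme \<Rightarrow> (complex, 'b, 'n) module_scheme \<Rightarrow> ('a \<times> 'b \<Rightarrow>\<^sub>0 complex) set"
  where "tensor_ker X Y =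
    subspace_gen (free_space (carrier X \<times> carrier Y)) (bilinear_relators X Y)"

definition tensor ::
    "(complex, 'a, 'm) module_scheme \<Rightarrow> (complex, 'b, 'n) module_scheme \<Rightarrow>
      (complex, ('a \<times> 'b \<Rightarrow>\<^sub>0 complex) set) module"
  where "tensor X Y = quot (free_space (carrier X \<times> carrier Y)) (tensor_ker X Y)"

definition pure_tensor ::
    "(complex, 'a, 'm) module_scheme \<Rightarrow> (complex, 'b, 'n) module_scheme \<Rightarrow>
      'a \<Rightarrow> 'b \<Rightarrow> ('a \<times> 'b \<Rightarrow>\<^sub>0 complex) set"
  where "pure_tensor X Y x y =
    tensor_ker X Y +>\<^bsub>free_space (carrier X \<times> carrier Y)\<^esub> basis (x, y)"

text \<open>\<open>tensor_map X Y F G\<close> is the operator \<open>F \<otimes> G\<close> on \<open>X \<otimes> Y\<close>.\<close>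

definition tensor_map ::
    "(complex, 'a, 'm) module_scheme \<Rightarrow> (complex, 'b, 'n) module_scheme \<Rightarrow>
      ('a \<Rightarrow> 'a) \<Rightarrow> ('b \<Rightarrow> 'b) \<Rightarrow> ('a \<times> 'b \<Rightarrow>\<^sub>0 complex) set \<Rightarrow> ('a \<times> 'b \<Rightarrow>\<^sub>0 complex) set"
  where "tensor_map X Y F G =
    quot_map (free_space (carrier X \<times> carrier Y)) (tensor_ker X Y)
      (lin_ext (\<lambda>(x, y). basis (F x, G y)))"


section \<open>Algebras given by generators and relations, and their modules\<close>

text \<open>The free algebra on \<open>G\<close>: its basis consists of the words over \<open>G\<close>.\<close>

definition free_alg :: "'g set \<Rightarrow> (complex, 'g list \<Rightarrow>\<^sub>0 complex) module"
  where "free_alg G = (free_space (lists G))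
    \<lparr>monoid.mult := (\<lambda>f g. lin_ext (\<lambda>v. lin_ext (\<lambda>w. basis (v @ w)) g) f),
     one := basis []\<rparr>"

record 'g presentation =
  gens :: "'g set"
  rels :: "('g list \<Rightarrow>\<^sub>0 complex) set"

definition rel_ideal :: "'g presentation \<Rightarrow> ('g list \<Rightarrow>\<^sub>0 complex) set"
  where "rel_ideal P = Idl\<^bsub>free_alg (gens P)\<^esub> (rels P)"

definition alg :: "'g presentation \<Rightarrow> (complex, ('g list \<Rightarrow>\<^sub>0 complex) set) module"
  where "alg P = quot (free_alg (gens P)) (rel_ideal P)"

definition cls :: "'g presentation \<Rightarrow> ('g list \<Rightarrow>\<^sub>0 complex) \<Rightarrow> ('g list \<Rightarrow>\<^sub>0 complex) set"
  where "cls P x = rel_ideal P +>\<^bsub>free_alg (gens P)\<^esub> x"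

text \<open>
  The action on \<open>X\<close> of an element \<open>x\<close> of the free algebra, when each generator \<open>g\<close> acts by
  \<open>\<rho> g\<close>; a word \<open>[g, h, \<dots>]\<close> acts as \<open>\<rho> g \<circ> \<rho> h \<circ> \<dots>\<close>.
\<close>

definition eval_in ::
    "(complex, 'a, 'm) module_scheme \<Rightarrow> ('g \<Rightarrow> 'a \<Rightarrow> 'a) \<Rightarrow> ('g list \<Rightarrow>\<^sub>0 complex) \<Rightarrow> 'a \<Rightarrow> 'a"
  where "eval_in X \<rho> x v = (\<Oplus>\<^bsub>X\<^esub>w\<in>Poly_Mapping.keys x. Poly_Mapping.lookup x w \<odot>\<^bsub>X\<^esub> foldr \<rho> w v)"

text \<open>
  A left module over \<open>alg P\<close>: linear operators for the generators, satisfying the relations.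
\<close>

definition is_module ::
    "'g presentation \<Rightarrow> (complex, 'a, 'm) module_scheme \<Rightarrow> ('g \<Rightarrow> 'a \<Rightarrow> 'a) \<Rightarrow> bool"
  where "is_module P X \<rho> \<longleftrightarrow> module CC X \<and>
    (\<forall>g \<in> gens P. \<rho> g \<in> linear_maps X X) \<and>
    (\<forall>r \<in> rels P. \<forall>v \<in> carrier X. eval_in X \<rho> r v = \<zero>\<^bsub>X\<^esub>)"

text \<open>A vector space together with operators indexed by \<open>'g\<close>.\<close>

record ('g, 'a) rep = "(complex, 'a) module" +
  act :: "'g \<Rightarrow> 'a \<Rightarrow> 'a"

definition with_act :: "(complex, 'a) module \<Rightarrow> ('g \<Rightarrow> 'a \<Rightarrow> 'a) \<Rightarrow> ('g, 'a) rep"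
  where "with_act X \<rho> = module.extend X (rep.fields \<rho>)"

text \<open>
  Induction from the subalgebra \<open>B\<close> of \<open>A = alg P\<close> generated by \<open>S \<subseteq> gens P\<close>: the space
  \<open>A \<otimes>\<^sub>B X\<close> is the quotient of \<open>A \<otimes> X\<close> by the span of all \<open>ab \<otimes> v - a \<otimes> bv\<close> with \<open>b \<in> B\<close>.
  The elements of \<open>B\<close> are the classes of the elements \<open>x\<close> of the free algebra on \<open>S\<close>,
  and \<open>\<rho>\<close> gives the action of \<open>S\<close> on \<open>X\<close>.
\<close>

definition ind_ker ::
    "'g presentation \<Rightarrow> 'g set \<Rightarrow> (complex, 'a, 'm) module_scheme \<Rightarrow> ('g \<Rightarrow> 'a \<Rightarrow> 'a) \<Rightarrow>
      (('g list \<Rightarrow>\<^sub>0 complex) set \<times> 'a \<Rightarrow>\<^sub>0 complex) set set"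
  where "ind_ker P S X \<rho> = subspace_gen (tensor (alg P) X)
    {pure_tensor (alg P) X (a \<otimes>\<^bsub>alg P\<^esub> cls P x) v
       \<ominus>\<^bsub>tensor (alg P) X\<^esub> pure_tensor (alg P) X a (eval_in X \<rho> x v) | a x v.
     a \<in> carrier (alg P) \<and> x \<in> carrier (free_alg S) \<and> v \<in> carrier X}"

definition ind ::
    "'g presentation \<Rightarrow> 'g set \<Rightarrow> (complex, 'a, 'm) module_scheme \<Rightarrow> ('g \<Rightarrow> 'a \<Rightarrow> 'a) \<Rightarrow>
      (complex, (('g list \<Rightarrow>\<^sub>0 complex) set \<times> 'a \<Rightarrow>\<^sub>0 complex) set set) module"
  where "ind P S X \<rho> = quot (tensor (alg P) X) (ind_ker P S X \<rho>)"

text \<open>Left multiplication by a generator on the first factor.\<close>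

definition ind_act ::
    "'g presentation \<Rightarrow> 'g set \<Rightarrow> (complex, 'a, 'm) module_scheme \<Rightarrow> ('g \<Rightarrow> 'a \<Rightarrow> 'a) \<Rightarrow>
      'g \<Rightarrow> (('g list \<Rightarrow>\<^sub>0 complex) set \<times> 'a \<Rightarrow>\<^sub>0 complex) set set \<Rightarrow>
      (('g list \<Rightarrow>\<^sub>0 complex) set \<times> 'a \<Rightarrow>\<^sub>0 complex) set set"
  where "ind_act P S X \<rho> g = quot_map (tensor (alg P) X) (ind_ker P S X \<rho>)
    (tensor_map (alg P) X (\<lambda>a. cls P (basis [g]) \<otimes>\<^bsub>alg P\<^esub> a) (\<lambda>v. v))"

text \<open>The operator on \<open>A \<otimes>\<^sub>B X\<close> induced by an operator \<open>F\<close> on \<open>X\<close> commuting with \<open>B\<close>.\<close>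

definition ind_map ::
    "'g presentation \<Rightarrow> 'g set \<Rightarrow> (complex, 'a, 'm) module_scheme \<Rightarrow> ('g \<Rightarrow> 'a \<Rightarrow> 'a) \<Rightarrow>
      ('a \<Rightarrow> 'a) \<Rightarrow> (('g list \<Rightarrow>\<^sub>0 complex) set \<times> 'a \<Rightarrow>\<^sub>0 complex) set set \<Rightarrow>
      (('g list \<Rightarrow>\<^sub>0 complex) set \<times> 'a \<Rightarrow>\<^sub>0 complex) set set"
  where "ind_map P S X \<rho> F = quot_map (tensor (alg P) X) (ind_ker P S X \<rho>)
    (tensor_map (alg P) X (\<lambda>a. a) F)"

definition direct_sum :: "'i set \<Rightarrow> ('i \<Rightarrow> ('g, 'a) rep) \<Rightarrow> ('g, 'i \<Rightarrow> 'a) rep"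
  where "direct_sum I X = \<lparr>
    carrier = (\<Pi>\<^sub>E i\<in>I. carrier (X i)), monoid.mult = undefined, one = undefined,
    zero = (\<lambda>i\<in>I. \<zero>\<^bsub>X i\<^esub>),
    add = (\<lambda>f g. \<lambda>i\<in>I. f i \<oplus>\<^bsub>X i\<^esub> g i),
    smult = (\<lambda>c f. \<lambda>i\<in>I. c \<odot>\<^bsub>X i\<^esub> f i),
    act = (\<lambda>a f. \<lambda>i\<in>I. act (X i) a (f i))\<rparr>"


section \<open>General linear Lie algebras\<close>

text \<open>
  The pair \<open>(a, b)\<close> stands for the matrix unit \<open>E\<^sub>a\<^sub>b\<close>.  For a set \<open>G\<close> of pairs whose matrix units
  span a Lie subalgebra, \<open>gl_pres G\<close> presents its universal enveloping algebra, by the relations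
  \<open>E\<^sub>a\<^sub>b E\<^sub>c\<^sub>d - E\<^sub>c\<^sub>d E\<^sub>a\<^sub>b = \<delta>\<^sub>b\<^sub>c E\<^sub>a\<^sub>d - \<delta>\<^sub>a\<^sub>d E\<^sub>c\<^sub>b\<close>.
\<close>

definition gl_pres :: "(nat \<times> nat) set \<Rightarrow> (nat \<times> nat) presentation"
  where "gl_pres G = \<lparr>gens = G, rels =
    {basis [(a, b), (c, d)] - basis [(c, d), (a, b)]
       - ((if b = c then basis [(a, d)] else 0) - (if a = d then basis [(c, b)] else 0))
     | a b c d. (a, b) \<in> G \<and> (c, d) \<in> G}\<rparr>"

definition gl_units :: "nat \<Rightarrow> (nat \<times> nat) set"
  where "gl_units k = {1..k} \<times> {1..k}"

abbreviation gl_module :: "nat \<Rightarrow> (nat \<times> nat, 'a) rep \<Rightarrow> bool"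
  where "gl_module k M \<equiv> is_module (gl_pres (gl_units k)) M (act M)"

definition levi_units :: "nat \<Rightarrow> nat \<Rightarrow> (nat \<times> nat) set"
  where "levi_units m n = {1..m} \<times> {1..m} \<union> {m+1..m+n} \<times> {m+1..m+n}"

definition q_units :: "nat \<Rightarrow> nat \<Rightarrow> (nat \<times> nat) set"
  where "q_units m n = {m+1..m+n} \<times> {1..m}"

definition p_units :: "nat \<Rightarrow> nat \<Rightarrow> (nat \<times> nat) set"
  where "p_units m n = gl_units (m + n) - q_units m n"

text \<open>
  The action of \<open>\<pp>\<close> on \<open>U \<otimes> V\<close>; the last alternative is reached by elements of \<open>p_units m n\<close>
  only when \<open>a \<le> m < b\<close>.
\<close>

definition p_act ::
    "nat \<Rightarrow> (nat \<times> nat, 'a) rep \<Rightarrow> (nat \<times> nat, 'b) rep \<Rightarrow>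
      nat \<times> nat \<Rightarrow> ('a \<times> 'b \<Rightarrow>\<^sub>0 complex) set \<Rightarrow> ('a \<times> 'b \<Rightarrow>\<^sub>0 complex) set"
  where "p_act m U V = (\<lambda>(a, b).
    if a \<le> m \<and> b \<le> m then tensor_map U V (act U (a, b)) (\<lambda>y. y)
    else if m < a \<and> m < b then tensor_map U V (\<lambda>x. x) (act V (a - m, b - m))
    else (\<lambda>t. \<zero>\<^bsub>tensor U V\<^esub>))"

definition box ::
    "nat \<Rightarrow> nat \<Rightarrow> (nat \<times> nat, 'a) rep \<Rightarrow> (nat \<times> nat, 'b) rep \<Rightarrow>
      (nat \<times> nat, (((nat \<times> nat) list \<Rightarrow>\<^sub>0 complex) set \<times> ('a \<times> 'b \<Rightarrow>\<^sub>0 complex) set \<Rightarrow>\<^sub>0 complex) set set) rep"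
  where "box m n U V =
    (let P = gl_pres (gl_units (m + n)); W = tensor U V
     in with_act (ind P (p_units m n) W (p_act m U V)) (ind_act P (p_units m n) W (p_act m U V)))"


section \<open>The degenerate affine Hecke algebra\<close>

text \<open>
  \<open>Perm w\<close> is a permutation \<open>w\<close> of \<open>{1..N}\<close>, extended by the identity to all of \<open>nat\<close>;
  \<open>Aff p\<close> is \<open>u\<^sub>p\<close>.
\<close>

datatype hecke_gen = Perm "nat \<Rightarrow> nat" | Aff nat

abbreviation trp :: "nat \<Rightarrow> nat \<Rightarrow> nat \<Rightarrow> nat"
  where "trp \<equiv> Transposition.transpose"

definition hecke_gens :: "nat \<Rightarrow> hecke_gen set"
  where "hecke_gens N = Perm ` {w. w permutes {1..N}} \<union> Aff ` {1..N}"

definition hecke_pres :: "nat \<Rightarrow> hecke_gen presentation"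
  where "hecke_pres N = \<lparr>gens = hecke_gens N, rels =
    {basis [Perm id] - basis []} \<union>
    {basis [Perm v, Perm w] - basis [Perm (v \<circ> w)] | v w.
       v permutes {1..N} \<and> w permutes {1..N}} \<union>
    {basis [Aff p, Aff q] - basis [Aff q, Aff p] | p q. p \<in> {1..N} \<and> q \<in> {1..N}} \<union>
    {basis [Perm (trp p (p+1)), Aff q] - basis [Aff q, Perm (trp p (p+1))] | p q.
       p \<in> {1..<N} \<and> q \<in> {1..N} \<and> q \<noteq> p \<and> q \<noteq> p+1} \<union>
    {basis [Perm (trp p (p+1)), Aff p] - (basis [Aff (p+1), Perm (trp p (p+1))] - basis []) | p.
       p \<in> {1..<N}}\<rparr>"

definition parabolic_gens :: "nat \<Rightarrow> nat \<Rightarrow> hecke_gen set"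
  where "parabolic_gens K N =
    Perm ` {w. w permutes {1..N} \<and> w ` {1..K} = {1..K}} \<union> Aff ` {1..N}"


section \<open>Bimodules\<close>

text \<open>
  Operators of matrix units are indexed by \<open>Inl\<close>, those of the Hecke algebra by \<open>Inr\<close>.
\<close>

type_synonym 'a birep = "((nat \<times> nat) + hecke_gen, 'a) rep"

definition bimodule :: "nat \<Rightarrow> nat \<Rightarrow> nat \<Rightarrow> 'a birep \<Rightarrow> bool"
  where "bimodule m n N X \<longleftrightarrow>
    is_module (gl_pres (levi_units m n)) X (\<lambda>e. act X (Inl e)) \<and>
    is_module (hecke_pres N) X (\<lambda>h. act X (Inr h)) \<and>
    (\<forall>e \<in> levi_units m n. \<forall>h \<in> hecke_gens N. \<forall>x \<in> carrier X.
       act X (Inl e) (act X (Inr h) x) = act X (Inr h) (act X (Inl e) x))"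

definition bimodule_equivalent :: "nat \<Rightarrow> nat \<Rightarrow> nat \<Rightarrow> 'a birep \<Rightarrow> 'b birep \<Rightarrow> bool"
  where "bimodule_equivalent m n N X Y \<longleftrightarrow> bimodule m n N X \<and> bimodule m n N Y \<and>
    (\<exists>h \<in> linear_maps X Y. bij_betw h (carrier X) (carrier Y) \<and>
       (\<forall>g \<in> Inl ` levi_units m n \<union> Inr ` hecke_gens N. \<forall>x \<in> carrier X.
          h (act X g x) = act Y g (h x)))"


section \<open>The functor from gl-modules to bimodules\<close>

text \<open>
  The tensor power \<open>(\<complex>\<^sup>k)\<^sup>\<otimes>\<^sup>N\<close>: the multi-index \<open>i\<close> stands for \<open>e\<^bsub>i 1\<^esub> \<otimes> \<dots> \<otimes> e\<^bsub>i N\<^esub>\<close>.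
\<close>

type_synonym tens = "(nat \<Rightarrow> nat) \<Rightarrow>\<^sub>0 complex"

definition tens_pow :: "nat \<Rightarrow> nat \<Rightarrow> (complex, tens) module"
  where "tens_pow k N = free_space ({1..N} \<rightarrow>\<^sub>E {1..k})"

text \<open>\<open>E\<^sub>a\<^sub>b\<close> on the \<open>p\<close>-th tensor factor.\<close>

definition unit_at :: "nat \<Rightarrow> nat \<Rightarrow> nat \<Rightarrow> tens \<Rightarrow> tens"
  where "unit_at p a b = lin_ext (\<lambda>i. if i p = b then basis (i(p := a)) else 0)"

text \<open>The factor at position \<open>p\<close> is moved to position \<open>w p\<close>.\<close>

definition perm_factors :: "(nat \<Rightarrow> nat) \<Rightarrow> tens \<Rightarrow> tens"
  where "perm_factors w = lin_ext (\<lambda>i. basis (i \<circ> inv_into UNIV w))"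

definition E_gl ::
    "nat \<Rightarrow> nat \<Rightarrow> (nat \<times> nat, 'a) rep \<Rightarrow> nat \<times> nat \<Rightarrow>
      (tens \<times> 'a \<Rightarrow>\<^sub>0 complex) set \<Rightarrow> (tens \<times> 'a \<Rightarrow>\<^sub>0 complex) set"
  where "E_gl k N M = (\<lambda>(a, b) t.
    tensor_map (tens_pow k N) M (\<lambda>x. \<Sum>p\<in>{1..N}. unit_at p a b x) (\<lambda>y. y) t
    \<oplus>\<^bsub>tensor (tens_pow k N) M\<^esub> tensor_map (tens_pow k N) M (\<lambda>x. x) (act M (a, b)) t)"

definition E_perm ::
    "nat \<Rightarrow> nat \<Rightarrow> (nat \<times> nat, 'a) rep \<Rightarrow> (nat \<Rightarrow> nat) \<Rightarrow>
      (tens \<times> 'a \<Rightarrow>\<^sub>0 complex) set \<Rightarrow> (tens \<times> 'a \<Rightarrow>\<^sub>0 complex) set"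
  where "E_perm k N M w = tensor_map (tens_pow k N) M (perm_factors w) (\<lambda>y. y)"

definition E_z ::
    "nat \<Rightarrow> nat \<Rightarrow> (nat \<times> nat, 'a) rep \<Rightarrow> nat \<Rightarrow>
      (tens \<times> 'a \<Rightarrow>\<^sub>0 complex) set \<Rightarrow> (tens \<times> 'a \<Rightarrow>\<^sub>0 complex) set"
  where "E_z k N M p t = (\<Oplus>\<^bsub>tensor (tens_pow k N) M\<^esub>e\<in>{1..k} \<times> {1..k}.
    tensor_map (tens_pow k N) M (unit_at p (fst e) (snd e)) (act M (snd e, fst e)) t)"

text \<open>The action of \<open>u\<^sub>p = z\<^sub>p + \<sigma>\<^sub>1\<^sub>p + \<dots> + \<sigma>\<^bsub>p-1,p\<^esub>\<close>.\<close>

definition E_u ::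
    "nat \<Rightarrow> nat \<Rightarrow> (nat \<times> nat, 'a) rep \<Rightarrow> nat \<Rightarrow>
      (tens \<times> 'a \<Rightarrow>\<^sub>0 complex) set \<Rightarrow> (tens \<times> 'a \<Rightarrow>\<^sub>0 complex) set"
  where "E_u k N M p t = E_z k N M p t \<oplus>\<^bsub>tensor (tens_pow k N) M\<^esub>
    (\<Oplus>\<^bsub>tensor (tens_pow k N) M\<^esub>q\<in>{1..<p}. E_perm k N M (trp q p) t)"

definition E_functor ::
    "nat \<Rightarrow> nat \<Rightarrow> (nat \<times> nat, 'a) rep \<Rightarrow> (tens \<times> 'a \<Rightarrow>\<^sub>0 complex) set birep"
  where "E_functor k N M = with_act (tensor (tens_pow k N) M)
    (\<lambda>g. case g of
       Inl e \<Rightarrow> E_gl k N M e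
     | Inr (Perm w) \<Rightarrow> E_perm k N M w
     | Inr (Aff p) \<Rightarrow> E_u k N M p)"

text \<open>Pull-back of the Hecke action through \<open>u\<^sub>p \<mapsto> u\<^sub>p + f\<close>.\<close>

definition twist :: "complex \<Rightarrow> 'a birep \<Rightarrow> 'a birep"
  where "twist f X = X\<lparr>act := (\<lambda>g x. case g of
       Inr (Aff p) \<Rightarrow> act X g x \<oplus>\<^bsub>X\<^esub> f \<odot>\<^bsub>X\<^esub> x
     | _ \<Rightarrow> act X g x)\<rparr>"

definition coinvariants :: "nat \<Rightarrow> nat \<Rightarrow> 'a birep \<Rightarrow> 'a set birep"
  where "coinvariants m n X =
    (let Q = subspace_gen X {act X (Inl e) x | e x. e \<in> q_units m n \<and> x \<in> carrier X}
     in with_act (quot X Q) (\<lambda>g. quot_map X Q (act X g)))"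


section \<open>Induction from the parabolic subalgebra of the Hecke algebra\<close>

text \<open>
  The second component of a permutation \<open>w\<close> of \<open>{1..N}\<close> preserving \<open>{1..K}\<close>, as a permutation of
  \<open>{1..N-K}\<close>; the first component is \<open>restrict_id w {1..K}\<close>.
\<close>

definition perm_snd :: "nat \<Rightarrow> nat \<Rightarrow> (nat \<Rightarrow> nat) \<Rightarrow> nat \<Rightarrow> nat"
  where "perm_snd K N w = restrict_id (\<lambda>p. w (K + p) - K) {1..N-K}"

text \<open>
  The actions on \<open>X \<otimes> Y\<close>, where \<open>X\<close> is a \<open>gl\<^sub>m\<close>-\<open>H\<^sub>K\<close>-bimodule and \<open>Y\<close> a
  \<open>gl\<^sub>n\<close>-\<open>H\<^bsub>N-K\<^esub>\<close>-bimodule, of the matrix units in \<open>levi_units m n\<close> and of \<open>parabolic_gens K N\<close>.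
  The values at other indices play no role.
\<close>

definition outer_act ::
    "nat \<Rightarrow> nat \<Rightarrow> nat \<Rightarrow> 'a birep \<Rightarrow> 'b birep \<Rightarrow> (nat \<times> nat) + hecke_gen \<Rightarrow>
      ('a \<times> 'b \<Rightarrow>\<^sub>0 complex) set \<Rightarrow> ('a \<times> 'b \<Rightarrow>\<^sub>0 complex) set"
  where "outer_act m K N X Y g = (case g of
      Inl (a, b) \<Rightarrow>
        if a \<le> m \<and> b \<le> m then tensor_map X Y (act X (Inl (a, b))) (\<lambda>y. y)
        else tensor_map X Y (\<lambda>x. x) (act Y (Inl (a - m, b - m)))
    | Inr (Perm w) \<Rightarrow>
        tensor_map X Y (act X (Inr (Perm (restrict_id w {1..K})))) (act Y (Inr (Perm (perm_snd K N w))))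
    | Inr (Aff p) \<Rightarrow>
        if p \<le> K then tensor_map X Y (act X (Inr (Aff p))) (\<lambda>y. y)
        else tensor_map X Y (\<lambda>x. x) (act Y (Inr (Aff (p - K)))))"

definition hecke_ind ::
    "nat \<Rightarrow> nat \<Rightarrow> nat \<Rightarrow> 'a birep \<Rightarrow> 'b birep \<Rightarrow>
      ((hecke_gen list \<Rightarrow>\<^sub>0 complex) set \<times> ('a \<times> 'b \<Rightarrow>\<^sub>0 complex) set \<Rightarrow>\<^sub>0 complex) set set birep"
  where "hecke_ind m K N X Y =
    (let P = hecke_pres N; S = parabolic_gens K N; W = tensor X Y;
         \<rho> = (\<lambda>h. outer_act m K N X Y (Inr h))
     in with_act (ind P S W \<rho>)
       (\<lambda>g. case g of
          Inl e \<Rightarrow> ind_map P S W \<rho> (outer_act m K N X Y (Inl e))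
        | Inr h \<Rightarrow> ind_act P S W \<rho> h))"

end

theory Submission imports Defs begin

text \<open>
  As \<open>\<qq>\<close> is Abelian, \<open>U \<box> V\<close> is \<open>S(\<qq>) \<otimes> U \<otimes> V\<close> as a \<open>\<qq>\<close>-module, hence
  \<open>\<E>\<^sub>N(U \<box> V)\<close> is free over \<open>U(\<qq>)\<close> and its coinvariants are
  \<open>(\<complex>\<^bsup>m+n\<^esup>)\<^sup>\<otimes>\<^sup>N \<otimes> U \<otimes> V\<close> as a vector space.  A multi-index \<open>i\<close> with values in \<open>{1..m+n}\<close>
  amounts to the set of positions \<open>p\<close> with \<open>i p \<le> m\<close> (say \<open>K\<close> of them) together with a
  multi-index for each of \<open>(\<complex>\<^sup>m)\<^sup>\<otimes>\<^sup>K\<close> and \<open>(\<complex>\<^sup>n)\<^bsup>\<otimes>(N-K)\<^esup>\<close>.  When the positions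
  are \<open>1, \<dots>, K\<close>, juxtaposition embeds \<open>\<E>\<^sub>K(U) \<otimes> \<E>\<^bsub>N-K\<^esub>(V)\<close> into the coinvariants; modulo the
  image of \<open>\<qq>\<close> this map commutes with the parabolic subalgebra, with the shift of
  \<open>u\<^sub>p\<close> by \<open>-m\<close> for \<open>p > K\<close>.  So Frobenius reciprocity gives maps of the induced modules.  The
  induced module is spanned by \<open>w \<otimes> x\<close> with \<open>w\<close> in the symmetric group, where only the coset of \<open>w\<close>
  matters, and cosets correspond to the \<open>K\<close>-element sets of positions.  This yields an inverse
  on the multi-indices.

  Identities in vector spaces are checked by applying linear functionals.
\<close>

section \<open>Vector spaces and their functionals\<close>

text \<open>\<open>U\<close> and \<open>V\<close> may be infinite-dimensional, so injectivity cannot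
  come from counting dimensions; nor is a basis of the Hecke algebra or the theorem of Poincare,
  Birkhoff and Witt invoked. Freeness over the enveloping algebra of \<open>q\<close> is split in
  two. That the products span follows by moving generators past each other. Their independence is
  replaced by an explicit \<open>gl\<close>-module of words in \<open>q\<close> modulo commutators,
  to which the induced module maps by Frobenius reciprocity. Words, not symmetric tensors, carry the
  action at first because it can then be defined by recursion; that it respects commuting letters is
  proved afterwards. As a result, a linear map out of the coinvariants is given by one linear map on
  \<open>U \<otimes> V\<close> for each multi-index, without further condition. On the Hecke side
  only a spanning set of the induced module is established: a left inverse of the map from the
  direct sum is defined on multi-indices, and it is enough to compare on spanning vectors. The
  relations on the direct sum are never verified there; they are inherited along the injective map
  into the coinvariants.\<close>

lemma CC_simps [simp]:
  "carrier CC = UNIV" "x \<oplus>\<^bsub>CC\<^esub> y = x + y" "x \<otimes>\<^bsub>CC\<^esub> y = x * y"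
  "\<one>\<^bsub>CC\<^esub> = 1" "\<zero>\<^bsub>CC\<^esub> = 0"
  by (simp_all add: CC_def)

lemma cring_CC: "cring CC"
proof (rule cringI)
  have "\<exists>y. y + x = 0" for x :: complex by (rule exI[of _ "- x"]) simp
  then show "abelian_group CC" by (intro abelian_groupI) (auto simp: algebra_simps)
  show "comm_monoid CC" by (rule comm_monoidI) (auto simp: algebra_simps)
qed (auto simp: algebra_simps)

abbreviation vs :: "(complex, 'a, 'm) module_scheme \<Rightarrow> bool"
  where "vs X \<equiv> module CC X"

lemma vs_ag: "vs X \<Longrightarrow> abelian_group X"
  by (rule module.axioms(2))

text \<open>Additive inverses are left out of the hypotheses because \<open>(-1) x\<close> is one,
  by distributivity and \<open>0 x = \<zero>\<close>.\<close>

lemma vsI: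
  assumes "\<And>x y. x \<in> carrier X \<Longrightarrow> y \<in> carrier X \<Longrightarrow> x \<oplus>\<^bsub>X\<^esub> y \<in> carrier X"
    "\<zero>\<^bsub>X\<^esub> \<in> carrier X"
    "\<And>x y z. x \<in> carrier X \<Longrightarrow> y \<in> carrier X \<Longrightarrow> z \<in> carrier X \<Longrightarrow>
      (x \<oplus>\<^bsub>X\<^esub> y) \<oplus>\<^bsub>X\<^esub> z = x \<oplus>\<^bsub>X\<^esub> (y \<oplus>\<^bsub>X\<^esub> z)"
    "\<And>x y. x \<in> carrier X \<Longrightarrow> y \<in> carrier X \<Longrightarrow> x \<oplus>\<^bsub>X\<^esub> y = y \<oplus>\<^bsub>X\<^esub> x"
    "\<And>x. x \<in> carrier X \<Longrightarrow> \<zero>\<^bsub>X\<^esub> \<oplus>\<^bsub>X\<^esub> x = x"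
    "\<And>c x. x \<in> carrier X \<Longrightarrow> c \<odot>\<^bsub>X\<^esub> x \<in> carrier X"
    "\<And>x. x \<in> carrier X \<Longrightarrow> 0 \<odot>\<^bsub>X\<^esub> x = \<zero>\<^bsub>X\<^esub>"
    "\<And>c d x. x \<in> carrier X \<Longrightarrow> (c + d) \<odot>\<^bsub>X\<^esub> x = c \<odot>\<^bsub>X\<^esub> x \<oplus>\<^bsub>X\<^esub> d \<odot>\<^bsub>X\<^esub> x"
    "\<And>c x y. x \<in> carrier X \<Longrightarrow> y \<in> carrier X \<Longrightarrow> c \<odot>\<^bsub>X\<^esub> (x \<oplus>\<^bsub>X\<^esub> y) = c \<odot>\<^bsub>X\<^esub> x \<oplus>\<^bsub>X\<^esub> c \<odot>\<^bsub>X\<^esub> y"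
    "\<And>c d x. x \<in> carrier X \<Longrightarrow> (c * d) \<odot>\<^bsub>X\<^esub> x = c \<odot>\<^bsub>X\<^esub> (d \<odot>\<^bsub>X\<^esub> x)"
    "\<And>x. x \<in> carrier X \<Longrightarrow> 1 \<odot>\<^bsub>X\<^esub> x = x"
  shows "vs X"
proof (rule moduleI[OF cring_CC])
  have "\<exists>y\<in>carrier X. y \<oplus>\<^bsub>X\<^esub> x = \<zero>\<^bsub>X\<^esub>" if "x \<in> carrier X" for x
    using assms(8)[of x "-1" 1] assms(6)[of x "-1"] assms(7)[of x] assms(11)[of x] that by auto
  then show "abelian_group X"
    by (intro abelian_groupI) (use assms in auto)
qed (use assms in auto)

lemma vs_add [simp]: "vs X \<Longrightarrow> x \<in> carrier X \<Longrightarrow> y \<in> carrier X \<Longrightarrow> x \<oplus>\<^bsub>X\<^esub> y \<in> carrier X"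
  by (simp add: abelian_monoid.a_closed abelian_group.axioms(1) vs_ag)

lemma vs_zero [simp]: "vs X \<Longrightarrow> \<zero>\<^bsub>X\<^esub> \<in> carrier X"
  by (simp add: abelian_monoid.zero_closed abelian_group.axioms(1) vs_ag)

lemma vs_minus [simp]: "vs X \<Longrightarrow> x \<in> carrier X \<Longrightarrow> \<ominus>\<^bsub>X\<^esub> x \<in> carrier X"
  by (simp add: abelian_group.a_inv_closed vs_ag)

lemma vs_diff [simp]: "vs X \<Longrightarrow> x \<in> carrier X \<Longrightarrow> y \<in> carrier X \<Longrightarrow> x \<ominus>\<^bsub>X\<^esub> y \<in> carrier X"
  by (simp add: a_minus_def)

lemma vs_smult [simp]: "vs X \<Longrightarrow> x \<in> carrier X \<Longrightarrow> c \<odot>\<^bsub>X\<^esub> x \<in> carrier X"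
  by (simp add: module.smult_closed)

lemma vs_finsum [simp]:
  "vs X \<Longrightarrow> (\<And>a. a \<in> A \<Longrightarrow> g a \<in> carrier X) \<Longrightarrow> (\<Oplus>\<^bsub>X\<^esub>a\<in>A. g a) \<in> carrier X"
  by (rule abelian_monoid.finsum_closed[OF abelian_group.axioms(1)[OF vs_ag]]) auto

lemma vs_smult_0 [simp]: "vs X \<Longrightarrow> x \<in> carrier X \<Longrightarrow> 0 \<odot>\<^bsub>X\<^esub> x = \<zero>\<^bsub>X\<^esub>"
  using module.smult_l_null[of CC X x] by simp

lemma vs_smult_m1: "vs X \<Longrightarrow> x \<in> carrier X \<Longrightarrow> (-1) \<odot>\<^bsub>X\<^esub> x = \<ominus>\<^bsub>X\<^esub> x"
proof -
  assume X: "vs X" "x \<in> carrier X"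
  interpret module CC X by fact
  have "(-1) \<odot>\<^bsub>X\<^esub> x \<oplus>\<^bsub>X\<^esub> x = \<zero>\<^bsub>X\<^esub>"
    using smult_l_distr[of "-1" 1 x] X smult_one[of x] by simp
  then show ?thesis using X minus_equality[of "(-1) \<odot>\<^bsub>X\<^esub> x" x] by simp
qed

section \<open>Subspaces and linear maps\<close>

lemma submoduleI:
  assumes "vs X" "W \<subseteq> carrier X" "\<zero>\<^bsub>X\<^esub> \<in> W"
    "\<And>x y. x \<in> W \<Longrightarrow> y \<in> W \<Longrightarrow> x \<oplus>\<^bsub>X\<^esub> y \<in> W" "\<And>c x. x \<in> W \<Longrightarrow> c \<odot>\<^bsub>X\<^esub> x \<in> W"
  shows "submodule W CC X"
  by (rule module.submoduleI[OF assms(1)])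
    (use assms in \<open>auto simp: vs_smult_m1[OF assms(1), symmetric] subset_iff\<close>)

lemma submoduleD:
  assumes "vs X" "submodule W CC X"
  shows "x \<in> W \<Longrightarrow> x \<in> carrier X" "\<zero>\<^bsub>X\<^esub> \<in> W"
    "x \<in> W \<Longrightarrow> y \<in> W \<Longrightarrow> x \<oplus>\<^bsub>X\<^esub> y \<in> W" "x \<in> W \<Longrightarrow> c \<odot>\<^bsub>X\<^esub> x \<in> W"
    "x \<in> W \<Longrightarrow> \<ominus>\<^bsub>X\<^esub> x \<in> W" "x \<in> W \<Longrightarrow> y \<in> W \<Longrightarrow> x \<ominus>\<^bsub>X\<^esub> y \<in> W"
  using module.submoduleE[OF assms] subgroup.one_closed[OF submodule.axioms(1)[OF assms(2)]]
  by (auto simp: a_minus_def)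

lemma submodule_finsum:
  assumes "vs X" "submodule W CC X" "finite A" "\<And>a. a \<in> A \<Longrightarrow> g a \<in> W"
  shows "(\<Oplus>\<^bsub>X\<^esub>a\<in>A. g a) \<in> W"
proof -
  interpret module CC X by fact
  show ?thesis using assms(3,4)
  proof (induction A)
    case (insert a A)
    then have "g a \<in> carrier X" "g \<in> A \<rightarrow> carrier X"
      using submoduleD(1)[OF assms(1,2)] by auto
    then show ?case using insert submoduleD(3)[OF assms(1,2)] by simp
  qed (simp add: submoduleD(2)[OF assms(1,2)])
qed

lemma linear_mapsI:
  assumes "\<And>x. x \<in> carrier X \<Longrightarrow> F x \<in> carrier Y"
    "\<And>x y. x \<in> carrier X \<Longrightarrow> y \<in> carrier X \<Longrightarrow> F (x \<oplus>\<^bsub>X\<^esub> y) = F x \<oplus>\<^bsub>Y\<^esub> F y"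
    "\<And>c x. x \<in> carrier X \<Longrightarrow> F (c \<odot>\<^bsub>X\<^esub> x) = c \<odot>\<^bsub>Y\<^esub> F x"
  shows "F \<in> linear_maps X Y"
  using assms by (auto simp: linear_maps_def)

lemma lin_closed: "F \<in> linear_maps X Y \<Longrightarrow> x \<in> carrier X \<Longrightarrow> F x \<in> carrier Y"
  and lin_add: "F \<in> linear_maps X Y \<Longrightarrow> x \<in> carrier X \<Longrightarrow> y \<in> carrier X \<Longrightarrow> F (x \<oplus>\<^bsub>X\<^esub> y) = F x \<oplus>\<^bsub>Y\<^esub> F y"
  and lin_smult: "F \<in> linear_maps X Y \<Longrightarrow> x \<in> carrier X \<Longrightarrow> F (c \<odot>\<^bsub>X\<^esub> x) = c \<odot>\<^bsub>Y\<^esub> F x"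
  by (auto simp: linear_maps_def)

lemma lin_zero: "vs X \<Longrightarrow> vs Y \<Longrightarrow> F \<in> linear_maps X Y \<Longrightarrow> F \<zero>\<^bsub>X\<^esub> = \<zero>\<^bsub>Y\<^esub>"
  using lin_smult[of F X Y "\<zero>\<^bsub>X\<^esub>" 0] by (simp add: lin_closed)

lemma lin_minus: "vs X \<Longrightarrow> vs Y \<Longrightarrow> F \<in> linear_maps X Y \<Longrightarrow> x \<in> carrier X \<Longrightarrow> F (\<ominus>\<^bsub>X\<^esub> x) = \<ominus>\<^bsub>Y\<^esub> F x"
  using lin_smult[of F X Y x "-1"] by (simp add: lin_closed vs_smult_m1)

lemma lin_diff: "vs X \<Longrightarrow> vs Y \<Longrightarrow> F \<in> linear_maps X Y \<Longrightarrow> x \<in> carrier X \<Longrightarrow> y \<in> carrier X \<Longrightarrow>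
    F (x \<ominus>\<^bsub>X\<^esub> y) = F x \<ominus>\<^bsub>Y\<^esub> F y"
  by (simp add: a_minus_def lin_add lin_minus)

lemma lin_comp: "F \<in> linear_maps X Y \<Longrightarrow> G \<in> linear_maps Y Z \<Longrightarrow> (\<lambda>x. G (F x)) \<in> linear_maps X Z"
  by (auto simp: linear_maps_def Pi_iff)

lemma lin_id: "(\<lambda>x. x) \<in> linear_maps X X"
  by (auto simp: linear_maps_def)

text \<open>Functionals take values in the type \<open>complex\<close> and are unrestricted outside
  the carrier, so that an identity between their values is settled by ordinary arithmetic.\<close>

definition dual :: "(complex, 'a, 'm) module_scheme \<Rightarrow> ('a \<Rightarrow> complex) set"
  where "dual X = {f. (\<forall>x \<in> carrier X. \<forall>y \<in> carrier X. f (x \<oplus>\<^bsub>X\<^esub> y) = f x + f y) \<and>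
    (\<forall>c. \<forall>x \<in> carrier X. f (c \<odot>\<^bsub>X\<^esub> x) = c * f x)}"

lemma dual_add: "f \<in> dual X \<Longrightarrow> x \<in> carrier X \<Longrightarrow> y \<in> carrier X \<Longrightarrow> f (x \<oplus>\<^bsub>X\<^esub> y) = f x + f y"
  and dual_smult: "f \<in> dual X \<Longrightarrow> x \<in> carrier X \<Longrightarrow> f (c \<odot>\<^bsub>X\<^esub> x) = c * f x"
  by (auto simp: dual_def)

lemma dual_zero: "vs X \<Longrightarrow> f \<in> dual X \<Longrightarrow> f \<zero>\<^bsub>X\<^esub> = 0"
  using dual_smult[of f X "\<zero>\<^bsub>X\<^esub>" 0] by simp

lemma dual_minus: "vs X \<Longrightarrow> f \<in> dual X \<Longrightarrow> x \<in> carrier X \<Longrightarrow> f (\<ominus>\<^bsub>X\<^esub> x) = - f x"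
  using dual_smult[of f X x "-1"] by (simp add: vs_smult_m1)

lemma dual_diff: "vs X \<Longrightarrow> f \<in> dual X \<Longrightarrow> x \<in> carrier X \<Longrightarrow> y \<in> carrier X \<Longrightarrow> f (x \<ominus>\<^bsub>X\<^esub> y) = f x - f y"
  by (simp add: a_minus_def dual_add dual_minus)

lemma dual_finsum:
  assumes "vs X" "f \<in> dual X" "\<And>a. a \<in> A \<Longrightarrow> g a \<in> carrier X" "finite A"
  shows "f (\<Oplus>\<^bsub>X\<^esub>a\<in>A. g a) = (\<Sum>a\<in>A. f (g a))"
proof -
  interpret module CC X by fact
  show ?thesis using assms(4,3)
    by (induction A) (use assms(1,2) in \<open>auto simp: dual_zero dual_add Pi_iff\<close>)
qed

lemmas dual_simps = dual_add dual_smult dual_zero dual_minus dual_diff dual_finsum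

lemma dual_comp: "f \<in> dual Y \<Longrightarrow> F \<in> linear_maps X Y \<Longrightarrow> (\<lambda>x. f (F x)) \<in> dual X"
  by (auto simp: dual_def linear_maps_def Pi_iff)

text \<open>Zorn's lemma gives a subspace \<open>M\<close> maximal among those that avoid
  \<open>x\<close>. The whole space is then the direct sum of \<open>M\<close> and the line through
  \<open>x\<close>, and the functional is the coefficient of \<open>x\<close> along
  \<open>M\<close>; its value at \<open>x\<close> is 1.\<close>

lemma exists_functional:
  assumes X: "vs X" and x: "x \<in> carrier X" "x \<noteq> \<zero>\<^bsub>X\<^esub>"
  shows "\<exists>f\<in>dual X. f x \<noteq> 0"
proof -
  interpret X: module CC X by fact
  define \<A> where "\<A> = {W. submodule W CC X \<and> x \<notin> W}"
  have "\<exists>M\<in>\<A>. \<forall>W\<in>\<A>. M \<subseteq> W \<longrightarrow> W = M"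
  proof (rule subset_Zorn_nonempty)
    have "submodule {\<zero>\<^bsub>X\<^esub>} CC X"
      by (rule submoduleI[OF X]) (use X X.smult_r_null in auto)
    then show "\<A> \<noteq> {}" using x by (auto simp: \<A>_def)
  next
    fix C assume C: "C \<noteq> {}" "subset.chain \<A> C"
    then have sub: "submodule W CC X" "x \<notin> W" if "W \<in> C" for W
      using that by (auto simp: \<A>_def subset.chain_def)
    have tot: "V \<subseteq> W \<or> W \<subseteq> V" if "V \<in> C" "W \<in> C" for V W
      using C that by (auto simp: subset.chain_def)
    have "submodule (\<Union>C) CC X"
    proof (rule submoduleI[OF X])
      show "\<Union>C \<subseteq> carrier X" using submoduleD(1)[OF X sub(1)] by auto
      show "\<zero>\<^bsub>X\<^esub> \<in> \<Union>C" using C submoduleD(2)[OF X sub(1)] by auto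
      show "a \<oplus>\<^bsub>X\<^esub> b \<in> \<Union>C" if ab: "a \<in> \<Union>C" "b \<in> \<Union>C" for a b
      proof -
        obtain V W where "V \<in> C" "W \<in> C" "a \<in> V" "b \<in> W" using ab by auto
        with tot[of V W] obtain Z where "Z \<in> C" "a \<in> Z" "b \<in> Z" by auto
        then show ?thesis using submoduleD(3)[OF X sub(1)] by blast
      qed
      show "c \<odot>\<^bsub>X\<^esub> a \<in> \<Union>C" if "a \<in> \<Union>C" for a c
        using that submoduleD(4)[OF X sub(1)] by blast
    qed
    then show "\<Union>C \<in> \<A>" using sub by (auto simp: \<A>_def)
  qed
  then obtain M where M: "submodule M CC X" "x \<notin> M"
    and max: "\<And>W. submodule W CC X \<Longrightarrow> x \<notin> W \<Longrightarrow> M \<subseteq> W \<Longrightarrow> W = M"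
    unfolding \<A>_def by blast
  note MD = submoduleD[OF X M(1)]
  have ex: "\<exists>c. y \<ominus>\<^bsub>X\<^esub> c \<odot>\<^bsub>X\<^esub> x \<in> M" if y: "y \<in> carrier X" for y
  proof (cases "y \<in> M")
    case True
    have "y \<ominus>\<^bsub>X\<^esub> 0 \<odot>\<^bsub>X\<^esub> x = y" using x y X by (simp add: a_minus_def)
    then show ?thesis using True by metis
  next
    case False
    \<comment> \<open>\<open>M\<close> plus the line through \<open>y\<close> is strictly larger
      than \<open>M\<close>, so by maximality it contains \<open>x\<close>; solving that equation
      for \<open>y\<close> produces the coefficient.\<close>
    define W where "W = {v \<oplus>\<^bsub>X\<^esub> c \<odot>\<^bsub>X\<^esub> y | v c. v \<in> M}"
    have yW: "v \<oplus>\<^bsub>X\<^esub> c \<odot>\<^bsub>X\<^esub> y \<in> W" if "v \<in> M" for v c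
      using that by (auto simp: W_def)
    have "submodule W CC X"
    proof (rule submoduleI[OF X])
      show "W \<subseteq> carrier X" using MD(1) y X by (auto simp: W_def)
      have "\<zero>\<^bsub>X\<^esub> \<oplus>\<^bsub>X\<^esub> 0 \<odot>\<^bsub>X\<^esub> y = \<zero>\<^bsub>X\<^esub>" using y X by simp
      then show "\<zero>\<^bsub>X\<^esub> \<in> W" using yW[OF MD(2), of 0] by simp
      show "a \<oplus>\<^bsub>X\<^esub> b \<in> W" if ab: "a \<in> W" "b \<in> W" for a b
      proof -
        obtain v c v' c' where *: "a = v \<oplus>\<^bsub>X\<^esub> c \<odot>\<^bsub>X\<^esub> y" "v \<in> M" "b = v' \<oplus>\<^bsub>X\<^esub> c' \<odot>\<^bsub>X\<^esub> y" "v' \<in> M"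
          using ab by (auto simp: W_def)
        then have "a \<oplus>\<^bsub>X\<^esub> b = (v \<oplus>\<^bsub>X\<^esub> v') \<oplus>\<^bsub>X\<^esub> (c + c') \<odot>\<^bsub>X\<^esub> y"
          using y MD(1) X.smult_l_distr[of c c' y] by (simp add: X.M.a_ac X)
        then show ?thesis using yW[OF MD(3)] * by simp
      qed
      show "d \<odot>\<^bsub>X\<^esub> a \<in> W" if a: "a \<in> W" for a d
      proof -
        obtain v c where *: "a = v \<oplus>\<^bsub>X\<^esub> c \<odot>\<^bsub>X\<^esub> y" "v \<in> M" using a by (auto simp: W_def)
        then have "d \<odot>\<^bsub>X\<^esub> a = d \<odot>\<^bsub>X\<^esub> v \<oplus>\<^bsub>X\<^esub> (d * c) \<odot>\<^bsub>X\<^esub> y"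
          using y MD(1) X.smult_r_distr[of d v] X.smult_assoc1[of d c y] X by simp
        then show ?thesis using yW[OF MD(4)] * by simp
      qed
    qed
    moreover have "M \<subseteq> W"
    proof
      fix v assume "v \<in> M"
      then have "v \<oplus>\<^bsub>X\<^esub> 0 \<odot>\<^bsub>X\<^esub> y = v" using y X MD(1) by simp
      then show "v \<in> W" using yW[OF \<open>v \<in> M\<close>, of 0] by simp
    qed
    moreover have "y \<in> W"
    proof -
      have "\<zero>\<^bsub>X\<^esub> \<oplus>\<^bsub>X\<^esub> 1 \<odot>\<^bsub>X\<^esub> y = y" using y X X.smult_one[of y] by simp
      then show ?thesis using yW[OF MD(2), of 1] by simp
    qed
    ultimately have "x \<in> W" using max[of W] False by blast
    then obtain v c where vc: "x = v \<oplus>\<^bsub>X\<^esub> c \<odot>\<^bsub>X\<^esub> y" "v \<in> M" by (auto simp: W_def)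
    have c: "c \<noteq> 0"
    proof
      assume "c = 0"
      then have "x = v" using vc y X MD(1) by simp
      then show False using vc M by simp
    qed
    have "inverse c \<odot>\<^bsub>X\<^esub> x = inverse c \<odot>\<^bsub>X\<^esub> v \<oplus>\<^bsub>X\<^esub> (inverse c * c) \<odot>\<^bsub>X\<^esub> y"
      using vc y MD(1)[OF vc(2)] X.smult_r_distr[of "inverse c" v "c \<odot>\<^bsub>X\<^esub> y"]
        X.smult_assoc1[of "inverse c" c y] X by simp
    also have "\<dots> = inverse c \<odot>\<^bsub>X\<^esub> v \<oplus>\<^bsub>X\<^esub> y" using c y X.smult_one[of y] by simp
    finally have "y \<ominus>\<^bsub>X\<^esub> inverse c \<odot>\<^bsub>X\<^esub> x = \<ominus>\<^bsub>X\<^esub> (inverse c \<odot>\<^bsub>X\<^esub> v)"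
      using y X MD(1)[OF vc(2)]
      by (simp add: a_minus_def X.M.minus_add X.M.a_ac X.M.r_neg1 X.M.r_neg2)
    then show ?thesis using MD(4,5) vc(2) by metis
  qed
  define f where "f y = (SOME c. y \<ominus>\<^bsub>X\<^esub> c \<odot>\<^bsub>X\<^esub> x \<in> M)" for y
  have f: "y \<ominus>\<^bsub>X\<^esub> f y \<odot>\<^bsub>X\<^esub> x \<in> M" if "y \<in> carrier X" for y
    unfolding f_def by (rule someI_ex[OF ex[OF that]])
  \<comment> \<open>Two different coefficients would put a nonzero multiple of \<open>x\<close>,
    hence \<open>x\<close> itself, into \<open>M\<close>. Linearity of \<open>f\<close> then only
    needs the right candidate for each value.\<close>
  have uniq: "f y = c" if y: "y \<in> carrier X" "y \<ominus>\<^bsub>X\<^esub> c \<odot>\<^bsub>X\<^esub> x \<in> M" for y c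
  proof (rule ccontr)
    assume ne: "f y \<noteq> c"
    define d where "d = f y - c"
    have d: "d \<noteq> 0" using ne by (simp add: d_def)
    have "(y \<ominus>\<^bsub>X\<^esub> c \<odot>\<^bsub>X\<^esub> x) \<ominus>\<^bsub>X\<^esub> (y \<ominus>\<^bsub>X\<^esub> f y \<odot>\<^bsub>X\<^esub> x) \<in> M"
      using f y MD(6) by blast
    also have "(y \<ominus>\<^bsub>X\<^esub> c \<odot>\<^bsub>X\<^esub> x) \<ominus>\<^bsub>X\<^esub> (y \<ominus>\<^bsub>X\<^esub> f y \<odot>\<^bsub>X\<^esub> x) = d \<odot>\<^bsub>X\<^esub> x"
    proof -
      have "f y \<odot>\<^bsub>X\<^esub> x = d \<odot>\<^bsub>X\<^esub> x \<oplus>\<^bsub>X\<^esub> c \<odot>\<^bsub>X\<^esub> x"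
        using X.smult_l_distr[of d c x] x by (simp add: d_def)
      moreover have "c \<odot>\<^bsub>X\<^esub> x \<oplus>\<^bsub>X\<^esub> (d \<odot>\<^bsub>X\<^esub> x \<oplus>\<^bsub>X\<^esub> \<ominus>\<^bsub>X\<^esub> (c \<odot>\<^bsub>X\<^esub> x)) = d \<odot>\<^bsub>X\<^esub> x"
        using x X X.M.a_lcomm[of "c \<odot>\<^bsub>X\<^esub> x" "d \<odot>\<^bsub>X\<^esub> x" "\<ominus>\<^bsub>X\<^esub> (c \<odot>\<^bsub>X\<^esub> x)"] by (simp add: X.M.r_neg)
      ultimately show ?thesis using x y X
        by (simp add: a_minus_def X.M.minus_add X.M.a_ac X.M.r_neg1 X.M.r_neg2)
    qed
    finally have "inverse d \<odot>\<^bsub>X\<^esub> (d \<odot>\<^bsub>X\<^esub> x) \<in> M" by (rule MD(4))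
    moreover have "inverse d \<odot>\<^bsub>X\<^esub> (d \<odot>\<^bsub>X\<^esub> x) = x"
      using X.smult_assoc1[of "inverse d" d x] x d X.smult_one[of x] by simp
    ultimately show False using M by simp
  qed
  have "f \<in> dual X"
    unfolding dual_def
  proof safe
    fix y z assume yz: "y \<in> carrier X" "z \<in> carrier X"
    have "(y \<oplus>\<^bsub>X\<^esub> z) \<ominus>\<^bsub>X\<^esub> (f y + f z) \<odot>\<^bsub>X\<^esub> x = (y \<ominus>\<^bsub>X\<^esub> f y \<odot>\<^bsub>X\<^esub> x) \<oplus>\<^bsub>X\<^esub> (z \<ominus>\<^bsub>X\<^esub> f z \<odot>\<^bsub>X\<^esub> x)"
      using yz x X X.smult_l_distr[of "f y" "f z" x] by (simp add: a_minus_def X.M.minus_add X.M.a_ac)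
    then have "(y \<oplus>\<^bsub>X\<^esub> z) \<ominus>\<^bsub>X\<^esub> (f y + f z) \<odot>\<^bsub>X\<^esub> x \<in> M" using f yz MD(3) by simp
    then show "f (y \<oplus>\<^bsub>X\<^esub> z) = f y + f z" using yz X uniq by simp
  next
    fix c y assume y: "y \<in> carrier X"
    have "c \<odot>\<^bsub>X\<^esub> y \<ominus>\<^bsub>X\<^esub> (c * f y) \<odot>\<^bsub>X\<^esub> x = c \<odot>\<^bsub>X\<^esub> (y \<ominus>\<^bsub>X\<^esub> f y \<odot>\<^bsub>X\<^esub> x)"
      using y x X X.smult_r_distr[of c y "\<ominus>\<^bsub>X\<^esub> (f y \<odot>\<^bsub>X\<^esub> x)"] X.smult_assoc1[of c "f y" x]
        X.smult_r_minus[of c "f y \<odot>\<^bsub>X\<^esub> x"]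
      by (simp add: a_minus_def)
    then have "c \<odot>\<^bsub>X\<^esub> y \<ominus>\<^bsub>X\<^esub> (c * f y) \<odot>\<^bsub>X\<^esub> x \<in> M" using f[OF y] MD(4) by simp
    then show "f (c \<odot>\<^bsub>X\<^esub> y) = c * f y" using y X uniq by simp
  qed
  moreover have "f x = 1"
  proof (rule uniq)
    have "x \<ominus>\<^bsub>X\<^esub> 1 \<odot>\<^bsub>X\<^esub> x = \<zero>\<^bsub>X\<^esub>" using x X.smult_one[of x] by (simp add: a_minus_def X.M.r_neg)
    then show "x \<ominus>\<^bsub>X\<^esub> 1 \<odot>\<^bsub>X\<^esub> x \<in> M" using MD(2) by simp
  qed (rule x)
  ultimately show ?thesis by (metis zero_neq_one)
qed

lemma vs_diff_zeroD:
  assumes "vs X" "x \<in> carrier X" "y \<in> carrier X" "x \<ominus>\<^bsub>X\<^esub> y = \<zero>\<^bsub>X\<^esub>"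
  shows "x = y"
proof -
  interpret module CC X by fact
  have "x = (x \<ominus>\<^bsub>X\<^esub> y) \<oplus>\<^bsub>X\<^esub> y" using assms(2,3) by (simp add: a_minus_def M.a_assoc M.l_neg)
  then show ?thesis using assms by simp
qed

text \<open>
  Reduces identities in an arbitrary vector space to identities of complex numbers, where the
  ordinary algebra of the library is available.
\<close>

lemma vs_eqI:
  assumes "vs X" "x \<in> carrier X" "y \<in> carrier X" "\<And>f. f \<in> dual X \<Longrightarrow> f x = f y"
  shows "x = y"
proof -
  have "x \<ominus>\<^bsub>X\<^esub> y = \<zero>\<^bsub>X\<^esub>"
  proof (rule ccontr)
    assume "x \<ominus>\<^bsub>X\<^esub> y \<noteq> \<zero>\<^bsub>X\<^esub>"
    then obtain f where f: "f \<in> dual X" "f (x \<ominus>\<^bsub>X\<^esub> y) \<noteq> 0"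
      using exists_functional[of X "x \<ominus>\<^bsub>X\<^esub> y"] assms(1-3) by auto
    then show False using dual_diff[OF assms(1) f(1) assms(2,3)] assms(4)[OF f(1)] by simp
  qed
  then show ?thesis by (rule vs_diff_zeroD[OF assms(1-3)])
qed

section \<open>Constructions of linear maps and of subspaces\<close>

lemma lin_plus:
  assumes "vs Y" "F \<in> linear_maps X Y" "G \<in> linear_maps X Y"
  shows "(\<lambda>x. F x \<oplus>\<^bsub>Y\<^esub> G x) \<in> linear_maps X Y"
  by (rule linear_mapsI; (intro vs_eqI[OF assms(1)])?)
    (auto simp: assms(1) lin_closed[OF assms(2)] lin_closed[OF assms(3)] lin_add[OF assms(2)] lin_add[OF assms(3)]
      lin_smult[OF assms(2)] lin_smult[OF assms(3)] dual_simps algebra_simps)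

lemma lin_scale:
  assumes "vs Y" "F \<in> linear_maps X Y"
  shows "(\<lambda>x. c \<odot>\<^bsub>Y\<^esub> F x) \<in> linear_maps X Y"
  by (rule linear_mapsI; (intro vs_eqI[OF assms(1)])?)
    (auto simp: assms(1) lin_closed[OF assms(2)] lin_add[OF assms(2)] lin_smult[OF assms(2)] dual_simps algebra_simps)

lemma lin_const_zero:
  assumes "vs Y" shows "(\<lambda>x. \<zero>\<^bsub>Y\<^esub>) \<in> linear_maps X Y"
  by (rule linear_mapsI; (intro vs_eqI[OF assms])?) (simp_all add: assms dual_simps)

lemma lin_if:
  assumes "vs Y" "P \<Longrightarrow> F \<in> linear_maps X Y" shows "(\<lambda>x. if P then F x else \<zero>\<^bsub>Y\<^esub>) \<in> linear_maps X Y"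
  using assms lin_const_zero[of Y X] by (cases P) auto

lemma lin_sub:
  assumes "vs Y" "F \<in> linear_maps X Y" "G \<in> linear_maps X Y"
  shows "(\<lambda>x. F x \<ominus>\<^bsub>Y\<^esub> G x) \<in> linear_maps X Y"
  by (rule linear_mapsI; (intro vs_eqI[OF assms(1)])?)
    (auto simp: assms(1) lin_closed[OF assms(2)] lin_closed[OF assms(3)] lin_add[OF assms(2)] lin_add[OF assms(3)]
      lin_smult[OF assms(2)] lin_smult[OF assms(3)] dual_simps algebra_simps)

lemma lin_uminus:
  assumes "vs Y" "F \<in> linear_maps X Y"
  shows "(\<lambda>x. \<ominus>\<^bsub>Y\<^esub> F x) \<in> linear_maps X Y"
  by (rule linear_mapsI; (intro vs_eqI[OF assms(1)])?)
    (auto simp: assms(1) lin_closed[OF assms(2)] lin_add[OF assms(2)] lin_smult[OF assms(2)] dual_simps)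

lemma lin_finsum:
  assumes "vs X" "vs Y" "finite A" "\<And>a. a \<in> A \<Longrightarrow> F a \<in> linear_maps X Y"
  shows "(\<lambda>x. \<Oplus>\<^bsub>Y\<^esub>a\<in>A. F a x) \<in> linear_maps X Y"
  by (rule linear_mapsI; (intro vs_eqI[OF assms(2)])?)
    (auto simp: assms(1-3) lin_closed[OF assms(4)] lin_add[OF assms(4)] lin_smult[OF assms(4)] dual_simps
      sum.distrib sum_distrib_left intro!: vs_finsum)

lemma submodule_preimage:
  assumes "vs X" "vs Y" "F \<in> linear_maps X Y" "submodule W CC Y"
  shows "submodule {x \<in> carrier X. F x \<in> W} CC X"
  by (rule submoduleI) (use assms submoduleD[OF assms(2,4)] in \<open>auto simp: lin_zero lin_add lin_smult\<close>)

lemma submodule_zero: "vs X \<Longrightarrow> submodule {\<zero>\<^bsub>X\<^esub>} CC X"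
  by (rule submoduleI) (auto intro: vs_eqI simp: dual_simps)

lemma submodule_carrier: "vs X \<Longrightarrow> submodule (carrier X) CC X"
  by (rule module.carrier_is_submodule)

lemma submodule_Int:
  "vs X \<Longrightarrow> submodule V CC X \<Longrightarrow> submodule W CC X \<Longrightarrow> submodule (V \<inter> W) CC X"
  by (rule submoduleI) (auto dest: submoduleD)

lemma submodule_INT:
  assumes "vs X" "\<And>i. i \<in> I \<Longrightarrow> submodule (W i) CC X"
  shows "submodule {x \<in> carrier X. \<forall>i\<in>I. x \<in> W i} CC X"
  by (rule submoduleI) (use assms submoduleD[OF assms(1) assms(2)] in auto)

lemma submodule_image:
  assumes "vs X" "vs Y" "F \<in> linear_maps X Y"
  shows "submodule (F ` carrier X) CC Y"
proof (rule submoduleI[OF assms(2)])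
  show "\<zero>\<^bsub>Y\<^esub> \<in> F ` carrier X" using lin_zero[OF assms] assms(1) by (metis image_eqI vs_zero)
  show "a \<oplus>\<^bsub>Y\<^esub> b \<in> F ` carrier X" if "a \<in> F ` carrier X" "b \<in> F ` carrier X" for a b
    using that lin_add[OF assms(3), symmetric] vs_add[OF assms(1)] by (auto intro!: imageI)
  show "c \<odot>\<^bsub>Y\<^esub> a \<in> F ` carrier X" if "a \<in> F ` carrier X" for a c
    using that lin_smult[OF assms(3), symmetric] vs_smult[OF assms(1)] by (auto intro!: imageI)
qed (use assms(3) in \<open>auto simp: lin_closed\<close>)

lemma submodule_equalizer:
  assumes "vs X" "vs Y" "F \<in> linear_maps X Y" "G \<in> linear_maps X Y"
  shows "submodule {x \<in> carrier X. F x = G x} CC X"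
  by (rule submoduleI) (use assms in \<open>auto simp: lin_zero lin_add lin_smult\<close>)

subsection \<open>Generated subspaces and quotients\<close>

lemma submodule_subspace_gen:
  assumes "vs X" "S \<subseteq> carrier X"
  shows "submodule (subspace_gen X S) CC X"
proof (rule submoduleI[OF assms(1)])
  show "subspace_gen X S \<subseteq> carrier X"
    using assms submodule_carrier by (auto simp: subspace_gen_def)
qed (use submoduleD[OF assms(1)] in \<open>auto simp: subspace_gen_def\<close>)

lemma subspace_gen_superset: "S \<subseteq> subspace_gen X S"
  by (auto simp: subspace_gen_def)

lemma subspace_gen_least: "submodule W CC X \<Longrightarrow> S \<subseteq> W \<Longrightarrow> subspace_gen X S \<subseteq> W"
  by (auto simp: subspace_gen_def)

lemma subspace_gen_map:
  assumes "vs X" "vs Y" "F \<in> linear_maps X Y" "submodule W CC Y"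
    "S \<subseteq> carrier X" "\<And>s. s \<in> S \<Longrightarrow> F s \<in> W" "x \<in> subspace_gen X S"
  shows "F x \<in> W"
  using subspace_gen_least[OF submodule_preimage[OF assms(1-4)], of S] assms(5-7) by auto

lemma subspace_gen_kill:
  assumes "vs X" "vs Y" "F \<in> linear_maps X Y"
    "S \<subseteq> carrier X" "\<And>s. s \<in> S \<Longrightarrow> F s = \<zero>\<^bsub>Y\<^esub>" "x \<in> subspace_gen X S"
  shows "F x = \<zero>\<^bsub>Y\<^esub>"
  using subspace_gen_map[OF assms(1-3) submodule_zero[OF assms(2)] assms(4) _ assms(6)] assms(5) by auto

lemma carrier_quot: "carrier (quot X W) = (\<lambda>x. W +>\<^bsub>X\<^esub> x) ` carrier X"
  by (auto simp: quot_def ring.defs FactRing_def A_RCOSETS_def')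

lemma quot_zero: "\<zero>\<^bsub>quot X W\<^esub> = W"
  by (simp add: quot_def ring.defs FactRing_def)

context
  fixes X :: "(complex, 'a, 'm) module_scheme" and W
  assumes X: "vs X" and W: "submodule W CC X"
begin

lemma coset_self: "x \<in> carrier X \<Longrightarrow> x \<in> W +>\<^bsub>X\<^esub> x"
  using submoduleD(2)[OF X W] abelian_monoid.l_zero[OF abelian_group.axioms(1)[OF vs_ag[OF X]]]
  unfolding a_r_coset_def' by fastforce

lemma coset_memD: "x \<in> carrier X \<Longrightarrow> y \<in> W +>\<^bsub>X\<^esub> x \<Longrightarrow> y \<in> carrier X \<and> y \<ominus>\<^bsub>X\<^esub> x \<in> W"
proof -
  assume x: "x \<in> carrier X" and "y \<in> W +>\<^bsub>X\<^esub> x"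
  then obtain w where w: "w \<in> W" "y = w \<oplus>\<^bsub>X\<^esub> x" by (auto simp: a_r_coset_def')
  then have "w \<in> carrier X" using submoduleD(1)[OF X W] by simp
  then have "y \<ominus>\<^bsub>X\<^esub> x = w" using x w X by (intro vs_eqI[OF X]) (auto simp: dual_simps)
  then show ?thesis using w x X submoduleD(1)[OF X W] by simp
qed

lemma coset_eq_iff:
  assumes x: "x \<in> carrier X" and y: "y \<in> carrier X"
  shows "W +>\<^bsub>X\<^esub> x = W +>\<^bsub>X\<^esub> y \<longleftrightarrow> x \<ominus>\<^bsub>X\<^esub> y \<in> W"
proof
  assume "W +>\<^bsub>X\<^esub> x = W +>\<^bsub>X\<^esub> y"
  then show "x \<ominus>\<^bsub>X\<^esub> y \<in> W" using coset_self[OF x] coset_memD[OF y] by auto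
next
  interpret module CC X by (rule X)
  interpret abelian_subgroup W X
    by (rule abelian_subgroupI3[OF additive_subgroupI]) (use X W vs_ag submodule.axioms(1) in auto)
  assume "x \<ominus>\<^bsub>X\<^esub> y \<in> W"
  moreover have "x = (x \<ominus>\<^bsub>X\<^esub> y) \<oplus>\<^bsub>X\<^esub> y" using x y X by (intro vs_eqI[OF X]) (auto simp: dual_simps)
  ultimately have "x \<in> W +>\<^bsub>X\<^esub> y" by (auto simp: a_r_coset_def')
  then show "W +>\<^bsub>X\<^esub> x = W +>\<^bsub>X\<^esub> y" using a_repr_independence'[of x y] y by simp
qed

lemma coset_zero: "W +>\<^bsub>X\<^esub> \<zero>\<^bsub>X\<^esub> = W"
proof -
  have "w \<oplus>\<^bsub>X\<^esub> \<zero>\<^bsub>X\<^esub> = w" if "w \<in> W" for w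
    using that submoduleD(1)[OF X W] X by (intro vs_eqI[OF X]) (auto simp: dual_simps)
  then show ?thesis by (auto simp: a_r_coset_def')
qed

lemma quot_add:
  assumes "x \<in> carrier X" "y \<in> carrier X"
  shows "(W +>\<^bsub>X\<^esub> x) \<oplus>\<^bsub>quot X W\<^esub> (W +>\<^bsub>X\<^esub> y) = W +>\<^bsub>X\<^esub> (x \<oplus>\<^bsub>X\<^esub> y)"
proof -
  interpret module CC X by (rule X)
  interpret abelian_subgroup W X
    by (rule abelian_subgroupI3[OF additive_subgroupI]) (use X W vs_ag submodule.axioms(1) in auto)
  show ?thesis using assms a_rcos_sum by (simp add: quot_def ring.defs FactRing_def)
qed

text \<open>The union in \<open>quot_map\<close> collapses: as \<open>F\<close> preserves
  \<open>W\<close>, every representative of the coset contributes the same coset.\<close>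

lemma quot_map_coset:
  assumes F: "F \<in> linear_maps X X" "\<And>w. w \<in> W \<Longrightarrow> F w \<in> W" and x: "x \<in> carrier X"
  shows "quot_map X W F (W +>\<^bsub>X\<^esub> x) = W +>\<^bsub>X\<^esub> F x"
proof -
  have "W +>\<^bsub>X\<^esub> F y = W +>\<^bsub>X\<^esub> F x" if "y \<in> W +>\<^bsub>X\<^esub> x" for y
  proof -
    have y: "y \<in> carrier X" "y \<ominus>\<^bsub>X\<^esub> x \<in> W" using coset_memD[OF x that] by auto
    have "F y \<ominus>\<^bsub>X\<^esub> F x \<in> W" using F(2)[OF y(2)] lin_diff[OF X X F(1)] x y by simp
    then show ?thesis using coset_eq_iff lin_closed[OF F(1)] x y by simp
  qed
  then have "quot_map X W F (W +>\<^bsub>X\<^esub> x) = (\<Union>y\<in>W +>\<^bsub>X\<^esub> x. W +>\<^bsub>X\<^esub> F x)"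
    unfolding quot_map_def by (intro SUP_cong refl)
  then show ?thesis using coset_self[OF x] by blast
qed

lemma quot_smult:
  assumes x: "x \<in> carrier X"
  shows "c \<odot>\<^bsub>quot X W\<^esub> (W +>\<^bsub>X\<^esub> x) = W +>\<^bsub>X\<^esub> (c \<odot>\<^bsub>X\<^esub> x)"
proof -
  interpret module CC X by (rule X)
  have "(\<lambda>x. c \<odot>\<^bsub>X\<^esub> x) \<in> linear_maps X X"
  proof (rule linear_mapsI)
    fix d y assume "y \<in> carrier X"
    then show "c \<odot>\<^bsub>X\<^esub> (d \<odot>\<^bsub>X\<^esub> y) = d \<odot>\<^bsub>X\<^esub> (c \<odot>\<^bsub>X\<^esub> y)"
      using smult_assoc1[of c d y] smult_assoc1[of d c y] by (simp add: mult.commute)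
  qed (use smult_r_distr in auto)
  then have "quot_map X W (\<lambda>x. c \<odot>\<^bsub>X\<^esub> x) (W +>\<^bsub>X\<^esub> x) = W +>\<^bsub>X\<^esub> (c \<odot>\<^bsub>X\<^esub> x)"
    by (rule quot_map_coset[OF _ _ x]) (rule submoduleD(4)[OF X W])
  then show ?thesis by (simp add: quot_def ring.defs module.defs)
qed

lemma quot_in: "x \<in> carrier X \<Longrightarrow> W +>\<^bsub>X\<^esub> x \<in> carrier (quot X W)"
  by (auto simp: carrier_quot)

lemma vs_quot: "vs (quot X W)"
proof (rule vsI)
  interpret module CC X by (rule X)
  note [simp] = carrier_quot quot_zero quot_smult quot_add
  show "\<zero>\<^bsub>quot X W\<^esub> \<in> carrier (quot X W)" using coset_zero X by force
  fix x assume "x \<in> carrier (quot X W)"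
  then show "\<zero>\<^bsub>quot X W\<^esub> \<oplus>\<^bsub>quot X W\<^esub> x = x"
    using quot_add[of "\<zero>\<^bsub>X\<^esub>"] X by (auto simp: coset_zero)
  show "0 \<odot>\<^bsub>quot X W\<^esub> x = \<zero>\<^bsub>quot X W\<^esub>" using \<open>x \<in> _\<close> X by (auto simp: coset_zero)
  show "1 \<odot>\<^bsub>quot X W\<^esub> x = x" using \<open>x \<in> _\<close> X smult_one by auto
  show "(c + d) \<odot>\<^bsub>quot X W\<^esub> x = c \<odot>\<^bsub>quot X W\<^esub> x \<oplus>\<^bsub>quot X W\<^esub> d \<odot>\<^bsub>quot X W\<^esub> x" for c d
    using \<open>x \<in> _\<close> X smult_l_distr[of c d] by auto
  show "(c * d) \<odot>\<^bsub>quot X W\<^esub> x = c \<odot>\<^bsub>quot X W\<^esub> (d \<odot>\<^bsub>quot X W\<^esub> x)" for c d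
    using \<open>x \<in> _\<close> X smult_assoc1[of c d] by auto
  show "c \<odot>\<^bsub>quot X W\<^esub> x \<in> carrier (quot X W)" for c
    using \<open>x \<in> _\<close> X by auto
  fix y assume "y \<in> carrier (quot X W)"
  then show "x \<oplus>\<^bsub>quot X W\<^esub> y \<in> carrier (quot X W)" "x \<oplus>\<^bsub>quot X W\<^esub> y = y \<oplus>\<^bsub>quot X W\<^esub> x"
    using \<open>x \<in> _\<close> X a_comm by auto
  show "c \<odot>\<^bsub>quot X W\<^esub> (x \<oplus>\<^bsub>quot X W\<^esub> y) = c \<odot>\<^bsub>quot X W\<^esub> x \<oplus>\<^bsub>quot X W\<^esub> c \<odot>\<^bsub>quot X W\<^esub> y" for c
    using \<open>x \<in> _\<close> \<open>y \<in> _\<close> X smult_r_distr[of c] by auto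
  fix z assume "z \<in> carrier (quot X W)"
  then show "(x \<oplus>\<^bsub>quot X W\<^esub> y) \<oplus>\<^bsub>quot X W\<^esub> z = x \<oplus>\<^bsub>quot X W\<^esub> (y \<oplus>\<^bsub>quot X W\<^esub> z)"
    using \<open>x \<in> _\<close> \<open>y \<in> _\<close> X a_assoc by auto
qed

lemma coset_lin: "(\<lambda>x. W +>\<^bsub>X\<^esub> x) \<in> linear_maps X (quot X W)"
  by (rule linear_mapsI) (auto simp: quot_in quot_add quot_smult)

lemma coset_eq_zero_iff: "x \<in> carrier X \<Longrightarrow> W +>\<^bsub>X\<^esub> x = \<zero>\<^bsub>quot X W\<^esub> \<longleftrightarrow> x \<in> W"
proof -
  assume x: "x \<in> carrier X"
  have "x \<ominus>\<^bsub>X\<^esub> \<zero>\<^bsub>X\<^esub> = x" using x X by (intro vs_eqI[OF X]) (auto simp: dual_simps)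
  then show ?thesis
    using coset_eq_iff[OF x, of "\<zero>\<^bsub>X\<^esub>"] X by (simp add: quot_zero coset_zero)
qed

text \<open>The value at a coset is read off from an arbitrary representative; two representatives
  differ by an element of \<open>W\<close>, which \<open>F\<close> kills.\<close>

lemma quot_lift:
  assumes Y: "vs Y" and F: "F \<in> linear_maps X Y" "\<And>w. w \<in> W \<Longrightarrow> F w = \<zero>\<^bsub>Y\<^esub>"
  shows "\<exists>G\<in>linear_maps (quot X W) Y. \<forall>x\<in>carrier X. G (W +>\<^bsub>X\<^esub> x) = F x"
proof -
  define G where "G C = F (SOME x. x \<in> carrier X \<and> C = W +>\<^bsub>X\<^esub> x)" for C
  have G: "G (W +>\<^bsub>X\<^esub> x) = F x" if x: "x \<in> carrier X" for x
  proof -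
    define y where "y = (SOME y. y \<in> carrier X \<and> W +>\<^bsub>X\<^esub> x = W +>\<^bsub>X\<^esub> y)"
    have y: "y \<in> carrier X" "W +>\<^bsub>X\<^esub> x = W +>\<^bsub>X\<^esub> y"
      using someI[of "\<lambda>y. y \<in> carrier X \<and> W +>\<^bsub>X\<^esub> x = W +>\<^bsub>X\<^esub> y" x] x by (auto simp: y_def)
    have "F (x \<ominus>\<^bsub>X\<^esub> y) = \<zero>\<^bsub>Y\<^esub>" using coset_eq_iff[OF x y(1)] y(2) F(2) by simp
    then have "F x \<ominus>\<^bsub>Y\<^esub> F y = \<zero>\<^bsub>Y\<^esub>" using lin_diff[OF X Y F(1) x y(1)] by simp
    then have "F x = F y"
      using vs_diff_zeroD[OF Y] lin_closed[OF F(1)] x y(1) by simp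
    then show ?thesis by (simp add: G_def y_def)
  qed
  have "G \<in> linear_maps (quot X W) Y"
    by (rule linear_mapsI)
      (auto simp: carrier_quot G quot_add quot_smult X lin_closed[OF F(1)] lin_add[OF F(1)] lin_smult[OF F(1)])
  then show ?thesis using G by blast
qed

lemma quot_map_lin:
  assumes "F \<in> linear_maps X X" "\<And>w. w \<in> W \<Longrightarrow> F w \<in> W"
  shows "quot_map X W F \<in> linear_maps (quot X W) (quot X W)"
  by (rule linear_mapsI)
    (auto simp: carrier_quot quot_add quot_smult X quot_map_coset[OF assms] lin_closed[OF assms(1)]
      lin_add[OF assms(1)] lin_smult[OF assms(1)])

text \<open>Spanning is expressed by saying that every subspace containing \<open>S\<close> is
  everything. In this form it passes to a quotient by taking preimages, without any linear
  combination.\<close>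

lemma quot_spanning:
  assumes V: "submodule V CC (quot X W)"
    and S: "\<And>V. submodule V CC X \<Longrightarrow> S \<subseteq> V \<Longrightarrow> carrier X \<subseteq> V"
    and SV: "\<And>s. s \<in> S \<Longrightarrow> W +>\<^bsub>X\<^esub> s \<in> V" "S \<subseteq> carrier X"
  shows "carrier (quot X W) \<subseteq> V"
proof -
  have "carrier X \<subseteq> {x \<in> carrier X. W +>\<^bsub>X\<^esub> x \<in> V}"
    using S[OF submodule_preimage[OF X vs_quot coset_lin V]] SV by auto
  then show ?thesis by (auto simp: carrier_quot)
qed

end

subsection \<open>Finite linear combinations\<close>

text \<open>The pairing of a formal combination with a function on the basis. Such pairings separate
  formal combinations (\<open>lc_eqI\<close>), so identities between them become identities of
  numbers, with simplification rules for every operation in sight.\<close>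

definition lc :: "('x \<Rightarrow>\<^sub>0 complex) \<Rightarrow> ('x \<Rightarrow> complex) \<Rightarrow> complex"
  where "lc f \<phi> = (\<Sum>x\<in>Poly_Mapping.keys f. Poly_Mapping.lookup f x * \<phi> x)"

lemma lookup_scale [simp]: "Poly_Mapping.lookup (scale c f) x = c * Poly_Mapping.lookup f x"
  by (simp add: scale_def Poly_Mapping.map.rep_eq when_def)

lemma scale_simps [simp]: "scale c (f + g) = scale c f + scale c g" "scale (c + d) f = scale c f + scale d f"
  "scale (c * d) f = scale c (scale d f)" "scale 1 f = f" "scale 0 f = 0" "scale c 0 = 0"
  by (simp_all add: poly_mapping_eq_iff fun_eq_iff lookup_add algebra_simps)

lemma keys_scale: "Poly_Mapping.keys (scale c f) \<subseteq> Poly_Mapping.keys f"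
  by (auto simp: in_keys_iff)

lemma keys_basis [simp]: "Poly_Mapping.keys (basis x) = {x}"
  by (simp add: basis_def)

lemma lc_superset:
  "finite A \<Longrightarrow> Poly_Mapping.keys f \<subseteq> A \<Longrightarrow> lc f \<phi> = (\<Sum>x\<in>A. Poly_Mapping.lookup f x * \<phi> x)"
  unfolding lc_def by (rule sum.mono_neutral_left) (auto simp: in_keys_iff)

lemma lc_add [simp]: "lc (f + g) \<phi> = lc f \<phi> + lc g \<phi>"
proof -
  let ?A = "Poly_Mapping.keys f \<union> Poly_Mapping.keys g"
  show ?thesis
    using lc_superset[of ?A f \<phi>] lc_superset[of ?A g \<phi>] lc_superset[of ?A "f + g" \<phi>]
      Poly_Mapping.keys_add[of f g]
    by (simp add: lookup_add distrib_right sum.distrib)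
qed

lemma lc_scale [simp]: "lc (scale c f) \<phi> = c * lc f \<phi>"
  using lc_superset[of "Poly_Mapping.keys f" "scale c f" \<phi>] keys_scale[of c f]
  by (simp add: lc_def sum_distrib_left mult.assoc)

lemma lc_zero [simp]: "lc 0 \<phi> = 0"
  by (simp add: lc_def)

lemma lc_minus [simp]: "lc (- f) \<phi> = - lc f \<phi>"
  using lc_add[of f "- f" \<phi>] by (simp add: eq_neg_iff_add_eq_0 add.commute)

lemma lc_diff [simp]: "lc (f - g) \<phi> = lc f \<phi> - lc g \<phi>"
  using lc_add[of f "- g" \<phi>] by simp

lemma lc_sum [simp]: "lc (\<Sum>a\<in>A. f a) \<phi> = (\<Sum>a\<in>A. lc (f a) \<phi>)"
  by (induction A rule: infinite_finite_induct) auto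

lemma lc_basis [simp]: "lc (basis x) \<phi> = \<phi> x"
  by (simp add: lc_def basis_def)

lemma lc_if: "lc (if P then f else g) \<phi> = (if P then lc f \<phi> else lc g \<phi>)"
  by simp

lemma lc_lin_ext [simp]: "lc (lin_ext h f) \<phi> = lc f (\<lambda>x. lc (h x) \<phi>)"
  by (simp add: lin_ext_def lc_def[of f])

lemma lc_cong: "(\<And>x. x \<in> Poly_Mapping.keys f \<Longrightarrow> \<phi> x = \<psi> x) \<Longrightarrow> lc f \<phi> = lc f \<psi>"
  by (simp add: lc_def)

lemma lc_fun_add: "lc f (\<lambda>x. \<phi> x + \<psi> x) = lc f \<phi> + lc f \<psi>"
  by (simp add: lc_def distrib_left sum.distrib)

lemma lc_fun_scale: "lc f (\<lambda>x. c * \<phi> x) = c * lc f \<phi>"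
  by (simp add: lc_def sum_distrib_left algebra_simps)

text \<open>Pairing with the indicator function of a basis element extracts its coefficient.\<close>

lemma lc_eqI: "(\<And>\<phi>. lc f \<phi> = lc g \<phi>) \<Longrightarrow> f = g"
proof -
  assume "\<And>\<phi>. lc f \<phi> = lc g \<phi>"
  moreover have "lc f (\<lambda>y. if y = x then 1 else 0) = Poly_Mapping.lookup f x" for f :: "'a \<Rightarrow>\<^sub>0 complex" and x
  proof -
    have "lc f (\<lambda>y. if y = x then 1 else 0) =
        (\<Sum>y\<in>Poly_Mapping.keys f. if y = x then Poly_Mapping.lookup f y else 0)"
      unfolding lc_def by (rule sum.cong) auto
    then show ?thesis by (simp add: in_keys_iff sum.delta')
  qed
  ultimately show ?thesis by (metis poly_mapping_eqI)
qed

lemma keys_lin_ext: "Poly_Mapping.keys (lin_ext h f) \<subseteq> (\<Union>x\<in>Poly_Mapping.keys f. Poly_Mapping.keys (h x))"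
  unfolding lin_ext_def using keys_scale by (fastforce dest: subsetD[OF Poly_Mapping.keys_sum])

lemma lin_ext_simps [simp]: "lin_ext h (f + g) = lin_ext h f + lin_ext h g"
  "lin_ext h (scale c f) = scale c (lin_ext h f)" "lin_ext h (basis x) = h x"
  by (rule lc_eqI, simp)+

lemma free_space_simps [simp]:
  "carrier (free_space S) = {f. Poly_Mapping.keys f \<subseteq> S}" "f \<oplus>\<^bsub>free_space S\<^esub> g = f + g"
  "\<zero>\<^bsub>free_space S\<^esub> = 0" "c \<odot>\<^bsub>free_space S\<^esub> f = scale c f"
  by (simp_all add: free_space_def)

lemma vs_free_space [simp]: "vs (free_space S)"
proof (rule vsI)
  fix x y assume "x \<in> carrier (free_space S)" "y \<in> carrier (free_space S)"
  then show "x \<oplus>\<^bsub>free_space S\<^esub> y \<in> carrier (free_space S)"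
    using Poly_Mapping.keys_add[of x y] by auto
next
  fix c x assume "x \<in> carrier (free_space S)"
  then show "c \<odot>\<^bsub>free_space S\<^esub> x \<in> carrier (free_space S)" using keys_scale[of c x] by auto
qed (auto simp: algebra_simps)

lemma free_space_diff [simp]: "Poly_Mapping.keys f \<subseteq> S \<Longrightarrow> Poly_Mapping.keys g \<subseteq> S \<Longrightarrow> f \<ominus>\<^bsub>free_space S\<^esub> g = f - g"
proof -
  assume fg: "Poly_Mapping.keys f \<subseteq> S" "Poly_Mapping.keys g \<subseteq> S"
  have "\<ominus>\<^bsub>free_space S\<^esub> g = scale (-1) g" using vs_smult_m1[of "free_space S" g] fg by simp
  then show ?thesis by (intro lc_eqI) (simp add: a_minus_def)
qed

lemma free_space_spanning:
  assumes "submodule W CC (free_space S)" "\<And>x. x \<in> S \<Longrightarrow> basis x \<in> W"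
  shows "carrier (free_space S) \<subseteq> W"
proof
  fix f assume f: "f \<in> carrier (free_space S)"
  note D = submoduleD[OF vs_free_space assms(1), simplified]
  have "(\<Sum>x\<in>A. scale (Poly_Mapping.lookup f x) (basis x)) \<in> W" if "finite A" "A \<subseteq> S" for A
    using that by (induction A) (auto intro: D assms(2))
  moreover have "f = (\<Sum>x\<in>Poly_Mapping.keys f. scale (Poly_Mapping.lookup f x) (basis x))"
    by (rule lc_eqI) (simp add: lc_def[of f])
  ultimately show "f \<in> W" using f by (metis finite_keys free_space_simps(1) mem_Collect_eq)
qed

text \<open>Linear extension into an arbitrary module, where \<open>lin_ext\<close> only covers
  formal combinations. The evaluation \<open>eval_in\<close> of words on a vector is an
  instance.\<close>

definition free_ext :: "(complex, 'a, 'm) module_scheme \<Rightarrow> ('x \<Rightarrow> 'a) \<Rightarrow> ('x \<Rightarrow>\<^sub>0 complex) \<Rightarrow> 'a"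
  where "free_ext X h f = (\<Oplus>\<^bsub>X\<^esub>x\<in>Poly_Mapping.keys f. Poly_Mapping.lookup f x \<odot>\<^bsub>X\<^esub> h x)"

lemma eval_in_free_ext: "eval_in X \<rho> x v = free_ext X (\<lambda>w. foldr \<rho> w v) x"
  by (simp add: eval_in_def free_ext_def)

lemma dual_free_ext:
  assumes "vs X" "\<phi> \<in> dual X" "\<And>x. x \<in> Poly_Mapping.keys f \<Longrightarrow> h x \<in> carrier X"
  shows "\<phi> (free_ext X h f) = lc f (\<lambda>x. \<phi> (h x))"
  using assms by (simp add: free_ext_def lc_def dual_finsum dual_smult)

lemma free_ext_lin:
  assumes "vs X" "\<And>x. x \<in> S \<Longrightarrow> h x \<in> carrier X"
  shows "free_ext X h \<in> linear_maps (free_space S) X"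
proof -
  have in_X: "free_ext X h f \<in> carrier X" if "Poly_Mapping.keys f \<subseteq> S" for f
    unfolding free_ext_def using assms that by (intro vs_finsum) auto
  have dual: "\<phi> (free_ext X h f) = lc f (\<lambda>x. \<phi> (h x))" if "Poly_Mapping.keys f \<subseteq> S" "\<phi> \<in> dual X" for f \<phi>
    using that assms by (intro dual_free_ext) auto
  show ?thesis
  proof (rule linear_mapsI)
    fix f g assume fg: "f \<in> carrier (free_space S)" "g \<in> carrier (free_space S)"
    then have "Poly_Mapping.keys (f + g) \<subseteq> S" using Poly_Mapping.keys_add[of f g] by auto
    then show "free_ext X h (f \<oplus>\<^bsub>free_space S\<^esub> g) = free_ext X h f \<oplus>\<^bsub>X\<^esub> free_ext X h g"
      using fg assms(1) by (intro vs_eqI[OF assms(1)]) (simp_all add: in_X dual dual_add)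
  next
    fix c f assume f: "f \<in> carrier (free_space S)"
    then have "Poly_Mapping.keys (scale c f) \<subseteq> S" using keys_scale[of c f] by auto
    then show "free_ext X h (c \<odot>\<^bsub>free_space S\<^esub> f) = c \<odot>\<^bsub>X\<^esub> free_ext X h f"
      using f assms(1) by (intro vs_eqI[OF assms(1)]) (simp_all add: in_X dual dual_smult)
  qed (simp add: in_X)
qed

lemma free_ext_basis: "vs X \<Longrightarrow> h x \<in> carrier X \<Longrightarrow> free_ext X h (basis x) = h x"
proof -
  assume X: "vs X" and h: "h x \<in> carrier X"
  have "free_ext X h \<in> linear_maps (free_space {x}) X" by (rule free_ext_lin[OF X]) (simp add: h)
  then have "free_ext X h (basis x) \<in> carrier X" by (rule lin_closed) simp
  then show ?thesis
  proof (rule vs_eqI[OF X _ h])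
    fix \<phi> assume "\<phi> \<in> dual X"
    from dual_free_ext[OF X this, of "basis x" h] show "\<phi> (free_ext X h (basis x)) = \<phi> (h x)" by (simp add: h)
  qed
qed

lemma lin_ext_lin:
  assumes "\<And>x. x \<in> S \<Longrightarrow> Poly_Mapping.keys (h x) \<subseteq> T"
  shows "lin_ext h \<in> linear_maps (free_space S) (free_space T)"
proof (rule linear_mapsI)
  fix f assume "f \<in> carrier (free_space S)"
  then have "(\<Union>x\<in>Poly_Mapping.keys f. Poly_Mapping.keys (h x)) \<subseteq> T" using assms by auto
  then show "lin_ext h f \<in> carrier (free_space T)" using keys_lin_ext[of h f] by simp
qed auto

section \<open>Tensor products\<close>

lemma basis_sub3: "Poly_Mapping.keys (basis a - basis b - basis c) \<subseteq> {a, b, c}"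
  using keys_diff[of "basis a - basis b" "basis c"] keys_diff[of "basis a" "basis b"] by auto

lemma basis_sub_scale: "Poly_Mapping.keys (basis a - scale r (basis b)) \<subseteq> {a, b}"
  using keys_diff[of "basis a" "scale r (basis b)"] keys_scale[of r "basis b"] by auto

definition bilinear :: "(complex, 'a, 'm) module_scheme \<Rightarrow> (complex, 'b, 'n) module_scheme \<Rightarrow>
    (complex, 'c, 'l) module_scheme \<Rightarrow> ('a \<Rightarrow> 'b \<Rightarrow> 'c) \<Rightarrow> bool"
  where "bilinear X Y Z \<beta> \<longleftrightarrow> (\<forall>x\<in>carrier X. \<beta> x \<in> linear_maps Y Z) \<and>
    (\<forall>y\<in>carrier Y. (\<lambda>x. \<beta> x y) \<in> linear_maps X Z)"

context
  fixes X :: "(complex, 'a, 'm) module_scheme" and Y :: "(complex, 'b, 'n) module_scheme"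
  assumes X: "vs X" and Y: "vs Y"
begin

lemma bilinear_relators_carrier: "bilinear_relators X Y \<subseteq> carrier (free_space (carrier X \<times> carrier Y))"
proof -
  have "Poly_Mapping.keys (basis (x \<oplus>\<^bsub>X\<^esub> x', y) - basis (x, y) - basis (x', y)) \<subseteq> carrier X \<times> carrier Y"
    if "x \<in> carrier X" "x' \<in> carrier X" "y \<in> carrier Y" for x x' y
    using X that by (intro subset_trans[OF basis_sub3]) auto
  moreover have "Poly_Mapping.keys (basis (x, y \<oplus>\<^bsub>Y\<^esub> y') - basis (x, y) - basis (x, y')) \<subseteq> carrier X \<times> carrier Y"
    if "x \<in> carrier X" "y' \<in> carrier Y" "y \<in> carrier Y" for x y' y
    using Y that by (intro subset_trans[OF basis_sub3]) auto
  moreover have "Poly_Mapping.keys (basis (c \<odot>\<^bsub>X\<^esub> x, y) - scale c (basis (x, y))) \<subseteq> carrier X \<times> carrier Y"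
    "Poly_Mapping.keys (basis (x, c \<odot>\<^bsub>Y\<^esub> y) - scale c (basis (x, y))) \<subseteq> carrier X \<times> carrier Y"
    if "x \<in> carrier X" "y \<in> carrier Y" for x y c
    using X Y that by (auto intro!: subset_trans[OF basis_sub_scale])
  ultimately show ?thesis unfolding bilinear_relators_def free_space_simps by blast
qed

lemma tensor_ker_submodule: "submodule (tensor_ker X Y) CC (free_space (carrier X \<times> carrier Y))"
  unfolding tensor_ker_def by (rule submodule_subspace_gen[OF vs_free_space bilinear_relators_carrier])

lemma vs_tensor: "vs (tensor X Y)"
  unfolding tensor_def by (rule vs_quot[OF vs_free_space tensor_ker_submodule])

lemma pure_tensor_in: "x \<in> carrier X \<Longrightarrow> y \<in> carrier Y \<Longrightarrow> pure_tensor X Y x y \<in> carrier (tensor X Y)"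
  unfolding tensor_def pure_tensor_def by (rule quot_in[OF vs_free_space tensor_ker_submodule]) simp

lemma pure_tensor_bilinear: "bilinear X Y (tensor X Y) (pure_tensor X Y)"
proof -
  let ?F = "free_space (carrier X \<times> carrier Y)"
  have eq: "tensor_ker X Y +>\<^bsub>?F\<^esub> a = tensor_ker X Y +>\<^bsub>?F\<^esub> b"
    if "Poly_Mapping.keys a \<subseteq> carrier X \<times> carrier Y" "Poly_Mapping.keys b \<subseteq> carrier X \<times> carrier Y" "a - b \<in> bilinear_relators X Y" for a b
    using that coset_eq_iff[OF vs_free_space tensor_ker_submodule, of a b]
      subspace_gen_superset[of "bilinear_relators X Y" ?F]
    by (auto simp: tensor_ker_def)
  have add: "(tensor_ker X Y +>\<^bsub>?F\<^esub> a) \<oplus>\<^bsub>tensor X Y\<^esub> (tensor_ker X Y +>\<^bsub>?F\<^esub> b) = tensor_ker X Y +>\<^bsub>?F\<^esub> (a + b)"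
    if "Poly_Mapping.keys a \<subseteq> carrier X \<times> carrier Y" "Poly_Mapping.keys b \<subseteq> carrier X \<times> carrier Y" for a b
    using quot_add[OF vs_free_space tensor_ker_submodule, of a b] that by (simp add: tensor_def)
  have smult: "c \<odot>\<^bsub>tensor X Y\<^esub> (tensor_ker X Y +>\<^bsub>?F\<^esub> a) = tensor_ker X Y +>\<^bsub>?F\<^esub> scale c a"
    if "Poly_Mapping.keys a \<subseteq> carrier X \<times> carrier Y" for a c
    using quot_smult[OF vs_free_space tensor_ker_submodule, of a c] that by (simp add: tensor_def)
  have k2: "Poly_Mapping.keys (basis a + basis b) \<subseteq> carrier X \<times> carrier Y" if "a \<in> carrier X \<times> carrier Y" "b \<in> carrier X \<times> carrier Y" for a b
    using Poly_Mapping.keys_add[of "basis a" "basis b"] that by auto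
  have k3: "Poly_Mapping.keys (scale c (basis a)) \<subseteq> carrier X \<times> carrier Y" if "a \<in> carrier X \<times> carrier Y" for a c
    using keys_scale[of c "basis a"] that by auto
  show ?thesis
    unfolding bilinear_def
  proof (intro conjI ballI linear_mapsI)
    fix x y y' assume *: "x \<in> carrier X" "y \<in> carrier Y" "y' \<in> carrier Y"
    have "basis (x, y \<oplus>\<^bsub>Y\<^esub> y') - (basis (x, y) + basis (x, y')) \<in> bilinear_relators X Y"
      unfolding diff_diff_add[symmetric] bilinear_relators_def using * by blast
    then have "tensor_ker X Y +>\<^bsub>?F\<^esub> basis (x, y \<oplus>\<^bsub>Y\<^esub> y') = tensor_ker X Y +>\<^bsub>?F\<^esub> (basis (x, y) + basis (x, y'))"
      by (intro eq) (use * Y k2 in auto)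
    then show "pure_tensor X Y x (y \<oplus>\<^bsub>Y\<^esub> y') = pure_tensor X Y x y \<oplus>\<^bsub>tensor X Y\<^esub> pure_tensor X Y x y'"
      unfolding pure_tensor_def using * by (simp add: add)
  next
    fix x x' y assume *: "x \<in> carrier X" "x' \<in> carrier X" "y \<in> carrier Y"
    have "basis (x \<oplus>\<^bsub>X\<^esub> x', y) - (basis (x, y) + basis (x', y)) \<in> bilinear_relators X Y"
      unfolding diff_diff_add[symmetric] bilinear_relators_def using * by blast
    then have "tensor_ker X Y +>\<^bsub>?F\<^esub> basis (x \<oplus>\<^bsub>X\<^esub> x', y) = tensor_ker X Y +>\<^bsub>?F\<^esub> (basis (x, y) + basis (x', y))"
      by (intro eq) (use * X k2 in auto)
    then show "pure_tensor X Y (x \<oplus>\<^bsub>X\<^esub> x') y = pure_tensor X Y x y \<oplus>\<^bsub>tensor X Y\<^esub> pure_tensor X Y x' y"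
      unfolding pure_tensor_def using * by (simp add: add)
  next
    fix c x y assume *: "x \<in> carrier X" "y \<in> carrier Y"
    have "basis (x, c \<odot>\<^bsub>Y\<^esub> y) - scale c (basis (x, y)) \<in> bilinear_relators X Y"
      "basis (c \<odot>\<^bsub>X\<^esub> x, y) - scale c (basis (x, y)) \<in> bilinear_relators X Y"
      unfolding bilinear_relators_def using * by blast+
    then have "tensor_ker X Y +>\<^bsub>?F\<^esub> basis (x, c \<odot>\<^bsub>Y\<^esub> y) = tensor_ker X Y +>\<^bsub>?F\<^esub> scale c (basis (x, y))"
      "tensor_ker X Y +>\<^bsub>?F\<^esub> basis (c \<odot>\<^bsub>X\<^esub> x, y) = tensor_ker X Y +>\<^bsub>?F\<^esub> scale c (basis (x, y))"
      by - (rule eq; use * X Y k3 in auto)+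
    then show "pure_tensor X Y x (c \<odot>\<^bsub>Y\<^esub> y) = c \<odot>\<^bsub>tensor X Y\<^esub> pure_tensor X Y x y"
      "pure_tensor X Y (c \<odot>\<^bsub>X\<^esub> x) y = c \<odot>\<^bsub>tensor X Y\<^esub> pure_tensor X Y x y"
      unfolding pure_tensor_def using * by (simp_all add: smult)
  qed (auto simp: pure_tensor_in)
qed

lemma pure_tensor_lin1: "y \<in> carrier Y \<Longrightarrow> (\<lambda>x. pure_tensor X Y x y) \<in> linear_maps X (tensor X Y)"
  and pure_tensor_lin2: "x \<in> carrier X \<Longrightarrow> pure_tensor X Y x \<in> linear_maps Y (tensor X Y)"
  using pure_tensor_bilinear by (auto simp: bilinear_def)

lemma tensor_spanning:
  assumes "submodule V CC (tensor X Y)"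
    and "\<And>x y. x \<in> carrier X \<Longrightarrow> y \<in> carrier Y \<Longrightarrow> pure_tensor X Y x y \<in> V"
  shows "carrier (tensor X Y) \<subseteq> V"
  using assms(1) unfolding tensor_def
proof (rule quot_spanning[OF vs_free_space tensor_ker_submodule, of V "basis ` (carrier X \<times> carrier Y)"])
  fix W assume "submodule W CC (free_space (carrier X \<times> carrier Y))" "basis ` (carrier X \<times> carrier Y) \<subseteq> W"
  then show "carrier (free_space (carrier X \<times> carrier Y)) \<subseteq> W" by (intro free_space_spanning) auto
qed (use assms(2) in \<open>auto simp: pure_tensor_def\<close>)

text \<open>The universal property: bilinearity of \<open>\<beta>\<close> says that its linear
  extension to formal combinations kills the four families of relators.\<close>

lemma tensor_lift:
  assumes Z: "vs Z" and b: "bilinear X Y Z \<beta>"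
  shows "\<exists>F\<in>linear_maps (tensor X Y) Z. \<forall>x\<in>carrier X. \<forall>y\<in>carrier Y. F (pure_tensor X Y x y) = \<beta> x y"
proof -
  let ?F = "free_space (carrier X \<times> carrier Y)"
  define L where "L = free_ext Z (\<lambda>(x, y). \<beta> x y)"
  have in_Z: "\<beta> x y \<in> carrier Z" if "x \<in> carrier X" "y \<in> carrier Y" for x y
    using b that by (auto simp: bilinear_def intro: lin_closed)
  have L: "L \<in> linear_maps ?F Z" unfolding L_def by (rule free_ext_lin[OF Z]) (auto intro: in_Z)
  have Lb: "L (basis (x, y)) = \<beta> x y" if "x \<in> carrier X" "y \<in> carrier Y" for x y
    unfolding L_def using free_ext_basis[OF Z, of "\<lambda>(x, y). \<beta> x y" "(x, y)"] in_Z[OF that] by simp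
  have b1: "\<beta> (x \<oplus>\<^bsub>X\<^esub> x') y = \<beta> x y \<oplus>\<^bsub>Z\<^esub> \<beta> x' y" if "x \<in> carrier X" "x' \<in> carrier X" "y \<in> carrier Y" for x x' y
    using b that lin_add[of "\<lambda>x. \<beta> x y" X Z] by (auto simp: bilinear_def)
  have b2: "\<beta> x (y \<oplus>\<^bsub>Y\<^esub> y') = \<beta> x y \<oplus>\<^bsub>Z\<^esub> \<beta> x y'" if "x \<in> carrier X" "y' \<in> carrier Y" "y \<in> carrier Y" for x y' y
    using b that lin_add[of "\<beta> x" Y Z] by (auto simp: bilinear_def)
  have b3: "\<beta> (c \<odot>\<^bsub>X\<^esub> x) y = c \<odot>\<^bsub>Z\<^esub> \<beta> x y" if "x \<in> carrier X" "y \<in> carrier Y" for x y c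
    using b that lin_smult[of "\<lambda>x. \<beta> x y" X Z] by (auto simp: bilinear_def)
  have b4: "\<beta> x (c \<odot>\<^bsub>Y\<^esub> y) = c \<odot>\<^bsub>Z\<^esub> \<beta> x y" if "x \<in> carrier X" "y \<in> carrier Y" for x y c
    using b that lin_smult[of "\<beta> x" Y Z] by (auto simp: bilinear_def)
  have "L r = \<zero>\<^bsub>Z\<^esub>" if r: "r \<in> bilinear_relators X Y" for r
  proof (rule vs_eqI[OF Z])
    have rc: "r \<in> carrier ?F" using r bilinear_relators_carrier by auto
    then show "L r \<in> carrier Z" by (rule lin_closed[OF L])
    fix \<phi> assume \<phi>: "\<phi> \<in> dual Z"
    have "(case p of (x, y) \<Rightarrow> \<beta> x y) \<in> carrier Z" if "p \<in> Poly_Mapping.keys r" for p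
      using that rc in_Z by auto
    from dual_free_ext[OF Z \<phi> this] have "\<phi> (L r) = lc r (\<lambda>(x, y). \<phi> (\<beta> x y))"
      unfolding L_def by (simp add: case_prod_unfold)
    also have "\<dots> = 0"
      using r unfolding bilinear_relators_def
      by (auto simp: X Y Z b1 b2 b3 b4 in_Z dual_add[OF \<phi>] dual_smult[OF \<phi>])
    finally show "\<phi> (L r) = \<phi> \<zero>\<^bsub>Z\<^esub>" by (simp add: dual_zero[OF Z \<phi>])
  qed (use Z in simp)
  then have "L k = \<zero>\<^bsub>Z\<^esub>" if "k \<in> tensor_ker X Y" for k
    using subspace_gen_kill[OF vs_free_space Z L bilinear_relators_carrier] that by (auto simp: tensor_ker_def)
  then obtain G where G: "G \<in> linear_maps (tensor X Y) Z"
    "\<forall>x\<in>carrier ?F. G (tensor_ker X Y +>\<^bsub>?F\<^esub> x) = L x"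
    using quot_lift[OF vs_free_space tensor_ker_submodule Z L] unfolding tensor_def by blast
  then show ?thesis by (intro bexI[OF _ G(1)]) (auto simp: pure_tensor_def Lb)
qed

lemma tensor_lin_eqI:
  assumes "vs Z" "F \<in> linear_maps (tensor X Y) Z" "G \<in> linear_maps (tensor X Y) Z"
    "\<And>x y. x \<in> carrier X \<Longrightarrow> y \<in> carrier Y \<Longrightarrow> F (pure_tensor X Y x y) = G (pure_tensor X Y x y)"
    "t \<in> carrier (tensor X Y)"
  shows "F t = G t"
  using tensor_spanning[OF submodule_equalizer[OF vs_tensor assms(1-3)]] assms(4,5) pure_tensor_in by auto

context
  fixes F G
  assumes F: "F \<in> linear_maps X X" and G: "G \<in> linear_maps Y Y"
begin

text \<open>By linearity of \<open>F\<close> and \<open>G\<close>, the operator on formal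
  combinations maps a relator of each of the four families to a relator of the same family.\<close>

lemma tensor_map_aux:
  "lin_ext (\<lambda>(x, y). basis (F x, G y)) \<in>
    linear_maps (free_space (carrier X \<times> carrier Y)) (free_space (carrier X \<times> carrier Y))" (is "?L \<in> linear_maps ?S ?S")
  "k \<in> tensor_ker X Y \<Longrightarrow> lin_ext (\<lambda>(x, y). basis (F x, G y)) k \<in> tensor_ker X Y"
proof -
  show L: "?L \<in> linear_maps ?S ?S"
    by (rule lin_ext_lin) (use lin_closed[OF F] lin_closed[OF G] in auto)
  have ld: "lin_ext h (f - g) = lin_ext h f - lin_ext h g" for h :: "'a \<times> 'b \<Rightarrow> 'a \<times> 'b \<Rightarrow>\<^sub>0 complex" and f g
    by (rule lc_eqI) simp
  have "?L r \<in> bilinear_relators X Y" if r: "r \<in> bilinear_relators X Y" for r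
  proof -
    consider (1) x x' y where "r = basis (x \<oplus>\<^bsub>X\<^esub> x', y) - basis (x, y) - basis (x', y)"
        "x \<in> carrier X" "x' \<in> carrier X" "y \<in> carrier Y"
      | (2) x y y' where "r = basis (x, y \<oplus>\<^bsub>Y\<^esub> y') - basis (x, y) - basis (x, y')"
        "x \<in> carrier X" "y \<in> carrier Y" "y' \<in> carrier Y"
      | (3) c x y where "r = basis (c \<odot>\<^bsub>X\<^esub> x, y) - scale c (basis (x, y))" "x \<in> carrier X" "y \<in> carrier Y"
      | (4) c x y where "r = basis (x, c \<odot>\<^bsub>Y\<^esub> y) - scale c (basis (x, y))" "x \<in> carrier X" "y \<in> carrier Y"
      using r unfolding bilinear_relators_def by blast
    then show ?thesis
    proof cases
      case 1
      then have "?L r = basis (F x \<oplus>\<^bsub>X\<^esub> F x', G y) - basis (F x, G y) - basis (F x', G y)"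
        by (simp add: ld lin_add[OF F])
      then show ?thesis using 1 lin_closed[OF F] lin_closed[OF G] unfolding bilinear_relators_def by blast
    next
      case 2
      then have "?L r = basis (F x, G y \<oplus>\<^bsub>Y\<^esub> G y') - basis (F x, G y) - basis (F x, G y')"
        by (simp add: ld lin_add[OF G])
      then show ?thesis using 2 lin_closed[OF F] lin_closed[OF G] unfolding bilinear_relators_def by blast
    next
      case 3
      then have "?L r = basis (c \<odot>\<^bsub>X\<^esub> F x, G y) - scale c (basis (F x, G y))"
        by (simp add: ld lin_smult[OF F])
      then show ?thesis using 3 lin_closed[OF F] lin_closed[OF G] unfolding bilinear_relators_def by blast
    next
      case 4
      then have "?L r = basis (F x, c \<odot>\<^bsub>Y\<^esub> G y) - scale c (basis (F x, G y))"
        by (simp add: ld lin_smult[OF G])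
      then show ?thesis using 4 lin_closed[OF F] lin_closed[OF G] unfolding bilinear_relators_def by blast
    qed
  qed
  then show "k \<in> tensor_ker X Y \<Longrightarrow> ?L k \<in> tensor_ker X Y"
    using subspace_gen_map[OF vs_free_space vs_free_space L tensor_ker_submodule bilinear_relators_carrier, of k]
      subspace_gen_superset[of "bilinear_relators X Y" ?S]
    by (auto simp: tensor_ker_def)
qed

lemma tensor_map_lin: "tensor_map X Y F G \<in> linear_maps (tensor X Y) (tensor X Y)"
  unfolding tensor_map_def tensor_def by (rule quot_map_lin[OF vs_free_space tensor_ker_submodule tensor_map_aux])

lemma tensor_map_pure: "x \<in> carrier X \<Longrightarrow> y \<in> carrier Y \<Longrightarrow>
    tensor_map X Y F G (pure_tensor X Y x y) = pure_tensor X Y (F x) (G y)"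
  unfolding tensor_map_def pure_tensor_def
  using quot_map_coset[OF vs_free_space tensor_ker_submodule tensor_map_aux, of "basis (x, y)"] by simp

end

end

lemma dual_free_space:
  assumes "\<psi> \<in> dual (free_space S)" "Poly_Mapping.keys f \<subseteq> S"
  shows "\<psi> f = lc f (\<lambda>x. \<psi> (basis x))"
proof -
  have c: "scale c (basis x) \<in> carrier (free_space S)" if "x \<in> S" for c x
    using vs_smult[OF vs_free_space, of "basis x" S c] that by simp
  have "\<psi> (\<Sum>x\<in>A. scale (Poly_Mapping.lookup f x) (basis x)) = (\<Sum>x\<in>A. Poly_Mapping.lookup f x * \<psi> (basis x)) \<and>
    (\<Sum>x\<in>A. scale (Poly_Mapping.lookup f x) (basis x)) \<in> carrier (free_space S)"
    if "finite A" "A \<subseteq> S" for A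
    using that
  proof (induction A)
    case empty
    then show ?case using dual_zero[OF vs_free_space assms(1)] by simp
  next
    case (insert a A)
    let ?s = "\<Sum>x\<in>A. scale (Poly_Mapping.lookup f x) (basis x)"
    let ?a = "scale (Poly_Mapping.lookup f a) (basis a)"
    have a: "?a \<in> carrier (free_space S)" "?s \<in> carrier (free_space S)" using c insert by auto
    have "\<psi> (?a + ?s) = \<psi> ?a + \<psi> ?s" using dual_add[OF assms(1) a] by simp
    moreover have "\<psi> ?a = Poly_Mapping.lookup f a * \<psi> (basis a)"
      using dual_smult[OF assms(1), of "basis a"] insert by simp
    moreover have "?a + ?s \<in> carrier (free_space S)" using vs_add[OF vs_free_space a] by simp
    ultimately show ?case using insert by simp
  qed
  moreover have "f = (\<Sum>x\<in>Poly_Mapping.keys f. scale (Poly_Mapping.lookup f x) (basis x))"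
    by (rule lc_eqI) (simp add: lc_def[of f])
  ultimately show ?thesis using assms(2) unfolding lc_def by (metis finite_keys)
qed

section \<open>Tensor products with a space that has a given basis\<close>

abbreviation TP :: "'i set \<Rightarrow> (complex, 'a, 'm) module_scheme \<Rightarrow> (complex, (('i \<Rightarrow>\<^sub>0 complex) \<times> 'a \<Rightarrow>\<^sub>0 complex) set) module"
  where "TP I M \<equiv> tensor (free_space I) M"

definition tp :: "'i set \<Rightarrow> (complex, 'a, 'm) module_scheme \<Rightarrow> 'i \<Rightarrow> 'a \<Rightarrow> (('i \<Rightarrow>\<^sub>0 complex) \<times> 'a \<Rightarrow>\<^sub>0 complex) set"
  where "tp I M i x = pure_tensor (free_space I) M (basis i) x"

lemma tp_lin: "vs M \<Longrightarrow> i \<in> I \<Longrightarrow> tp I M i \<in> linear_maps M (TP I M)"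
  using pure_tensor_lin2[OF vs_free_space, of M "basis i" I] by (simp add: tp_def[abs_def])

lemma tp_in: "vs M \<Longrightarrow> i \<in> I \<Longrightarrow> x \<in> carrier M \<Longrightarrow> tp I M i x \<in> carrier (TP I M)"
  by (rule lin_closed[OF tp_lin])

lemma dual_pure_tensor:
  assumes "vs M" "\<phi> \<in> dual (TP I M)" "Poly_Mapping.keys f \<subseteq> I" "x \<in> carrier M"
  shows "\<phi> (pure_tensor (free_space I) M f x) = lc f (\<lambda>i. \<phi> (tp I M i x))"
  using dual_free_space[OF dual_comp[OF assms(2) pure_tensor_lin1[OF vs_free_space assms(1,4)]] assms(3)]
  by (simp add: tp_def)

lemma TP_spanning:
  assumes M: "vs M" and V: "submodule V CC (TP I M)"
    and "\<And>i x. i \<in> I \<Longrightarrow> x \<in> carrier M \<Longrightarrow> tp I M i x \<in> V"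
  shows "carrier (TP I M) \<subseteq> V"
proof (rule tensor_spanning[OF vs_free_space M V])
  fix f x assume f: "f \<in> carrier (free_space I)" and x: "x \<in> carrier M"
  have "submodule {f \<in> carrier (free_space I). pure_tensor (free_space I) M f x \<in> V} CC (free_space I)"
    by (rule submodule_preimage[OF vs_free_space vs_tensor[OF vs_free_space M] pure_tensor_lin1[OF vs_free_space M x] V])
  from free_space_spanning[OF this] show "pure_tensor (free_space I) M f x \<in> V"
    using assms(3) f x by (auto simp: tp_def)
qed

lemma TP_lin_eqI:
  assumes "vs M" "vs Z" "F \<in> linear_maps (TP I M) Z" "G \<in> linear_maps (TP I M) Z"
    "\<And>i x. i \<in> I \<Longrightarrow> x \<in> carrier M \<Longrightarrow> F (tp I M i x) = G (tp I M i x)" "t \<in> carrier (TP I M)"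
  shows "F t = G t"
proof -
  have "carrier (TP I M) \<subseteq> {t \<in> carrier (TP I M). F t = G t}"
    by (rule TP_spanning[OF assms(1) submodule_equalizer[OF vs_tensor[OF vs_free_space assms(1)] assms(2-4)]])
      (simp add: assms(1,5) tp_in)
  then show ?thesis using assms(6) by auto
qed

text \<open>As \<open>I\<close> indexes a basis, the tensor product is a direct sum of copies of
  \<open>M\<close>, so the maps of an arbitrary family glue without any compatibility between
  them.\<close>

lemma TP_lift:
  assumes M: "vs M" and Z: "vs Z" and g: "\<And>i. i \<in> I \<Longrightarrow> g i \<in> linear_maps M Z"
  shows "\<exists>F\<in>linear_maps (TP I M) Z. \<forall>i\<in>I. \<forall>x\<in>carrier M. F (tp I M i x) = g i x"
proof -
  define \<beta> where "\<beta> f x = free_ext Z (\<lambda>i. g i x) f" for f x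
  have l1: "free_ext Z (\<lambda>i. g i x) \<in> linear_maps (free_space I) Z" if "x \<in> carrier M" for x
    by (rule free_ext_lin[OF Z]) (rule lin_closed[OF g that])
  have in_Z: "\<beta> f x \<in> carrier Z" if "Poly_Mapping.keys f \<subseteq> I" "x \<in> carrier M" for f x
    unfolding \<beta>_def using lin_closed[OF l1[OF that(2)], of f] that by simp
  have d: "\<phi> (\<beta> f x) = lc f (\<lambda>i. \<phi> (g i x))" if "Poly_Mapping.keys f \<subseteq> I" "x \<in> carrier M" "\<phi> \<in> dual Z" for f x \<phi>
    unfolding \<beta>_def using that(1,2) by (intro dual_free_ext[OF Z that(3)] lin_closed[OF g]) auto
  have "bilinear (free_space I) M Z \<beta>"
    unfolding bilinear_def
  proof (intro conjI ballI)
    fix f assume f: "f \<in> carrier (free_space I)"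
    then have f': "Poly_Mapping.keys f \<subseteq> I" by simp
    show "\<beta> f \<in> linear_maps M Z"
    proof (rule linear_mapsI)
      fix x y assume xy: "x \<in> carrier M" "y \<in> carrier M"
      show "\<beta> f (x \<oplus>\<^bsub>M\<^esub> y) = \<beta> f x \<oplus>\<^bsub>Z\<^esub> \<beta> f y"
      proof (rule vs_eqI[OF Z])
        fix \<phi> assume \<phi>: "\<phi> \<in> dual Z"
        have "lc f (\<lambda>i. \<phi> (g i (x \<oplus>\<^bsub>M\<^esub> y))) = lc f (\<lambda>i. \<phi> (g i x) + \<phi> (g i y))"
          by (rule lc_cong) (use f' xy in \<open>auto simp: lin_add[OF g] dual_add[OF \<phi>] lin_closed[OF g] subsetD\<close>)
        then show "\<phi> (\<beta> f (x \<oplus>\<^bsub>M\<^esub> y)) = \<phi> (\<beta> f x \<oplus>\<^bsub>Z\<^esub> \<beta> f y)"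
          using xy M f' by (simp add: d[OF _ _ \<phi>] in_Z dual_add[OF \<phi>] lc_fun_add)
      qed (use xy M f' Z in_Z in auto)
    next
      fix c x assume x: "x \<in> carrier M"
      show "\<beta> f (c \<odot>\<^bsub>M\<^esub> x) = c \<odot>\<^bsub>Z\<^esub> \<beta> f x"
      proof (rule vs_eqI[OF Z])
        fix \<phi> assume \<phi>: "\<phi> \<in> dual Z"
        have "lc f (\<lambda>i. \<phi> (g i (c \<odot>\<^bsub>M\<^esub> x))) = lc f (\<lambda>i. c * \<phi> (g i x))"
          by (rule lc_cong) (use f' x in \<open>auto simp: lin_smult[OF g] dual_smult[OF \<phi>] lin_closed[OF g] subsetD\<close>)
        then show "\<phi> (\<beta> f (c \<odot>\<^bsub>M\<^esub> x)) = \<phi> (c \<odot>\<^bsub>Z\<^esub> \<beta> f x)"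
          using x M f' by (simp add: d[OF _ _ \<phi>] in_Z dual_smult[OF \<phi>] lc_fun_scale)
      qed (use x M f' Z in_Z in auto)
    qed (use f' in_Z in auto)
  next
    fix x assume "x \<in> carrier M"
    then show "(\<lambda>f. \<beta> f x) \<in> linear_maps (free_space I) Z" unfolding \<beta>_def by (rule l1)
  qed
  from tensor_lift[OF vs_free_space M Z this] obtain F where F: "F \<in> linear_maps (TP I M) Z"
    "\<forall>f\<in>carrier (free_space I). \<forall>x\<in>carrier M. F (pure_tensor (free_space I) M f x) = \<beta> f x" by blast
  have "F (tp I M i x) = g i x" if "i \<in> I" "x \<in> carrier M" for i x
    using F(2) that g lin_closed[of "g i" M Z x] by (simp add: tp_def \<beta>_def free_ext_basis[OF Z])
  then show ?thesis using F(1) by blast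
qed

lemma tensor_map_tp:
  assumes "vs M" "F \<in> linear_maps (free_space I) (free_space I)" "G \<in> linear_maps M M" "i \<in> I" "x \<in> carrier M"
  shows "\<phi> \<in> dual (TP I M) \<Longrightarrow>
    \<phi> (tensor_map (free_space I) M F G (tp I M i x)) = lc (F (basis i)) (\<lambda>j. \<phi> (tp I M j (G x)))"
  using tensor_map_pure[OF vs_free_space assms(1-3), of "basis i" x] assms(4,5)
    lin_closed[OF assms(2), of "basis i"] lin_closed[OF assms(3,5)]
  by (simp add: tp_def[of I M i] dual_pure_tensor[OF assms(1)])

lemma tensor_map_tp_id:
  assumes "vs M" "G \<in> linear_maps M M" "i \<in> I" "x \<in> carrier M"
  shows "tensor_map (free_space I) M (\<lambda>x. x) G (tp I M i x) = tp I M i (G x)"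
  using tensor_map_pure[OF vs_free_space assms(1) lin_id assms(2), of "basis i" I x] assms(3,4)
  by (simp add: tp_def)

text \<open>One variable at a time: for fixed \<open>i\<close> and \<open>u\<close> the family in
  \<open>j\<close> is glued over the second factor (\<open>L\<close>); then, for a fixed element
  \<open>b\<close> of the second factor, the family in \<open>i\<close> is glued over the first
  (\<open>B\<close>). Linearity in the parameter held fixed follows because linear maps that agree
  on the vectors \<open>tp\<close> are equal.\<close>

lemma TP_lift2:
  assumes U: "vs U" and V: "vs V" and Z: "vs Z"
    and g: "\<And>i j. i \<in> I \<Longrightarrow> j \<in> J \<Longrightarrow> bilinear U V Z (g i j)"
  shows "\<exists>F\<in>linear_maps (tensor (TP I U) (TP J V)) Z. \<forall>i\<in>I. \<forall>j\<in>J. \<forall>u\<in>carrier U. \<forall>v\<in>carrier V.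
    F (pure_tensor (TP I U) (TP J V) (tp I U i u) (tp J V j v)) = g i j u v"
proof -
  have TU: "vs (TP I U)" and TV: "vs (TP J V)" by (rule vs_tensor[OF vs_free_space], fact)+
  have "\<exists>F. F \<in> linear_maps (TP J V) Z \<and> (\<forall>j\<in>J. \<forall>v\<in>carrier V. F (tp J V j v) = g i j u v)"
    if "i \<in> I" "u \<in> carrier U" for i u
    using TP_lift[OF V Z, of J "\<lambda>j. g i j u"] g that by (auto simp: bilinear_def)
  then obtain L where L: "L i u \<in> linear_maps (TP J V) Z"
    "j \<in> J \<Longrightarrow> v \<in> carrier V \<Longrightarrow> L i u (tp J V j v) = g i j u v"
    if "i \<in> I" "u \<in> carrier U" for i u j v by metis
  have L1: "(\<lambda>u. L i u b) \<in> linear_maps U Z" if i: "i \<in> I" and b: "b \<in> carrier (TP J V)" for i b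
  proof (rule linear_mapsI)
    show "L i u b \<in> carrier Z" if "u \<in> carrier U" for u using lin_closed[OF L(1)] i b that by auto
    fix u u' assume u: "u \<in> carrier U" "u' \<in> carrier U"
    have "L i (u \<oplus>\<^bsub>U\<^esub> u') b = (\<lambda>b. L i u b \<oplus>\<^bsub>Z\<^esub> L i u' b) b"
    proof (rule TP_lin_eqI[OF V Z _ _ _ b])
      show "(\<lambda>b. L i u b \<oplus>\<^bsub>Z\<^esub> L i u' b) \<in> linear_maps (TP J V) Z"
        by (rule lin_plus[OF Z L(1)[OF i u(1)] L(1)[OF i u(2)]])
      show "L i (u \<oplus>\<^bsub>U\<^esub> u') (tp J V j v) = L i u (tp J V j v) \<oplus>\<^bsub>Z\<^esub> L i u' (tp J V j v)" if "j \<in> J" "v \<in> carrier V" for j v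
        using that i u U L(2) lin_add[of "\<lambda>u. g i j u v" U Z] g by (simp add: bilinear_def)
    qed (use L(1) i u U in auto)
    then show "L i (u \<oplus>\<^bsub>U\<^esub> u') b = L i u b \<oplus>\<^bsub>Z\<^esub> L i u' b" .
  next
    fix c u assume u: "u \<in> carrier U"
    have "L i (c \<odot>\<^bsub>U\<^esub> u) b = (\<lambda>b. c \<odot>\<^bsub>Z\<^esub> L i u b) b"
    proof (rule TP_lin_eqI[OF V Z _ _ _ b])
      show "(\<lambda>b. c \<odot>\<^bsub>Z\<^esub> L i u b) \<in> linear_maps (TP J V) Z"
        by (rule lin_scale[OF Z L(1)[OF i u]])
      show "L i (c \<odot>\<^bsub>U\<^esub> u) (tp J V j v) = c \<odot>\<^bsub>Z\<^esub> L i u (tp J V j v)" if "j \<in> J" "v \<in> carrier V" for j v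
        using that i u U L(2) lin_smult[of "\<lambda>u. g i j u v" U Z] g by (simp add: bilinear_def)
    qed (use L(1) i u U in auto)
    then show "L i (c \<odot>\<^bsub>U\<^esub> u) b = c \<odot>\<^bsub>Z\<^esub> L i u b" .
  qed
  have "\<exists>F. F \<in> linear_maps (TP I U) Z \<and> (\<forall>i\<in>I. \<forall>u\<in>carrier U. F (tp I U i u) = L i u b)" if "b \<in> carrier (TP J V)" for b
    using TP_lift[OF U Z, of I "\<lambda>i u. L i u b"] L1 that by auto
  then obtain B where B: "B b \<in> linear_maps (TP I U) Z"
    "i \<in> I \<Longrightarrow> u \<in> carrier U \<Longrightarrow> B b (tp I U i u) = L i u b" if "b \<in> carrier (TP J V)" for b i u by metis
  have "bilinear (TP I U) (TP J V) Z (\<lambda>a b. B b a)"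
    unfolding bilinear_def
  proof (intro conjI ballI)
    fix a assume a: "a \<in> carrier (TP I U)"
    show "(\<lambda>b. B b a) \<in> linear_maps (TP J V) Z"
    proof (rule linear_mapsI)
      fix b b' assume b: "b \<in> carrier (TP J V)" "b' \<in> carrier (TP J V)"
      have "B (b \<oplus>\<^bsub>TP J V\<^esub> b') a = (\<lambda>a. B b a \<oplus>\<^bsub>Z\<^esub> B b' a) a"
      proof (rule TP_lin_eqI[OF U Z _ _ _ a])
        show "(\<lambda>a. B b a \<oplus>\<^bsub>Z\<^esub> B b' a) \<in> linear_maps (TP I U) Z"
          by (rule lin_plus[OF Z B(1)[OF b(1)] B(1)[OF b(2)]])
        show "B (b \<oplus>\<^bsub>TP J V\<^esub> b') (tp I U i u) = B b (tp I U i u) \<oplus>\<^bsub>Z\<^esub> B b' (tp I U i u)" if "i \<in> I" "u \<in> carrier U" for i u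
          using that b TV B(2) lin_add[OF L(1)[OF that] b] by simp
      qed (use B(1) b TV in auto)
      then show "B (b \<oplus>\<^bsub>TP J V\<^esub> b') a = B b a \<oplus>\<^bsub>Z\<^esub> B b' a" .
    next
      fix c b assume b: "b \<in> carrier (TP J V)"
      have "B (c \<odot>\<^bsub>TP J V\<^esub> b) a = (\<lambda>a. c \<odot>\<^bsub>Z\<^esub> B b a) a"
      proof (rule TP_lin_eqI[OF U Z _ _ _ a])
        show "(\<lambda>a. c \<odot>\<^bsub>Z\<^esub> B b a) \<in> linear_maps (TP I U) Z"
          by (rule lin_scale[OF Z B(1)[OF b]])
        show "B (c \<odot>\<^bsub>TP J V\<^esub> b) (tp I U i u) = c \<odot>\<^bsub>Z\<^esub> B b (tp I U i u)" if "i \<in> I" "u \<in> carrier U" for i u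
          using that b TV B(2) lin_smult[OF L(1)[OF that] b] by simp
      qed (use B(1) b TV in auto)
      then show "B (c \<odot>\<^bsub>TP J V\<^esub> b) a = c \<odot>\<^bsub>Z\<^esub> B b a" .
    qed (rule lin_closed[OF B(1) a])
  qed (rule B(1))
  from tensor_lift[OF TU TV Z this] obtain F where F: "F \<in> linear_maps (tensor (TP I U) (TP J V)) Z"
    "\<forall>x\<in>carrier (TP I U). \<forall>y\<in>carrier (TP J V). F (pure_tensor (TP I U) (TP J V) x y) = B y x" by blast
  then show ?thesis
    by (intro bexI[OF _ F(1)]) (simp add: B(2) L(2) tp_in[OF U] tp_in[OF V])
qed

section \<open>Presented algebras and induced modules\<close>

declare in_listsI [rule del] in_listsD [rule del]

lemma lin_ext_basis [simp]: "lin_ext basis x = x"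
  by (rule lc_eqI) simp

lemma free_alg_simps [simp]:
  "carrier (free_alg G) = {f. Poly_Mapping.keys f \<subseteq> lists G}" "f \<oplus>\<^bsub>free_alg G\<^esub> g = f + g"
  "\<zero>\<^bsub>free_alg G\<^esub> = 0" "c \<odot>\<^bsub>free_alg G\<^esub> f = scale c f" "\<one>\<^bsub>free_alg G\<^esub> = basis []"
  "f \<otimes>\<^bsub>free_alg G\<^esub> g = lin_ext (\<lambda>v. lin_ext (\<lambda>w. basis (v @ w)) g) f"
  by (simp_all add: free_alg_def free_space_def)

text \<open>\<open>free_alg\<close> differs from a free space only in \<open>mult\<close> and
  \<open>one\<close>, which the vector space axioms do not see.\<close>

lemma vs_free_alg: "vs (free_alg G)"
  using vs_free_space[of "lists G"] unfolding module_def module_axioms_def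
  by (simp add: abelian_group_def abelian_monoid_def abelian_group_axioms_def free_space_def free_alg_def)

lemma linear_maps_free_alg: "linear_maps (free_alg G) = linear_maps (free_space (lists G))"
  by (simp add: linear_maps_def fun_eq_iff)

lemma free_alg_mult_closed:
  assumes "Poly_Mapping.keys f \<subseteq> lists G" "Poly_Mapping.keys g \<subseteq> lists G"
  shows "Poly_Mapping.keys (lin_ext (\<lambda>v. lin_ext (\<lambda>w. basis (v @ w)) g) f) \<subseteq> lists G"
proof -
  have "Poly_Mapping.keys (lin_ext (\<lambda>w. basis (v @ w)) g) \<subseteq> lists G" if "v \<in> lists G" for v
    using assms(2) that by (intro subset_trans[OF keys_lin_ext]) auto
  then show ?thesis using assms(1) by - (rule subset_trans[OF keys_lin_ext], rule UN_least, blast)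
qed

lemma ring_free_alg: "ring (free_alg G)"
proof (rule ringI)
  show "abelian_group (free_alg G)" by (rule vs_ag[OF vs_free_alg])
  show "Group.monoid (free_alg G)"
    by (rule monoidI) (auto intro: free_alg_mult_closed[THEN subsetD] lc_eqI)
qed (auto intro!: lc_eqI simp: lc_fun_add)

section \<open>Algebras given by generators and relations\<close>

locale presented =
  fixes P :: "'g presentation"
  assumes rels_carrier: "rels P \<subseteq> carrier (free_alg (gens P))"
begin

abbreviation "FA \<equiv> free_alg (gens P)"

lemma ideal_rel_ideal: "ideal (rel_ideal P) FA"
  unfolding rel_ideal_def by (rule ring.genideal_ideal[OF ring_free_alg rels_carrier])

lemma rels_in_rel_ideal: "rels P \<subseteq> rel_ideal P"
  unfolding rel_ideal_def by (rule ring.genideal_self[OF ring_free_alg rels_carrier])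

text \<open>Closure under a scalar \<open>c\<close> comes from multiplying by \<open>c\<close> times
  the empty word, the unit of the free algebra.\<close>

lemma rel_ideal_submodule: "submodule (rel_ideal P) CC FA"
proof -
  interpret ideal "rel_ideal P" FA by (rule ideal_rel_ideal)
  show ?thesis
  proof (rule submoduleI[OF vs_free_alg])
    fix c x assume x: "x \<in> rel_ideal P"
    then have xc: "x \<in> carrier FA" by (rule a_Hcarr)
    have "scale c (basis []) \<in> carrier FA" using vs_smult[OF vs_free_alg, of "basis []" "gens P" c] by simp
    then have "scale c (basis []) \<otimes>\<^bsub>FA\<^esub> x \<in> rel_ideal P" using I_l_closed x by blast
    moreover have "scale c (basis []) \<otimes>\<^bsub>FA\<^esub> x = c \<odot>\<^bsub>FA\<^esub> x" by (intro lc_eqI) simp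
    ultimately show "c \<odot>\<^bsub>FA\<^esub> x \<in> rel_ideal P" by simp
  qed (use a_subset additive_subgroup.zero_closed[OF ideal.axioms(1)[OF ideal_rel_ideal]]
      additive_subgroup.a_closed[OF ideal.axioms(1)[OF ideal_rel_ideal]] in auto)
qed

lemma vs_alg: "vs (alg P)"
  unfolding alg_def by (rule vs_quot[OF vs_free_alg rel_ideal_submodule])

lemma carrier_alg: "carrier (alg P) = cls P ` carrier FA"
  unfolding alg_def carrier_quot cls_def by simp

lemma cls_lin: "cls P \<in> linear_maps FA (alg P)"
  unfolding alg_def cls_def[abs_def] by (rule coset_lin[OF vs_free_alg rel_ideal_submodule])

lemma cls_in: "Poly_Mapping.keys x \<subseteq> lists (gens P) \<Longrightarrow> cls P x \<in> carrier (alg P)"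
  using lin_closed[OF cls_lin, of x] by simp

lemma cls_mult: "x \<in> carrier FA \<Longrightarrow> y \<in> carrier FA \<Longrightarrow> cls P x \<otimes>\<^bsub>alg P\<^esub> cls P y = cls P (x \<otimes>\<^bsub>FA\<^esub> y)"
  using ideal.rcoset_mult_add[OF ideal_rel_ideal, of x y]
  by (simp add: alg_def quot_def ring.defs FactRing_def cls_def)

lemma cls_zero_iff: "x \<in> carrier FA \<Longrightarrow> cls P x = \<zero>\<^bsub>alg P\<^esub> \<longleftrightarrow> x \<in> rel_ideal P"
  unfolding alg_def cls_def by (rule coset_eq_zero_iff[OF vs_free_alg rel_ideal_submodule])

lemma alg_mult_lin1: "b \<in> carrier (alg P) \<Longrightarrow> (\<lambda>a. a \<otimes>\<^bsub>alg P\<^esub> b) \<in> linear_maps (alg P) (alg P)"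
  and alg_mult_lin2: "b \<in> carrier (alg P) \<Longrightarrow> (\<lambda>a. b \<otimes>\<^bsub>alg P\<^esub> a) \<in> linear_maps (alg P) (alg P)"
proof -
  interpret FA: ring FA by (rule ring_free_alg)
  have add: "cls P (x + y) = cls P x \<oplus>\<^bsub>alg P\<^esub> cls P y" if "x \<in> carrier FA" "y \<in> carrier FA" for x y
    using lin_add[OF cls_lin that] by simp
  have sm: "cls P (scale c x) = c \<odot>\<^bsub>alg P\<^esub> cls P x" if "x \<in> carrier FA" for c x
    using lin_smult[OF cls_lin that] by simp
  have eq1: "lin_ext (\<lambda>v. scale c (lin_ext (\<lambda>w. basis (v @ w)) y)) x =
    scale c (lin_ext (\<lambda>v. lin_ext (\<lambda>w. basis (v @ w)) y) x)" for x y :: "'g list \<Rightarrow>\<^sub>0 complex" and c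
    by (rule lc_eqI) (simp add: lc_fun_scale)
  have eq2: "lin_ext (\<lambda>v. lin_ext (\<lambda>w. basis (v @ w)) y + lin_ext (\<lambda>w. basis (v @ w)) z) x =
    lin_ext (\<lambda>v. lin_ext (\<lambda>w. basis (v @ w)) y) x + lin_ext (\<lambda>v. lin_ext (\<lambda>w. basis (v @ w)) z) x"
    for x y z :: "'g list \<Rightarrow>\<^sub>0 complex"
    by (rule lc_eqI) (simp add: lc_fun_add)
  have cl: "x \<otimes>\<^bsub>FA\<^esub> y \<in> carrier FA" "x + y \<in> carrier FA" "scale c x \<in> carrier FA"
    if "x \<in> carrier FA" "y \<in> carrier FA" for x y c
    using FA.m_closed[OF that] FA.a_closed[OF that] vs_smult[OF vs_free_alg that(1), of c] by simp_all
  assume "b \<in> carrier (alg P)"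
  then obtain z where z: "z \<in> carrier FA" "b = cls P z" by (auto simp: carrier_alg)
  have c: "a \<otimes>\<^bsub>alg P\<^esub> b \<in> carrier (alg P)" "b \<otimes>\<^bsub>alg P\<^esub> a \<in> carrier (alg P)" if "a \<in> carrier (alg P)" for a
    using that z cl(1) by (auto simp: carrier_alg cls_mult simp del: free_alg_simps)
  have s: "(c \<odot>\<^bsub>alg P\<^esub> a) \<otimes>\<^bsub>alg P\<^esub> b = c \<odot>\<^bsub>alg P\<^esub> (a \<otimes>\<^bsub>alg P\<^esub> b)"
    "b \<otimes>\<^bsub>alg P\<^esub> (c \<odot>\<^bsub>alg P\<^esub> a) = c \<odot>\<^bsub>alg P\<^esub> (b \<otimes>\<^bsub>alg P\<^esub> a)" if a: "a \<in> carrier (alg P)" for a c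
  proof -
    obtain x where x: "x \<in> carrier FA" "a = cls P x" using a by (auto simp: carrier_alg)
    show "(c \<odot>\<^bsub>alg P\<^esub> a) \<otimes>\<^bsub>alg P\<^esub> b = c \<odot>\<^bsub>alg P\<^esub> (a \<otimes>\<^bsub>alg P\<^esub> b)"
      "b \<otimes>\<^bsub>alg P\<^esub> (c \<odot>\<^bsub>alg P\<^esub> a) = c \<odot>\<^bsub>alg P\<^esub> (b \<otimes>\<^bsub>alg P\<^esub> a)"
      using x z cl(1)[OF x(1) z(1)] cl(1)[OF z(1) x(1)]
        cls_mult[OF cl(3)[OF x(1) x(1)] z(1), of c] cls_mult[OF z(1) cl(3)[OF x(1) x(1)], of c]
        cls_mult[OF x(1) z(1)] cls_mult[OF z(1) x(1)]
      by (simp_all add: sm[symmetric] eq1)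
  qed
  have d: "(a \<oplus>\<^bsub>alg P\<^esub> a') \<otimes>\<^bsub>alg P\<^esub> b = a \<otimes>\<^bsub>alg P\<^esub> b \<oplus>\<^bsub>alg P\<^esub> a' \<otimes>\<^bsub>alg P\<^esub> b"
    "b \<otimes>\<^bsub>alg P\<^esub> (a \<oplus>\<^bsub>alg P\<^esub> a') = b \<otimes>\<^bsub>alg P\<^esub> a \<oplus>\<^bsub>alg P\<^esub> b \<otimes>\<^bsub>alg P\<^esub> a'"
    if a: "a \<in> carrier (alg P)" "a' \<in> carrier (alg P)" for a a'
  proof -
    obtain x y where x: "x \<in> carrier FA" "a = cls P x" "y \<in> carrier FA" "a' = cls P y"
      using a by (auto simp: carrier_alg)
    show "(a \<oplus>\<^bsub>alg P\<^esub> a') \<otimes>\<^bsub>alg P\<^esub> b = a \<otimes>\<^bsub>alg P\<^esub> b \<oplus>\<^bsub>alg P\<^esub> a' \<otimes>\<^bsub>alg P\<^esub> b"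
      "b \<otimes>\<^bsub>alg P\<^esub> (a \<oplus>\<^bsub>alg P\<^esub> a') = b \<otimes>\<^bsub>alg P\<^esub> a \<oplus>\<^bsub>alg P\<^esub> b \<otimes>\<^bsub>alg P\<^esub> a'"
      using x z cl(1)[OF x(1) z(1)] cl(1)[OF x(3) z(1)] cl(1)[OF z(1) x(1)] cl(1)[OF z(1) x(3)]
        cls_mult[OF cl(2)[OF x(1) x(3)] z(1)] cls_mult[OF z(1) cl(2)[OF x(1) x(3)]]
        cls_mult[OF x(1) z(1)] cls_mult[OF z(1) x(1)] cls_mult[OF x(3) z(1)] cls_mult[OF z(1) x(3)]
      by (simp_all add: add[symmetric] eq2)
  qed
  show "(\<lambda>a. a \<otimes>\<^bsub>alg P\<^esub> b) \<in> linear_maps (alg P) (alg P)" "(\<lambda>a. b \<otimes>\<^bsub>alg P\<^esub> a) \<in> linear_maps (alg P) (alg P)"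
    by (rule linear_mapsI; (rule c s d; assumption))+
qed

lemma alg_mult_closed: "a \<in> carrier (alg P) \<Longrightarrow> b \<in> carrier (alg P) \<Longrightarrow> a \<otimes>\<^bsub>alg P\<^esub> b \<in> carrier (alg P)"
  by (rule lin_closed[OF alg_mult_lin1])

lemma alg_mult_assoc:
  assumes "a \<in> carrier (alg P)" "b \<in> carrier (alg P)" "c \<in> carrier (alg P)"
  shows "(a \<otimes>\<^bsub>alg P\<^esub> b) \<otimes>\<^bsub>alg P\<^esub> c = a \<otimes>\<^bsub>alg P\<^esub> (b \<otimes>\<^bsub>alg P\<^esub> c)"
proof -
  interpret FA: ring FA by (rule ring_free_alg)
  show ?thesis
    using assms by (auto simp: carrier_alg cls_mult FA.m_assoc simp del: free_alg_simps)
qed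

lemma cls_one_mult: "x \<in> carrier FA \<Longrightarrow> cls P (basis []) \<otimes>\<^bsub>alg P\<^esub> cls P x = cls P x"
  using cls_mult[of "basis []" x] ring_free_alg[of "gens P"] by (simp add: lc_eqI)

end

section \<open>The free algebra acting on a space with operators\<close>

context
  fixes G :: "'g set" and Y :: "(complex, 'b, 'n) module_scheme" and \<sigma>
  assumes Y: "vs Y" and \<sigma>: "\<forall>g\<in>G. \<sigma> g \<in> linear_maps Y Y"
begin

lemma foldr_lin: "w \<in> lists G \<Longrightarrow> foldr \<sigma> w \<in> linear_maps Y Y"
proof (induction w)
  case (Cons g w)
  then show ?case using lin_comp[of "foldr \<sigma> w" Y Y "\<sigma> g" Y] \<sigma> by (simp add: comp_def)
qed (use lin_id in \<open>auto simp: id_def\<close>)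

lemma eval_in_closed:
  "Poly_Mapping.keys x \<subseteq> lists G \<Longrightarrow> v \<in> carrier Y \<Longrightarrow> eval_in Y \<sigma> x v \<in> carrier Y"
  unfolding eval_in_def by (intro vs_finsum[OF Y] vs_smult[OF Y] lin_closed[OF foldr_lin]) auto

lemma dual_eval_in:
  assumes "\<phi> \<in> dual Y" "Poly_Mapping.keys x \<subseteq> lists G" "v \<in> carrier Y"
  shows "\<phi> (eval_in Y \<sigma> x v) = lc x (\<lambda>w. \<phi> (foldr \<sigma> w v))"
  unfolding eval_in_free_ext by (rule dual_free_ext[OF Y assms(1)]) (use assms lin_closed[OF foldr_lin] in auto)

lemma eval_in_lin: "Poly_Mapping.keys x \<subseteq> lists G \<Longrightarrow> eval_in Y \<sigma> x \<in> linear_maps Y Y"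
  unfolding eval_in_def[abs_def]
  by (rule lin_finsum[OF Y Y]) (auto intro!: lin_scale[OF Y] foldr_lin)

lemma eval_in_lin1: "v \<in> carrier Y \<Longrightarrow> (\<lambda>x. eval_in Y \<sigma> x v) \<in> linear_maps (free_alg G) Y"
  unfolding eval_in_free_ext linear_maps_free_alg
  by (rule free_ext_lin[OF Y]) (use lin_closed[OF foldr_lin] in auto)

lemma eval_in_mult:
  assumes "Poly_Mapping.keys x \<subseteq> lists G" "Poly_Mapping.keys y \<subseteq> lists G" "v \<in> carrier Y"
  shows "eval_in Y \<sigma> (x \<otimes>\<^bsub>free_alg G\<^esub> y) v = eval_in Y \<sigma> x (eval_in Y \<sigma> y v)"
proof (rule vs_eqI[OF Y])
  fix \<phi> assume \<phi>: "\<phi> \<in> dual Y"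
  have "lc y (\<lambda>u. \<phi> (foldr \<sigma> w (foldr \<sigma> u v))) = \<phi> (foldr \<sigma> w (eval_in Y \<sigma> y v))" if "w \<in> lists G" for w
    using dual_eval_in[OF dual_comp[OF \<phi> foldr_lin[OF that]] assms(2,3)] by simp
  then have "lc x (\<lambda>w. lc y (\<lambda>u. \<phi> (foldr \<sigma> w (foldr \<sigma> u v)))) = lc x (\<lambda>w. \<phi> (foldr \<sigma> w (eval_in Y \<sigma> y v)))"
    using assms(1) by (intro lc_cong) auto
  then show "\<phi> (eval_in Y \<sigma> (x \<otimes>\<^bsub>free_alg G\<^esub> y) v) = \<phi> (eval_in Y \<sigma> x (eval_in Y \<sigma> y v))"
    using assms free_alg_mult_closed[OF assms(1,2)] eval_in_closed by (simp add: dual_eval_in[OF \<phi>])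
qed (use assms free_alg_mult_closed[OF assms(1,2)] eval_in_closed in auto)

end

lemma eval_in_basis:
  assumes "vs Y" "foldr \<sigma> w v \<in> carrier Y" shows "eval_in Y \<sigma> (basis w) v = foldr \<sigma> w v"
  using free_ext_basis[OF assms(1), of "\<lambda>w. foldr \<sigma> w v"] assms(2) by (simp add: eval_in_free_ext)

lemma is_moduleD:
  assumes "is_module P Y \<sigma>"
  shows "vs Y" "\<forall>g\<in>gens P. \<sigma> g \<in> linear_maps Y Y" "r \<in> rels P \<Longrightarrow> v \<in> carrier Y \<Longrightarrow> eval_in Y \<sigma> r v = \<zero>\<^bsub>Y\<^esub>"
  using assms by (auto simp: is_module_def)

text \<open>The annihilator of the module is a two-sided ideal that contains the relations, so it
  contains the ideal generated by them.\<close>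

lemma (in presented) eval_in_rel_ideal:
  assumes M: "is_module P Y \<sigma>" and x: "x \<in> rel_ideal P" and v: "v \<in> carrier Y"
  shows "eval_in Y \<sigma> x v = \<zero>\<^bsub>Y\<^esub>"
proof -
  note D = is_moduleD[OF M]
  interpret FA: ring FA by (rule ring_free_alg)
  let ?I = "{x \<in> carrier FA. \<forall>v\<in>carrier Y. eval_in Y \<sigma> x v = \<zero>\<^bsub>Y\<^esub>}"
  have "submodule {x \<in> carrier FA. \<forall>v\<in>carrier Y. x \<in> {x \<in> carrier FA. eval_in Y \<sigma> x v \<in> {\<zero>\<^bsub>Y\<^esub>}}} CC FA"
    by (intro submodule_INT[OF vs_free_alg] submodule_preimage[OF vs_free_alg D(1) eval_in_lin1[OF D(1,2)]] submodule_zero D(1))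
  also have "{x \<in> carrier FA. \<forall>v\<in>carrier Y. x \<in> {x \<in> carrier FA. eval_in Y \<sigma> x v \<in> {\<zero>\<^bsub>Y\<^esub>}}} = ?I" by auto
  finally have I: "submodule ?I CC FA" .
  from I have "additive_subgroup ?I FA"
    by (intro additive_subgroupI) (rule submodule.axioms(1))
  moreover have "a \<otimes>\<^bsub>FA\<^esub> x \<in> ?I" "x \<otimes>\<^bsub>FA\<^esub> a \<in> ?I" if x: "x \<in> ?I" and a: "a \<in> carrier FA" for x a
    using x a FA.m_closed[of a x] FA.m_closed[of x a] eval_in_mult[OF D(1,2)]
      eval_in_closed[OF D(1,2)] lin_zero[OF D(1,1) eval_in_lin[OF D(1,2)]]
    by (auto simp del: free_alg_simps(6))
  ultimately have "ideal ?I FA"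
    by (intro idealI[OF ring_free_alg]) (auto simp: additive_subgroup_def)
  then have "rel_ideal P \<subseteq> ?I"
    unfolding rel_ideal_def using D(3) rels_carrier by (intro FA.genideal_minimal) auto
  then show ?thesis using x v by auto
qed

text \<open>Serves twice: for the enveloping algebra of \<open>gl\<close> over that of
  \<open>p\<close>, and for the Hecke algebra over its parabolic subalgebra. The operators
  \<open>\<rho>\<close> are only assumed linear; any relation of the subalgebra that they violate is
  forced by the quotient, and Frobenius reciprocity below holds all the same.\<close>

locale induction = presented P for P :: "'g presentation" +
  fixes S :: "'g set" and X :: "(complex, 'a, 'm) module_scheme" and \<rho> :: "'g \<Rightarrow> 'a \<Rightarrow> 'a"
  assumes S_gens: "S \<subseteq> gens P" and X: "vs X" and \<rho>: "\<forall>s\<in>S. \<rho> s \<in> linear_maps X X"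
begin

abbreviation "I \<equiv> ind P S X \<rho>"
abbreviation "K \<equiv> ind_ker P S X \<rho>"
abbreviation "pt \<equiv> pure_tensor (alg P) X"
abbreviation "iact \<equiv> ind_act P S X \<rho>"

definition pc where "pc a v = K +>\<^bsub>tensor (alg P) X\<^esub> pt a v"

text \<open>The unit \<open>v \<mapsto> 1 \<otimes> v\<close> of the adjunction between induction
  and restriction.\<close>

definition ie where "ie v = pc (cls P (basis [])) v"

lemma vs_AX: "vs (tensor (alg P) X)"
  by (rule vs_tensor[OF vs_alg X])

lemma cls_S: "Poly_Mapping.keys x \<subseteq> lists S \<Longrightarrow> cls P x \<in> carrier (alg P)"
  using S_gens lists_mono[OF S_gens] by (intro cls_in) auto

lemma ind_gens_carrier: "{pt (a \<otimes>\<^bsub>alg P\<^esub> cls P x) v \<ominus>\<^bsub>tensor (alg P) X\<^esub> pt a (eval_in X \<rho> x v) | a x v.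
     a \<in> carrier (alg P) \<and> x \<in> carrier (free_alg S) \<and> v \<in> carrier X} \<subseteq> carrier (tensor (alg P) X)"
  by (auto intro!: vs_diff[OF vs_AX] pure_tensor_in[OF vs_alg X] alg_mult_closed eval_in_closed[OF X \<rho>] cls_S)

lemma K_submodule: "submodule K CC (tensor (alg P) X)"
  unfolding ind_ker_def by (rule submodule_subspace_gen[OF vs_AX ind_gens_carrier])

lemma vs_ind: "vs I"
  unfolding ind_def by (rule vs_quot[OF vs_AX K_submodule])

lemma pc_in: "a \<in> carrier (alg P) \<Longrightarrow> v \<in> carrier X \<Longrightarrow> pc a v \<in> carrier I"
  unfolding pc_def ind_def by (rule quot_in[OF vs_AX K_submodule pure_tensor_in[OF vs_alg X]])

lemma pc_lin1: "v \<in> carrier X \<Longrightarrow> (\<lambda>a. pc a v) \<in> linear_maps (alg P) I"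
  unfolding pc_def ind_def
  by (rule lin_comp[OF pure_tensor_lin1[OF vs_alg X] coset_lin[OF vs_AX K_submodule]])

lemma pc_lin2: "a \<in> carrier (alg P) \<Longrightarrow> pc a \<in> linear_maps X I"
  unfolding pc_def[abs_def] ind_def
  by (rule lin_comp[OF pure_tensor_lin2[OF vs_alg X] coset_lin[OF vs_AX K_submodule]])

lemma ie_lin: "ie \<in> linear_maps X I"
  unfolding ie_def[abs_def] by (rule pc_lin2[OF cls_in]) simp

lemma ie_in: "v \<in> carrier X \<Longrightarrow> ie v \<in> carrier I"
  by (rule lin_closed[OF ie_lin])

lemma pc_balanced:
  assumes "a \<in> carrier (alg P)" "Poly_Mapping.keys x \<subseteq> lists S" "v \<in> carrier X"
  shows "pc (a \<otimes>\<^bsub>alg P\<^esub> cls P x) v = pc a (eval_in X \<rho> x v)"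
proof -
  have "pt (a \<otimes>\<^bsub>alg P\<^esub> cls P x) v \<ominus>\<^bsub>tensor (alg P) X\<^esub> pt a (eval_in X \<rho> x v) \<in> K"
    unfolding ind_ker_def using assms by (intro subsetD[OF subspace_gen_superset]) auto
  then show ?thesis
    unfolding pc_def using assms
    by (subst coset_eq_iff[OF vs_AX K_submodule])
      (auto intro!: pure_tensor_in[OF vs_alg X] alg_mult_closed eval_in_closed[OF X \<rho>] cls_S)
qed

lemma ind_lin_eqI_pc:
  assumes "submodule V CC I" "\<And>a v. a \<in> carrier (alg P) \<Longrightarrow> v \<in> carrier X \<Longrightarrow> pc a v \<in> V"
  shows "carrier I \<subseteq> V"
  using assms(1) unfolding ind_def
proof (rule quot_spanning[OF vs_AX K_submodule, of V "{pt a v | a v. a \<in> carrier (alg P) \<and> v \<in> carrier X}"])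
  fix W assume "submodule W CC (tensor (alg P) X)" "{pt a v | a v. a \<in> carrier (alg P) \<and> v \<in> carrier X} \<subseteq> W"
  then show "carrier (tensor (alg P) X) \<subseteq> W" by (intro tensor_spanning[OF vs_alg X]) auto
qed (use assms(2) pure_tensor_in[OF vs_alg X] in \<open>auto simp: pc_def\<close>)

text \<open>Treats \<open>ind_act\<close> (\<open>L\<close> a left multiplication, \<open>F\<close>
  the identity) and \<open>ind_map\<close> (\<open>L\<close> the identity) at once. What preserves
  the relations of the balanced tensor product is that \<open>L\<close> commutes with right
  multiplications and \<open>F\<close> with the subalgebra.\<close>

context
  fixes L F
  assumes L: "L \<in> linear_maps (alg P) (alg P)" and F: "F \<in> linear_maps X X"
    and L_assoc: "\<And>a b. a \<in> carrier (alg P) \<Longrightarrow> b \<in> carrier (alg P) \<Longrightarrow> L (a \<otimes>\<^bsub>alg P\<^esub> b) = L a \<otimes>\<^bsub>alg P\<^esub> b"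
    and F_comm: "\<And>s v. s \<in> S \<Longrightarrow> v \<in> carrier X \<Longrightarrow> F (\<rho> s v) = \<rho> s (F v)"
begin

lemma F_eval: assumes "Poly_Mapping.keys x \<subseteq> lists S" "v \<in> carrier X"
  shows "F (eval_in X \<rho> x v) = eval_in X \<rho> x (F v)"
proof (rule vs_eqI[OF X])
  fix \<phi> assume \<phi>: "\<phi> \<in> dual X"
  have "F (foldr \<rho> w v) = foldr \<rho> w (F v)" if "w \<in> lists S" for w
    using that by (induction w) (use assms(2) lin_closed[OF foldr_lin[OF X \<rho>]] in \<open>auto simp: F_comm\<close>)
  then have "lc x (\<lambda>w. \<phi> (F (foldr \<rho> w v))) = lc x (\<lambda>w. \<phi> (foldr \<rho> w (F v)))"
    using assms(1) by (intro lc_cong) auto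
  then show "\<phi> (F (eval_in X \<rho> x v)) = \<phi> (eval_in X \<rho> x (F v))"
    using dual_eval_in[OF X \<rho> dual_comp[OF \<phi> F] assms] dual_eval_in[OF X \<rho> \<phi> assms(1)]
      lin_closed[OF F assms(2)] by simp
qed (use assms lin_closed[OF F] eval_in_closed[OF X \<rho>] in auto)

lemma ind_tensor_map_K: "k \<in> K \<Longrightarrow> tensor_map (alg P) X L F k \<in> K"
  unfolding ind_ker_def
proof (rule subspace_gen_map[OF vs_AX vs_AX tensor_map_lin[OF vs_alg X L F] submodule_subspace_gen[OF vs_AX ind_gens_carrier] ind_gens_carrier])
  fix s assume "s \<in> {pt (a \<otimes>\<^bsub>alg P\<^esub> cls P x) v \<ominus>\<^bsub>tensor (alg P) X\<^esub> pt a (eval_in X \<rho> x v) | a x v.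
     a \<in> carrier (alg P) \<and> x \<in> carrier (free_alg S) \<and> v \<in> carrier X}"
  then obtain a x v where s: "s = pt (a \<otimes>\<^bsub>alg P\<^esub> cls P x) v \<ominus>\<^bsub>tensor (alg P) X\<^esub> pt a (eval_in X \<rho> x v)"
    and c: "a \<in> carrier (alg P)" "Poly_Mapping.keys x \<subseteq> lists S" "v \<in> carrier X" by auto
  have ev: "eval_in X \<rho> x v \<in> carrier X" using c eval_in_closed[OF X \<rho>] by simp
  have "tensor_map (alg P) X L F s = pt (L a \<otimes>\<^bsub>alg P\<^esub> cls P x) (F v) \<ominus>\<^bsub>tensor (alg P) X\<^esub> pt (L a) (eval_in X \<rho> x (F v))"
    unfolding s using c ev cls_S
    by (simp add: lin_diff[OF vs_AX vs_AX tensor_map_lin[OF vs_alg X L F]] tensor_map_pure[OF vs_alg X L F]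
      pure_tensor_in[OF vs_alg X] alg_mult_closed L_assoc F_eval)
  then show "tensor_map (alg P) X L F s \<in> subspace_gen (tensor (alg P) X) {pt (a \<otimes>\<^bsub>alg P\<^esub> cls P x) v \<ominus>\<^bsub>tensor (alg P) X\<^esub> pt a (eval_in X \<rho> x v) | a x v.
     a \<in> carrier (alg P) \<and> x \<in> carrier (free_alg S) \<and> v \<in> carrier X}"
    using lin_closed[OF L c(1)] c(2) lin_closed[OF F c(3)]
    by (intro subsetD[OF subspace_gen_superset]) (simp, blast)
qed

lemma ind_quot_map_lin: "quot_map (tensor (alg P) X) K (tensor_map (alg P) X L F) \<in> linear_maps I I"
  unfolding ind_def by (rule quot_map_lin[OF vs_AX K_submodule tensor_map_lin[OF vs_alg X L F] ind_tensor_map_K])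

lemma ind_quot_map_pc: "a \<in> carrier (alg P) \<Longrightarrow> v \<in> carrier X \<Longrightarrow>
    quot_map (tensor (alg P) X) K (tensor_map (alg P) X L F) (pc a v) = pc (L a) (F v)"
  unfolding pc_def
  using quot_map_coset[OF vs_AX K_submodule tensor_map_lin[OF vs_alg X L F] ind_tensor_map_K, of "pt a v"]
  by (simp add: tensor_map_pure[OF vs_alg X L F] pure_tensor_in[OF vs_alg X])

end

lemma cls_gen: "g \<in> gens P \<Longrightarrow> cls P (basis [g]) \<in> carrier (alg P)"
  by (rule cls_in) simp

lemma iact_lin: "g \<in> gens P \<Longrightarrow> iact g \<in> linear_maps I I"
  unfolding ind_act_def
  by (rule ind_quot_map_lin[OF alg_mult_lin2[OF cls_gen] lin_id]) (auto simp: alg_mult_assoc cls_gen)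

lemma iact_lin_ball: "\<forall>g\<in>gens P. iact g \<in> linear_maps I I"
  by (simp add: iact_lin)

lemma iact_pc: "g \<in> gens P \<Longrightarrow> a \<in> carrier (alg P) \<Longrightarrow> v \<in> carrier X \<Longrightarrow>
    iact g (pc a v) = pc (cls P (basis [g]) \<otimes>\<^bsub>alg P\<^esub> a) v"
  unfolding ind_act_def
  by (rule ind_quot_map_pc[OF alg_mult_lin2[OF cls_gen] lin_id]) (auto simp: alg_mult_assoc cls_gen)

lemma iact_word: "w \<in> lists (gens P) \<Longrightarrow> a \<in> carrier (alg P) \<Longrightarrow> v \<in> carrier X \<Longrightarrow>
    foldr iact w (pc a v) = pc (cls P (basis w) \<otimes>\<^bsub>alg P\<^esub> a) v"
proof (induction w)
  case Nil
  then show ?case using cls_one_mult by (auto simp: carrier_alg)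
next
  case (Cons g w)
  then have "foldr iact (g # w) (pc a v) = pc (cls P (basis [g]) \<otimes>\<^bsub>alg P\<^esub> (cls P (basis w) \<otimes>\<^bsub>alg P\<^esub> a)) v"
    by (auto simp: iact_pc alg_mult_closed cls_in)
  also have "cls P (basis [g]) \<otimes>\<^bsub>alg P\<^esub> (cls P (basis w) \<otimes>\<^bsub>alg P\<^esub> a) = cls P (basis (g # w)) \<otimes>\<^bsub>alg P\<^esub> a"
    using Cons alg_mult_assoc[of "cls P (basis [g])" "cls P (basis w)" a] cls_mult[of "basis [g]" "basis w"]
    by (simp add: cls_in)
  finally show ?case .
qed

text \<open>The class of the word \<open>[s]\<close> is \<open>s\<close> times 1 and also 1 times
  \<open>s\<close>; in the second reading \<open>s\<close> belongs to the subalgebra and crosses the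
  tensor sign.\<close>

lemma iact_ie: "s \<in> S \<Longrightarrow> v \<in> carrier X \<Longrightarrow> iact s (ie v) = ie (\<rho> s v)"
proof -
  assume s: "s \<in> S" and v: "v \<in> carrier X"
  then have g: "s \<in> gens P" using S_gens by auto
  have "iact s (ie v) = pc (cls P (basis [s]) \<otimes>\<^bsub>alg P\<^esub> cls P (basis [])) v"
    unfolding ie_def using g v by (intro iact_pc) (auto intro: cls_in)
  also have "\<dots> = pc (cls P (basis []) \<otimes>\<^bsub>alg P\<^esub> cls P (basis [s])) v"
    using g by (simp add: cls_mult)
  also have "\<dots> = ie (eval_in X \<rho> (basis [s]) v)"
    unfolding ie_def using s v by (intro pc_balanced cls_in) auto
  also have "eval_in X \<rho> (basis [s]) v = \<rho> s v"
    using eval_in_basis[OF X, of \<rho> "[s]" v] lin_closed[OF bspec[OF \<rho> s] v] by simp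
  finally show ?thesis .
qed

text \<open>Words in the generators, applied to \<open>1 \<otimes> v\<close>, produce the classes of
  all \<open>a \<otimes> v\<close>.\<close>

lemma ind_spanning:
  assumes V: "submodule V CC I" and ie: "\<And>v. v \<in> carrier X \<Longrightarrow> ie v \<in> V"
    and act: "\<And>g t. g \<in> gens P \<Longrightarrow> t \<in> V \<Longrightarrow> iact g t \<in> V"
  shows "carrier I \<subseteq> V"
proof (rule ind_lin_eqI_pc[OF V])
  fix a v assume a: "a \<in> carrier (alg P)" and v: "v \<in> carrier X"
  obtain x where x: "x \<in> carrier FA" "a = cls P x" using a by (auto simp: carrier_alg)
  have lin: "(\<lambda>x. pc (cls P x) v) \<in> linear_maps (free_space (lists (gens P))) I"
    using lin_comp[OF cls_lin pc_lin1[OF v]] by (simp add: linear_maps_free_alg)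
  have "foldr iact w (ie v) \<in> V" if "w \<in> lists (gens P)" for w
    using that by (induction w) (auto simp: ie v act)
  then have "pc (cls P (basis w)) v \<in> V" if w: "w \<in> lists (gens P)" for w
  proof -
    have "foldr iact w (ie v) = pc (cls P (basis w)) v"
      using iact_word[of w "cls P (basis [])" v] w v by (simp add: cls_in ie_def cls_mult)
    then show ?thesis using \<open>\<And>w. w \<in> lists (gens P) \<Longrightarrow> foldr iact w (ie v) \<in> V\<close>[OF w] by simp
  qed
  then have "carrier (free_space (lists (gens P))) \<subseteq> {x \<in> carrier (free_space (lists (gens P))). pc (cls P x) v \<in> V}"
    by (intro free_space_spanning submodule_preimage[OF vs_free_space vs_ind lin V]) auto
  then show "pc a v \<in> V" using x by auto
qed

lemma ind_lin_eqI:
  assumes Y: "vs Y" "F \<in> linear_maps I Y" "G \<in> linear_maps I Y"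
    and ie: "\<And>v. v \<in> carrier X \<Longrightarrow> F (ie v) = G (ie v)"
    and act: "\<And>g t. g \<in> gens P \<Longrightarrow> t \<in> carrier I \<Longrightarrow> F t = G t \<Longrightarrow> F (iact g t) = G (iact g t)"
    and t: "t \<in> carrier I"
  shows "F t = G t"
proof -
  have "carrier I \<subseteq> {t \<in> carrier I. F t = G t}"
    by (rule ind_spanning[OF submodule_equalizer[OF vs_ind Y]])
      (use ie act ie_in lin_closed[OF iact_lin] in auto)
  then show ?thesis using t by auto
qed

text \<open>On the class of \<open>a \<otimes> v\<close> a relation \<open>r\<close> acts by giving
  the class of \<open>ra \<otimes> v\<close>, and \<open>r\<close> vanishes in the algebra.\<close>

lemma ind_is_module: "is_module P I iact"
  unfolding is_module_def
proof (intro conjI ballI)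
  fix r t assume r: "r \<in> rels P" and t: "t \<in> carrier I"
  have rc: "Poly_Mapping.keys r \<subseteq> lists (gens P)" using r rels_carrier by auto
  have "eval_in I iact r (pc a v) = \<zero>\<^bsub>I\<^esub>" if a: "a \<in> carrier (alg P)" and v: "v \<in> carrier X" for a v
  proof (rule vs_eqI[OF vs_ind])
    show "eval_in I iact r (pc a v) \<in> carrier I"
      by (rule eval_in_closed[OF vs_ind iact_lin_ball rc pc_in[OF a v]])
    fix \<phi> assume \<phi>: "\<phi> \<in> dual I"
    have lin: "(\<lambda>x. pc (cls P x \<otimes>\<^bsub>alg P\<^esub> a) v) \<in> linear_maps (free_space (lists (gens P))) I"
      using lin_comp[OF lin_comp[OF cls_lin alg_mult_lin1[OF a]] pc_lin1[OF v]] by (simp add: linear_maps_free_alg)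
    have "\<phi> (eval_in I iact r (pc a v)) = lc r (\<lambda>w. \<phi> (foldr iact w (pc a v)))"
      by (rule dual_eval_in[OF vs_ind iact_lin_ball \<phi> rc pc_in[OF a v]])
    also have "\<dots> = lc r (\<lambda>w. \<phi> (pc (cls P (basis w) \<otimes>\<^bsub>alg P\<^esub> a) v))"
      by (rule lc_cong) (use rc iact_word[OF _ a v] in auto)
    also have "\<dots> = \<phi> (pc (cls P r \<otimes>\<^bsub>alg P\<^esub> a) v)"
      using dual_free_space[OF dual_comp[OF \<phi> lin] rc] by simp
    also have "cls P r = \<zero>\<^bsub>alg P\<^esub>" using r rels_in_rel_ideal rels_carrier by (subst cls_zero_iff) auto
    also have "\<zero>\<^bsub>alg P\<^esub> \<otimes>\<^bsub>alg P\<^esub> a = \<zero>\<^bsub>alg P\<^esub>" by (rule lin_zero[OF vs_alg vs_alg alg_mult_lin1[OF a]])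
    also have "pc \<zero>\<^bsub>alg P\<^esub> v = \<zero>\<^bsub>I\<^esub>" by (rule lin_zero[OF vs_alg vs_ind pc_lin1[OF v]])
    finally show "\<phi> (eval_in I iact r (pc a v)) = \<phi> \<zero>\<^bsub>I\<^esub>" .
  qed (simp add: vs_ind)
  then have "carrier I \<subseteq> {t \<in> carrier I. eval_in I iact r t \<in> {\<zero>\<^bsub>I\<^esub>}}"
    by (intro ind_lin_eqI_pc submodule_preimage[OF vs_ind vs_ind eval_in_lin[OF vs_ind iact_lin_ball rc] submodule_zero[OF vs_ind]])
      (auto simp: pc_in)
  then show "eval_in I iact r t = \<zero>\<^bsub>I\<^esub>" using t by auto
qed (auto simp: vs_ind iact_lin)

text \<open>The existence half of Frobenius reciprocity: the map is
  \<open>a \<otimes> v \<mapsto> a (f v)\<close>. It is well defined in \<open>a\<close> because the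
  relations act by zero on \<open>Y\<close>, and it kills
  \<open>ab \<otimes> v - a \<otimes> bv\<close> because \<open>f\<close> commutes with the
  generators of the subalgebra.\<close>

lemma frobenius:
  assumes M: "is_module P Y \<sigma>" and f: "f \<in> linear_maps X Y"
    and fs: "\<And>s v. s \<in> S \<Longrightarrow> v \<in> carrier X \<Longrightarrow> f (\<rho> s v) = \<sigma> s (f v)"
  shows "\<exists>F\<in>linear_maps I Y. (\<forall>v\<in>carrier X. F (ie v) = f v) \<and>
    (\<forall>g\<in>gens P. \<forall>t\<in>carrier I. F (iact g t) = \<sigma> g (F t))"
proof -
  note D = is_moduleD[OF M]
  have "\<exists>E\<in>linear_maps (alg P) Y. \<forall>x\<in>carrier FA. E (cls P x) = eval_in Y \<sigma> x v" if "v \<in> carrier Y" for v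
    unfolding alg_def cls_def
    by (rule quot_lift[OF vs_free_alg rel_ideal_submodule D(1) eval_in_lin1[OF D(1,2) that]])
      (auto intro: eval_in_rel_ideal[OF M _ that])
  then obtain E where E: "E v \<in> linear_maps (alg P) Y" "x \<in> carrier FA \<Longrightarrow> E v (cls P x) = eval_in Y \<sigma> x v"
    if "v \<in> carrier Y" for v x by metis
  have fY: "f v \<in> carrier Y" if "v \<in> carrier X" for v by (rule lin_closed[OF f that])
  have "bilinear (alg P) X Y (\<lambda>a v. E (f v) a)"
    unfolding bilinear_def
  proof (intro conjI ballI)
    fix a assume "a \<in> carrier (alg P)"
    then obtain x where x: "x \<in> carrier FA" "a = cls P x" by (auto simp: carrier_alg)
    have "(\<lambda>v. eval_in Y \<sigma> x (f v)) \<in> linear_maps X Y"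
      using x by (intro lin_comp[OF f eval_in_lin[OF D(1,2)]]) auto
    moreover have "E (f v) a = eval_in Y \<sigma> x (f v)" if "v \<in> carrier X" for v
      using E(2)[OF fY[OF that] x(1)] x(2) by simp
    ultimately show "(\<lambda>v. E (f v) a) \<in> linear_maps X Y" by (auto simp: linear_maps_def Pi_iff X)
  qed (rule E(1)[OF fY])
  from tensor_lift[OF vs_alg X D(1) this] obtain T where T: "T \<in> linear_maps (tensor (alg P) X) Y"
    "\<And>a v. a \<in> carrier (alg P) \<Longrightarrow> v \<in> carrier X \<Longrightarrow> T (pt a v) = E (f v) a" by blast
  have f_eval: "f (eval_in X \<rho> x v) = eval_in Y \<sigma> x (f v)" if "Poly_Mapping.keys x \<subseteq> lists S" "v \<in> carrier X" for x v
  proof (rule vs_eqI[OF D(1)])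
    have xg: "Poly_Mapping.keys x \<subseteq> lists (gens P)" using that(1) lists_mono[OF S_gens] by auto
    show "f (eval_in X \<rho> x v) \<in> carrier Y" by (rule fY[OF eval_in_closed[OF X \<rho> that]])
    show "eval_in Y \<sigma> x (f v) \<in> carrier Y" by (rule eval_in_closed[OF D(1,2) xg fY[OF that(2)]])
    fix \<phi> assume \<phi>: "\<phi> \<in> dual Y"
    have "f (foldr \<rho> w v) = foldr \<sigma> w (f v)" if "w \<in> lists S" for w
      using that by (induction w) (use \<open>v \<in> carrier X\<close> lin_closed[OF foldr_lin[OF X \<rho>]] in \<open>auto simp: fs\<close>)
    then have "lc x (\<lambda>w. \<phi> (f (foldr \<rho> w v))) = lc x (\<lambda>w. \<phi> (foldr \<sigma> w (f v)))"
      using that(1) by (intro lc_cong) auto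
    then show "\<phi> (f (eval_in X \<rho> x v)) = \<phi> (eval_in Y \<sigma> x (f v))"
      using dual_eval_in[OF X \<rho> dual_comp[OF \<phi> f] that] dual_eval_in[OF D(1,2) \<phi> xg fY[OF that(2)]] by simp
  qed
  have "T k = \<zero>\<^bsub>Y\<^esub>" if k: "k \<in> K" for k
  proof (rule subspace_gen_kill[OF vs_AX D(1) T(1) ind_gens_carrier _ k[unfolded ind_ker_def]])
    fix s assume "s \<in> {pt (a \<otimes>\<^bsub>alg P\<^esub> cls P x) v \<ominus>\<^bsub>tensor (alg P) X\<^esub> pt a (eval_in X \<rho> x v) | a x v.
     a \<in> carrier (alg P) \<and> x \<in> carrier (free_alg S) \<and> v \<in> carrier X}"
    then obtain a x v where s: "s = pt (a \<otimes>\<^bsub>alg P\<^esub> cls P x) v \<ominus>\<^bsub>tensor (alg P) X\<^esub> pt a (eval_in X \<rho> x v)"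
      and c: "a \<in> carrier (alg P)" "Poly_Mapping.keys x \<subseteq> lists S" "v \<in> carrier X" by auto
    obtain y where y: "y \<in> carrier FA" "a = cls P y" using c by (auto simp: carrier_alg)
    have xg: "x \<in> carrier FA" using c(2) lists_mono[OF S_gens] by auto
    have ev: "eval_in X \<rho> x v \<in> carrier X" using c eval_in_closed[OF X \<rho>] by simp
    have "T s = T (pt (a \<otimes>\<^bsub>alg P\<^esub> cls P x) v) \<ominus>\<^bsub>Y\<^esub> T (pt a (eval_in X \<rho> x v))"
      unfolding s using c ev cls_S
      by (simp add: lin_diff[OF vs_AX D(1) T(1)] pure_tensor_in[OF vs_alg X] alg_mult_closed)
    also have "T (pt (a \<otimes>\<^bsub>alg P\<^esub> cls P x) v) = E (f v) (cls P (y \<otimes>\<^bsub>FA\<^esub> x))"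
      using c cls_S[OF c(2)] y(2) alg_mult_closed[of a "cls P x"] cls_mult[OF y(1) xg] by (simp add: T(2))
    also have "\<dots> = eval_in Y \<sigma> (y \<otimes>\<^bsub>FA\<^esub> x) (f v)"
      by (rule E(2)[OF fY[OF c(3)]]) (use y xg free_alg_mult_closed[of y "gens P" x] in simp)
    also have "\<dots> = eval_in Y \<sigma> y (eval_in Y \<sigma> x (f v))"
      using y xg by (intro eval_in_mult[OF D(1,2) _ _ fY[OF c(3)]]) auto
    also have "T (pt a (eval_in X \<rho> x v)) = eval_in Y \<sigma> y (eval_in Y \<sigma> x (f v))"
      using c(1) ev y E(2)[OF fY[OF ev] y(1)] f_eval[OF c(2,3)] by (simp add: T(2))
    also have "eval_in Y \<sigma> y (eval_in Y \<sigma> x (f v)) \<ominus>\<^bsub>Y\<^esub> eval_in Y \<sigma> y (eval_in Y \<sigma> x (f v)) = \<zero>\<^bsub>Y\<^esub>"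
      using y xg c D(1) eval_in_closed[OF D(1,2)] fY
      by (intro vs_eqI[OF D(1)]) (auto simp: dual_simps)
    finally show "T s = \<zero>\<^bsub>Y\<^esub>" .
  qed
  from quot_lift[OF vs_AX K_submodule D(1) T(1) this]
  obtain F where F: "F \<in> linear_maps I Y" "\<forall>t\<in>carrier (tensor (alg P) X). F (K +>\<^bsub>tensor (alg P) X\<^esub> t) = T t"
    unfolding ind_def by blast
  have Fpc: "F (pc (cls P x) v) = eval_in Y \<sigma> x (f v)" if "x \<in> carrier FA" "v \<in> carrier X" for x v
    unfolding pc_def using that F(2) pure_tensor_in[OF vs_alg X] T(2) E(2)[OF fY] cls_in by simp
  have "F (ie v) = f v" if "v \<in> carrier X" for v
    unfolding ie_def using Fpc[of "basis []" v] that eval_in_basis[OF D(1), of \<sigma> "[]" "f v"] fY by simp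
  moreover have "F (iact g t) = \<sigma> g (F t)" if g: "g \<in> gens P" and t: "t \<in> carrier I" for g t
  proof -
    have "F (iact g (pc a v)) = \<sigma> g (F (pc a v))" if a: "a \<in> carrier (alg P)" and v: "v \<in> carrier X" for a v
    proof -
      obtain x where x: "x \<in> carrier FA" "a = cls P x" using a by (auto simp: carrier_alg)
      have b: "basis [g] \<in> carrier FA" using g by simp
      have "F (iact g (pc a v)) = eval_in Y \<sigma> (basis [g] \<otimes>\<^bsub>FA\<^esub> x) (f v)"
        using x g v a iact_pc[OF g a v] cls_mult[OF b x(1)] Fpc[of "basis [g] \<otimes>\<^bsub>FA\<^esub> x" v]
          free_alg_mult_closed[of "basis [g]" "gens P" x] by simp
      also have "\<dots> = eval_in Y \<sigma> (basis [g]) (eval_in Y \<sigma> x (f v))"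
        using x b by (intro eval_in_mult[OF D(1,2) _ _ fY[OF v]]) auto
      also have "\<dots> = \<sigma> g (eval_in Y \<sigma> x (f v))"
        using eval_in_basis[OF D(1), of \<sigma> "[g]"] lin_closed[OF bspec[OF D(2) g]] x eval_in_closed[OF D(1,2) _ fY[OF v], of x] by simp
      also have "eval_in Y \<sigma> x (f v) = F (pc a v)" using Fpc[OF x(1) v] x(2) by simp
      finally show ?thesis .
    qed
    then have "carrier I \<subseteq> {t \<in> carrier I. F (iact g t) = \<sigma> g (F t)}"
      by (intro ind_lin_eqI_pc submodule_equalizer[OF vs_ind D(1) lin_comp[OF iact_lin[OF g] F(1)] lin_comp[OF F(1) bspec[OF D(2) g]]])
        (auto simp: pc_in)
    then show ?thesis using t by auto
  qed
  ultimately show ?thesis using F(1) by blast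
qed

context
  fixes F
  assumes F: "F \<in> linear_maps X X"
    and F_comm: "\<And>s v. s \<in> S \<Longrightarrow> v \<in> carrier X \<Longrightarrow> F (\<rho> s v) = \<rho> s (F v)"
begin

lemma ind_map_lin: "ind_map P S X \<rho> F \<in> linear_maps I I"
  unfolding ind_map_def by (rule ind_quot_map_lin[OF lin_id F]) (auto simp: F_comm)

lemma ind_map_pc: "a \<in> carrier (alg P) \<Longrightarrow> v \<in> carrier X \<Longrightarrow> ind_map P S X \<rho> F (pc a v) = pc a (F v)"
  unfolding ind_map_def by (rule ind_quot_map_pc[OF lin_id F]) (auto simp: F_comm)

lemma ind_map_ie: "v \<in> carrier X \<Longrightarrow> ind_map P S X \<rho> F (ie v) = ie (F v)"
  unfolding ie_def by (rule ind_map_pc[OF cls_in]) auto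

lemma ind_map_iact: "g \<in> gens P \<Longrightarrow> t \<in> carrier I \<Longrightarrow> ind_map P S X \<rho> F (iact g t) = iact g (ind_map P S X \<rho> F t)"
proof -
  assume g: "g \<in> gens P" and t: "t \<in> carrier I"
  have "carrier I \<subseteq> {t \<in> carrier I. ind_map P S X \<rho> F (iact g t) = iact g (ind_map P S X \<rho> F t)}"
    by (intro ind_lin_eqI_pc submodule_equalizer[OF vs_ind vs_ind lin_comp[OF iact_lin[OF g] ind_map_lin] lin_comp[OF ind_map_lin iact_lin[OF g]]])
      (auto simp: pc_in iact_pc[OF g] ind_map_pc alg_mult_closed cls_gen[OF g] lin_closed[OF F])
  then show ?thesis using t by auto
qed

end

end

section \<open>Modules over presented algebras\<close>

lemma eval_in_hom:
  assumes X: "vs X" "\<forall>g\<in>G. \<rho> g \<in> linear_maps X X" and Y: "vs Y" "\<forall>g\<in>G. \<sigma> g \<in> linear_maps Y Y"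
    and F: "F \<in> linear_maps X Y" "\<And>g v. g \<in> G \<Longrightarrow> v \<in> carrier X \<Longrightarrow> F (\<rho> g v) = \<sigma> g (F v)"
    and x: "Poly_Mapping.keys x \<subseteq> lists G" and v: "v \<in> carrier X"
  shows "F (eval_in X \<rho> x v) = eval_in Y \<sigma> x (F v)"
proof (rule vs_eqI[OF Y(1)])
  have Fv: "F v \<in> carrier Y" by (rule lin_closed[OF F(1) v])
  show "F (eval_in X \<rho> x v) \<in> carrier Y" by (rule lin_closed[OF F(1) eval_in_closed[OF X x v]])
  show "eval_in Y \<sigma> x (F v) \<in> carrier Y" by (rule eval_in_closed[OF Y x Fv])
  fix \<phi> assume \<phi>: "\<phi> \<in> dual Y"
  have "F (foldr \<rho> w v) = foldr \<sigma> w (F v)" if "w \<in> lists G" for w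
    using that by (induction w) (use v lin_closed[OF foldr_lin[OF X]] in \<open>auto simp: F(2)\<close>)
  then have "lc x (\<lambda>w. \<phi> (F (foldr \<rho> w v))) = lc x (\<lambda>w. \<phi> (foldr \<sigma> w (F v)))"
    using x by (intro lc_cong) auto
  then show "\<phi> (F (eval_in X \<rho> x v)) = \<phi> (eval_in Y \<sigma> x (F v))"
    using dual_eval_in[OF X dual_comp[OF \<phi> F(1)] x v] dual_eval_in[OF Y \<phi> x Fv] by simp
qed

context presented
begin

lemma rels_keys: "r \<in> rels P \<Longrightarrow> Poly_Mapping.keys r \<subseteq> lists (gens P)"
  using rels_carrier by auto

lemma is_module_quot:
  assumes M: "is_module P X \<rho>" and W: "submodule W CC X"
    and stable: "\<And>g w. g \<in> gens P \<Longrightarrow> w \<in> W \<Longrightarrow> \<rho> g w \<in> W"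
  shows "is_module P (quot X W) (\<lambda>g. quot_map X W (\<rho> g))"
  unfolding is_module_def
proof (intro conjI ballI)
  note D = is_moduleD[OF M]
  note Q = vs_quot[OF D(1) W]
  show "module CC (quot X W)" by (rule Q)
  show lin: "quot_map X W (\<rho> g) \<in> linear_maps (quot X W) (quot X W)" if "g \<in> gens P" for g
    using D(2) that stable by (intro quot_map_lin[OF D(1) W]) auto
  fix r C assume r: "r \<in> rels P" and "C \<in> carrier (quot X W)"
  then obtain v where v: "v \<in> carrier X" "C = W +>\<^bsub>X\<^esub> v" by (auto simp: carrier_quot)
  have "eval_in (quot X W) (\<lambda>g. quot_map X W (\<rho> g)) r C = W +>\<^bsub>X\<^esub> eval_in X \<rho> r v"
    unfolding v(2)
    by (rule eval_in_hom[symmetric, OF D(1,2) Q _ coset_lin[OF D(1) W] _ rels_keys[OF r] v(1)])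
      (use lin D(2) stable in \<open>auto simp: quot_map_coset[OF D(1) W]\<close>)
  then show "eval_in (quot X W) (\<lambda>g. quot_map X W (\<rho> g)) r C = \<zero>\<^bsub>quot X W\<^esub>"
    using D(3)[OF r v(1)] by (simp add: coset_zero[OF D(1) W] quot_zero)
qed

text \<open>Relations are inherited along an injective equivariant map into a module. This is how
  the direct sum of induced modules gets its bimodule structure.\<close>

lemma is_module_transfer:
  assumes M: "is_module P X \<sigma>" and Y: "vs Y" "\<forall>g\<in>gens P. \<rho> g \<in> linear_maps Y Y"
    and h: "h \<in> linear_maps Y X" "inj_on h (carrier Y)"
      "\<And>g y. g \<in> gens P \<Longrightarrow> y \<in> carrier Y \<Longrightarrow> h (\<rho> g y) = \<sigma> g (h y)"
  shows "is_module P Y \<rho>"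
  unfolding is_module_def
proof (intro conjI ballI)
  note D = is_moduleD[OF M]
  fix r y assume r: "r \<in> rels P" and y: "y \<in> carrier Y"
  have "h (eval_in Y \<rho> r y) = eval_in X \<sigma> r (h y)"
    by (rule eval_in_hom[OF Y D(1,2) h(1) _ rels_keys[OF r] y]) (rule h(3))
  also have "\<dots> = h \<zero>\<^bsub>Y\<^esub>" using D(3)[OF r lin_closed[OF h(1) y]] lin_zero[OF Y(1) D(1) h(1)] by simp
  finally show "eval_in Y \<rho> r y = \<zero>\<^bsub>Y\<^esub>"
    using h(2) eval_in_closed[OF Y rels_keys[OF r] y] Y(1) by (auto dest: inj_onD)
qed (use Y in auto)

end

lemma is_module_mono:
  "is_module P X \<rho> \<Longrightarrow> gens Q \<subseteq> gens P \<Longrightarrow> rels Q \<subseteq> rels P \<Longrightarrow> is_module Q X \<rho>"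
  unfolding is_module_def by blast

lemma keys_diff_basis: "Poly_Mapping.keys f \<subseteq> A \<Longrightarrow> Poly_Mapping.keys g \<subseteq> A \<Longrightarrow> Poly_Mapping.keys (f - g) \<subseteq> A"
  using keys_diff[of f g] by auto

lemma keys_add_basis: "Poly_Mapping.keys f \<subseteq> A \<Longrightarrow> Poly_Mapping.keys g \<subseteq> A \<Longrightarrow> Poly_Mapping.keys (f + g) \<subseteq> A"
  using Poly_Mapping.keys_add[of f g] by auto

section \<open>Modules over enveloping algebras and Hecke algebras, by their relations\<close>

lemma gl_pres_simps [simp]: "gens (gl_pres G) = G"
  by (simp add: gl_pres_def)

text \<open>Transitivity of \<open>G\<close>, as a relation between indices, keeps the commutator of
  two of its matrix units inside the span of \<open>G\<close>.\<close>

lemma presented_gl: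
  assumes "trans G" shows "presented (gl_pres G)"
proof (unfold_locales, rule subsetI)
  fix r assume "r \<in> rels (gl_pres G)"
  then obtain a b c d where r: "r = basis [(a, b), (c, d)] - basis [(c, d), (a, b)]
       - ((if b = c then basis [(a, d)] else 0) - (if a = d then basis [(c, b)] else 0))"
    and G: "(a, b) \<in> G" "(c, d) \<in> G"
    unfolding gl_pres_def by auto
  have "b = c \<Longrightarrow> (a, d) \<in> G" "a = d \<Longrightarrow> (c, b) \<in> G" using assms G by (auto dest: transD)
  then show "r \<in> carrier (free_alg (gens (gl_pres G)))"
    unfolding r using G by (auto intro!: keys_diff_basis keys_add_basis del: subsetI)
qed

text \<open>The relation is asked for only after applying a functional: the Kronecker terms are then
  plain numbers, and no subtraction inside \<open>Y\<close> has to be manipulated.\<close>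

lemma gl_moduleI:
  assumes G: "trans G" and Y: "vs Y" "\<forall>g\<in>G. \<sigma> g \<in> linear_maps Y Y"
    and rel: "\<And>a b c d v \<phi>. (a, b) \<in> G \<Longrightarrow> (c, d) \<in> G \<Longrightarrow> v \<in> carrier Y \<Longrightarrow> \<phi> \<in> dual Y \<Longrightarrow>
      \<phi> (\<sigma> (a, b) (\<sigma> (c, d) v)) - \<phi> (\<sigma> (c, d) (\<sigma> (a, b) v)) =
      (if b = c then \<phi> (\<sigma> (a, d) v) else 0) - (if a = d then \<phi> (\<sigma> (c, b) v) else 0)"
  shows "is_module (gl_pres G) Y \<sigma>"
  unfolding is_module_def
proof (intro conjI ballI)
  interpret presented "gl_pres G" by (rule presented_gl[OF G])
  fix r v assume r: "r \<in> rels (gl_pres G)" and v: "v \<in> carrier Y"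
  have rk: "Poly_Mapping.keys r \<subseteq> lists G" using rels_keys[OF r] by simp
  show "eval_in Y \<sigma> r v = \<zero>\<^bsub>Y\<^esub>"
  proof (rule vs_eqI[OF Y(1) eval_in_closed[OF Y rk v]])
    fix \<phi> assume \<phi>: "\<phi> \<in> dual Y"
    obtain a b c d where r': "r = basis [(a, b), (c, d)] - basis [(c, d), (a, b)]
       - ((if b = c then basis [(a, d)] else 0) - (if a = d then basis [(c, b)] else 0))"
      and "(a, b) \<in> G" "(c, d) \<in> G"
      using r unfolding gl_pres_def by auto
    then have "lc r (\<lambda>w. \<phi> (foldr \<sigma> w v)) = 0"
      unfolding r' using rel[of a b c d v \<phi>] v \<phi> by (simp add: lc_if)
    then show "\<phi> (eval_in Y \<sigma> r v) = \<phi> \<zero>\<^bsub>Y\<^esub>"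
      by (simp add: dual_eval_in[OF Y \<phi> rk v] dual_zero[OF Y(1) \<phi>])
  qed (simp add: Y)
qed (use Y in auto)

lemma gl_relation:
  assumes M: "is_module (gl_pres G) Y \<sigma>" and G: "trans G" "(a, b) \<in> G" "(c, d) \<in> G"
    and v: "v \<in> carrier Y" and \<phi>: "\<phi> \<in> dual Y"
  shows "\<phi> (\<sigma> (a, b) (\<sigma> (c, d) v)) - \<phi> (\<sigma> (c, d) (\<sigma> (a, b) v)) =
      (if b = c then \<phi> (\<sigma> (a, d) v) else 0) - (if a = d then \<phi> (\<sigma> (c, b) v) else 0)"
proof -
  note D = is_moduleD[OF M, simplified]
  interpret presented "gl_pres G" by (rule presented_gl[OF G(1)])
  define r where "r = basis [(a, b), (c, d)] - basis [(c, d), (a, b)]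
       - ((if b = c then basis [(a, d)] else 0) - (if a = d then basis [(c, b)] else 0))"
  have r: "r \<in> rels (gl_pres G)" using G(2,3) unfolding gl_pres_def r_def presentation.simps by blast
  have rk: "Poly_Mapping.keys r \<subseteq> lists G" using rels_keys[OF r] by simp
  have "lc r (\<lambda>w. \<phi> (foldr \<sigma> w v)) = 0"
    using dual_eval_in[OF D(1,2) \<phi> rk v] D(3)[OF r v] dual_zero[OF D(1) \<phi>] by simp
  then show ?thesis by (simp add: r_def lc_if)
qed

lemma hecke_pres_simps [simp]: "gens (hecke_pres N) = hecke_gens N"
  by (simp add: hecke_pres_def)

lemma permutes_adjacent: "p \<in> {1..<N} \<Longrightarrow> trp p (p+1) permutes {1..N}"
  by (intro permutes_swap_id) auto

lemma hecke_gens_simps [simp]: "Perm w \<in> hecke_gens N \<longleftrightarrow> w permutes {1..N}" "Aff p \<in> hecke_gens N \<longleftrightarrow> p \<in> {1..N}"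
  by (auto simp: hecke_gens_def)

lemma presented_hecke: "presented (hecke_pres N)"
proof (unfold_locales, rule subsetI)
  fix r assume "r \<in> rels (hecke_pres N)"
  then show "r \<in> carrier (free_alg (gens (hecke_pres N)))"
    unfolding hecke_pres_def
    by (auto simp: permutes_id permutes_compose permutes_adjacent[simplified]
      intro!: keys_diff_basis keys_add_basis del: subsetI)
qed

lemma hecke_moduleI:
  assumes Y: "vs Y" "\<forall>g\<in>hecke_gens N. \<sigma> g \<in> linear_maps Y Y"
    and r1: "\<And>x. x \<in> carrier Y \<Longrightarrow> \<sigma> (Perm id) x = x"
    and r2: "\<And>v w x. v permutes {1..N} \<Longrightarrow> w permutes {1..N} \<Longrightarrow> x \<in> carrier Y \<Longrightarrow>
      \<sigma> (Perm v) (\<sigma> (Perm w) x) = \<sigma> (Perm (v \<circ> w)) x"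
    and r3: "\<And>p q x. p \<in> {1..N} \<Longrightarrow> q \<in> {1..N} \<Longrightarrow> x \<in> carrier Y \<Longrightarrow>
      \<sigma> (Aff p) (\<sigma> (Aff q) x) = \<sigma> (Aff q) (\<sigma> (Aff p) x)"
    and r4: "\<And>p q x. p \<in> {1..<N} \<Longrightarrow> q \<in> {1..N} \<Longrightarrow> q \<noteq> p \<Longrightarrow> q \<noteq> p + 1 \<Longrightarrow> x \<in> carrier Y \<Longrightarrow>
      \<sigma> (Perm (trp p (p+1))) (\<sigma> (Aff q) x) = \<sigma> (Aff q) (\<sigma> (Perm (trp p (p+1))) x)"
    and r5: "\<And>p x \<phi>. p \<in> {1..<N} \<Longrightarrow> x \<in> carrier Y \<Longrightarrow> \<phi> \<in> dual Y \<Longrightarrow>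
      \<phi> (\<sigma> (Perm (trp p (p+1))) (\<sigma> (Aff p) x)) = \<phi> (\<sigma> (Aff (p+1)) (\<sigma> (Perm (trp p (p+1))) x)) - \<phi> x"
  shows "is_module (hecke_pres N) Y \<sigma>"
  unfolding is_module_def
proof (intro conjI ballI)
  interpret presented "hecke_pres N" by (rule presented_hecke)
  fix r v assume r: "r \<in> rels (hecke_pres N)" and v: "v \<in> carrier Y"
  have rk: "Poly_Mapping.keys r \<subseteq> lists (hecke_gens N)" using rels_keys[OF r] by simp
  show "eval_in Y \<sigma> r v = \<zero>\<^bsub>Y\<^esub>"
  proof (rule vs_eqI[OF Y(1) eval_in_closed[OF Y rk v]])
    fix \<phi> assume \<phi>: "\<phi> \<in> dual Y"
    show "\<phi> (eval_in Y \<sigma> r v) = \<phi> \<zero>\<^bsub>Y\<^esub>"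
      using r r1[OF v] r2[OF _ _ v] r3[OF _ _ v] r4[OF _ _ _ _ v] r5[OF _ v \<phi>]
      by (auto simp: dual_eval_in[OF Y \<phi> rk v] dual_zero[OF Y(1) \<phi>] hecke_pres_def)
  qed (simp add: Y)
qed (use Y in auto)

text \<open>In the mixed relations the affine generator stands on the left, ready to be moved past a
  simple transposition. This is the form that the spanning argument for induced modules
  consumes.\<close>

lemma hecke_relation:
  assumes M: "is_module (hecke_pres N) Y \<sigma>" and x: "x \<in> carrier Y"
  shows "\<sigma> (Perm id) x = x"
    "v permutes {1..N} \<Longrightarrow> w permutes {1..N} \<Longrightarrow> \<sigma> (Perm v) (\<sigma> (Perm w) x) = \<sigma> (Perm (v \<circ> w)) x"
    "p \<in> {1..<N} \<Longrightarrow> q \<in> {1..N} \<Longrightarrow> q \<noteq> p \<Longrightarrow> q \<noteq> p + 1 \<Longrightarrow>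
      \<sigma> (Aff q) (\<sigma> (Perm (trp p (p+1))) x) = \<sigma> (Perm (trp p (p+1))) (\<sigma> (Aff q) x)"
    "p \<in> {1..<N} \<Longrightarrow> \<sigma> (Aff (p+1)) (\<sigma> (Perm (trp p (p+1))) x) = \<sigma> (Perm (trp p (p+1))) (\<sigma> (Aff p) x) \<oplus>\<^bsub>Y\<^esub> x"
    "p \<in> {1..<N} \<Longrightarrow> \<sigma> (Aff p) (\<sigma> (Perm (trp p (p+1))) x) = \<sigma> (Perm (trp p (p+1))) (\<sigma> (Aff (p+1)) x) \<ominus>\<^bsub>Y\<^esub> x"
proof -
  interpret presented "hecke_pres N" by (rule presented_hecke)
  note D = is_moduleD[OF M, simplified]
  note c = lin_closed[OF bspec[OF D(2)]]
  have rel: "lc r (\<lambda>w. \<phi> (foldr \<sigma> w y)) = 0" if "r \<in> rels (hecke_pres N)" "\<phi> \<in> dual Y" "y \<in> carrier Y" for r \<phi> y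
    using dual_eval_in[OF D(1,2) that(2) _ that(3), of r] rels_keys[OF that(1)] D(3)[OF that(1,3)] dual_zero[OF D(1) that(2)] by simp
  have r1: "\<sigma> (Perm id) y = y" if "y \<in> carrier Y" for y
  proof (rule vs_eqI[OF D(1)])
    fix \<phi> assume "\<phi> \<in> dual Y"
    moreover have "basis [Perm id] - basis [] \<in> rels (hecke_pres N)"
      unfolding hecke_pres_def presentation.simps by blast
    ultimately show "\<phi> (\<sigma> (Perm id) y) = \<phi> y" using rel[of _ \<phi> y] that by fastforce
  qed (use that c permutes_id in auto)
  have r2: "\<sigma> (Perm v) (\<sigma> (Perm w) y) = \<sigma> (Perm (v \<circ> w)) y"
    if "v permutes {1..N}" "w permutes {1..N}" "y \<in> carrier Y" for v w y
  proof (rule vs_eqI[OF D(1)])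
    fix \<phi> assume "\<phi> \<in> dual Y"
    moreover have "basis [Perm v, Perm w] - basis [Perm (v \<circ> w)] \<in> rels (hecke_pres N)"
      using that unfolding hecke_pres_def presentation.simps by blast
    ultimately show "\<phi> (\<sigma> (Perm v) (\<sigma> (Perm w) y)) = \<phi> (\<sigma> (Perm (v \<circ> w)) y)"
      using rel[of _ \<phi> y] that by fastforce
  qed (use that c permutes_compose[of w _ v] in auto)
  have r5: "\<sigma> (Aff (p+1)) (\<sigma> (Perm (trp p (p+1))) y) = \<sigma> (Perm (trp p (p+1))) (\<sigma> (Aff p) y) \<oplus>\<^bsub>Y\<^esub> y"
    if p: "p \<in> {1..<N}" and y: "y \<in> carrier Y" for p y
  proof (rule vs_eqI[OF D(1)])
    have cc: "\<sigma> (Perm (trp p (p+1))) (\<sigma> (Aff p) y) \<in> carrier Y"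
      using p y c permutes_adjacent[of p N] by auto
    fix \<phi> assume \<phi>: "\<phi> \<in> dual Y"
    moreover have "basis [Perm (trp p (p+1)), Aff p] - (basis [Aff (p+1), Perm (trp p (p+1))] - basis []) \<in> rels (hecke_pres N)"
      using p unfolding hecke_pres_def presentation.simps by blast
    ultimately have "lc (basis [Perm (trp p (p+1)), Aff p] - (basis [Aff (p+1), Perm (trp p (p+1))] - basis [])) (\<lambda>w. \<phi> (foldr \<sigma> w y)) = 0"
      using rel y by blast
    then show "\<phi> (\<sigma> (Aff (p+1)) (\<sigma> (Perm (trp p (p+1))) y)) = \<phi> (\<sigma> (Perm (trp p (p+1))) (\<sigma> (Aff p) y) \<oplus>\<^bsub>Y\<^esub> y)"
      using y cc by (simp add: dual_add[OF \<phi>] algebra_simps)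
  qed (use p y c permutes_adjacent[of p N] D(1) in auto)
  show "\<sigma> (Perm id) x = x" by (rule r1[OF x])
  show "\<sigma> (Perm v) (\<sigma> (Perm w) x) = \<sigma> (Perm (v \<circ> w)) x" if "v permutes {1..N}" "w permutes {1..N}"
    by (rule r2[OF that x])
  show "\<sigma> (Aff q) (\<sigma> (Perm (trp p (p+1))) x) = \<sigma> (Perm (trp p (p+1))) (\<sigma> (Aff q) x)"
    if "p \<in> {1..<N}" "q \<in> {1..N}" "q \<noteq> p" "q \<noteq> p + 1"
  proof (rule vs_eqI[OF D(1)])
    fix \<phi> assume "\<phi> \<in> dual Y"
    moreover have "basis [Perm (trp p (p+1)), Aff q] - basis [Aff q, Perm (trp p (p+1))] \<in> rels (hecke_pres N)"
      using that unfolding hecke_pres_def presentation.simps by blast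
    ultimately show "\<phi> (\<sigma> (Aff q) (\<sigma> (Perm (trp p (p+1))) x)) = \<phi> (\<sigma> (Perm (trp p (p+1))) (\<sigma> (Aff q) x))"
      using rel[of _ \<phi> x] x by fastforce
  qed (use that x c permutes_adjacent[of p N] in auto)
  show "\<sigma> (Aff (p+1)) (\<sigma> (Perm (trp p (p+1))) x) = \<sigma> (Perm (trp p (p+1))) (\<sigma> (Aff p) x) \<oplus>\<^bsub>Y\<^esub> x"
    if "p \<in> {1..<N}" by (rule r5[OF that x])
  show "\<sigma> (Aff p) (\<sigma> (Perm (trp p (p+1))) x) = \<sigma> (Perm (trp p (p+1))) (\<sigma> (Aff (p+1)) x) \<ominus>\<^bsub>Y\<^esub> x"
    if p: "p \<in> {1..<N}"
  proof -
    define s where "s = \<sigma> (Perm (trp p (p+1)))"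
    have s: "s \<in> linear_maps Y Y" using D(2) permutes_adjacent[OF p] by (simp add: s_def)
    have ss: "s (s y) = y" if "y \<in> carrier Y" for y
      using r2[OF permutes_adjacent[OF p] permutes_adjacent[OF p] that] r1[OF that] by (simp add: s_def)
    have cl: "s y \<in> carrier Y" "\<sigma> (Aff p) y \<in> carrier Y" "\<sigma> (Aff (p+1)) y \<in> carrier Y" if "y \<in> carrier Y" for y
      using lin_closed[OF s] c[of "Aff p"] c[of "Aff (p+1)"] p that by auto
    \<comment> \<open>The defining mixed relation is applied to \<open>s x\<close>, where
      \<open>s s x = x\<close>; applying \<open>s\<close> once more gives the relation with
      \<open>p\<close> and \<open>p + 1\<close> exchanged.\<close>
    have "\<sigma> (Aff (p+1)) x = s (\<sigma> (Aff p) (s x)) \<oplus>\<^bsub>Y\<^esub> s x"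
      using r5[OF p cl(1)[OF x], folded s_def] ss[OF x] by simp
    then have "s (\<sigma> (Aff (p+1)) x) = \<sigma> (Aff p) (s x) \<oplus>\<^bsub>Y\<^esub> x"
      using lin_add[OF s] cl x by (simp add: ss)
    then show ?thesis unfolding s_def[symmetric] using cl x D(1) by (intro vs_eqI[OF D(1)]) (auto simp: dual_simps)
  qed
qed

section \<open>Records that carry an action\<close>

lemma with_act_simps [simp]:
  "carrier (with_act X \<rho>) = carrier X" "add (with_act X \<rho>) = add X" "zero (with_act X \<rho>) = zero X"
  "smult (with_act X \<rho>) = smult X" "act (with_act X \<rho>) = \<rho>"
  by (simp_all add: with_act_def module.defs rep.defs)

lemma linear_maps_with_act [simp]:
  "linear_maps (with_act X \<rho>) Y = linear_maps X Y" "linear_maps Z (with_act X \<rho>) = linear_maps Z X"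
  by (simp_all add: linear_maps_def)

lemma dual_with_act [simp]: "dual (with_act X \<rho>) = dual X"
  by (simp add: dual_def)

lemma vs_cong:
  assumes X: "vs X" and eq: "carrier Y = carrier X" "add Y = add X" "zero Y = zero X" "smult Y = smult X"
  shows "vs Y"
proof -
  interpret module CC X by (rule X)
  show ?thesis
    by (rule vsI)
      (use X smult_l_distr smult_r_distr smult_assoc1 smult_one in
        \<open>auto simp: eq M.a_ac\<close>)
qed

lemma vs_with_act [simp]: "vs (with_act X \<rho>) \<longleftrightarrow> vs X"
  using vs_cong[of X "with_act X \<rho>"] vs_cong[of "with_act X \<rho>" X] by auto

lemma (in presented) is_module_with_act: "is_module P (with_act X \<rho>) \<sigma> \<longleftrightarrow> is_module P X \<sigma>"
proof
  assume M: "is_module P (with_act X \<rho>) \<sigma>"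
  show "is_module P X \<sigma>"
    by (rule is_module_transfer[OF M, of X \<sigma> "\<lambda>x. x"]) (use is_moduleD(1,2)[OF M] lin_id in \<open>auto simp: inj_on_def\<close>)
next
  assume M: "is_module P X \<sigma>"
  show "is_module P (with_act X \<rho>) \<sigma>"
    by (rule is_module_transfer[OF M, of "with_act X \<rho>" \<sigma> "\<lambda>x. x"]) (use is_moduleD(1,2)[OF M] lin_id in \<open>auto simp: inj_on_def\<close>)
qed

text \<open>In use, \<open>A\<close> and \<open>B\<close> are the two orders of a product, and
  \<open>C\<close>, \<open>D\<close> the two terms of the commutator. The identity is linear, so it
  may be checked on a spanning set and under functionals. \<open>C\<close> and \<open>D\<close> are
  assumed linear only under their Kronecker condition, since otherwise the matrix unit in question
  may lie outside the subalgebra that acts.\<close>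

lemma commutator_spanning:
  assumes X: "vs X" and Y: "vs Y" and A: "A \<in> linear_maps X Y" and B: "B \<in> linear_maps X Y"
    and C: "P \<Longrightarrow> C \<in> linear_maps X Y" and D: "Q \<Longrightarrow> D \<in> linear_maps X Y"
    and span: "\<And>W. submodule W CC X \<Longrightarrow> S \<subseteq> W \<Longrightarrow> carrier X \<subseteq> W" and S: "S \<subseteq> carrier X"
    and rel: "\<And>s \<phi>. s \<in> S \<Longrightarrow> \<phi> \<in> dual Y \<Longrightarrow>
      \<phi> (A s) = \<phi> (B s) + ((if P then \<phi> (C s) else 0) - (if Q then \<phi> (D s) else 0))"
    and x: "x \<in> carrier X" and \<phi>: "\<phi> \<in> dual Y"
  shows "\<phi> (A x) = \<phi> (B x) + ((if P then \<phi> (C x) else 0) - (if Q then \<phi> (D x) else 0))"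
proof -
  define R where "R x = B x \<oplus>\<^bsub>Y\<^esub> ((if P then C x else \<zero>\<^bsub>Y\<^esub>) \<ominus>\<^bsub>Y\<^esub> (if Q then D x else \<zero>\<^bsub>Y\<^esub>))" for x
  have R: "R \<in> linear_maps X Y"
    unfolding R_def[abs_def] by (intro lin_plus lin_sub lin_if B C D Y)
  have dR: "\<psi> (R y) = \<psi> (B y) + ((if P then \<psi> (C y) else 0) - (if Q then \<psi> (D y) else 0))"
    if "y \<in> carrier X" "\<psi> \<in> dual Y" for y \<psi>
    using that Y lin_closed[OF B] lin_closed[OF C] lin_closed[OF D] by (simp add: R_def dual_simps)
  have "A s = R s" if "s \<in> S" for s
    using that S lin_closed[OF A] lin_closed[OF R] by (intro vs_eqI[OF Y]) (auto simp: dR rel)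
  then have "carrier X \<subseteq> {x \<in> carrier X. A x = R x}"
    using S by (intro span[OF submodule_equalizer[OF X Y A R]]) auto
  then show ?thesis using dR[OF x \<phi>] x by auto
qed

section \<open>The commuting actions on \<open>E\<^sub>N(M)\<close>\<close>

text \<open>Interpreted three times: at \<open>U\<close> and at \<open>V\<close>, with any number of
  factors, and at the induced module.\<close>

locale gl_rep =
  fixes k N :: nat and M :: "(nat \<times> nat, 'a) rep"
  assumes gl: "gl_module k M"
begin

definition "idx = ({1..N} \<rightarrow>\<^sub>E {1..k})"
definition "T = TP idx M"
definition "t = tp idx M"
abbreviation "e a b \<equiv> act M (a, b)"

lemma M: "vs M"
  and e_lin: "a \<in> {1..k} \<Longrightarrow> b \<in> {1..k} \<Longrightarrow> e a b \<in> linear_maps M M"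
  using is_moduleD[OF gl] by (auto simp: gl_units_def)

lemma trans_gl_units: "trans (gl_units k)"
  by (auto simp: trans_def gl_units_def)

lemma e_rel:
  assumes "a \<in> {1..k}" "b \<in> {1..k}" "c \<in> {1..k}" "d \<in> {1..k}" "x \<in> carrier M" "\<phi> \<in> dual M"
  shows "\<phi> (e a b (e c d x)) = \<phi> (e c d (e a b x)) +
      ((if b = c then \<phi> (e a d x) else 0) - (if a = d then \<phi> (e c b x) else 0))"
  using gl_relation[OF gl trans_gl_units _ _ assms(5,6), of a b c d] assms by (auto simp: gl_units_def diff_eq_eq)

lemma e_in: "a \<in> {1..k} \<Longrightarrow> b \<in> {1..k} \<Longrightarrow> x \<in> carrier M \<Longrightarrow> e a b x \<in> carrier M"
  by (rule lin_closed[OF e_lin])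

lemma T: "vs T"
  unfolding T_def by (rule vs_tensor[OF vs_free_space M])

lemma t_in: "i \<in> idx \<Longrightarrow> x \<in> carrier M \<Longrightarrow> t i x \<in> carrier T"
  unfolding T_def t_def by (rule tp_in[OF M])

lemma dual_t: "\<phi> \<in> dual T \<Longrightarrow> i \<in> idx \<Longrightarrow> (\<lambda>x. \<phi> (t i x)) \<in> dual M"
  unfolding T_def t_def by (rule dual_comp[OF _ tp_lin[OF M]])

lemma idx_in: "i \<in> idx \<Longrightarrow> p \<in> {1..N} \<Longrightarrow> i p \<in> {1..k}"
  by (auto simp: idx_def)

lemma idx_upd: "i \<in> idx \<Longrightarrow> p \<in> {1..N} \<Longrightarrow> a \<in> {1..k} \<Longrightarrow> i(p := a) \<in> idx"
  by (auto simp: idx_def PiE_iff extensional_def)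

lemma idx_perm: "i \<in> idx \<Longrightarrow> w permutes {1..N} \<Longrightarrow> i \<circ> w \<in> idx"
  using permutes_in_image[of w "{1..N}"] by (auto simp: idx_def PiE_iff extensional_def permutes_not_in)

lemma tens_pow_eq: "tens_pow k N = free_space idx"
  by (simp add: tens_pow_def idx_def)

lemma perm_factors_lin: "w permutes {1..N} \<Longrightarrow> perm_factors w \<in> linear_maps (free_space idx) (free_space idx)"
  unfolding perm_factors_def by (rule lin_ext_lin) (auto intro!: idx_perm permutes_inv)

lemma unit_at_lin: "p \<in> {1..N} \<Longrightarrow> a \<in> {1..k} \<Longrightarrow> unit_at p a b \<in> linear_maps (free_space idx) (free_space idx)"
  unfolding unit_at_def by (rule lin_ext_lin) (simp add: idx_upd del: fun_upd_apply)

lemma unit_sum_lin: "a \<in> {1..k} \<Longrightarrow> (\<lambda>x. \<Sum>p\<in>{1..N}. unit_at p a b x) \<in> linear_maps (free_space idx) (free_space idx)"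
proof -
  assume a: "a \<in> {1..k}"
  have "(\<lambda>x. \<Sum>p\<in>{1..N}. unit_at p a b x) = lin_ext (\<lambda>i. \<Sum>p\<in>{1..N}. if i p = b then basis (i(p := a)) else 0)"
  proof (rule ext, rule lc_eqI)
    fix x :: tens and \<phi>
    have "lc x (\<lambda>i. \<Sum>p\<in>A. g p i) = (\<Sum>p\<in>A. lc x (g p))" if "finite A" for A :: "nat set" and g
      using that by (induction A) (simp_all add: lc_fun_add, simp add: lc_def)
    then show "lc (\<Sum>p\<in>{1..N}. unit_at p a b x) \<phi> = lc (lin_ext (\<lambda>i. \<Sum>p\<in>{1..N}. if i p = b then basis (i(p := a)) else 0) x) \<phi>"
      by (simp add: unit_at_def)
  qed
  moreover have "Poly_Mapping.keys (\<Sum>p\<in>{1..N}. if i p = b then basis (i(p := a)) else 0) \<subseteq> idx" if "i \<in> idx" for i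
  proof -
    have "Poly_Mapping.keys (if i p = b then basis (i(p := a)) else 0 :: tens) \<subseteq> idx" if "p \<in> {1..N}" for p
      using idx_upd[OF \<open>i \<in> idx\<close> that a] by simp
    then show ?thesis by (intro subset_trans[OF Poly_Mapping.keys_sum] UN_least)
  qed
  ultimately show ?thesis using lin_ext_lin[of idx _ idx] by simp
qed

lemma E_perm_lin: "w permutes {1..N} \<Longrightarrow> E_perm k N M w \<in> linear_maps T T"
  unfolding E_perm_def tens_pow_eq T_def by (rule tensor_map_lin[OF vs_free_space M perm_factors_lin lin_id])

lemma E_perm_t: "w permutes {1..N} \<Longrightarrow> i \<in> idx \<Longrightarrow> x \<in> carrier M \<Longrightarrow> E_perm k N M w (t i x) = t (i \<circ> inv_into UNIV w) x"
  unfolding E_perm_def tens_pow_eq t_def tp_def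
  using tensor_map_pure[OF vs_free_space M perm_factors_lin lin_id, of w "basis i" x]
  by (simp add: perm_factors_def)

lemma E_gl_lin: "a \<in> {1..k} \<Longrightarrow> b \<in> {1..k} \<Longrightarrow> E_gl k N M (a, b) \<in> linear_maps T T"
  unfolding E_gl_def[abs_def] tens_pow_eq prod.case T_def
  by (intro lin_plus T[unfolded T_def] tensor_map_lin[OF vs_free_space M] lin_id e_lin unit_sum_lin)

lemma E_gl_t:
  assumes "a \<in> {1..k}" "b \<in> {1..k}" "i \<in> idx" "x \<in> carrier M" "\<phi> \<in> dual T"
  shows "\<phi> (E_gl k N M (a, b) (t i x)) = (\<Sum>p\<in>{1..N}. if i p = b then \<phi> (t (i(p := a)) x) else 0) + \<phi> (t i (e a b x))"
proof -
  let ?F = "tensor_map (free_space idx) M (\<lambda>x. \<Sum>p\<in>{1..N}. unit_at p a b x) (\<lambda>y. y)"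
  have "\<phi> (E_gl k N M (a, b) (t i x)) = \<phi> (?F (t i x)) + \<phi> (t i (e a b x))"
    unfolding E_gl_def tens_pow_eq T_def[symmetric]
    using assms tensor_map_tp_id[OF M e_lin, of a b i idx x, folded t_def] t_in e_in
      lin_closed[OF tensor_map_lin[OF vs_free_space M unit_sum_lin[OF assms(1)] lin_id, folded T_def] t_in[OF assms(3,4)], of b]
    by (simp add: dual_add)
  also have "\<phi> (?F (t i x)) = (\<Sum>p\<in>{1..N}. if i p = b then \<phi> (t (i(p := a)) x) else 0)"
    using tensor_map_tp[OF M unit_sum_lin[OF assms(1)] lin_id assms(3,4,5)[unfolded T_def], of b, folded t_def]
    by (simp add: unit_at_def lc_if del: fun_upd_apply cong: if_cong)
  finally show ?thesis .
qed

lemma E_z_lin: "p \<in> {1..N} \<Longrightarrow> E_z k N M p \<in> linear_maps T T"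
  unfolding E_z_def[abs_def] tens_pow_eq T_def
  by (intro lin_finsum T[unfolded T_def] tensor_map_lin[OF vs_free_space M] unit_at_lin e_lin) auto

text \<open>At the factor \<open>p\<close> only the matrix units with column \<open>i p\<close>
  survive, which leaves a single sum.\<close>

lemma E_z_t:
  assumes "p \<in> {1..N}" "i \<in> idx" "x \<in> carrier M" "\<phi> \<in> dual T"
  shows "\<phi> (E_z k N M p (t i x)) = (\<Sum>a\<in>{1..k}. \<phi> (t (i(p := a)) (e (i p) a x)))"
proof -
  have "\<phi> (E_z k N M p (t i x)) = (\<Sum>q\<in>{1..k} \<times> {1..k}.
      \<phi> (tensor_map (free_space idx) M (unit_at p (fst q) (snd q)) (act M (snd q, fst q)) (t i x)))"
    unfolding E_z_def tens_pow_eq T_def[symmetric]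
    using assms by (intro dual_finsum[OF T] lin_closed[OF tensor_map_lin[OF vs_free_space[of idx] M, folded T_def]] unit_at_lin e_lin t_in) auto
  also have "\<dots> = (\<Sum>q\<in>{1..k} \<times> {1..k}. if i p = snd q then \<phi> (t (i(p := fst q)) (e (snd q) (fst q) x)) else 0)"
  proof (rule sum.cong[OF refl])
    fix q assume q: "q \<in> {1..k} \<times> {1..k}"
    then have "fst q \<in> {1..k}" "snd q \<in> {1..k}" by auto
    then show "\<phi> (tensor_map (free_space idx) M (unit_at p (fst q) (snd q)) (act M (snd q, fst q)) (t i x)) =
        (if i p = snd q then \<phi> (t (i(p := fst q)) (e (snd q) (fst q) x)) else 0)"
      using tensor_map_tp[OF M unit_at_lin[OF assms(1)] e_lin assms(2,3,4)[unfolded T_def], folded t_def, of "fst q" "snd q" "fst q" "snd q"]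
      by (simp add: unit_at_def lc_if del: fun_upd_apply)
  qed
  also have "\<dots> = (\<Sum>a\<in>{1..k}. \<Sum>b\<in>{1..k}. if i p = b then \<phi> (t (i(p := a)) (e b a x)) else 0)"
    by (simp only: sum.cartesian_product case_prod_unfold)
  also have "\<dots> = (\<Sum>a\<in>{1..k}. \<phi> (t (i(p := a)) (e (i p) a x)))"
    using idx_in[OF assms(2,1)] by (intro sum.cong[OF refl]) (simp add: sum.delta')
  finally show ?thesis .
qed

lemma trp_permutes: "q \<in> {1..<p} \<Longrightarrow> p \<in> {1..N} \<Longrightarrow> trp q p permutes {1..N}"
  by (intro permutes_swap_id) auto

lemma E_u_lin: "p \<in> {1..N} \<Longrightarrow> E_u k N M p \<in> linear_maps T T"
  unfolding E_u_def[abs_def] tens_pow_eq T_def[symmetric]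
  by (intro lin_plus T E_z_lin lin_finsum E_perm_lin trp_permutes) auto

lemma E_u_t:
  assumes "p \<in> {1..N}" "i \<in> idx" "x \<in> carrier M" "\<phi> \<in> dual T"
  shows "\<phi> (E_u k N M p (t i x)) =
    (\<Sum>a\<in>{1..k}. \<phi> (t (i(p := a)) (e (i p) a x))) + (\<Sum>q\<in>{1..<p}. \<phi> (t (i \<circ> trp q p) x))"
proof -
  have in_T: "E_perm k N M (trp q p) (t i x) \<in> carrier T" if "q \<in> {1..<p}" for q
    using lin_closed[OF E_perm_lin[OF trp_permutes[OF that assms(1)]] t_in[OF assms(2,3)]] .
  have fin: "(\<Oplus>\<^bsub>T\<^esub>q\<in>{1..<p}. E_perm k N M (trp q p) (t i x)) \<in> carrier T"
    by (rule vs_finsum[OF T in_T])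
  have "\<phi> (E_u k N M p (t i x)) = \<phi> (E_z k N M p (t i x)) + (\<Sum>q\<in>{1..<p}. \<phi> (E_perm k N M (trp q p) (t i x)))"
    unfolding E_u_def tens_pow_eq T_def[symmetric]
    by (simp only: dual_add[OF assms(4) lin_closed[OF E_z_lin[OF assms(1)] t_in[OF assms(2,3)]] fin]
      dual_finsum[OF T assms(4) in_T finite_atLeastLessThan])
  also have "(\<Sum>q\<in>{1..<p}. \<phi> (E_perm k N M (trp q p) (t i x))) = (\<Sum>q\<in>{1..<p}. \<phi> (t (i \<circ> trp q p) x))"
    using assms(2,3) trp_permutes[OF _ assms(1)] by (intro sum.cong[OF refl]) (simp add: E_perm_t)
  finally show ?thesis by (simp add: E_z_t[OF assms])
qed

lemma T_spanning: "submodule W CC T \<Longrightarrow> {t i x | i x. i \<in> idx \<and> x \<in> carrier M} \<subseteq> W \<Longrightarrow> carrier T \<subseteq> W"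
  unfolding T_def t_def by (rule TP_spanning[OF M]) auto

lemma T_eqI:
  assumes "F \<in> linear_maps T T" "G \<in> linear_maps T T"
    "\<And>i x \<phi>. i \<in> idx \<Longrightarrow> x \<in> carrier M \<Longrightarrow> \<phi> \<in> dual T \<Longrightarrow> \<phi> (F (t i x)) = \<phi> (G (t i x))"
    "y \<in> carrier T"
  shows "F y = G y"
proof (rule TP_lin_eqI[OF M T[unfolded T_def] assms(1,2)[unfolded T_def] _ assms(4)[unfolded T_def]])
  fix i x assume "i \<in> idx" "x \<in> carrier M"
  then show "F (tp idx M i x) = G (tp idx M i x)" unfolding t_def[symmetric]
    using assms(3) lin_closed[OF assms(1)] lin_closed[OF assms(2)] t_in by (intro vs_eqI[OF T]) auto
qed

section \<open>The \<open>gl\<close> relations and the commutation with the Hecke generators\<close>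

lemma E_perm_perm:
  assumes "v permutes {1..N}" "w permutes {1..N}" "y \<in> carrier T"
  shows "E_perm k N M v (E_perm k N M w y) = E_perm k N M (v \<circ> w) y"
proof (rule T_eqI[OF _ _ _ assms(3)])
  show "(\<lambda>y. E_perm k N M v (E_perm k N M w y)) \<in> linear_maps T T"
    by (rule lin_comp[OF E_perm_lin E_perm_lin]) fact+
  show "E_perm k N M (v \<circ> w) \<in> linear_maps T T" by (rule E_perm_lin[OF permutes_compose]) fact+
  fix i x and \<phi> :: "_ \<Rightarrow> complex" assume "i \<in> idx" "x \<in> carrier M"
  then show "\<phi> (E_perm k N M v (E_perm k N M w (t i x))) = \<phi> (E_perm k N M (v \<circ> w) (t i x))"
    using assms idx_perm[OF _ permutes_inv[OF assms(2)], of i] permutes_compose[OF assms(2,1)]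
    by (simp add: E_perm_t o_inv_distrib permutes_bij o_assoc)
qed

lemma E_gl_perm:
  assumes ab: "a \<in> {1..k}" "b \<in> {1..k}" and w: "w permutes {1..N}" and y: "y \<in> carrier T"
  shows "E_gl k N M (a, b) (E_perm k N M w y) = E_perm k N M w (E_gl k N M (a, b) y)"
proof (rule T_eqI[OF lin_comp[OF E_perm_lin[OF w] E_gl_lin[OF ab]] lin_comp[OF E_gl_lin[OF ab] E_perm_lin[OF w]] _ y])
  fix i x \<phi> assume i: "i \<in> idx" and x: "x \<in> carrier M" and \<phi>: "\<phi> \<in> dual T"
  note iw = idx_perm[OF i permutes_inv[OF w]]
  have upd: "(i \<circ> inv_into UNIV w)(w p := a) = i(p := a) \<circ> inv_into UNIV w" for p
    using permutes_inverses[OF w] by (auto simp: fun_eq_iff)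
  have "\<phi> (E_gl k N M (a, b) (E_perm k N M w (t i x))) =
    (\<Sum>p\<in>{1..N}. if (i \<circ> inv_into UNIV w) p = b then \<phi> (t ((i \<circ> inv_into UNIV w)(p := a)) x) else 0) + \<phi> (t (i \<circ> inv_into UNIV w) (e a b x))"
    using E_gl_t[OF ab iw x \<phi>] E_perm_t[OF w i x] by simp
  \<comment> \<open>Renumber the positions by \<open>w\<close>: changing the entry
    \<open>w p\<close> after the permutation is changing the entry \<open>p\<close> before
    it.\<close>
  also have "(\<Sum>p\<in>{1..N}. if (i \<circ> inv_into UNIV w) p = b then \<phi> (t ((i \<circ> inv_into UNIV w)(p := a)) x) else 0) =
    (\<Sum>p\<in>{1..N}. if i p = b then \<phi> (t (i(p := a) \<circ> inv_into UNIV w) x) else 0)"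
    by (subst sum.reindex_bij_betw[OF permutes_imp_bij[OF w], symmetric]) (simp add: upd permutes_inverses[OF w] cong: if_cong)
  also have "(\<Sum>p\<in>{1..N}. if i p = b then \<phi> (t (i(p := a) \<circ> inv_into UNIV w) x) else 0) =
     (\<Sum>p\<in>{1..N}. if i p = b then \<phi> (E_perm k N M w (t (i(p := a)) x)) else 0)"
    using idx_upd[OF i _ ab(1)] by (intro sum.cong[OF refl]) (simp add: E_perm_t[OF w _ x])
  also have "\<phi> (t (i \<circ> inv_into UNIV w) (e a b x)) = \<phi> (E_perm k N M w (t i (e a b x)))"
    using E_perm_t[OF w i e_in[OF ab x]] by simp
  finally show "\<phi> (E_gl k N M (a, b) (E_perm k N M w (t i x))) = \<phi> (E_perm k N M w (E_gl k N M (a, b) (t i x)))"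
    using E_gl_t[OF ab i x dual_comp[OF \<phi> E_perm_lin[OF w]]] by simp
qed

text \<open>The terms are sorted by where the two matrix units act: on different factors, on the
  same factor, one on a factor and one on \<open>M\<close> (two sums), both on \<open>M\<close>. In
  the commutator only the second and the last kind survive.\<close>

lemma E_gl_gl:
  assumes ab: "a \<in> {1..k}" "b \<in> {1..k}" and cd: "c \<in> {1..k}" "d \<in> {1..k}"
    and i: "i \<in> idx" and x: "x \<in> carrier M" and \<phi>: "\<phi> \<in> dual T"
  shows "\<phi> (E_gl k N M (a, b) (E_gl k N M (c, d) (t i x))) =
    (\<Sum>q\<in>{1..N}. \<Sum>p\<in>{1..N}. if p \<noteq> q \<and> i q = d \<and> i p = b then \<phi> (t (i(q := c, p := a)) x) else 0)
    + (\<Sum>q\<in>{1..N}. if i q = d \<and> c = b then \<phi> (t (i(q := a)) x) else 0)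
    + (\<Sum>q\<in>{1..N}. if i q = d then \<phi> (t (i(q := c)) (e a b x)) else 0)
    + (\<Sum>p\<in>{1..N}. if i p = b then \<phi> (t (i(p := a)) (e c d x)) else 0)
    + \<phi> (t i (e a b (e c d x)))"
proof -
  have 1: "\<phi> (E_gl k N M (a, b) (t (i(q := c)) x)) =
      (\<Sum>p\<in>{1..N}. if p \<noteq> q \<and> i p = b then \<phi> (t (i(q := c, p := a)) x) else 0)
      + (if c = b then \<phi> (t (i(q := a)) x) else 0) + \<phi> (t (i(q := c)) (e a b x))" if q: "q \<in> {1..N}" for q
  proof -
    have "(\<Sum>p\<in>{1..N}. if (i(q := c)) p = b then \<phi> (t (i(q := c, p := a)) x) else 0) =
      (\<Sum>p\<in>{1..N}. (if p \<noteq> q \<and> i p = b then \<phi> (t (i(q := c, p := a)) x) else 0)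
        + (if p = q then (if c = b then \<phi> (t (i(q := a)) x) else 0) else 0))"
      by (intro sum.cong[OF refl]) auto
    then show ?thesis using E_gl_t[OF ab idx_upd[OF i q cd(1)] x \<phi>] q by (simp add: sum.distrib sum.delta)
  qed
  have "\<phi> (E_gl k N M (a, b) (E_gl k N M (c, d) (t i x))) =
    (\<Sum>q\<in>{1..N}. if i q = d then \<phi> (E_gl k N M (a, b) (t (i(q := c)) x)) else 0) + \<phi> (E_gl k N M (a, b) (t i (e c d x)))"
    by (rule E_gl_t[OF cd i x dual_comp[OF \<phi> E_gl_lin[OF ab]]])
  also have "(\<Sum>q\<in>{1..N}. if i q = d then \<phi> (E_gl k N M (a, b) (t (i(q := c)) x)) else 0) =
    (\<Sum>q\<in>{1..N}. (\<Sum>p\<in>{1..N}. if p \<noteq> q \<and> i q = d \<and> i p = b then \<phi> (t (i(q := c, p := a)) x) else 0)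
      + (if i q = d \<and> c = b then \<phi> (t (i(q := a)) x) else 0)
      + (if i q = d then \<phi> (t (i(q := c)) (e a b x)) else 0))"
    by (intro sum.cong[OF refl]) (simp add: 1 del: fun_upd_apply)
  also have "\<phi> (E_gl k N M (a, b) (t i (e c d x))) =
    (\<Sum>p\<in>{1..N}. if i p = b then \<phi> (t (i(p := a)) (e c d x)) else 0) + \<phi> (t i (e a b (e c d x)))"
    by (rule E_gl_t[OF ab i e_in[OF cd x] \<phi>])
  finally show ?thesis by (simp add: sum.distrib)
qed

lemma E_gl_is_module: "is_module (gl_pres (gl_units k)) T (E_gl k N M)"
proof (rule gl_moduleI[OF trans_gl_units T])
  show "\<forall>g\<in>gl_units k. E_gl k N M g \<in> linear_maps T T" using E_gl_lin by (auto simp: gl_units_def)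
  fix a b c d v \<phi> assume "(a, b) \<in> gl_units k" "(c, d) \<in> gl_units k" and v: "v \<in> carrier T" and \<phi>: "\<phi> \<in> dual T"
  then have ab: "a \<in> {1..k}" "b \<in> {1..k}" and cd: "c \<in> {1..k}" "d \<in> {1..k}" by (auto simp: gl_units_def)
  have "\<phi> (E_gl k N M (a, b) (E_gl k N M (c, d) v)) = \<phi> (E_gl k N M (c, d) (E_gl k N M (a, b) v)) +
      ((if b = c then \<phi> (E_gl k N M (a, d) v) else 0) - (if a = d then \<phi> (E_gl k N M (c, b) v) else 0))"
  proof (rule commutator_spanning[OF T T lin_comp[OF E_gl_lin[OF cd] E_gl_lin[OF ab]] lin_comp[OF E_gl_lin[OF ab] E_gl_lin[OF cd]]
      E_gl_lin[OF ab(1) cd(2)] E_gl_lin[OF cd(1) ab(2)] T_spanning _ _ v \<phi>])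
    fix s \<phi> assume "s \<in> {t i x | i x. i \<in> idx \<and> x \<in> carrier M}" and \<phi>: "\<phi> \<in> dual T"
    then obtain i x where i: "i \<in> idx" and x: "x \<in> carrier M" and s: "s = t i x" by auto
    have sw: "(\<Sum>q\<in>{1..N}. \<Sum>p\<in>{1..N}. if p \<noteq> q \<and> i q = d \<and> i p = b then \<phi> (t (i(q := c, p := a)) x) else 0) =
      (\<Sum>q\<in>{1..N}. \<Sum>p\<in>{1..N}. if p \<noteq> q \<and> i q = b \<and> i p = d then \<phi> (t (i(q := a, p := c)) x) else 0)"
      by (subst sum.swap) (intro sum.cong refl, auto simp: fun_upd_twist)
    have su: "(\<Sum>q\<in>{1..N}. if i q = d \<and> c = b then \<phi> (t (i(q := a)) x) else 0) =
      (if b = c then (\<Sum>p\<in>{1..N}. if i p = d then \<phi> (t (i(p := a)) x) else 0) else 0)"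
      "(\<Sum>q\<in>{1..N}. if i q = b \<and> a = d then \<phi> (t (i(q := c)) x) else 0) =
      (if a = d then (\<Sum>p\<in>{1..N}. if i p = b then \<phi> (t (i(p := c)) x) else 0) else 0)"
      by (auto intro: sum.cong)
    show "\<phi> (E_gl k N M (a, b) (E_gl k N M (c, d) s)) = \<phi> (E_gl k N M (c, d) (E_gl k N M (a, b) s)) +
      ((if b = c then \<phi> (E_gl k N M (a, d) s) else 0) - (if a = d then \<phi> (E_gl k N M (c, b) s) else 0))"
      unfolding s E_gl_gl[OF ab cd i x \<phi>] E_gl_gl[OF cd ab i x \<phi>]
        E_gl_t[OF ab(1) cd(2) i x \<phi>] E_gl_t[OF cd(1) ab(2) i x \<phi>] sw su
      using e_rel[OF ab cd x dual_t[OF \<phi> i]] by simp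
  qed (auto simp: t_in)
  then show "\<phi> (E_gl k N M (a, b) (E_gl k N M (c, d) v)) - \<phi> (E_gl k N M (c, d) (E_gl k N M (a, b) v)) =
      (if b = c then \<phi> (E_gl k N M (a, d) v) else 0) - (if a = d then \<phi> (E_gl k N M (c, b) v) else 0)"
    by simp
qed

text \<open>
  As \<open>E_gl\<close> commutes with permutations, only \<open>z\<^sub>q\<close> matters; the terms where \<open>E\<^sub>a\<^sub>b\<close> meets the
  factor \<open>q\<close> cancel against the commutator on \<open>M\<close>.
\<close>

lemma E_gl_u:
  assumes ab: "a \<in> {1..k}" "b \<in> {1..k}" and q: "q \<in> {1..N}" and y: "y \<in> carrier T"
  shows "E_gl k N M (a, b) (E_u k N M q y) = E_u k N M q (E_gl k N M (a, b) y)"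
proof (rule T_eqI[OF lin_comp[OF E_u_lin[OF q] E_gl_lin[OF ab]] lin_comp[OF E_gl_lin[OF ab] E_u_lin[OF q]] _ y])
  fix i x \<phi> assume i: "i \<in> idx" and x: "x \<in> carrier M" and \<phi>: "\<phi> \<in> dual T"
  have iq: "i q \<in> {1..k}" by (rule idx_in[OF i q])
  let ?J = "\<lambda>j y. \<Sum>s\<in>{1..<q}. \<phi> (t (j \<circ> trp s q) y)"
  \<comment> \<open>For the transposition terms the matrix unit is first moved through the
    permutation by \<open>E_gl_perm\<close>, so the sum over positions needs no distinction of
    cases.\<close>
  have perm: "\<phi> (E_gl k N M (a, b) (t (i \<circ> trp s q) x)) =
      (\<Sum>p\<in>{1..N}. if i p = b then \<phi> (t (i(p := a) \<circ> trp s q) x) else 0) + \<phi> (t (i \<circ> trp s q) (e a b x))"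
    if s: "s \<in> {1..<q}" for s
  proof -
    note w = trp_permutes[OF s q]
    have "E_gl k N M (a, b) (t (i \<circ> trp s q) x) = E_perm k N M (trp s q) (E_gl k N M (a, b) (t i x))"
      using E_gl_perm[OF ab w t_in[OF i x]] E_perm_t[OF w i x] by simp
    then have "\<phi> (E_gl k N M (a, b) (t (i \<circ> trp s q) x)) =
      (\<Sum>p\<in>{1..N}. if i p = b then \<phi> (E_perm k N M (trp s q) (t (i(p := a)) x)) else 0) + \<phi> (E_perm k N M (trp s q) (t i (e a b x)))"
      using E_gl_t[OF ab i x dual_comp[OF \<phi> E_perm_lin[OF w]]] by simp
    also have "(\<Sum>p\<in>{1..N}. if i p = b then \<phi> (E_perm k N M (trp s q) (t (i(p := a)) x)) else 0) =
      (\<Sum>p\<in>{1..N}. if i p = b then \<phi> (t (i(p := a) \<circ> trp s q) x) else 0)"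
      using idx_upd[OF i _ ab(1)] by (intro sum.cong[OF refl]) (simp add: E_perm_t[OF w _ x])
    also have "\<phi> (E_perm k N M (trp s q) (t i (e a b x))) = \<phi> (t (i \<circ> trp s q) (e a b x))"
      using E_perm_t[OF w i e_in[OF ab x]] by simp
    finally show ?thesis .
  qed
  have Z1: "\<phi> (E_gl k N M (a, b) (t (i(q := c)) (e (i q) c x))) =
      (\<Sum>p\<in>{1..N}-{q}. if i p = b then \<phi> (t (i(q := c, p := a)) (e (i q) c x)) else 0)
      + (if c = b then \<phi> (t (i(q := a)) (e (i q) c x)) else 0) + \<phi> (t (i(q := c)) (e a b (e (i q) c x)))"
    if c: "c \<in> {1..k}" for c
  proof -
    have "(\<Sum>p\<in>{1..N}. if (i(q := c)) p = b then \<phi> (t (i(q := c, p := a)) (e (i q) c x)) else 0) =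
      (if c = b then \<phi> (t (i(q := a)) (e (i q) c x)) else 0) +
      (\<Sum>p\<in>{1..N}-{q}. if (i(q := c)) p = b then \<phi> (t (i(q := c, p := a)) (e (i q) c x)) else 0)"
      using q by (subst sum.remove[of _ q]) auto
    also have "(\<Sum>p\<in>{1..N}-{q}. if (i(q := c)) p = b then \<phi> (t (i(q := c, p := a)) (e (i q) c x)) else 0) =
      (\<Sum>p\<in>{1..N}-{q}. if i p = b then \<phi> (t (i(q := c, p := a)) (e (i q) c x)) else 0)"
      by (intro sum.cong) auto
    finally show ?thesis using E_gl_t[OF ab idx_upd[OF i q c] e_in[OF iq c x] \<phi>] by simp
  qed
  have "\<phi> (E_gl k N M (a, b) (E_u k N M q (t i x))) =
    (\<Sum>c\<in>{1..k}. \<phi> (E_gl k N M (a, b) (t (i(q := c)) (e (i q) c x)))) + (\<Sum>s\<in>{1..<q}. \<phi> (E_gl k N M (a, b) (t (i \<circ> trp s q) x)))"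
    by (rule E_u_t[OF q i x dual_comp[OF \<phi> E_gl_lin[OF ab]]])
  also have "\<dots> = (\<Sum>c\<in>{1..k}. \<Sum>p\<in>{1..N}-{q}. if i p = b then \<phi> (t (i(q := c, p := a)) (e (i q) c x)) else 0)
      + \<phi> (t (i(q := a)) (e (i q) b x)) + (\<Sum>c\<in>{1..k}. \<phi> (t (i(q := c)) (e a b (e (i q) c x))))
      + ((\<Sum>s\<in>{1..<q}. \<Sum>p\<in>{1..N}. if i p = b then \<phi> (t (i(p := a) \<circ> trp s q) x) else 0) + ?J i (e a b x))"
    using ab by (simp add: Z1 perm sum.distrib sum.delta del: fun_upd_apply)
  \<comment> \<open>The commutator on \<open>M\<close> leaves two terms: the negative one cancels
    the contribution of \<open>c = b\<close> at the factor \<open>q\<close>, and the one for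
    \<open>i q = b\<close> is the summand \<open>p = q\<close> of the other side.\<close>
  also have "(\<Sum>c\<in>{1..k}. \<phi> (t (i(q := c)) (e a b (e (i q) c x)))) =
      (\<Sum>c\<in>{1..k}. \<phi> (t (i(q := c)) (e (i q) c (e a b x)))) +
      ((if i q = b then \<Sum>c\<in>{1..k}. \<phi> (t (i(q := c)) (e a c x)) else 0) - \<phi> (t (i(q := a)) (e (i q) b x)))"
  proof -
    have "(\<Sum>c\<in>{1..k}. \<phi> (t (i(q := c)) (e a b (e (i q) c x)))) =
      (\<Sum>c\<in>{1..k}. \<phi> (t (i(q := c)) (e (i q) c (e a b x))) +
       ((if b = i q then \<phi> (t (i(q := c)) (e a c x)) else 0) - (if a = c then \<phi> (t (i(q := c)) (e (i q) b x)) else 0)))"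
      by (intro sum.cong[OF refl] e_rel[OF ab iq _ x dual_t[OF \<phi> idx_upd[OF i q]]])
    then show ?thesis using ab by (simp add: sum.distrib sum_subtractf sum.delta' eq_commute[of b] del: fun_upd_apply)
  qed
  also have "(\<Sum>c\<in>{1..k}. \<Sum>p\<in>{1..N}-{q}. if i p = b then \<phi> (t (i(q := c, p := a)) (e (i q) c x)) else 0) =
    (\<Sum>p\<in>{1..N}-{q}. if i p = b then \<Sum>c\<in>{1..k}. \<phi> (t (i(p := a, q := c)) (e (i q) c x)) else 0)"
    by (subst sum.swap) (intro sum.cong refl, auto simp: fun_upd_twist)
  also have "(\<Sum>s\<in>{1..<q}. \<Sum>p\<in>{1..N}. if i p = b then \<phi> (t (i(p := a) \<circ> trp s q) x) else 0) =
    (\<Sum>p\<in>{1..N}. if i p = b then ?J (i(p := a)) x else 0)"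
    by (subst sum.swap) (intro sum.cong refl, auto)
  finally have L: "\<phi> (E_gl k N M (a, b) (E_u k N M q (t i x))) =
      (\<Sum>p\<in>{1..N}-{q}. if i p = b then \<Sum>c\<in>{1..k}. \<phi> (t (i(p := a, q := c)) (e (i q) c x)) else 0)
      + (if i q = b then \<Sum>c\<in>{1..k}. \<phi> (t (i(q := c)) (e a c x)) else 0)
      + (\<Sum>p\<in>{1..N}. if i p = b then ?J (i(p := a)) x else 0)
      + (\<Sum>c\<in>{1..k}. \<phi> (t (i(q := c)) (e (i q) c (e a b x)))) + ?J i (e a b x)" by (simp add: comp_def fun_upd_def)
  have "\<phi> (E_u k N M q (E_gl k N M (a, b) (t i x))) =
    (\<Sum>p\<in>{1..N}. if i p = b then \<phi> (E_u k N M q (t (i(p := a)) x)) else 0) + \<phi> (E_u k N M q (t i (e a b x)))"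
    by (rule E_gl_t[OF ab i x dual_comp[OF \<phi> E_u_lin[OF q]]])
  also have "(\<Sum>p\<in>{1..N}. if i p = b then \<phi> (E_u k N M q (t (i(p := a)) x)) else 0) =
    (\<Sum>p\<in>{1..N}. (if i p = b then \<Sum>c\<in>{1..k}. \<phi> (t (i(p := a, q := c)) (e ((i(p := a)) q) c x)) else 0) +
      (if i p = b then ?J (i(p := a)) x else 0))"
    using E_u_t[OF q idx_upd[OF i _ ab(1)] x \<phi>] by (intro sum.cong[OF refl]) (simp del: fun_upd_apply)
  also have "\<dots> = (\<Sum>p\<in>{1..N}. if i p = b then \<Sum>c\<in>{1..k}. \<phi> (t (i(p := a, q := c)) (e ((i(p := a)) q) c x)) else 0) +
      (\<Sum>p\<in>{1..N}. if i p = b then ?J (i(p := a)) x else 0)" by (rule sum.distrib)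
  also have "(\<Sum>p\<in>{1..N}. if i p = b then \<Sum>c\<in>{1..k}. \<phi> (t (i(p := a, q := c)) (e ((i(p := a)) q) c x)) else 0) =
    (if i q = b then \<Sum>c\<in>{1..k}. \<phi> (t (i(q := c)) (e a c x)) else 0) +
    (\<Sum>p\<in>{1..N}-{q}. if i p = b then \<Sum>c\<in>{1..k}. \<phi> (t (i(p := a, q := c)) (e (i q) c x)) else 0)"
    using q by (subst sum.remove[of "{1..N}" q]) (auto intro!: sum.cong cong: if_cong)
  also have "\<phi> (E_u k N M q (t i (e a b x))) = (\<Sum>c\<in>{1..k}. \<phi> (t (i(q := c)) (e (i q) c (e a b x)))) + ?J i (e a b x)"
    by (rule E_u_t[OF q i e_in[OF ab x] \<phi>])
  finally show "\<phi> (E_gl k N M (a, b) (E_u k N M q (t i x))) = \<phi> (E_u k N M q (E_gl k N M (a, b) (t i x)))"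
    using L by simp
qed

section \<open>The Hecke relations\<close>

definition E_hecke :: "hecke_gen \<Rightarrow> (tens \<times> 'a \<Rightarrow>\<^sub>0 complex) set \<Rightarrow> (tens \<times> 'a \<Rightarrow>\<^sub>0 complex) set"
  where "E_hecke h = (case h of Perm w \<Rightarrow> E_perm k N M w | Aff p \<Rightarrow> E_u k N M p)"

lemma E_u_u_t:
  assumes pq: "p \<in> {1..N}" "q \<in> {1..N}" and i: "i \<in> idx" and x: "x \<in> carrier M" and \<phi>: "\<phi> \<in> dual T"
  shows "\<phi> (E_u k N M p (E_u k N M q (t i x))) =
    (\<Sum>a\<in>{1..k}. \<Sum>b\<in>{1..k}. \<phi> (t (i(q := a, p := b)) (e ((i(q := a)) p) b (e (i q) a x))))
    + (\<Sum>a\<in>{1..k}. \<Sum>r\<in>{1..<p}. \<phi> (t (i(q := a) \<circ> trp r p) (e (i q) a x)))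
    + (\<Sum>s\<in>{1..<q}. \<Sum>b\<in>{1..k}. \<phi> (t ((i \<circ> trp s q)(p := b)) (e ((i \<circ> trp s q) p) b x)))
    + (\<Sum>s\<in>{1..<q}. \<Sum>r\<in>{1..<p}. \<phi> (t (i \<circ> trp s q \<circ> trp r p) x))"
proof -
  have "\<phi> (E_u k N M p (E_u k N M q (t i x))) = (\<Sum>a\<in>{1..k}. \<phi> (E_u k N M p (t (i(q := a)) (e (i q) a x))))
      + (\<Sum>s\<in>{1..<q}. \<phi> (E_u k N M p (t (i \<circ> trp s q) x)))"
    by (rule E_u_t[OF pq(2) i x dual_comp[OF \<phi> E_u_lin[OF pq(1)]]])
  also have "(\<Sum>a\<in>{1..k}. \<phi> (E_u k N M p (t (i(q := a)) (e (i q) a x)))) =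
      (\<Sum>a\<in>{1..k}. (\<Sum>b\<in>{1..k}. \<phi> (t (i(q := a, p := b)) (e ((i(q := a)) p) b (e (i q) a x))))
       + (\<Sum>r\<in>{1..<p}. \<phi> (t (i(q := a) \<circ> trp r p) (e (i q) a x))))"
    by (intro sum.cong[OF refl] E_u_t[OF pq(1) idx_upd[OF i pq(2)] e_in[OF idx_in[OF i pq(2)]] \<phi>] x)
  also have "(\<Sum>s\<in>{1..<q}. \<phi> (E_u k N M p (t (i \<circ> trp s q) x))) =
      (\<Sum>s\<in>{1..<q}. (\<Sum>b\<in>{1..k}. \<phi> (t ((i \<circ> trp s q)(p := b)) (e ((i \<circ> trp s q) p) b x)))
       + (\<Sum>r\<in>{1..<p}. \<phi> (t (i \<circ> trp s q \<circ> trp r p) x)))"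
    by (intro sum.cong[OF refl] E_u_t[OF pq(1) idx_perm[OF i trp_permutes[OF _ pq(2)]] x \<phi>])
  finally show ?thesis by (simp only: sum.distrib add.assoc)
qed

text \<open>Write \<open>u_p = z_p + J_p\<close>, with \<open>J_p\<close> the sum of the
  transpositions of \<open>p\<close> with smaller positions. For \<open>p < q\<close> the operator
  \<open>J_p\<close> commutes with \<open>J_q\<close> and with \<open>z_q\<close>, while the
  commutator of \<open>z_p\<close> with \<open>J_q\<close> reduces to the summand
  \<open>s = p\<close> and cancels the commutator of \<open>z_p\<close> with
  \<open>z_q\<close>.\<close>

lemma E_u_commute_less:
  assumes pq: "p \<in> {1..N}" "q \<in> {1..N}" "p < q" and i: "i \<in> idx" and x: "x \<in> carrier M" and \<phi>: "\<phi> \<in> dual T"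
  shows "\<phi> (E_u k N M p (E_u k N M q (t i x))) = \<phi> (E_u k N M q (E_u k N M p (t i x)))"
proof -
  have ip: "i p \<in> {1..k}" and iq: "i q \<in> {1..k}" using idx_in[OF i] pq by auto
  have J: "(\<Sum>s\<in>{1..<q}. \<Sum>r\<in>{1..<p}. \<phi> (t (i \<circ> trp s q \<circ> trp r p) x)) =
      (\<Sum>r\<in>{1..<p}. \<Sum>s\<in>{1..<q}. \<phi> (t (i \<circ> trp r p \<circ> trp s q) x))"
  proof (subst sum.swap, rule sum.cong[OF refl])
    fix r assume r: "r \<in> {1..<p}"
    \<comment> \<open>Both \<open>r\<close> and \<open>p\<close> are below \<open>q\<close>, so
      conjugation by \<open>trp r p\<close> permutes the transpositions that make up
      \<open>J_q\<close>.\<close>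
    have "trp r p permutes {1..<q}" using r pq by (intro permutes_swap_id) auto
    from sum.reindex_bij_betw[OF permutes_imp_bij[OF this], of "\<lambda>s. \<phi> (t (i \<circ> trp s q \<circ> trp r p) x)"]
    have "(\<Sum>s\<in>{1..<q}. \<phi> (t (i \<circ> trp s q \<circ> trp r p) x)) = (\<Sum>s\<in>{1..<q}. \<phi> (t (i \<circ> trp (trp r p s) q \<circ> trp r p) x))" by simp
    also have "\<dots> = (\<Sum>s\<in>{1..<q}. \<phi> (t (i \<circ> trp r p \<circ> trp s q) x))"
    proof (intro sum.cong refl)
      fix s assume s: "s \<in> {1..<q}"
      have "i \<circ> trp (trp r p s) q \<circ> trp r p = i \<circ> trp r p \<circ> trp s q"
        using r s pq by (auto simp: fun_eq_iff Transposition.transpose_def)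
      then show "\<phi> (t (i \<circ> trp (trp r p s) q \<circ> trp r p) x) = \<phi> (t (i \<circ> trp r p \<circ> trp s q) x)" by simp
    qed
    finally show "(\<Sum>s\<in>{1..<q}. \<phi> (t (i \<circ> trp s q \<circ> trp r p) x)) = (\<Sum>s\<in>{1..<q}. \<phi> (t (i \<circ> trp r p \<circ> trp s q) x))" .
  qed
  have zJ: "(\<Sum>a\<in>{1..k}. \<Sum>r\<in>{1..<p}. \<phi> (t (i(q := a) \<circ> trp r p) (e (i q) a x))) =
      (\<Sum>r\<in>{1..<p}. \<Sum>a\<in>{1..k}. \<phi> (t ((i \<circ> trp r p)(q := a)) (e ((i \<circ> trp r p) q) a x)))"
  proof (subst sum.swap, intro sum.cong refl)
    fix r a assume r: "r \<in> {1..<p}"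
    have "i(q := a) \<circ> trp r p = (i \<circ> trp r p)(q := a)" "(i \<circ> trp r p) q = i q"
      using r pq by (auto simp: fun_eq_iff Transposition.transpose_def)
    then show "\<phi> (t (i(q := a) \<circ> trp r p) (e (i q) a x)) = \<phi> (t ((i \<circ> trp r p)(q := a)) (e ((i \<circ> trp r p) q) a x))" by simp
  qed
  have Jz: "(\<Sum>s\<in>{1..<q}. \<Sum>b\<in>{1..k}. \<phi> (t ((i \<circ> trp s q)(p := b)) (e ((i \<circ> trp s q) p) b x)))
      - (\<Sum>b\<in>{1..k}. \<Sum>s\<in>{1..<q}. \<phi> (t (i(p := b) \<circ> trp s q) (e (i p) b x))) =
      (\<Sum>b\<in>{1..k}. \<phi> (t (i(q := i p, p := b)) (e (i q) b x))) - (\<Sum>b\<in>{1..k}. \<phi> (t (i(p := i q, q := b)) (e (i p) b x)))"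
  proof -
    let ?A = "\<lambda>s. \<Sum>b\<in>{1..k}. \<phi> (t ((i \<circ> trp s q)(p := b)) (e ((i \<circ> trp s q) p) b x))"
    let ?B = "\<lambda>s. \<Sum>b\<in>{1..k}. \<phi> (t (i(p := b) \<circ> trp s q) (e (i p) b x))"
    have "?A s = ?B s" if "s \<in> {1..<q} - {p}" for s
    proof (intro sum.cong refl)
      fix b
      have "(i \<circ> trp s q)(p := b) = i(p := b) \<circ> trp s q" "(i \<circ> trp s q) p = i p"
        using that pq by (auto simp: fun_eq_iff Transposition.transpose_def)
      then show "\<phi> (t ((i \<circ> trp s q)(p := b)) (e ((i \<circ> trp s q) p) b x)) = \<phi> (t (i(p := b) \<circ> trp s q) (e (i p) b x))" by simp
    qed
    then have "sum ?A ({1..<q} - {p}) = sum ?B ({1..<q} - {p})" by (rule sum.cong[OF refl])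
    then have "sum ?A {1..<q} - sum ?B {1..<q} = ?A p - ?B p"
      using pq sum.remove[of "{1..<q}" p ?A] sum.remove[of "{1..<q}" p ?B] by simp
    moreover have "(i \<circ> trp p q)(p := b) = i(q := i p, p := b)" "(i \<circ> trp p q) p = i q"
      "i(p := b) \<circ> trp p q = i(p := i q, q := b)" for b
      using pq by (auto simp: fun_eq_iff Transposition.transpose_def)
    ultimately show ?thesis by (subst (2) sum.swap) simp
  qed
  have zz: "(\<Sum>a\<in>{1..k}. \<Sum>b\<in>{1..k}. \<phi> (t (i(q := a, p := b)) (e ((i(q := a)) p) b (e (i q) a x)))) =
      (\<Sum>b\<in>{1..k}. \<Sum>a\<in>{1..k}. \<phi> (t (i(p := b, q := a)) (e ((i(p := b)) q) a (e (i p) b x))))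
      + ((\<Sum>b\<in>{1..k}. \<phi> (t (i(p := i q, q := b)) (e (i p) b x))) - (\<Sum>b\<in>{1..k}. \<phi> (t (i(q := i p, p := b)) (e (i q) b x))))"
  proof -
    have "(\<Sum>a\<in>{1..k}. \<Sum>b\<in>{1..k}. \<phi> (t (i(q := a, p := b)) (e ((i(q := a)) p) b (e (i q) a x)))) =
      (\<Sum>a\<in>{1..k}. \<Sum>b\<in>{1..k}. \<phi> (t (i(q := a, p := b)) (e (i q) a (e (i p) b x))) +
        ((if b = i q then \<phi> (t (i(q := a, p := b)) (e (i p) a x)) else 0) - (if i p = a then \<phi> (t (i(q := a, p := b)) (e (i q) b x)) else 0)))"
    proof (intro sum.cong refl)
      fix a b assume ab: "a \<in> {1..k}" "b \<in> {1..k}"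
      have "(i(q := a)) p = i p" using pq by simp
      then show "\<phi> (t (i(q := a, p := b)) (e ((i(q := a)) p) b (e (i q) a x))) = \<phi> (t (i(q := a, p := b)) (e (i q) a (e (i p) b x))) +
        ((if b = i q then \<phi> (t (i(q := a, p := b)) (e (i p) a x)) else 0) - (if i p = a then \<phi> (t (i(q := a, p := b)) (e (i q) b x)) else 0))"
        using e_rel[OF ip ab(2) iq ab(1) x dual_t[OF \<phi> idx_upd[OF idx_upd[OF i pq(2) ab(1)] pq(1) ab(2)]]] by simp
    qed
    also have "\<dots> = (\<Sum>a\<in>{1..k}. \<Sum>b\<in>{1..k}. \<phi> (t (i(q := a, p := b)) (e (i q) a (e (i p) b x))))
      + ((\<Sum>a\<in>{1..k}. \<Sum>b\<in>{1..k}. if b = i q then \<phi> (t (i(q := a, p := b)) (e (i p) a x)) else 0)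
       - (\<Sum>a\<in>{1..k}. \<Sum>b\<in>{1..k}. if i p = a then \<phi> (t (i(q := a, p := b)) (e (i q) b x)) else 0))"
      by (simp only: sum.distrib sum_subtractf)
    also have "(\<Sum>a\<in>{1..k}. \<Sum>b\<in>{1..k}. if b = i q then \<phi> (t (i(q := a, p := b)) (e (i p) a x)) else 0) =
      (\<Sum>b\<in>{1..k}. \<phi> (t (i(p := i q, q := b)) (e (i p) b x)))"
      using iq pq by (intro sum.cong refl) (simp add: sum.delta fun_upd_twist[of p q] del: fun_upd_apply)
    also have "(\<Sum>a\<in>{1..k}. \<Sum>b\<in>{1..k}. if i p = a then \<phi> (t (i(q := a, p := b)) (e (i q) b x)) else 0) =
      (\<Sum>b\<in>{1..k}. \<phi> (t (i(q := i p, p := b)) (e (i q) b x)))"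
      using ip by (subst sum.swap) (intro sum.cong refl, simp add: sum.delta' del: fun_upd_apply)
    also have "(\<Sum>a\<in>{1..k}. \<Sum>b\<in>{1..k}. \<phi> (t (i(q := a, p := b)) (e (i q) a (e (i p) b x)))) =
      (\<Sum>b\<in>{1..k}. \<Sum>a\<in>{1..k}. \<phi> (t (i(p := b, q := a)) (e ((i(p := b)) q) a (e (i p) b x))))"
      using pq by (subst sum.swap) (intro sum.cong refl, simp add: fun_upd_twist[of p q])
    finally show ?thesis .
  qed
  show ?thesis unfolding E_u_u_t[OF pq(1,2) i x \<phi>] E_u_u_t[OF pq(2,1) i x \<phi>] J zJ zz using Jz by (simp add: algebra_simps)
qed

lemma E_u_commute:
  assumes "p \<in> {1..N}" "q \<in> {1..N}" "y \<in> carrier T"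
  shows "E_u k N M p (E_u k N M q y) = E_u k N M q (E_u k N M p y)"
proof (rule T_eqI[OF lin_comp[OF E_u_lin E_u_lin] lin_comp[OF E_u_lin E_u_lin] _ assms(3)])
  fix i x \<phi> assume "i \<in> idx" "x \<in> carrier M" "\<phi> \<in> dual T"
  then show "\<phi> (E_u k N M p (E_u k N M q (t i x))) = \<phi> (E_u k N M q (E_u k N M p (t i x)))"
    using E_u_commute_less[of p q i x \<phi>] E_u_commute_less[of q p i x \<phi>] assms(1,2) by (cases p q rule: linorder_cases) auto
qed (use assms in auto)

lemma E_perm_u_t:
  assumes w: "w permutes {1..N}" and q: "q \<in> {1..N}" and i: "i \<in> idx" and x: "x \<in> carrier M" and \<phi>: "\<phi> \<in> dual T"
  shows "\<phi> (E_perm k N M w (E_u k N M q (t i x))) =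
    (\<Sum>a\<in>{1..k}. \<phi> (t (i(q := a) \<circ> inv_into UNIV w) (e (i q) a x))) + (\<Sum>s\<in>{1..<q}. \<phi> (t (i \<circ> trp s q \<circ> inv_into UNIV w) x))"
proof -
  have "\<phi> (E_perm k N M w (E_u k N M q (t i x))) =
    (\<Sum>a\<in>{1..k}. \<phi> (E_perm k N M w (t (i(q := a)) (e (i q) a x)))) + (\<Sum>s\<in>{1..<q}. \<phi> (E_perm k N M w (t (i \<circ> trp s q) x)))"
    by (rule E_u_t[OF q i x dual_comp[OF \<phi> E_perm_lin[OF w]]])
  moreover have "E_perm k N M w (t (i(q := a)) (e (i q) a x)) = t (i(q := a) \<circ> inv_into UNIV w) (e (i q) a x)" if "a \<in> {1..k}" for a
    by (rule E_perm_t[OF w idx_upd[OF i q that] e_in[OF idx_in[OF i q] that x]])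
  moreover have "E_perm k N M w (t (i \<circ> trp s q) x) = t (i \<circ> trp s q \<circ> inv_into UNIV w) x" if "s \<in> {1..<q}" for s
    by (rule E_perm_t[OF w idx_perm[OF i trp_permutes[OF that q]] x])
  ultimately show ?thesis by simp
qed

lemma E_hecke_is_module: "is_module (hecke_pres N) T E_hecke"
proof (rule hecke_moduleI[OF T])
  show "\<forall>g\<in>hecke_gens N. E_hecke g \<in> linear_maps T T"
    by (auto simp: hecke_gens_def E_hecke_def E_perm_lin E_u_lin)
  show "E_hecke (Perm id) y = y" if "y \<in> carrier T" for y
    unfolding E_hecke_def hecke_gen.case
    by (rule T_eqI[OF E_perm_lin lin_id _ that]) (auto simp: permutes_id E_perm_t inv_id)
  show "E_hecke (Perm v) (E_hecke (Perm w) y) = E_hecke (Perm (v \<circ> w)) y"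
    if "v permutes {1..N}" "w permutes {1..N}" "y \<in> carrier T" for v w y
    unfolding E_hecke_def hecke_gen.case by (rule E_perm_perm[OF that])
  show "E_hecke (Aff p) (E_hecke (Aff q) y) = E_hecke (Aff q) (E_hecke (Aff p) y)"
    if "p \<in> {1..N}" "q \<in> {1..N}" "y \<in> carrier T" for p q y
    unfolding E_hecke_def hecke_gen.case by (rule E_u_commute[OF that])
  show "E_hecke (Perm (trp p (p+1))) (E_hecke (Aff q) y) = E_hecke (Aff q) (E_hecke (Perm (trp p (p+1))) y)"
    if p: "p \<in> {1..<N}" and q: "q \<in> {1..N}" "q \<noteq> p" "q \<noteq> p + 1" and y: "y \<in> carrier T" for p q y
    unfolding E_hecke_def hecke_gen.case
  proof (rule T_eqI[OF lin_comp[OF E_u_lin E_perm_lin] lin_comp[OF E_perm_lin E_u_lin] _ y])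
    let ?s = "trp p (p+1)"
    note w = permutes_adjacent[OF p]
    fix i x \<phi> assume i: "i \<in> idx" and x: "x \<in> carrier M" and \<phi>: "\<phi> \<in> dual T"
    \<comment> \<open>As \<open>q\<close> is neither \<open>p\<close> nor \<open>p + 1\<close>,
      either both of them lie below \<open>q\<close> or none does; hence conjugation permutes the
      transpositions in \<open>u_q\<close>.\<close>
    have bij: "bij_betw ?s {1..<q} {1..<q}"
    proof (cases "p + 1 < q")
      case True
      then show ?thesis using p by (intro permutes_imp_bij permutes_swap_id) auto
    next
      case False
      then have "?s s = s" if "s \<in> {1..<q}" for s using that q by (auto simp: Transposition.transpose_def)
      then show ?thesis using bij_betw_cong[of "{1..<q}" ?s "\<lambda>s. s" "{1..<q}"] by (simp add: bij_betw_def)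
    qed
    have eq: "i \<circ> trp (?s s) q \<circ> ?s = i \<circ> ?s \<circ> trp s q" if "s \<in> {1..<q}" for s
      using that q by (auto simp: fun_eq_iff Transposition.transpose_def)
    have eq': "i(q := a) \<circ> ?s = (i \<circ> ?s)(q := a)" "(i \<circ> ?s) q = i q" for a
      using q by (auto simp: fun_eq_iff Transposition.transpose_def)
    show "\<phi> (E_perm k N M ?s (E_u k N M q (t i x))) = \<phi> (E_u k N M q (E_perm k N M ?s (t i x)))"
      unfolding E_perm_u_t[OF w q(1) i x \<phi>] E_perm_t[OF w i x] inv_transpose_eq E_u_t[OF q(1) idx_perm[OF i w] x \<phi>]
      by (subst sum.reindex_bij_betw[OF bij, symmetric]) (simp only: eq eq' cong: sum.cong)
  qed (use p q permutes_adjacent[OF p] in auto)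
  fix p y \<phi> assume p: "p \<in> {1..<N}" and y: "y \<in> carrier T" and \<phi>: "\<phi> \<in> dual T"
  let ?s = "trp p (p+1)"
  have pN: "p \<in> {1..N}" "p + 1 \<in> {1..N}" using p by auto
  note w = permutes_adjacent[OF p]
  have "E_perm k N M ?s (E_u k N M p y) = E_u k N M (p+1) (E_perm k N M ?s y) \<ominus>\<^bsub>T\<^esub> y"
  proof (rule T_eqI[OF lin_comp[OF E_u_lin[OF pN(1)] E_perm_lin[OF w]] lin_sub[OF T lin_comp[OF E_perm_lin[OF w] E_u_lin[OF pN(2)]] lin_id] _ y])
    fix i x \<phi> assume i: "i \<in> idx" and x: "x \<in> carrier M" and \<phi>: "\<phi> \<in> dual T"
    have eq: "i \<circ> trp s p \<circ> ?s = i \<circ> ?s \<circ> trp s (p+1)" if "s \<in> {1..<p}" for s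
      using that by (auto simp: fun_eq_iff Transposition.transpose_def)
    have eq': "i(p := a) \<circ> ?s = (i \<circ> ?s)(p + 1 := a)" "(i \<circ> ?s) (p+1) = i p" "i \<circ> ?s \<circ> ?s = i" for a
      by (auto simp: fun_eq_iff Transposition.transpose_def)
    have cl: "E_u k N M (p+1) (t (i \<circ> ?s) x) \<in> carrier T"
      by (rule lin_closed[OF E_u_lin[OF pN(2)] t_in[OF idx_perm[OF i w] x]])
    \<comment> \<open>\<open>u_(p+1)\<close> contains one transposition more than
      \<open>u_p\<close>, namely \<open>?s\<close> itself. Against the outer \<open>?s\<close> it
      leaves the identity, which is the constant term of the relation.\<close>
    have "(\<Sum>s\<in>{1..<p+1}. \<phi> (t (i \<circ> ?s \<circ> trp s (p+1)) x)) = (\<Sum>s\<in>{1..<p}. \<phi> (t (i \<circ> trp s p \<circ> ?s) x)) + \<phi> (t i x)"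
    proof -
      have "(\<Sum>s\<in>{1..<p+1}. f s) = (\<Sum>s\<in>{1..<p}. f s) + f p" for f :: "nat \<Rightarrow> complex" using p by simp
      moreover have "(\<Sum>s\<in>{1..<p}. \<phi> (t (i \<circ> ?s \<circ> trp s (p+1)) x)) = (\<Sum>s\<in>{1..<p}. \<phi> (t (i \<circ> trp s p \<circ> ?s) x))"
        by (intro sum.cong refl) (simp only: eq)
      ultimately show ?thesis by (simp only: eq')
    qed
    then have "\<phi> (E_perm k N M ?s (E_u k N M p (t i x))) = \<phi> (E_u k N M (p+1) (t (i \<circ> ?s) x)) - \<phi> (t i x)"
      unfolding E_perm_u_t[OF w pN(1) i x \<phi>] inv_transpose_eq E_u_t[OF pN(2) idx_perm[OF i w] x \<phi>] eq' by simp
    then show "\<phi> (E_perm k N M ?s (E_u k N M p (t i x))) = \<phi> (E_u k N M (p+1) (E_perm k N M ?s (t i x)) \<ominus>\<^bsub>T\<^esub> t i x)"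
      unfolding E_perm_t[OF w i x] inv_transpose_eq using dual_diff[OF T \<phi> cl t_in[OF i x]] by simp
  qed
  then show "\<phi> (E_hecke (Perm ?s) (E_hecke (Aff p) y)) = \<phi> (E_hecke (Aff (p+1)) (E_hecke (Perm ?s) y)) - \<phi> y"
    unfolding E_hecke_def hecke_gen.case
    using dual_diff[OF T \<phi> lin_closed[OF E_u_lin[OF pN(2)] lin_closed[OF E_perm_lin[OF w] y]] y] by simp
qed

lemma E_gl_hecke:
  assumes "g \<in> gl_units k" "h \<in> hecke_gens N" "y \<in> carrier T"
  shows "E_gl k N M g (E_hecke h y) = E_hecke h (E_gl k N M g y)"
  using assms E_gl_perm E_gl_u by (cases g) (auto simp: gl_units_def hecke_gens_def E_hecke_def)

end

section \<open>A model of the parabolically induced module\<close>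

text \<open>An opaque Kronecker symbol, which keeps the simplifier from splitting cases.\<close>

definition kronecker :: "bool \<Rightarrow> complex"
  where "kronecker P = (if P then 1 else 0)"

lemma if_kronecker: "(if P then x else 0) = kronecker P * x"
  by (simp add: kronecker_def)

locale gl_pair =
  fixes m n :: nat and U :: "(nat \<times> nat, 'u) rep" and V :: "(nat \<times> nat, 'v) rep"
  assumes gl_U: "gl_module m U" and gl_V: "gl_module n V"
begin

sublocale U: gl_rep m N U for N by unfold_locales (rule gl_U)
sublocale V: gl_rep n N V for N by unfold_locales (rule gl_V)

definition "G = gl_units (m + n)"
definition "Q = q_units m n"
definition "W = tensor U V"
abbreviation "pa \<equiv> p_act m U V"

lemma G_iff [simp]: "(a, b) \<in> G \<longleftrightarrow> a \<in> {1..m+n} \<and> b \<in> {1..m+n}"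
  by (auto simp: G_def gl_units_def)

lemma Q_iff [simp]: "(a, b) \<in> Q \<longleftrightarrow> a \<in> {m+1..m+n} \<and> b \<in> {1..m}"
  by (auto simp: Q_def q_units_def)

lemma p_units_eq: "p_units m n = G - Q"
  by (simp add: p_units_def G_def Q_def)

lemma vU: "vs U" and vV: "vs V"
  by (rule U.M V.M)+

lemma W: "vs W"
  unfolding W_def by (rule vs_tensor[OF vU vV])

lemma pa_lin: "g \<in> G - Q \<Longrightarrow> pa g \<in> linear_maps W W"
  unfolding W_def p_act_def
  by (cases g) (auto intro!: tensor_map_lin[OF vU vV] U.e_lin V.e_lin lin_id lin_const_zero vs_tensor[OF vU vV])

lemma pa_1: "a \<in> {1..m} \<Longrightarrow> b \<in> {1..m} \<Longrightarrow> u \<in> carrier U \<Longrightarrow> v \<in> carrier V \<Longrightarrow>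
    pa (a, b) (pure_tensor U V u v) = pure_tensor U V (act U (a, b) u) v"
  using tensor_map_pure[OF vU vV U.e_lin lin_id] by (simp add: p_act_def)

lemma pa_2:
  assumes "a \<in> {m+1..m+n}" "b \<in> {m+1..m+n}" "u \<in> carrier U" "v \<in> carrier V"
  shows "pa (a, b) (pure_tensor U V u v) = pure_tensor U V u (act V (a - m, b - m) v)"
proof -
  have "a - m \<in> {1..n}" "b - m \<in> {1..n}" using assms by auto
  from tensor_map_pure[OF vU vV lin_id V.e_lin[OF this] assms(3,4)] show ?thesis using assms by (simp add: p_act_def)
qed

lemma pa_3: "a \<in> {1..m} \<Longrightarrow> b \<in> {m+1..m+n} \<Longrightarrow> pa (a, b) y = \<zero>\<^bsub>tensor U V\<^esub>"
  by (simp add: p_act_def)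

text \<open>The off-diagonal block is an ideal of \<open>p\<close> and acts by zero, so everything
  vanishes once one of the two units lies in it. Units of different diagonal blocks act on different
  tensor factors, and inside one block the relation of \<open>U\<close> or of \<open>V\<close>
  applies.\<close>

lemma pa_rel:
  assumes "(a, b) \<in> G - Q" "(c, d) \<in> G - Q" and w: "w \<in> carrier W" and \<phi>: "\<phi> \<in> dual W"
  shows "\<phi> (pa (a, b) (pa (c, d) w)) = \<phi> (pa (c, d) (pa (a, b) w)) +
      ((if b = c then \<phi> (pa (a, d) w) else 0) - (if a = d then \<phi> (pa (c, b) w) else 0))"
proof (rule commutator_spanning[OF W W lin_comp[OF pa_lin pa_lin] lin_comp[OF pa_lin pa_lin] pa_lin pa_lin
    tensor_spanning[OF vU vV, folded W_def] _ _ w \<phi>])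
  let ?S = "{pure_tensor U V u v | u v. u \<in> carrier U \<and> v \<in> carrier V}"
  show "\<And>x y. ?S \<subseteq> Wa \<Longrightarrow> x \<in> carrier U \<Longrightarrow> y \<in> carrier V \<Longrightarrow> pure_tensor U V x y \<in> Wa" for Wa by auto
  show "?S \<subseteq> carrier W" unfolding W_def by (auto intro: pure_tensor_in[OF vU vV])
  fix s \<phi> assume "s \<in> ?S" and \<phi>: "\<phi> \<in> dual W"
  then obtain u v where u: "u \<in> carrier U" and v: "v \<in> carrier V" and s: "s = pure_tensor U V u v" by auto
  have z: "pa g \<zero>\<^bsub>tensor U V\<^esub> = \<zero>\<^bsub>tensor U V\<^esub>" if "g \<in> G - Q" for g
    using lin_zero[OF W W pa_lin[OF that]] by (simp add: W_def)
  have \<phi>0: "\<phi> \<zero>\<^bsub>tensor U V\<^esub> = 0" using dual_zero[OF W \<phi>] by (simp add: W_def)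
  have d1: "(\<lambda>u. \<phi> (pure_tensor U V u v)) \<in> dual U" and d2: "(\<lambda>v. \<phi> (pure_tensor U V u v)) \<in> dual V"
    using dual_comp[OF \<phi>[unfolded W_def]] pure_tensor_lin1[OF vU vV v] pure_tensor_lin2[OF vU vV u] by auto
  have t: "a \<in> {1..m} \<and> b \<in> {1..m} \<or> a \<in> {m+1..m+n} \<and> b \<in> {m+1..m+n} \<or> a \<in> {1..m} \<and> b \<in> {m+1..m+n}"
    if "(a, b) \<in> G - Q" for a b using that by auto
  consider (11) "a \<in> {1..m}" "b \<in> {1..m}" "c \<in> {1..m}" "d \<in> {1..m}"
    | (12) "a \<in> {1..m}" "b \<in> {1..m}" "c \<in> {m+1..m+n}" "d \<in> {m+1..m+n}"
    | (21) "a \<in> {m+1..m+n}" "b \<in> {m+1..m+n}" "c \<in> {1..m}" "d \<in> {1..m}"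
    | (22) "a \<in> {m+1..m+n}" "b \<in> {m+1..m+n}" "c \<in> {m+1..m+n}" "d \<in> {m+1..m+n}"
    | (3) "a \<in> {1..m}" "b \<in> {m+1..m+n}" | (4) "c \<in> {1..m}" "d \<in> {m+1..m+n}"
    using t[OF assms(1)] t[OF assms(2)] by blast
  then show "\<phi> (pa (a, b) (pa (c, d) s)) = \<phi> (pa (c, d) (pa (a, b) s)) +
      ((if b = c then \<phi> (pa (a, d) s) else 0) - (if a = d then \<phi> (pa (c, b) s) else 0))"
  proof cases
    case 11
    then show ?thesis unfolding s using U.e_rel[OF 11 u d1] by (simp add: pa_1 u v U.e_in)
  next
    case 12
    then have "c - m \<in> {1..n}" "d - m \<in> {1..n}" using 12 by auto
    then show ?thesis unfolding s using 12 by (simp add: pa_1 pa_2 u v U.e_in V.e_in)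
  next
    case 21
    have "a - m \<in> {1..n}" "b - m \<in> {1..n}" using 21 by auto
    then show ?thesis unfolding s using 21 by (simp add: pa_1 pa_2 u v U.e_in V.e_in)
  next
    case 22
    have i: "a - m \<in> {1..n}" "b - m \<in> {1..n}" "c - m \<in> {1..n}" "d - m \<in> {1..n}" using 22 by auto
    have e: "b - m = c - m \<longleftrightarrow> b = c" "a - m = d - m \<longleftrightarrow> a = d" using 22 by auto
    show ?thesis unfolding s using V.e_rel[OF i v d2] 22 i by (simp add: pa_2 u v V.e_in e)
  next
    case 3
    then have "pa (a, b) y = \<zero>\<^bsub>tensor U V\<^esub>" for y by (rule pa_3)
    moreover have "b = c \<Longrightarrow> pa (a, d) s = \<zero>\<^bsub>tensor U V\<^esub>" using assms(2) 3 by (intro pa_3) auto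
    moreover have "a = d \<Longrightarrow> pa (c, b) s = \<zero>\<^bsub>tensor U V\<^esub>" using assms(2) 3 by (intro pa_3) auto
    ultimately show ?thesis by (simp add: \<phi>0 z[OF assms(2)])
  next
    case 4
    then have "pa (c, d) y = \<zero>\<^bsub>tensor U V\<^esub>" for y by (rule pa_3)
    moreover have "b = c \<Longrightarrow> pa (a, d) s = \<zero>\<^bsub>tensor U V\<^esub>" using assms(1) 4 by (intro pa_3) auto
    moreover have "a = d \<Longrightarrow> pa (c, b) s = \<zero>\<^bsub>tensor U V\<^esub>" using assms(1) 4 by (intro pa_3) auto
    ultimately show ?thesis by (simp add: \<phi>0 z[OF assms(1)])
  qed
qed (use assms in \<open>auto simp: not_le\<close>)

text \<open>
  The word \<open>y\<^sub>1 \<cdots> y\<^sub>r\<close> over \<open>\<qq>\<close> and \<open>w \<in> U \<otimes> V\<close> stand for \<open>y\<^sub>1 \<cdots> y\<^sub>r w\<close>;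
  \<open>word_act\<close> moves a matrix unit through the word to the right.  Letters commute only after the
  passage to the quotient by \<open>Comm\<close> below.
\<close>

definition "MM = TP (lists Q) W"
definition "tq = tp (lists Q) W"

definition cons_op where
  "cons_op y = tensor_map (free_space (lists Q)) W (lin_ext (\<lambda>ys. basis (y # ys))) (\<lambda>w. w)"

primrec word_act where
  "word_act [] = (\<lambda>e w. if e \<in> Q then tq [e] w else tq [] (pa e w))"
| "word_act (y # ys) = (\<lambda>e w. if e \<in> Q then tq (e # y # ys) w else
    (cons_op y (word_act ys e w) \<oplus>\<^bsub>MM\<^esub> (if snd e = fst y then word_act ys (fst e, snd y) w else \<zero>\<^bsub>MM\<^esub>))
      \<ominus>\<^bsub>MM\<^esub> (if fst e = snd y then word_act ys (fst y, snd e) w else \<zero>\<^bsub>MM\<^esub>))"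

text \<open>Chosen, because \<open>TP_lift\<close> only asserts existence; its values on words
  determine it on the carrier.\<close>

definition R where
  "R e = (SOME F. F \<in> linear_maps MM MM \<and> (\<forall>ys\<in>lists Q. \<forall>w\<in>carrier W. F (tq ys w) = word_act ys e w))"

lemma MM: "vs MM"
  unfolding MM_def by (rule vs_tensor[OF vs_free_space W])

lemma tq_lin: "ys \<in> lists Q \<Longrightarrow> tq ys \<in> linear_maps W MM"
  unfolding MM_def tq_def by (rule tp_lin[OF W])

lemma tq_in: "ys \<in> lists Q \<Longrightarrow> w \<in> carrier W \<Longrightarrow> tq ys w \<in> carrier MM"
  by (rule lin_closed[OF tq_lin])

lemma MM_spanning: "submodule S CC MM \<Longrightarrow> {tq ys w | ys w. ys \<in> lists Q \<and> w \<in> carrier W} \<subseteq> S \<Longrightarrow> carrier MM \<subseteq> S"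
  unfolding MM_def tq_def by (rule TP_spanning[OF W]) auto

lemma cons_op_lin: "y \<in> Q \<Longrightarrow> cons_op y \<in> linear_maps MM MM"
  unfolding cons_op_def MM_def by (rule tensor_map_lin[OF vs_free_space W lin_ext_lin lin_id]) auto

lemma cons_op_tq: "y \<in> Q \<Longrightarrow> ys \<in> lists Q \<Longrightarrow> w \<in> carrier W \<Longrightarrow> cons_op y (tq ys w) = tq (y # ys) w"
  unfolding cons_op_def tq_def tp_def
  by (subst tensor_map_pure[OF vs_free_space W lin_ext_lin lin_id]) auto

lemma word_act_lin: "ys \<in> lists Q \<Longrightarrow> e \<in> G \<Longrightarrow> word_act ys e \<in> linear_maps W MM"
proof (induction ys arbitrary: e)
  case Nil
  then show ?case
    using tq_lin[of "[e]"] lin_comp[OF pa_lin tq_lin[of "[]"], of e] by (cases "e \<in> Q") auto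
next
  case (Cons y ys)
  obtain a b c d where ey: "e = (a, b)" "y = (c, d)" by fastforce
  have "word_act ys e \<in> linear_maps W MM" "word_act ys (a, d) \<in> linear_maps W MM" "word_act ys (c, b) \<in> linear_maps W MM"
    using Cons ey by auto
  then have "(\<lambda>w. (cons_op y (word_act ys e w) \<oplus>\<^bsub>MM\<^esub> (if b = c then word_act ys (a, d) w else \<zero>\<^bsub>MM\<^esub>))
      \<ominus>\<^bsub>MM\<^esub> (if a = d then word_act ys (c, b) w else \<zero>\<^bsub>MM\<^esub>)) \<in> linear_maps W MM"
    using Cons.prems by (intro lin_plus lin_sub lin_if MM lin_comp[OF _ cons_op_lin]) auto
  then show ?case
    using tq_lin[of "e # y # ys"] Cons.prems by (cases "e \<in> Q") (auto simp: ey cong: if_cong)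
qed

lemma R_spec:
  assumes "e \<in> G"
  shows "R e \<in> linear_maps MM MM \<and> (\<forall>ys\<in>lists Q. \<forall>w\<in>carrier W. R e (tq ys w) = word_act ys e w)"
proof -
  have "\<exists>F. F \<in> linear_maps MM MM \<and> (\<forall>ys\<in>lists Q. \<forall>w\<in>carrier W. F (tq ys w) = word_act ys e w)"
    using TP_lift[OF W MM, of "lists Q" "\<lambda>ys. word_act ys e"] word_act_lin[OF _ assms]
    unfolding MM_def tq_def Bex_def by simp
  then show ?thesis unfolding R_def by (rule someI_ex)
qed

lemma R_lin: "e \<in> G \<Longrightarrow> R e \<in> linear_maps MM MM"
  and R_tq: "e \<in> G \<Longrightarrow> ys \<in> lists Q \<Longrightarrow> w \<in> carrier W \<Longrightarrow> R e (tq ys w) = word_act ys e w"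
  using R_spec by auto

lemma Q_sub_G: "Q \<subseteq> G"
  by auto

lemma MM_eqI:
  assumes "F \<in> linear_maps MM Z" "F' \<in> linear_maps MM Z" "vs Z"
    "\<And>ys w. ys \<in> lists Q \<Longrightarrow> w \<in> carrier W \<Longrightarrow> F (tq ys w) = F' (tq ys w)" "s \<in> carrier MM"
  shows "F s = F' s"
proof -
  have "carrier MM \<subseteq> {s \<in> carrier MM. F s = F' s}"
    by (rule MM_spanning[OF submodule_equalizer[OF MM assms(3,1,2)]]) (auto simp: assms(4) tq_in)
  then show ?thesis using assms(5) by auto
qed

lemma R_Q: "y \<in> Q \<Longrightarrow> s \<in> carrier MM \<Longrightarrow> R y s = cons_op y s"
proof (rule MM_eqI[OF R_lin cons_op_lin MM])
  fix ys w assume "y \<in> Q" "ys \<in> lists Q" "w \<in> carrier W"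
  then show "R y (tq ys w) = cons_op y (tq ys w)"
    using Q_sub_G by (cases ys) (auto simp: R_tq cons_op_tq simp del: Q_iff G_iff)
qed (use Q_sub_G in auto)

lemma R_in: "e \<in> G \<Longrightarrow> s \<in> carrier MM \<Longrightarrow> R e s \<in> carrier MM"
  by (rule lin_closed[OF R_lin])

lemma cons_op_in: "y \<in> Q \<Longrightarrow> s \<in> carrier MM \<Longrightarrow> cons_op y s \<in> carrier MM"
  by (rule lin_closed[OF cons_op_lin])

text \<open>The recursion of \<open>word_act\<close> read as an identity of operators. It is
  restricted to units outside \<open>Q\<close>: two letters of \<open>q\<close> commute only modulo
  \<open>Comm\<close>.\<close>

lemma R_cons:
  assumes "(a, b) \<in> G - Q" "(c, d) \<in> Q" and s: "s \<in> carrier MM" and \<phi>: "\<phi> \<in> dual MM"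
  shows "\<phi> (R (a, b) (cons_op (c, d) s)) = \<phi> (cons_op (c, d) (R (a, b) s)) +
    ((if b = c then \<phi> (R (a, d) s) else 0) - (if a = d then \<phi> (R (c, b) s) else 0))"
proof (rule commutator_spanning[OF MM MM lin_comp[OF cons_op_lin R_lin] lin_comp[OF R_lin cons_op_lin] R_lin R_lin MM_spanning _ _ s \<phi>])
  fix s \<phi> assume "s \<in> {tq ys w | ys w. ys \<in> lists Q \<and> w \<in> carrier W}" and \<phi>: "\<phi> \<in> dual MM"
  then obtain ys w where s: "s = tq ys w" "ys \<in> lists Q" "w \<in> carrier W" by auto
  have cl: "word_act ys (a', b') w \<in> carrier MM" if "(a', b') \<in> G" for a' b'
    by (rule lin_closed[OF word_act_lin[OF s(2) that] s(3)])
  have "R (a, b) (cons_op (c, d) s) = (cons_op (c, d) (word_act ys (a, b) w) \<oplus>\<^bsub>MM\<^esub> (if b = c then word_act ys (a, d) w else \<zero>\<^bsub>MM\<^esub>))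
      \<ominus>\<^bsub>MM\<^esub> (if a = d then word_act ys (c, b) w else \<zero>\<^bsub>MM\<^esub>)"
    using assms(1,2) s by (auto simp: cons_op_tq R_tq simp del: Q_iff)
  then show "\<phi> (R (a, b) (cons_op (c, d) s)) = \<phi> (cons_op (c, d) (R (a, b) s)) +
    ((if b = c then \<phi> (R (a, d) s) else 0) - (if a = d then \<phi> (R (c, b) s) else 0))"
    using assms(1,2) s MM \<phi> cl cons_op_in[OF assms(2)] by (simp add: R_tq dual_simps)
qed (use assms tq_in in auto)

text \<open>Units of \<open>p\<close> satisfy their relations already on words, by induction on the
  length. Moving both units past the first letter leaves brackets with that letter, and these
  recombine by the Jacobi identity.\<close>

lemma R_commutator:
  assumes "(a, b) \<in> G - Q" "(c, d) \<in> G - Q" "s \<in> carrier MM" "\<phi> \<in> dual MM"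
  shows "\<phi> (R (a, b) (R (c, d) s)) = \<phi> (R (c, d) (R (a, b) s)) +
    ((if b = c then \<phi> (R (a, d) s) else 0) - (if a = d then \<phi> (R (c, b) s) else 0))"
proof -
  have mixed: "\<phi> (R (a, b) (R (c, d) s)) = \<phi> (R (c, d) (R (a, b) s)) +
    ((if b = c then \<phi> (R (a, d) s) else 0) - (if a = d then \<phi> (R (c, b) s) else 0))"
    if "(a, b) \<in> G - Q" "(c, d) \<in> Q" "s \<in> carrier MM" "\<phi> \<in> dual MM" for a b c d s \<phi>
    using R_cons[OF that] R_Q[OF that(2)] that R_in by simp
  have rel: "\<phi> (R (a, b) (R (c, d) (tq ys w))) = \<phi> (R (c, d) (R (a, b) (tq ys w))) +
    ((if b = c then \<phi> (R (a, d) (tq ys w)) else 0) - (if a = d then \<phi> (R (c, b) (tq ys w)) else 0))"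
    if "(a, b) \<in> G - Q" "(c, d) \<in> G - Q" "ys \<in> lists Q" "w \<in> carrier W" "\<phi> \<in> dual MM" for a b c d ys w \<phi>
    using that(3,1,2,4,5)
  proof (induction ys arbitrary: a b c d \<phi>)
    case Nil
    note ab = Nil(1) and cd = Nil(2) and w = Nil(3) and \<phi> = Nil(4)
    have r: "R g (tq [] w') = tq [] (pa g w')" if "g \<in> G - Q" "w' \<in> carrier W" for g w'
      using that by (simp add: R_tq)
    have "b = c \<Longrightarrow> (a, d) \<in> G - Q" "a = d \<Longrightarrow> (c, b) \<in> G - Q" using ab cd by auto
    then show ?case
      using pa_rel[OF ab cd w dual_comp[OF \<phi> tq_lin[of "[]"]]] ab cd w lin_closed[OF pa_lin[OF ab] w] lin_closed[OF pa_lin[OF cd] w]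
      by (simp add: r del: Q_iff G_iff)
  next
    case (Cons y ys)
    obtain g h where y: "y = (g, h)" by fastforce
    note ab = Cons.prems(1) and cd = Cons.prems(2) and w = Cons.prems(3) and \<phi> = Cons.prems(4)
    define s where "s = tq ys w"
    have yQ: "(g, h) \<in> Q" and s: "s \<in> carrier MM" using Cons.hyps w y tq_in by (auto simp: s_def simp del: Q_iff)
    have cs: "tq (y # ys) w = cons_op (g, h) s" using Cons.hyps w yQ y by (simp add: s_def cons_op_tq)
    note C = cons_op_lin[OF yQ]
    \<comment> \<open>The bracket of a unit of \<open>p\<close> with the letter may fall into
      \<open>q\<close>. The induction hypothesis does not reach this case, and \<open>mixed\<close>
      supplies it.\<close>
    have IH: "\<psi> (R (a, b) (R (c, d) s)) = \<psi> (R (c, d) (R (a, b) s)) +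
      ((if b = c then \<psi> (R (a, d) s) else 0) - (if a = d then \<psi> (R (c, b) s) else 0))"
      if "(a, b) \<in> G - Q" "(c, d) \<in> G" "\<psi> \<in> dual MM" for a b c d \<psi>
    proof (cases "(c, d) \<in> Q")
      case True
      then show ?thesis by (rule mixed[OF that(1) _ s that(3)])
    next
      case False
      then show ?thesis using Cons.IH[OF that(1) _ w that(3), of c d] that(2) by (simp add: s_def)
    qed
    have expand: "\<phi> (R (a, b) (R (c, d) (cons_op (g, h) s))) = \<phi> (cons_op (g, h) (R (a, b) (R (c, d) s)))
      + ((if b = g then \<phi> (R (a, h) (R (c, d) s)) else 0) - (if a = h then \<phi> (R (g, b) (R (c, d) s)) else 0))
      + ((if d = g then \<phi> (R (a, b) (R (c, h) s)) else 0) - (if c = h then \<phi> (R (a, b) (R (g, d) s)) else 0))"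
      if ab: "(a, b) \<in> G - Q" and cd: "(c, d) \<in> G - Q" for a b c d
    proof -
      have "\<phi> (R (a, b) (R (c, d) (cons_op (g, h) s))) = \<phi> (R (a, b) (cons_op (g, h) (R (c, d) s)))
        + ((if d = g then \<phi> (R (a, b) (R (c, h) s)) else 0) - (if c = h then \<phi> (R (a, b) (R (g, d) s)) else 0))"
        by (rule R_cons[OF cd yQ s dual_comp[OF \<phi> R_lin]]) (use ab in auto)
      then show ?thesis using R_cons[OF ab yQ R_in[OF _ s] \<phi>, of "(c, d)"] cd by simp
    qed
    have in_G: "a \<in> {1..m+n}" "b \<in> {1..m+n}" "c \<in> {1..m+n}" "d \<in> {1..m+n}" "g \<in> {1..m+n}" "h \<in> {1..m+n}"
      using ab cd yQ by auto
    have ad: "b = c \<Longrightarrow> (a, d) \<in> G - Q" "a = d \<Longrightarrow> (c, b) \<in> G - Q" using ab cd by auto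
    have R1: "(if b = c then \<phi> (R (a, d) (cons_op (g, h) s)) else 0) = (if b = c then \<phi> (cons_op (g, h) (R (a, d) s)) +
      ((if d = g then \<phi> (R (a, h) s) else 0) - (if a = h then \<phi> (R (g, d) s) else 0)) else 0)"
      using R_cons[OF ad(1) yQ s \<phi>] by simp
    have R2: "(if a = d then \<phi> (R (c, b) (cons_op (g, h) s)) else 0) = (if a = d then \<phi> (cons_op (g, h) (R (c, b) s)) +
      ((if b = g then \<phi> (R (c, h) s) else 0) - (if c = h then \<phi> (R (g, b) s) else 0)) else 0)"
      using R_cons[OF ad(2) yQ s \<phi>] by simp
    have I0: "\<phi> (cons_op (g, h) (R (a, b) (R (c, d) s))) = \<phi> (cons_op (g, h) (R (c, d) (R (a, b) s))) +
      ((if b = c then \<phi> (cons_op (g, h) (R (a, d) s)) else 0) - (if a = d then \<phi> (cons_op (g, h) (R (c, b) s)) else 0))"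
      by (rule IH[OF ab _ dual_comp[OF \<phi> C]]) (use cd in simp)
    have I1: "\<phi> (R (c, d) (R (a, h) s)) = \<phi> (R (a, h) (R (c, d) s)) +
      ((if a = d then \<phi> (R (c, h) s) else 0) - (if c = h then \<phi> (R (a, d) s) else 0))"
      using IH[OF cd _ \<phi>, of a h] in_G(1,6) unfolding eq_commute[of d a] G_iff by blast
    have I2: "\<phi> (R (c, d) (R (g, b) s)) = \<phi> (R (g, b) (R (c, d) s)) +
      ((if d = g then \<phi> (R (c, b) s) else 0) - (if b = c then \<phi> (R (g, d) s) else 0))"
      using IH[OF cd _ \<phi>, of g b] in_G(2,5) unfolding eq_commute[of c b] G_iff by blast
    have I3: "\<phi> (R (a, b) (R (c, h) s)) = \<phi> (R (c, h) (R (a, b) s)) +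
      ((if b = c then \<phi> (R (a, h) s) else 0) - (if a = h then \<phi> (R (c, b) s) else 0))"
      by (rule IH[OF ab _ \<phi>]) (use in_G in simp)
    have I4: "\<phi> (R (a, b) (R (g, d) s)) = \<phi> (R (g, d) (R (a, b) s)) +
      ((if b = g then \<phi> (R (a, d) s) else 0) - (if a = d then \<phi> (R (g, b) s) else 0))"
      by (rule IH[OF ab _ \<phi>]) (use in_G in simp)
    \<comment> \<open>What is left is the Jacobi identity. With the Kronecker symbols as opaque
      factors it is an identity of polynomials, and the many cases of coinciding indices never
      arise.\<close>
    show ?case
      unfolding cs expand[OF ab cd] expand[OF cd ab] I0 I1 I2 I3 I4 R1 R2
      unfolding if_kronecker by (simp add: algebra_simps)
  qed
  have in_G: "(a, b) \<in> G" "(c, d) \<in> G" "(a, d) \<in> G" "(c, b) \<in> G" using assms(1,2) by auto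
  show ?thesis
  proof (rule commutator_spanning[OF MM MM lin_comp[OF R_lin R_lin] lin_comp[OF R_lin R_lin] R_lin R_lin MM_spanning _ _ assms(3,4)])
    fix s \<phi> assume "s \<in> {tq ys w | ys w. ys \<in> lists Q \<and> w \<in> carrier W}" "\<phi> \<in> dual MM"
    then show "\<phi> (R (a, b) (R (c, d) s)) = \<phi> (R (c, d) (R (a, b) s)) +
      ((if b = c then \<phi> (R (a, d) s) else 0) - (if a = d then \<phi> (R (c, b) s) else 0))"
      using rel[OF assms(1,2)] by blast
  qed (use in_G tq_in in \<open>auto simp del: G_iff Q_iff\<close>)
qed

text \<open>The quotient by \<open>Comm\<close> turns the tensor algebra of \<open>q\<close> into
  its symmetric algebra. The prefixes \<open>xs\<close> make the span stable under
  \<open>cons_op\<close>.\<close>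

definition "Comm = subspace_gen MM {foldr cons_op xs (cons_op y (cons_op y' s) \<ominus>\<^bsub>MM\<^esub> cons_op y' (cons_op y s)) | xs y y' s.
  xs \<in> lists Q \<and> y \<in> Q \<and> y' \<in> Q \<and> s \<in> carrier MM}"

lemma cons_ops_lin: "xs \<in> lists Q \<Longrightarrow> foldr cons_op xs \<in> linear_maps MM MM"
  by (rule foldr_lin[OF MM]) (auto simp: cons_op_lin simp del: Q_iff)

lemma Comm_gens: "{foldr cons_op xs (cons_op y (cons_op y' s) \<ominus>\<^bsub>MM\<^esub> cons_op y' (cons_op y s)) | xs y y' s.
  xs \<in> lists Q \<and> y \<in> Q \<and> y' \<in> Q \<and> s \<in> carrier MM} \<subseteq> carrier MM"
  by (auto intro!: lin_closed[OF cons_ops_lin] vs_diff[OF MM] cons_op_in simp del: Q_iff)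

lemma Comm: "submodule Comm CC MM"
  unfolding Comm_def by (rule submodule_subspace_gen[OF MM Comm_gens])

lemma Comm_gen: "xs \<in> lists Q \<Longrightarrow> y \<in> Q \<Longrightarrow> y' \<in> Q \<Longrightarrow> s \<in> carrier MM \<Longrightarrow>
    foldr cons_op xs (cons_op y (cons_op y' s) \<ominus>\<^bsub>MM\<^esub> cons_op y' (cons_op y s)) \<in> Comm"
  unfolding Comm_def by (rule subsetD[OF subspace_gen_superset]) blast

text \<open>The functionals that vanish on \<open>Comm\<close> are those of the quotient, and they
  separate its points. Computing modulo \<open>Comm\<close> thus means computing with such
  functionals.\<close>

lemma CommI:
  assumes x: "x \<in> carrier MM" and "\<And>\<phi>. \<phi> \<in> dual MM \<Longrightarrow> \<forall>c\<in>Comm. \<phi> c = 0 \<Longrightarrow> \<phi> x = 0"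
  shows "x \<in> Comm"
proof -
  note QM = vs_quot[OF MM Comm]
  have "Comm +>\<^bsub>MM\<^esub> x = \<zero>\<^bsub>quot MM Comm\<^esub>"
  proof (rule vs_eqI[OF QM quot_in[OF MM Comm x] vs_zero[OF QM]])
    fix \<psi> assume \<psi>: "\<psi> \<in> dual (quot MM Comm)"
    have "\<psi> (Comm +>\<^bsub>MM\<^esub> c) = 0" if "c \<in> Comm" for c
      using that coset_eq_zero_iff[OF MM Comm] submoduleD(1)[OF MM Comm] dual_zero[OF QM \<psi>] by metis
    then have "\<psi> (Comm +>\<^bsub>MM\<^esub> x) = 0"
      using assms(2)[OF dual_comp[OF \<psi> coset_lin[OF MM Comm]]] by blast
    then show "\<psi> (Comm +>\<^bsub>MM\<^esub> x) = \<psi> \<zero>\<^bsub>quot MM Comm\<^esub>" using dual_zero[OF QM \<psi>] by simp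
  qed
  then show ?thesis using coset_eq_zero_iff[OF MM Comm x] by simp
qed

lemma cons_op_Comm: "y \<in> Q \<Longrightarrow> c \<in> Comm \<Longrightarrow> cons_op y c \<in> Comm"
proof -
  assume y: "y \<in> Q" and c: "c \<in> Comm"
  show "cons_op y c \<in> Comm"
  proof (rule subspace_gen_map[OF MM MM cons_op_lin[OF y] Comm Comm_gens _ c[unfolded Comm_def]])
    fix s assume "s \<in> {foldr cons_op xs (cons_op y (cons_op y' s) \<ominus>\<^bsub>MM\<^esub> cons_op y' (cons_op y s)) | xs y y' s.
      xs \<in> lists Q \<and> y \<in> Q \<and> y' \<in> Q \<and> s \<in> carrier MM}"
    then obtain xs z z' s' where "s = foldr cons_op xs (cons_op z (cons_op z' s') \<ominus>\<^bsub>MM\<^esub> cons_op z' (cons_op z s'))"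
      "xs \<in> lists Q" "z \<in> Q" "z' \<in> Q" "s' \<in> carrier MM" by blast
    then show "cons_op y s \<in> Comm" using Comm_gen[of "y # xs" z z' s'] y by (simp del: Q_iff)
  qed
qed

lemma cons_commute:
  assumes \<phi>: "\<phi> \<in> dual MM" "\<forall>c\<in>Comm. \<phi> c = 0" and "y \<in> Q" "y' \<in> Q" "s \<in> carrier MM"
  shows "\<phi> (cons_op y (cons_op y' s)) = \<phi> (cons_op y' (cons_op y s))"
  using Comm_gen[of "[]" y y' s] assms cons_op_in[OF assms(3) cons_op_in[OF assms(4,5)]]
    cons_op_in[OF assms(4) cons_op_in[OF assms(3,5)]] by (auto simp: dual_diff[OF MM] simp del: Q_iff)

text \<open>Modulo \<open>Comm\<close> the rule extends to units of \<open>q\<close>: letters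
  commute there, and both bracket terms are absent because \<open>q\<close> is Abelian.\<close>

lemma R_cons_mod:
  assumes \<phi>: "\<phi> \<in> dual MM" "\<forall>c\<in>Comm. \<phi> c = 0" and "(a, b) \<in> G" "(c, d) \<in> Q" "s \<in> carrier MM"
  shows "\<phi> (R (a, b) (cons_op (c, d) s)) = \<phi> (cons_op (c, d) (R (a, b) s)) +
    ((if b = c then \<phi> (R (a, d) s) else 0) - (if a = d then \<phi> (R (c, b) s) else 0))"
proof (cases "(a, b) \<in> Q")
  case True
  then have "b \<noteq> c" "a \<noteq> d" using assms(4) by auto
  then show ?thesis
    using cons_commute[OF \<phi> True assms(4,5)] R_Q[OF True] cons_op_in[OF assms(4,5)] assms(5) by simp
qed (use R_cons assms in auto)

text \<open>Induction on the prefix, for all units at once because moving past a letter creates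
  brackets. For the empty prefix, moving \<open>e\<close> past two letters gives an expression
  symmetric in them modulo \<open>Comm\<close>: the double brackets \<open>[[e, y], y']\<close> and
  \<open>[[e, y'], y]\<close> agree by the Jacobi identity, as \<open>[y, y'] = 0\<close>.\<close>

lemma R_Comm:
  assumes e: "e \<in> G" and c: "c \<in> Comm"
  shows "R e c \<in> Comm"
proof (rule subspace_gen_map[OF MM MM R_lin[OF e] Comm Comm_gens _ c[unfolded Comm_def]])
  have "R e (foldr cons_op xs (cons_op y (cons_op y' s) \<ominus>\<^bsub>MM\<^esub> cons_op y' (cons_op y s))) \<in> Comm"
    if "xs \<in> lists Q" "e \<in> G" "y \<in> Q" "y' \<in> Q" "s \<in> carrier MM" for xs e y y' s
    using that(1,2)
  proof (induction xs arbitrary: e)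
    case Nil
    obtain a b where e: "e = (a, b)" by fastforce
    obtain c d where y: "y = (c, d)" by fastforce
    obtain c' d' where y': "y' = (c', d')" by fastforce
    note yQ = that(3)[unfolded y] and yQ' = that(4)[unfolded y'] and s = that(5)
    have D: "cons_op (c, d) (cons_op (c', d') s) \<in> carrier MM" "cons_op (c', d') (cons_op (c, d) s) \<in> carrier MM"
      using yQ yQ' s cons_op_in by blast+
    have eG: "(a, b) \<in> G" using Nil e by simp
    have G: "(a, d) \<in> G" "(c, b) \<in> G" "(a, d') \<in> G" "(c', b) \<in> G" "(a, b) \<in> G" using eG yQ yQ' by auto
    \<comment> \<open>Rows of units in \<open>q\<close> exceed \<open>m\<close> and columns do not,
      so a row of one letter is never a column of the other.\<close>
    have ne: "d \<noteq> c'" "c \<noteq> d'" "d' \<noteq> c" "c' \<noteq> d" using yQ yQ' by auto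
    have "\<phi> (R (a, b) (cons_op (c, d) (cons_op (c', d') s) \<ominus>\<^bsub>MM\<^esub> cons_op (c', d') (cons_op (c, d) s))) = 0"
      if \<phi>: "\<phi> \<in> dual MM" "\<forall>c\<in>Comm. \<phi> c = 0" for \<phi>
    proof -
      have \<phi>c: "(\<lambda>s. \<phi> (cons_op y s)) \<in> dual MM" "\<forall>c\<in>Comm. \<phi> (cons_op y c) = 0" if "y \<in> Q" for y
        using dual_comp[OF \<phi>(1) cons_op_lin[OF that]] cons_op_Comm[OF that] \<phi>(2) by auto
      note expand = R_cons_mod[OF \<phi> eG yQ cons_op_in[OF yQ' s]] R_cons_mod[OF \<phi> eG yQ' cons_op_in[OF yQ s]]
        R_cons_mod[OF \<phi>c[OF yQ] eG yQ' s] R_cons_mod[OF \<phi>c[OF yQ'] eG yQ s]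
        R_cons_mod[OF \<phi> G(1) yQ' s] R_cons_mod[OF \<phi> G(2) yQ' s] R_cons_mod[OF \<phi> G(3) yQ s] R_cons_mod[OF \<phi> G(4) yQ s]
        cons_commute[OF \<phi> yQ yQ' R_in[OF eG s]]
      have "\<phi> (R (a, b) (cons_op (c, d) (cons_op (c', d') s))) = \<phi> (R (a, b) (cons_op (c', d') (cons_op (c, d) s)))"
        unfolding expand if_not_P[OF ne(1)] if_not_P[OF ne(2)] if_not_P[OF ne(3)] if_not_P[OF ne(4)]
        unfolding if_kronecker by (simp add: algebra_simps)
      then show ?thesis
        using D lin_diff[OF MM MM R_lin[OF eG] D] R_in[OF eG] by (simp add: dual_diff[OF MM \<phi>(1)] del: G_iff)
    qed
    then show ?case unfolding e y y' foldr.simps id_apply by (intro CommI R_in[OF eG] vs_diff[OF MM D])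
  next
    case (Cons x xs)
    obtain a b where e: "e = (a, b)" by fastforce
    obtain c d where x: "x = (c, d)" by fastforce
    define g where "g = foldr cons_op xs (cons_op y (cons_op y' s) \<ominus>\<^bsub>MM\<^esub> cons_op y' (cons_op y s))"
    have xs: "xs \<in> lists Q" and xQ: "(c, d) \<in> Q" and eG: "(a, b) \<in> G" using Cons.hyps Cons.prems x e by (auto simp del: Q_iff G_iff)
    have gc: "g \<in> Comm" unfolding g_def by (rule Comm_gen[OF xs that(3-5)])
    have g: "g \<in> carrier MM" by (rule submoduleD(1)[OF MM Comm gc])
    have IH: "R e g \<in> Comm" if "e \<in> G" for e using Cons.IH[OF that] by (simp add: g_def)
    have "R (a, b) (cons_op (c, d) g) \<in> Comm"
    proof (rule CommI)
      show "R (a, b) (cons_op (c, d) g) \<in> carrier MM" by (rule R_in[OF eG cons_op_in[OF xQ g]])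
      fix \<phi> assume \<phi>: "\<phi> \<in> dual MM" "\<forall>c\<in>Comm. \<phi> c = 0"
      have "\<phi> (cons_op (c, d) (R (a, b) g)) = 0" using \<phi>(2) cons_op_Comm[OF xQ IH[OF eG]] by blast
      moreover have "\<phi> (R (a, d) g) = 0" "\<phi> (R (c, b) g) = 0" using \<phi>(2) IH eG xQ by auto
      ultimately show "\<phi> (R (a, b) (cons_op (c, d) g)) = 0" using R_cons_mod[OF \<phi> eG xQ g] by simp
    qed
    then show ?case by (simp add: g_def e x)
  qed
  then show "R e s \<in> Comm" if "s \<in> {foldr cons_op xs (cons_op y (cons_op y' s) \<ominus>\<^bsub>MM\<^esub> cons_op y' (cons_op y s)) | xs y y' s.
      xs \<in> lists Q \<and> y \<in> Q \<and> y' \<in> Q \<and> s \<in> carrier MM}" for s using that e by blast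
qed

lemma R_commutator_mod:
  assumes \<phi>: "\<phi> \<in> dual MM" "\<forall>c\<in>Comm. \<phi> c = 0" and G: "(a, b) \<in> G" "(c, d) \<in> G" and s: "s \<in> carrier MM"
  shows "\<phi> (R (a, b) (R (c, d) s)) = \<phi> (R (c, d) (R (a, b) s)) +
    ((if b = c then \<phi> (R (a, d) s) else 0) - (if a = d then \<phi> (R (c, b) s) else 0))"
proof -
  consider "(c, d) \<in> Q" | "(a, b) \<in> Q" | "(a, b) \<in> G - Q" "(c, d) \<in> G - Q" using G by blast
  then show ?thesis
  proof cases
    case 1
    then show ?thesis using R_cons_mod[OF \<phi> G(1) 1 s] R_Q[OF 1] s R_in[OF G(1) s] by simp
  next
    case 2
    then show ?thesis using R_cons_mod[OF \<phi> G(2) 2 s] R_Q[OF 2] s R_in[OF G(2) s] by simp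
  qed (use R_commutator s \<phi> in blast)
qed

text \<open>The model: the symmetric algebra of \<open>q\<close> tensored with
  \<open>U \<otimes> V\<close>, carrying an action of the whole of \<open>gl\<close>.\<close>

definition "QM = quot MM Comm"
definition "pq s = Comm +>\<^bsub>MM\<^esub> s"
definition "Rq e = quot_map MM Comm (R e)"

lemma QM: "vs QM"
  unfolding QM_def by (rule vs_quot[OF MM Comm])

lemma pq_lin: "pq \<in> linear_maps MM QM"
  unfolding QM_def pq_def[abs_def] by (rule coset_lin[OF MM Comm])

lemma Rq_pq: "e \<in> G \<Longrightarrow> s \<in> carrier MM \<Longrightarrow> Rq e (pq s) = pq (R e s)"
  unfolding Rq_def pq_def by (rule quot_map_coset[OF MM Comm R_lin R_Comm])

lemma trans_G: "trans G"
  by (auto simp: G_def trans_def gl_units_def)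

lemma QM_module: "is_module (gl_pres G) QM Rq"
proof (rule gl_moduleI[OF trans_G QM])
  show "\<forall>g\<in>G. Rq g \<in> linear_maps QM QM"
    unfolding QM_def Rq_def by (intro ballI quot_map_lin[OF MM Comm] R_lin R_Comm)
  fix a b c d v \<psi> assume G: "(a, b) \<in> G" "(c, d) \<in> G" and v: "v \<in> carrier QM" and \<psi>: "\<psi> \<in> dual QM"
  obtain s where s: "s \<in> carrier MM" "v = pq s" using v by (auto simp: QM_def carrier_quot pq_def)
  have G': "(a, d) \<in> G" "(c, b) \<in> G" using G by auto
  have k: "\<forall>c\<in>Comm. \<psi> (pq c) = 0"
    using coset_eq_zero_iff[OF MM Comm] submoduleD(1)[OF MM Comm] dual_zero[OF QM \<psi>] by (metis pq_def QM_def)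
  show "\<psi> (Rq (a, b) (Rq (c, d) v)) - \<psi> (Rq (c, d) (Rq (a, b) v)) =
      (if b = c then \<psi> (Rq (a, d) v) else 0) - (if a = d then \<psi> (Rq (c, b) v) else 0)"
    using R_commutator_mod[OF dual_comp[OF \<psi> pq_lin] k G s(1)]
    by (simp add: s Rq_pq G G' R_in del: G_iff)
qed

subsection \<open>The induced module\<close>

lemma presented_G: "presented (gl_pres G)"
  by (rule presented_gl[OF trans_G])

sublocale box: induction "gl_pres G" "G - Q" W pa
  by (intro induction.intro presented_G induction_axioms.intro) (auto simp: W pa_lin simp del: G_iff Q_iff)

definition "B = box m n U V"

lemma B_eq: "B = with_act (ind (gl_pres G) (G - Q) W pa) (ind_act (gl_pres G) (G - Q) W pa)"
  by (simp add: B_def box_def Let_def G_def[symmetric] p_units_eq W_def[symmetric])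

lemma act_B: "act B = box.iact" and carrier_B: "carrier B = carrier box.I"
  by (simp_all add: B_eq)

lemma gl_B: "gl_module (m + n) B"
  unfolding B_eq G_def[symmetric] presented.is_module_with_act[OF presented_G] with_act_simps by (rule box.ind_is_module)

lemma ie_lin: "box.ie \<in> linear_maps W B"
  using box.ie_lin by (simp add: B_eq)

text \<open>The spanning half of the Poincare-Birkhoff-Witt argument: \<open>1 \<otimes> W\<close>
  generates the induced module already over \<open>q\<close>. It suffices that the least
  \<open>q\<close>-stable subspace \<open>S0\<close> containing \<open>1 \<otimes> W\<close> is
  stable under all of \<open>gl\<close>.\<close>

lemma q_spanning:
  assumes S: "submodule S CC B" and ie: "\<And>w. w \<in> carrier W \<Longrightarrow> box.ie w \<in> S"
    and q: "\<And>y b. y \<in> Q \<Longrightarrow> b \<in> S \<Longrightarrow> act B y b \<in> S"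
  shows "carrier B \<subseteq> S"
proof -
  note B = is_moduleD(1,2)[OF gl_B, folded G_def, simplified]
  define \<S> where "\<S> = {S. submodule S CC B \<and> box.ie ` carrier W \<subseteq> S \<and> (\<forall>y\<in>Q. \<forall>b\<in>S. act B y b \<in> S)}"
  define S0 where "S0 = {b \<in> carrier B. \<forall>S\<in>\<S>. b \<in> S}"
  have S0: "submodule S0 CC B" unfolding S0_def by (rule submodule_INT[OF B(1)]) (auto simp: \<S>_def)
  have S0_least: "S0 \<subseteq> S" if "S \<in> \<S>" for S using that by (auto simp: S0_def)
  have ieB: "box.ie w \<in> carrier B" if "w \<in> carrier W" for w using lin_closed[OF ie_lin that] .
  have S0_ie: "box.ie w \<in> S0" if "w \<in> carrier W" for w using that ieB by (auto simp: S0_def \<S>_def)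
  have act_lin: "act B g \<in> linear_maps B B" if "g \<in> G" for g using B(2) that by blast
  have S0_q: "act B y b \<in> S0" if "y \<in> Q" "b \<in> S0" for y b
    using that lin_closed[OF act_lin[of y], of b] Q_sub_G by (auto simp: S0_def \<S>_def simp del: G_iff Q_iff)
  have S0_in: "b \<in> carrier B" if "b \<in> S0" for b using that by (simp add: S0_def)
  \<comment> \<open>\<open>S1\<close> consists of the vectors of \<open>S0\<close> that every matrix
    unit maps into \<open>S0\<close>. It is stable under \<open>q\<close> because
    \<open>g y = y g + [g, y]\<close>, and it contains \<open>1 \<otimes> W\<close>; minimality of
    \<open>S0\<close> then gives \<open>S0 \<subseteq> S1\<close>.\<close>
  define S1 where "S1 = {b \<in> carrier B. \<forall>g\<in>G. b \<in> {b \<in> carrier B. act B g b \<in> S0}} \<inter> S0"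
  have "S1 \<in> \<S>"
    unfolding \<S>_def
  proof (intro CollectI conjI ballI)
    show "submodule S1 CC B"
      unfolding S1_def by (intro submodule_Int[OF B(1)] submodule_INT[OF B(1)] submodule_preimage[OF B(1) B(1)] act_lin S0)
    show "box.ie ` carrier W \<subseteq> S1"
    proof clarify
      fix w assume w: "w \<in> carrier W"
      have "act B g (box.ie w) \<in> S0" if g: "g \<in> G" for g
      proof (cases "g \<in> Q")
        case False
        then have "act B g (box.ie w) = box.ie (pa g w)" using box.iact_ie[of g w] g w by (simp add: act_B)
        then show ?thesis using S0_ie lin_closed[OF pa_lin w, of g] False g by simp
      qed (use S0_q S0_ie w in blast)
      then show "box.ie w \<in> S1" using S0_ie[OF w] ieB[OF w] by (auto simp: S1_def)
    qed
    fix y b assume y: "y \<in> Q" and b: "b \<in> S1"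
    have b0: "b \<in> S0" and bg: "act B g b \<in> S0" if "g \<in> G" for g using b that by (auto simp: S1_def)
    have bS: "b \<in> S0" and bB: "b \<in> carrier B" using b by (auto simp: S1_def)
    have "act B g (act B y b) \<in> S0" if g: "g \<in> G" for g
    proof -
      obtain a c where gg: "g = (a, c)" by fastforce
      obtain d h where yy: "y = (d, h)" by fastforce
      have G': "(a, h) \<in> G" "(d, c) \<in> G" "(a, c) \<in> G" "(d, h) \<in> G" using g y gg yy by auto
      define r where "r = (act B y (act B g b) \<oplus>\<^bsub>B\<^esub> (if c = d then act B (a, h) b else \<zero>\<^bsub>B\<^esub>)) \<ominus>\<^bsub>B\<^esub> (if a = h then act B (d, c) b else \<zero>\<^bsub>B\<^esub>)"
      have "r \<in> S0"
        unfolding r_def using S0_q[OF y bg[OF g]] bg[OF G'(1)] bg[OF G'(2)] submoduleD[OF B(1) S0] by simp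
      moreover have "act B g (act B y b) = r"
      proof (rule vs_eqI[OF B(1)])
        fix \<phi> assume \<phi>: "\<phi> \<in> dual B"
        have cl: "act B g x \<in> carrier B" if "g \<in> G" "x \<in> carrier B" for g x using lin_closed[OF act_lin] that by blast
        show "\<phi> (act B g (act B y b)) = \<phi> r"
          using gl_relation[OF gl_B[folded G_def] trans_G G'(3,4) bB \<phi>] cl[OF G'(1) bB] cl[OF G'(2) bB]
            cl[OF G'(4) cl[OF G'(3) bB]] B(1) \<phi>
          by (simp add: r_def gg yy dual_simps diff_eq_eq del: G_iff)
      qed (use lin_closed[OF act_lin] bB y g Q_sub_G \<open>r \<in> S0\<close> S0_in in blast)+
      ultimately show ?thesis by simp
    qed
    then show "act B y b \<in> S1" using S0_q[OF y bS] S0_in by (auto simp: S1_def)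
  qed
  then have sub: "S0 \<subseteq> S1" by (rule S0_least)
  have "carrier box.I \<subseteq> S0"
  proof (rule box.ind_spanning)
    show "submodule S0 CC box.I"
      using submodule_preimage[of box.I B "\<lambda>x. x" S0] S0 box.vs_ind B(1) lin_id[of box.I] S0_in
      by (simp add: B_eq Collect_conj_eq Int_absorb1 subset_iff)
  qed (use S0_ie sub in \<open>auto simp: S1_def act_B simp del: G_iff\<close>)
  moreover have "S \<in> \<S>" using assms by (auto simp: \<S>_def)
  ultimately show ?thesis using S0_least by (auto simp: carrier_B)
qed

text \<open>Replaces the independence half: a relation between products of letters of
  \<open>q\<close> on \<open>1 \<otimes> W\<close> would be visible in the model, where the products
  are words modulo commutators.\<close>

lemma B_to_QM:
  "\<exists>\<kappa>\<in>linear_maps B QM. (\<forall>w\<in>carrier W. \<kappa> (box.ie w) = pq (tq [] w)) \<and>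
    (\<forall>g\<in>G. \<forall>b\<in>carrier B. \<kappa> (act B g b) = Rq g (\<kappa> b))"
proof -
  have "\<exists>F\<in>linear_maps box.I QM. (\<forall>v\<in>carrier W. F (box.ie v) = pq (tq [] v)) \<and>
    (\<forall>g\<in>gens (gl_pres G). \<forall>t\<in>carrier box.I. F (box.iact g t) = Rq g (F t))"
  proof (rule box.frobenius[OF QM_module])
    show "(\<lambda>w. pq (tq [] w)) \<in> linear_maps W QM" by (rule lin_comp[OF tq_lin pq_lin]) simp
    fix g w assume "g \<in> G - Q" "w \<in> carrier W"
    then show "pq (tq [] (pa g w)) = Rq g (pq (tq [] w))" by (simp add: Rq_pq R_tq tq_in del: G_iff Q_iff)
  qed
  then show ?thesis by (simp add: B_eq)
qed

end

section \<open>Shuffles of multi-indices\<close>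

text \<open>The entries of \<open>j\<close> are raised by \<open>m\<close> because the second block
  starts after row \<open>m\<close>. The value \<open>undefined\<close> elsewhere keeps the result
  an extensional function.\<close>

definition cat :: "nat \<Rightarrow> nat \<Rightarrow> nat \<Rightarrow> (nat \<Rightarrow> nat) \<Rightarrow> (nat \<Rightarrow> nat) \<Rightarrow> nat \<Rightarrow> nat"
  where "cat m K N i j p = (if p \<in> {1..K} then i p else if p \<in> {K+1..N} then j (p - K) + m else undefined)"

lemma cat_in:
  assumes "K \<le> N" "i \<in> {1..K} \<rightarrow>\<^sub>E {1..m}" "j \<in> {1..N-K} \<rightarrow>\<^sub>E {1..n}"
  shows "cat m K N i j \<in> {1..N} \<rightarrow>\<^sub>E {1..m+n}"
proof -
  have j: "j (p - K) \<in> {1..n}" if "p \<in> {K+1..N}" for p using that by (intro PiE_mem[OF assms(3)]) auto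
  have i: "i p \<in> {1..m}" if "p \<in> {1..K}" for p using PiE_mem[OF assms(2) that] .
  show ?thesis
  proof (rule PiE_I)
    fix p assume p: "p \<in> {1..N}"
    show "cat m K N i j p \<in> {1..m+n}"
    proof (cases "p \<in> {1..K}")
      case True
      then show ?thesis using i[OF True] by (simp add: cat_def)
    next
      case False
      then have "p \<in> {K+1..N}" using p by auto
      then show ?thesis using j[of p] False by (simp add: cat_def)
    qed
  qed (use assms(1) in \<open>auto simp: cat_def\<close>)
qed

lemma cat_inj:
  assumes "cat m K N i j = cat m K N i' j'" "K \<le> N"
    "i \<in> {1..K} \<rightarrow>\<^sub>E I" "i' \<in> {1..K} \<rightarrow>\<^sub>E I" "j \<in> {1..N-K} \<rightarrow>\<^sub>E J" "j' \<in> {1..N-K} \<rightarrow>\<^sub>E J"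
  shows "i = i'" "j = j'"
proof -
  note e = fun_cong[OF assms(1), unfolded cat_def]
  show "i = i'"
  proof (rule PiE_ext[OF assms(3,4)])
    fix p assume "p \<in> {1..K}"
    then show "i p = i' p" using e[of p] by simp
  qed
  show "j = j'"
  proof (rule PiE_ext[OF assms(5,6)])
    fix p assume "p \<in> {1..N-K}"
    then have "p + K \<notin> {1..K}" "p + K \<in> {K+1..N}" using assms(2) by auto
    then show "j p = j' p" using e[of "p + K"] by (simp only: if_False if_True diff_add_inverse2 add_right_cancel)
  qed
qed

lemma restrict_id_permutes:
  assumes w: "w permutes A" "w ` S = S" shows "restrict_id w S permutes S"
  using w permutes_inj[of w A] by (intro permutes_restrict_id) (auto simp: bij_betw_def intro: inj_on_subset)

lemma preserves_complement:
  fixes K N :: nat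
  assumes "w permutes {1..N}" "w ` {1..K} = {1..K}" "p \<in> {K+1..N}"
  shows "w p \<in> {K+1..N}"
proof -
  have "w p \<in> {1..N}" using permutes_in_image[OF assms(1), of p] assms(3) by auto
  moreover have "w p \<notin> {1..K}"
  proof
    assume "w p \<in> {1..K}"
    then obtain q where q: "q \<in> {1..K}" "w q = w p" using assms(2) by (metis imageE)
    show False using injD[OF permutes_inj[OF assms(1)] q(2)] q(1) assms(3) by simp
  qed
  ultimately show ?thesis by auto
qed

lemma perm_snd_permutes:
  assumes w: "w permutes {1..N}" "w ` {1..K} = {1..K}" shows "perm_snd K N w permutes {1..N-K}"
proof (rule inj_imp_permutes)
  have r: "w (K + p) \<in> {K+1..N}" if "p \<in> {1..N-K}" for p
    using that by (intro preserves_complement[OF w]) auto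
  have s: "perm_snd K N w p = w (K + p) - K" if "p \<in> {1..N-K}" for p using that by (simp add: perm_snd_def)
  show "perm_snd K N w p = p" if "p \<notin> {1..N-K}" for p using that by (auto simp: perm_snd_def restrict_id_def)
  show "perm_snd K N w p \<in> {1..N-K}" if "p \<in> {1..N-K}" for p using r[OF that] s[OF that] by auto
  show "inj_on (perm_snd K N w) {1..N-K}"
  proof (rule inj_onI)
    fix p q assume pq: "p \<in> {1..N-K}" "q \<in> {1..N-K}" "perm_snd K N w p = perm_snd K N w q"
    then have "w (K + p) = w (K + q)" using r[OF pq(1)] r[OF pq(2)] s[OF pq(1)] s[OF pq(2)] by auto
    from injD[OF permutes_inj[OF w(1)] this] show "p = q" by simp
  qed
qed simp

lemma cat_perm:
  assumes "w permutes {1..N}" "w ` {1..K} = {1..K}" "K \<le> N"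
  shows "cat m K N i j \<circ> w = cat m K N (i \<circ> restrict_id w {1..K}) (j \<circ> perm_snd K N w)"
proof
  fix p
  consider "p \<in> {1..K}" | "p \<in> {K+1..N}" | "p \<notin> {1..N}" by fastforce
  then show "(cat m K N i j \<circ> w) p = cat m K N (i \<circ> restrict_id w {1..K}) (j \<circ> perm_snd K N w) p"
  proof cases
    case 1
    then have "w p \<in> {1..K}" using assms(2) by blast
    then show ?thesis using 1 by (simp add: cat_def)
  next
    case 2
    then show ?thesis using preserves_complement[OF assms(1,2) 2] by (auto simp: cat_def perm_snd_def restrict_id_def)
  next
    case 3
    then show ?thesis using permutes_not_in[OF assms(1) 3] assms(3) by (auto simp: cat_def)
  qed
qed

text \<open>Composing with \<open>w\<close> reduces this to \<open>cat_perm\<close>, so the inverses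
  of the two component permutations need not be described.\<close>

lemma cat_perm_inv:
  assumes w: "w permutes {1..N}" "w ` {1..K} = {1..K}" and K: "K \<le> N"
  shows "cat m K N (i \<circ> inv_into UNIV (restrict_id w {1..K})) (j \<circ> inv_into UNIV (perm_snd K N w)) = cat m K N i j \<circ> inv_into UNIV w"
proof -
  have "cat m K N (i \<circ> inv_into UNIV (restrict_id w {1..K})) (j \<circ> inv_into UNIV (perm_snd K N w)) \<circ> w = cat m K N i j"
    using permutes_inv_o(2)[OF restrict_id_permutes[OF w]] permutes_inv_o(2)[OF perm_snd_permutes[OF w]] K
    by (simp add: cat_perm[OF w K] comp_assoc)
  then show ?thesis using permutes_inv_o(1)[OF w(1)] by (metis comp_assoc comp_id)
qed

text \<open>Glue a bijection between \<open>{1..card A}\<close> and \<open>A\<close> with one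
  between the complements, which have equal size.\<close>

lemma exists_perm_onto:
  assumes "A \<subseteq> {1..N}" shows "\<exists>w. w permutes {1..N} \<and> w ` {1..card A} = A"
proof -
  have fin: "finite A" using assms finite_subset by blast
  have cA: "card A \<le> N" using card_mono[OF _ assms] by simp
  obtain f where f: "bij_betw f {1..card A} A"
    using finite_same_card_bij[of "{1..card A}" A] fin by auto
  have "card ({1..N} - {1..card A}) = card ({1..N} - A)"
    using assms fin cA by (simp add: card_Diff_subset)
  then obtain g where g: "bij_betw g ({1..N} - {1..card A}) ({1..N} - A)"
    using finite_same_card_bij[of "{1..N} - {1..card A}" "{1..N} - A"] by auto
  define w where "w p = (if p \<in> {1..card A} then f p else if p \<in> {1..N} then g p else p)" for p
  have "bij_betw w ({1..card A} \<union> ({1..N} - {1..card A})) (A \<union> ({1..N} - A))"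
  proof (rule bij_betw_combine)
    show "bij_betw w {1..card A} A" using f by (subst bij_betw_cong[of _ _ f]) (auto simp: w_def)
    show "bij_betw w ({1..N} - {1..card A}) ({1..N} - A)" using g by (subst bij_betw_cong[of _ _ g]) (auto simp: w_def)
  qed auto
  moreover have "{1..card A} \<union> ({1..N} - {1..card A}) = {1..N}" "A \<union> ({1..N} - A) = {1..N}" using assms cA by auto
  ultimately have "w permutes {1..N}" using cA by (intro bij_imp_permutes) (auto simp: w_def)
  moreover have "w ` {1..card A} = A" using f by (auto simp: w_def bij_betw_def image_def)
  ultimately show ?thesis by blast
qed

text \<open>Adjacent transpositions generate the symmetric group, phrased as an induction principle.
  A longer transposition is reached by conjugation: \<open>(p, q+1)\<close> is the conjugate of
  \<open>(p, q)\<close> by \<open>(q, q+1)\<close>.\<close>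

lemma transposition_closed:
  assumes id: "P id" and comp: "\<And>v w. v permutes {1..N} \<Longrightarrow> w permutes {1..N} \<Longrightarrow> P v \<Longrightarrow> P w \<Longrightarrow> P (v \<circ> w)"
    and adj: "\<And>p. p \<in> {1..<N} \<Longrightarrow> P (trp p (p+1))" and w: "w permutes {1..N}"
  shows "P w"
proof -
  have less: "P (trp p (p + Suc d))" if "p \<ge> 1" "p + Suc d \<le> N" for p d
    using that
  proof (induction d)
    case 0
    then show ?case using adj[of p] by auto
  next
    case (Suc d)
    let ?q = "p + Suc d"
    have perms: "trp ?q (?q + 1) permutes {1..N}" "trp p ?q permutes {1..N}"
      using Suc.prems by (auto intro!: permutes_swap_id)
    have "trp p (?q + 1) = trp ?q (?q + 1) \<circ> (trp p ?q \<circ> trp ?q (?q + 1))"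
      by (auto simp: fun_eq_iff Transposition.transpose_def)
    moreover have "P (trp ?q (?q + 1) \<circ> (trp p ?q \<circ> trp ?q (?q + 1)))"
      using Suc by (intro comp perms permutes_compose adj) auto
    ultimately have "P (trp p (?q + 1))" by (simp only:)
    then show ?case by simp
  qed
  have tr: "P (trp a b)" if "a \<in> {1..N}" "b \<in> {1..N}" for a b
  proof (cases a b rule: linorder_cases)
    case less
    then show ?thesis using \<open>\<And>p d. p \<ge> 1 \<Longrightarrow> p + Suc d \<le> N \<Longrightarrow> P (trp p (p + Suc d))\<close>[of a "b - a - 1"] that by auto
  next
    case equal
    then show ?thesis using id by simp
  next
    case greater
    then show ?thesis using \<open>\<And>p d. p \<ge> 1 \<Longrightarrow> p + Suc d \<le> N \<Longrightarrow> P (trp p (p + Suc d))\<close>[of b "a - b - 1"] that by (auto simp: transpose_commute)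
  qed
  show ?thesis
    using w finite_atLeastAtMost
  proof (induction w rule: permutes_induct)
    case (swap a b w)
    then show ?case by (intro comp permutes_swap_id tr)
  qed (rule id)
qed

section \<open>Twists and direct sums\<close>

lemma twist_simps [simp]:
  "carrier (twist f X) = carrier X" "add (twist f X) = add X" "zero (twist f X) = zero X" "smult (twist f X) = smult X"
  by (simp_all add: twist_def)

text \<open>The tensor product does not look at \<open>act\<close>, so a twist changes neither the
  space nor the operators built on it.\<close>

lemma tensor_cong:
  assumes "carrier X = carrier X'" "add X = add X'" "smult X = smult X'" "carrier Y = carrier Y'" "add Y = add Y'" "smult Y = smult Y'"
  shows "tensor X Y = tensor X' Y'" "tensor_map X Y = tensor_map X' Y'"
proof -
  have "tensor_ker X Y = tensor_ker X' Y'"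
    unfolding tensor_ker_def bilinear_relators_def assms ..
  then show "tensor X Y = tensor X' Y'" "tensor_map X Y = tensor_map X' Y'"
    by (simp_all add: tensor_def tensor_map_def fun_eq_iff assms(1,4))
qed

lemma direct_sum_simps [simp]:
  "carrier (direct_sum I X) = (\<Pi>\<^sub>E i\<in>I. carrier (X i))" "\<zero>\<^bsub>direct_sum I X\<^esub> = (\<lambda>i\<in>I. \<zero>\<^bsub>X i\<^esub>)"
  "f \<oplus>\<^bsub>direct_sum I X\<^esub> g = (\<lambda>i\<in>I. f i \<oplus>\<^bsub>X i\<^esub> g i)" "c \<odot>\<^bsub>direct_sum I X\<^esub> f = (\<lambda>i\<in>I. c \<odot>\<^bsub>X i\<^esub> f i)"
  "act (direct_sum I X) a f = (\<lambda>i\<in>I. act (X i) a (f i))"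
  by (simp_all add: direct_sum_def)

lemma vs_direct_sum:
  assumes "\<And>i. i \<in> I \<Longrightarrow> vs (X i)" shows "vs (direct_sum I X)"
proof (rule vsI)
  fix x y z assume xyz: "x \<in> carrier (direct_sum I X)" "y \<in> carrier (direct_sum I X)" "z \<in> carrier (direct_sum I X)"
  then have m: "x i \<in> carrier (X i)" "y i \<in> carrier (X i)" "z i \<in> carrier (X i)" if "i \<in> I" for i using that by auto
  have "(x i \<oplus>\<^bsub>X i\<^esub> y i) \<oplus>\<^bsub>X i\<^esub> z i = x i \<oplus>\<^bsub>X i\<^esub> (y i \<oplus>\<^bsub>X i\<^esub> z i)" if "i \<in> I" for i
    by (rule vs_eqI[OF assms[OF that]]) (use that m assms in \<open>auto simp: dual_simps\<close>)
  then show "(x \<oplus>\<^bsub>direct_sum I X\<^esub> y) \<oplus>\<^bsub>direct_sum I X\<^esub> z = x \<oplus>\<^bsub>direct_sum I X\<^esub> (y \<oplus>\<^bsub>direct_sum I X\<^esub> z)"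
    by (auto simp: fun_eq_iff)
next
  fix x y assume xy: "x \<in> carrier (direct_sum I X)" "y \<in> carrier (direct_sum I X)"
  then have m: "x i \<in> carrier (X i)" "y i \<in> carrier (X i)" if "i \<in> I" for i using that by auto
  show "x \<oplus>\<^bsub>direct_sum I X\<^esub> y \<in> carrier (direct_sum I X)" using m assms by auto
  have "x i \<oplus>\<^bsub>X i\<^esub> y i = y i \<oplus>\<^bsub>X i\<^esub> x i" if "i \<in> I" for i
    by (rule vs_eqI[OF assms[OF that]]) (use that m assms in \<open>auto simp: dual_simps\<close>)
  then show "x \<oplus>\<^bsub>direct_sum I X\<^esub> y = y \<oplus>\<^bsub>direct_sum I X\<^esub> x" by (auto simp: fun_eq_iff)
  fix c
  have "c \<odot>\<^bsub>X i\<^esub> (x i \<oplus>\<^bsub>X i\<^esub> y i) = c \<odot>\<^bsub>X i\<^esub> x i \<oplus>\<^bsub>X i\<^esub> c \<odot>\<^bsub>X i\<^esub> y i" if "i \<in> I" for i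
    by (rule vs_eqI[OF assms[OF that]]) (use that m assms in \<open>auto simp: dual_simps algebra_simps\<close>)
  then show "c \<odot>\<^bsub>direct_sum I X\<^esub> (x \<oplus>\<^bsub>direct_sum I X\<^esub> y) = c \<odot>\<^bsub>direct_sum I X\<^esub> x \<oplus>\<^bsub>direct_sum I X\<^esub> c \<odot>\<^bsub>direct_sum I X\<^esub> y"
    by (auto simp: fun_eq_iff)
next
  fix x assume x: "x \<in> carrier (direct_sum I X)"
  then have m: "x i \<in> carrier (X i)" if "i \<in> I" for i using that by auto
  have ext: "x i = undefined" if "i \<notin> I" for i using x that by auto
  fix c d
  have e: "\<zero>\<^bsub>X i\<^esub> \<oplus>\<^bsub>X i\<^esub> x i = x i" "(c + d) \<odot>\<^bsub>X i\<^esub> x i = c \<odot>\<^bsub>X i\<^esub> x i \<oplus>\<^bsub>X i\<^esub> d \<odot>\<^bsub>X i\<^esub> x i"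
    "(c * d) \<odot>\<^bsub>X i\<^esub> x i = c \<odot>\<^bsub>X i\<^esub> (d \<odot>\<^bsub>X i\<^esub> x i)" "1 \<odot>\<^bsub>X i\<^esub> x i = x i" if "i \<in> I" for i
    by (rule vs_eqI[OF assms[OF that]]; use that m assms in \<open>auto simp: dual_simps algebra_simps\<close>)+
  show "\<zero>\<^bsub>direct_sum I X\<^esub> \<oplus>\<^bsub>direct_sum I X\<^esub> x = x" "1 \<odot>\<^bsub>direct_sum I X\<^esub> x = x"
    "(c + d) \<odot>\<^bsub>direct_sum I X\<^esub> x = c \<odot>\<^bsub>direct_sum I X\<^esub> x \<oplus>\<^bsub>direct_sum I X\<^esub> d \<odot>\<^bsub>direct_sum I X\<^esub> x"
    "(c * d) \<odot>\<^bsub>direct_sum I X\<^esub> x = c \<odot>\<^bsub>direct_sum I X\<^esub> (d \<odot>\<^bsub>direct_sum I X\<^esub> x)"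
    using e ext by (auto simp: fun_eq_iff)
  show "c \<odot>\<^bsub>direct_sum I X\<^esub> x \<in> carrier (direct_sum I X)" "0 \<odot>\<^bsub>direct_sum I X\<^esub> x = \<zero>\<^bsub>direct_sum I X\<^esub>"
    using m assms by (auto simp: fun_eq_iff)
qed (use assms in auto)

lemma direct_sum_component: "i \<in> I \<Longrightarrow> (\<lambda>x. x i) \<in> linear_maps (direct_sum I X) (X i)"
  by (rule linear_mapsI) auto

definition injection where
  "injection I X k x = (\<lambda>i\<in>I. if i = k then x else \<zero>\<^bsub>X i\<^esub>)"

lemma injection_lin:
  assumes "\<And>i. i \<in> I \<Longrightarrow> vs (X i)" "k \<in> I"
  shows "injection I X k \<in> linear_maps (X k) (direct_sum I X)"
proof (rule linear_mapsI)
  have z: "\<zero>\<^bsub>X i\<^esub> \<oplus>\<^bsub>X i\<^esub> \<zero>\<^bsub>X i\<^esub> = \<zero>\<^bsub>X i\<^esub>" "c \<odot>\<^bsub>X i\<^esub> \<zero>\<^bsub>X i\<^esub> = \<zero>\<^bsub>X i\<^esub>" if "i \<in> I" for i c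
    by (rule vs_eqI[OF assms(1)[OF that]]; use that assms(1) in \<open>auto simp: dual_simps\<close>)+
  show "injection I X k (x \<oplus>\<^bsub>X k\<^esub> y) = injection I X k x \<oplus>\<^bsub>direct_sum I X\<^esub> injection I X k y" for x y
    using z(1) by (auto simp: injection_def fun_eq_iff)
  show "injection I X k (c \<odot>\<^bsub>X k\<^esub> x) = c \<odot>\<^bsub>direct_sum I X\<^esub> injection I X k x" for c x
    using z(2) by (auto simp: injection_def fun_eq_iff)
qed (use assms in \<open>auto simp: injection_def\<close>)

section \<open>Spanning of modules induced from the parabolic subalgebra\<close>

lemma parabolic_gens_sub: "parabolic_gens K N \<subseteq> hecke_gens N"
  by (auto simp: parabolic_gens_def hecke_gens_def)

text \<open>The group algebra together with the parabolic subalgebra spans the Hecke algebra.\<close>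

lemma hecke_ind_spanning:
  assumes L: "induction (hecke_pres N) (parabolic_gens K N) X \<rho>"
    and V: "submodule V CC (ind (hecke_pres N) (parabolic_gens K N) X \<rho>)"
    and gen: "\<And>w x. w permutes {1..N} \<Longrightarrow> x \<in> carrier X \<Longrightarrow>
      ind_act (hecke_pres N) (parabolic_gens K N) X \<rho> (Perm w) (induction.ie (hecke_pres N) (parabolic_gens K N) X \<rho> x) \<in> V"
  shows "carrier (ind (hecke_pres N) (parabolic_gens K N) X \<rho>) \<subseteq> V"
proof -
  interpret L: induction "hecke_pres N" "parabolic_gens K N" X \<rho> by (rule L)
  note M = L.ind_is_module
  have lin: "L.iact g \<in> linear_maps L.I L.I" if "g \<in> hecke_gens N" for g using L.iact_lin[of g] that by simp
  define S where "S = subspace_gen L.I {L.iact (Perm w) (L.ie x) | w x. w permutes {1..N} \<and> x \<in> carrier X}"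
  have gens: "{L.iact (Perm w) (L.ie x) | w x. w permutes {1..N} \<and> x \<in> carrier X} \<subseteq> carrier L.I"
    using lin_closed[OF lin] L.ie_in by auto
  have S: "submodule S CC L.I" unfolding S_def by (rule submodule_subspace_gen[OF L.vs_ind gens])
  have S_gen: "L.iact (Perm w) (L.ie x) \<in> S" if "w permutes {1..N}" "x \<in> carrier X" for w x
    unfolding S_def using that by (intro subsetD[OF subspace_gen_superset]) blast
  have S_in: "t \<in> carrier L.I" if "t \<in> S" for t using submoduleD(1)[OF L.vs_ind S that] .
  have S_perm: "L.iact (Perm v) t \<in> S" if v: "v permutes {1..N}" and t: "t \<in> S" for v t
  proof (rule subspace_gen_map[OF L.vs_ind L.vs_ind lin S gens _ t[unfolded S_def]])
    fix s assume "s \<in> {L.iact (Perm w) (L.ie x) | w x. w permutes {1..N} \<and> x \<in> carrier X}"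
    then obtain w x where "s = L.iact (Perm w) (L.ie x)" "w permutes {1..N}" "x \<in> carrier X" by auto
    then show "L.iact (Perm v) s \<in> S"
      using hecke_relation(2)[OF M L.ie_in v] S_gen[OF permutes_compose[OF _ v]] by auto
  qed (use v in auto)
  \<comment> \<open>\<open>S'\<close> consists of the vectors of \<open>S\<close> that every
    \<open>u_q\<close> maps into \<open>S\<close>. The mixed relations make it stable under adjacent
    transpositions, their constant term being a vector of \<open>S\<close> again; hence it is stable
    under all permutations, and \<open>S \<subseteq> S'\<close>.\<close>
  define S' where "S' = {t \<in> carrier L.I. \<forall>q\<in>{1..N}. t \<in> {t \<in> carrier L.I. L.iact (Aff q) t \<in> S}} \<inter> S"
  have S': "submodule S' CC L.I"
    unfolding S'_def by (intro submodule_Int submodule_INT submodule_preimage[where Y = L.I] L.vs_ind lin S) auto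
  have S'_iff: "t \<in> S' \<longleftrightarrow> t \<in> S \<and> (\<forall>q\<in>{1..N}. L.iact (Aff q) t \<in> S)" for t
    using S_in by (auto simp: S'_def)
  have adj: "L.iact (Perm (trp p (p+1))) t \<in> S'" if p: "p \<in> {1..<N}" and t: "t \<in> S'" for p t
    unfolding S'_iff
  proof (intro conjI ballI)
    have tS: "t \<in> S" "t \<in> carrier L.I" using t S'_iff S_in by auto
    have pN: "p \<in> {1..N}" "p + 1 \<in> {1..N}" using p by auto
    note w = permutes_adjacent[OF p]
    show "L.iact (Perm (trp p (p+1))) t \<in> S" by (rule S_perm[OF w tS(1)])
    have u: "L.iact (Perm (trp p (p+1))) (L.iact (Aff q) t) \<in> S" if "q \<in> {1..N}" for q
      using t that S'_iff by (intro S_perm[OF w]) auto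
    fix q assume q: "q \<in> {1..N}"
    consider "q = p" | "q = p + 1" | "q \<noteq> p" "q \<noteq> p + 1" by blast
    then show "L.iact (Aff q) (L.iact (Perm (trp p (p+1))) t) \<in> S"
    proof cases
      case 1
      then show ?thesis using hecke_relation(5)[OF M tS(2) p] submoduleD(6)[OF L.vs_ind S u[OF pN(2)] tS(1)] by simp
    next
      case 2
      then show ?thesis using hecke_relation(4)[OF M tS(2) p] submoduleD(3)[OF L.vs_ind S u[OF pN(1)] tS(1)] by simp
    next
      case 3
      then show ?thesis using hecke_relation(3)[OF M tS(2) p q 3] u[OF q] by simp
    qed
  qed
  have S'_perm: "\<forall>t\<in>S'. L.iact (Perm w) t \<in> S'" if "w permutes {1..N}" for w
  proof (rule transposition_closed[of "\<lambda>w. \<forall>t\<in>S'. L.iact (Perm w) t \<in> S'", OF _ _ _ that])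
    show "\<forall>t\<in>S'. L.iact (Perm id) t \<in> S'" using hecke_relation(1)[OF M] S_in S'_iff by auto
    show "\<forall>t\<in>S'. L.iact (Perm (v \<circ> w)) t \<in> S'"
      if "v permutes {1..N}" "w permutes {1..N}" "\<forall>t\<in>S'. L.iact (Perm v) t \<in> S'" "\<forall>t\<in>S'. L.iact (Perm w) t \<in> S'" for v w
      using that hecke_relation(2)[OF M _ that(1,2)] S_in S'_iff by metis
  qed (use adj in blast)
  have ie_S: "L.ie x \<in> S" if "x \<in> carrier X" for x
    using S_gen[OF permutes_id that] hecke_relation(1)[OF M L.ie_in[OF that]] by simp
  have ie_S': "L.ie x \<in> S'" if "x \<in> carrier X" for x
  proof -
    have "L.iact (Aff q) (L.ie x) \<in> S" if q: "q \<in> {1..N}" for q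
    proof -
      have s: "Aff q \<in> parabolic_gens K N" using q by (auto simp: parabolic_gens_def)
      show ?thesis using L.iact_ie[OF s \<open>x \<in> carrier X\<close>] ie_S[OF lin_closed[OF bspec[OF L.\<rho> s] \<open>x \<in> carrier X\<close>]] by simp
    qed
    then show ?thesis using ie_S[OF that] S'_iff by blast
  qed
  have "S \<subseteq> S'" unfolding S_def using S'_perm ie_S' by (intro subspace_gen_least[OF S']) blast
  then have "carrier L.I \<subseteq> S"
    by (intro L.ind_spanning[OF S]) (use ie_S S_perm S'_iff in \<open>auto simp: hecke_gens_def\<close>)
  moreover have "S \<subseteq> V" unfolding S_def using gen by (intro subspace_gen_least[OF V]) blast
  ultimately show ?thesis by blast
qed

lemma tensor_map_commute:
  assumes X: "vs X" and Y: "vs Y" and F: "F \<in> linear_maps X X" "F' \<in> linear_maps X X" and H: "H \<in> linear_maps Y Y" "H' \<in> linear_maps Y Y"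
    and c: "\<And>x. x \<in> carrier X \<Longrightarrow> F (F' x) = F' (F x)" "\<And>y. y \<in> carrier Y \<Longrightarrow> H (H' y) = H' (H y)"
    and t: "t \<in> carrier (tensor X Y)"
  shows "tensor_map X Y F H (tensor_map X Y F' H' t) = tensor_map X Y F' H' (tensor_map X Y F H t)"
  by (rule tensor_lin_eqI[OF X Y vs_tensor[OF X Y] lin_comp[OF tensor_map_lin[OF X Y F(2) H(2)] tensor_map_lin[OF X Y F(1) H(1)]]
      lin_comp[OF tensor_map_lin[OF X Y F(1) H(1)] tensor_map_lin[OF X Y F(2) H(2)]] _ t])
    (simp add: tensor_map_pure[OF X Y F(1) H(1)] tensor_map_pure[OF X Y F(2) H(2)] lin_closed[OF F(1)] lin_closed[OF F(2)]
      lin_closed[OF H(1)] lin_closed[OF H(2)] c)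

lemma sum_split: "K \<le> (N :: nat) \<Longrightarrow> (\<Sum>p\<in>{1..N}. g p) = (\<Sum>p\<in>{1..K}. g p) + (\<Sum>p\<in>{1..N-K}. g (p + K) :: complex)"
proof -
  assume K: "K \<le> N"
  have "(\<Sum>p\<in>{1..N}. g p) = (\<Sum>p\<in>{1..K}. g p) + (\<Sum>p\<in>{K+1..N}. g p)"
    using K sum.ub_add_nat[of 1 K g "N - K"] by simp
  also have "(\<Sum>p\<in>{K+1..N}. g p) = (\<Sum>p\<in>{1..N-K}. g (p + K))"
    using K sum.shift_bounds_cl_nat_ivl[of g 1 K "N - K"] by (simp add: add.commute)
  finally show ?thesis .
qed

lemma cat_upd1: "p \<in> {1..K} \<Longrightarrow> (cat m K N i j)(p := a) = cat m K N (i(p := a)) j"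
  by (auto simp: cat_def fun_eq_iff)

lemma cat_upd2: "K \<le> N \<Longrightarrow> p \<in> {1..N-K} \<Longrightarrow> (cat m K N i j)(p + K := a + m) = cat m K N i (j(p := a))"
  by (auto simp: cat_def fun_eq_iff)

lemma cat_1: "p \<in> {1..K} \<Longrightarrow> cat m K N i j p = i p"
  and cat_2: "K \<le> N \<Longrightarrow> p \<in> {1..N-K} \<Longrightarrow> cat m K N i j (p + K) = j p + m"
  by (auto simp: cat_def)


section \<open>The coinvariants\<close>

locale gl_coinv = gl_pair m n U V
  for m n :: nat and U :: "(nat \<times> nat, 'u) rep" and V :: "(nat \<times> nat, 'v) rep" +
  fixes N :: nat
begin

sublocale E: gl_rep "m + n" N B
  by unfold_locales (rule gl_B)

definition "EB = E_functor (m + n) N B"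
definition "QE = subspace_gen EB {act EB (Inl e) x | e x. e \<in> Q \<and> x \<in> carrier EB}"
definition "CX = coinvariants m n EB"
definition "ec x = QE +>\<^bsub>EB\<^esub> x"
definition "cx i b = ec (E.t i b)"
definition "L = levi_units m n"

lemma L_iff [simp]: "(a, b) \<in> L \<longleftrightarrow> a \<in> {1..m} \<and> b \<in> {1..m} \<or> a \<in> {m+1..m+n} \<and> b \<in> {m+1..m+n}"
  by (auto simp: L_def levi_units_def)

lemma L_G: "L \<subseteq> G"
  by auto

lemma trans_L: "trans L"
  by (auto simp: trans_def)

lemma EB_eq: "EB = with_act E.T (act EB)" and act_EB: "act EB (Inl e) = E_gl (m + n) N B e" "act EB (Inr h) = E.E_hecke h"
  by (simp_all add: EB_def E_functor_def E.tens_pow_eq E.T_def E.E_hecke_def fun_eq_iff split: hecke_gen.splits)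

lemma carrier_EB: "carrier EB = carrier E.T" and linear_EB: "linear_maps EB Y = linear_maps E.T Y" "linear_maps Z EB = linear_maps Z E.T"
  by (subst EB_eq, simp)+

lemma vs_EB: "vs EB"
  by (subst EB_eq) (simp add: E.T)

lemma gl_EB: "g \<in> G \<Longrightarrow> act EB (Inl g) \<in> linear_maps EB EB"
  unfolding linear_EB act_EB by (cases g) (auto intro: E.E_gl_lin)

lemma hecke_EB: "h \<in> hecke_gens N \<Longrightarrow> act EB (Inr h) \<in> linear_maps EB EB"
  unfolding linear_EB act_EB using is_moduleD(2)[OF E.E_hecke_is_module] by simp

lemma EB_module: "is_module (gl_pres L) EB (\<lambda>e. act EB (Inl e))" "is_module (hecke_pres N) EB (\<lambda>h. act EB (Inr h))"
proof -
  have "rels (gl_pres L) \<subseteq> rels (gl_pres G)" using L_G unfolding gl_pres_def presentation.simps by blast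
  then have "is_module (gl_pres L) E.T (E_gl (m + n) N B)"
    by (rule is_module_mono[OF E.E_gl_is_module[folded G_def], rotated]) (simp only: gl_pres_simps L_G)
  then show "is_module (gl_pres L) EB (\<lambda>e. act EB (Inl e))"
    unfolding act_EB by (subst EB_eq) (simp add: presented.is_module_with_act[OF presented_gl[OF trans_L]])
  show "is_module (hecke_pres N) EB (\<lambda>h. act EB (Inr h))"
    unfolding act_EB using E.E_hecke_is_module
    by (subst EB_eq) (simp add: presented.is_module_with_act[OF presented_hecke])
qed

lemma EB_commute: "g \<in> G \<Longrightarrow> h \<in> hecke_gens N \<Longrightarrow> x \<in> carrier EB \<Longrightarrow>
    act EB (Inl g) (act EB (Inr h) x) = act EB (Inr h) (act EB (Inl g) x)"
  unfolding carrier_EB act_EB G_def by (rule E.E_gl_hecke)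

lemma QE_gens: "{act EB (Inl e) x | e x. e \<in> Q \<and> x \<in> carrier EB} \<subseteq> carrier EB"
proof clarify
  fix a b x assume "(a, b) \<in> Q" "x \<in> carrier EB"
  then show "act EB (Inl (a, b)) x \<in> carrier EB" using Q_sub_G by (intro lin_closed[OF gl_EB]) auto
qed

lemma QE: "submodule QE CC EB"
  unfolding QE_def by (rule submodule_subspace_gen[OF vs_EB QE_gens])

lemma QE_gen: "e \<in> Q \<Longrightarrow> x \<in> carrier EB \<Longrightarrow> act EB (Inl e) x \<in> QE"
  unfolding QE_def by (rule subsetD[OF subspace_gen_superset]) blast

text \<open>The Levi subalgebra normalizes \<open>q\<close>: in \<open>e y = y e + [e, y]\<close>
  the bracket is again a combination of units of \<open>q\<close>.\<close>

lemma QE_levi: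
  assumes e: "e \<in> L" and x: "x \<in> QE" shows "act EB (Inl e) x \<in> QE"
proof -
  obtain a b where e': "e = (a, b)" by fastforce
  have eG: "(a, b) \<in> G" using e e' L_G by blast
  show ?thesis
  proof (rule subspace_gen_map[OF vs_EB vs_EB gl_EB QE QE_gens _ x[unfolded QE_def]])
    fix s assume "s \<in> {act EB (Inl e) x | e x. e \<in> Q \<and> x \<in> carrier EB}"
    then obtain c d y where s: "s = act EB (Inl (c, d)) y" and cd: "(c, d) \<in> Q" and y: "y \<in> carrier EB" by auto
    have G': "(c, d) \<in> G" "(a, d) \<in> G" "(c, b) \<in> G" using cd eG by auto
    have Q': "b = c \<Longrightarrow> (a, d) \<in> Q" "a = d \<Longrightarrow> (c, b) \<in> Q" using cd e e' by auto
    have cl: "act EB (Inl g) z \<in> carrier EB" if "g \<in> G" "z \<in> carrier EB" for g z using lin_closed[OF gl_EB] that .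
    define r where "r = (act EB (Inl (c, d)) (act EB (Inl (a, b)) y) \<oplus>\<^bsub>EB\<^esub> (if b = c then act EB (Inl (a, d)) y else \<zero>\<^bsub>EB\<^esub>))
      \<ominus>\<^bsub>EB\<^esub> (if a = d then act EB (Inl (c, b)) y else \<zero>\<^bsub>EB\<^esub>)"
    have rQ: "r \<in> QE"
      unfolding r_def using QE_gen[OF cd cl[OF eG y]] QE_gen[OF Q'(1) y] QE_gen[OF Q'(2) y] submoduleD[OF vs_EB QE] by auto
    have "act EB (Inl (a, b)) s = r"
    proof (rule vs_eqI[OF vs_EB])
      fix \<phi> assume \<phi>: "\<phi> \<in> dual EB"
      then have \<phi>': "\<phi> \<in> dual E.T" using EB_eq dual_with_act by metis
      show "\<phi> (act EB (Inl (a, b)) s) = \<phi> r"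
        using gl_relation[OF E.E_gl_is_module[folded G_def] trans_G eG G'(1) y[unfolded carrier_EB] \<phi>', folded act_EB]
          cl[OF G'(2) y] cl[OF G'(3) y] cl[OF G'(1) cl[OF eG y]] vs_EB \<phi>
        by (simp add: r_def s dual_simps diff_eq_eq del: G_iff)
    qed (use cl y eG G' s rQ submoduleD(1)[OF vs_EB QE] in auto)
    then show "act EB (Inl e) s \<in> QE" using rQ e' by simp
  qed (use eG e' in simp)
qed

lemma QE_hecke:
  assumes h: "h \<in> hecke_gens N" and x: "x \<in> QE" shows "act EB (Inr h) x \<in> QE"
proof (rule subspace_gen_map[OF vs_EB vs_EB hecke_EB[OF h] QE QE_gens _ x[unfolded QE_def]])
  fix s assume "s \<in> {act EB (Inl e) x | e x. e \<in> Q \<and> x \<in> carrier EB}"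
  then obtain e y where s: "s = act EB (Inl e) y" "e \<in> Q" "y \<in> carrier EB" by blast
  then have "act EB (Inr h) s = act EB (Inl e) (act EB (Inr h) y)" using EB_commute[of e h y] h Q_sub_G by auto
  then show "act EB (Inr h) s \<in> QE" using QE_gen[OF s(2) lin_closed[OF hecke_EB[OF h] s(3)]] by simp
qed

lemma CX_eq: "CX = with_act (quot EB QE) (\<lambda>g. quot_map EB QE (act EB g))"
  by (simp add: CX_def coinvariants_def QE_def Q_def Let_def)

lemma vs_CX: "vs CX"
  by (simp add: CX_eq vs_quot[OF vs_EB QE])

lemma linear_CX: "linear_maps CX Y = linear_maps (quot EB QE) Y" "linear_maps Z CX = linear_maps Z (quot EB QE)"
  by (simp_all add: CX_eq)

lemma carrier_CX: "carrier CX = ec ` carrier EB"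
  by (simp add: CX_eq carrier_quot ec_def)

lemma ec_lin: "ec \<in> linear_maps EB CX"
  unfolding linear_CX ec_def[abs_def] by (rule coset_lin[OF vs_EB QE])

lemma act_ec: "g \<in> Inl ` L \<union> Inr ` hecke_gens N \<Longrightarrow> x \<in> carrier EB \<Longrightarrow> act CX g (ec x) = ec (act EB g x)"
  unfolding CX_eq with_act_simps ec_def
  by (rule quot_map_coset[OF vs_EB QE]) (use gl_EB L_G hecke_EB QE_levi QE_hecke in blast)+

lemma act_CX_lin: "g \<in> Inl ` L \<union> Inr ` hecke_gens N \<Longrightarrow> act CX g \<in> linear_maps CX CX"
  unfolding linear_CX unfolding CX_eq with_act_simps
  by (rule quot_map_lin[OF vs_EB QE]) (use gl_EB L_G hecke_EB QE_levi QE_hecke in blast)+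

lemma CX_bimodule: "bimodule m n N CX"
  unfolding bimodule_def L_def[symmetric]
proof (intro conjI ballI)
  interpret gl: presented "gl_pres L" by (rule presented_gl[OF trans_L])
  interpret he: presented "hecke_pres N" by (rule presented_hecke)
  show "is_module (gl_pres L) CX (\<lambda>e. act CX (Inl e))"
    unfolding CX_eq gl.is_module_with_act with_act_simps
    by (rule gl.is_module_quot[OF EB_module(1) QE]) (use QE_levi in simp)
  show "is_module (hecke_pres N) CX (\<lambda>h. act CX (Inr h))"
    unfolding CX_eq he.is_module_with_act with_act_simps
    by (rule he.is_module_quot[OF EB_module(2) QE]) (use QE_hecke in simp)
  fix e h c assume e: "e \<in> L" and h: "h \<in> hecke_gens N" and "c \<in> carrier CX"
  then obtain x where x: "x \<in> carrier EB" "c = ec x" by (auto simp: carrier_CX)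
  have "e \<in> G" using e L_G by blast
  then show "act CX (Inl e) (act CX (Inr h) c) = act CX (Inr h) (act CX (Inl e) c)"
    using e h x EB_commute[of e h x] lin_closed[OF gl_EB x(1)] lin_closed[OF hecke_EB[OF h] x(1)]
    by (simp add: act_ec del: hecke_gens_simps L_iff G_iff)
qed

lemma vB: "vs B"
  by (rule E.M)

lemma cx_lin: "i \<in> E.idx \<Longrightarrow> cx i \<in> linear_maps B CX"
proof -
  assume i: "i \<in> E.idx"
  have "E.t i \<in> linear_maps B EB" unfolding linear_EB E.T_def E.t_def by (rule tp_lin[OF vB i])
  from lin_comp[OF this ec_lin] show ?thesis by (simp add: cx_def[abs_def])
qed

lemma cx_in: "i \<in> E.idx \<Longrightarrow> b \<in> carrier B \<Longrightarrow> cx i b \<in> carrier CX"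
  by (rule lin_closed[OF cx_lin])

lemma dual_ec: "\<phi> \<in> dual CX \<Longrightarrow> (\<lambda>x. \<phi> (ec x)) \<in> dual E.T"
  using dual_comp[OF _ ec_lin[unfolded linear_EB]] .

lemma ec_linT: "ec \<in> linear_maps E.T CX"
  using ec_lin by (simp add: linear_EB)

section \<open>Computing with classes in the coinvariants\<close>

lemma gl_cx:
  assumes "(a, b) \<in> L" "i \<in> E.idx" "x \<in> carrier B" "\<phi> \<in> dual CX"
  shows "\<phi> (act CX (Inl (a, b)) (cx i x)) = (\<Sum>p\<in>{1..N}. if i p = b then \<phi> (cx (i(p := a)) x) else 0) + \<phi> (cx i (act B (a, b) x))"
proof -
  have ab: "a \<in> {1..m+n}" "b \<in> {1..m+n}" using assms(1) by auto
  have "act CX (Inl (a, b)) (cx i x) = ec (E_gl (m + n) N B (a, b) (E.t i x))"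
    unfolding cx_def using assms(1) E.t_in[OF assms(2,3)] by (subst act_ec) (auto simp: carrier_EB act_EB)
  then show ?thesis using E.E_gl_t[OF ab assms(2,3) dual_ec[OF assms(4)]] by (simp add: cx_def cong: if_cong)
qed

lemma perm_cx: "w permutes {1..N} \<Longrightarrow> i \<in> E.idx \<Longrightarrow> x \<in> carrier B \<Longrightarrow> act CX (Inr (Perm w)) (cx i x) = cx (i \<circ> inv_into UNIV w) x"
  unfolding cx_def by (subst act_ec) (auto simp: carrier_EB act_EB E.t_in E.E_hecke_def E.E_perm_t)

lemma u_cx:
  assumes "p \<in> {1..N}" "i \<in> E.idx" "x \<in> carrier B" "\<phi> \<in> dual CX"
  shows "\<phi> (act CX (Inr (Aff p)) (cx i x)) =
    (\<Sum>a\<in>{1..m+n}. \<phi> (cx (i(p := a)) (act B (i p, a) x))) + (\<Sum>q\<in>{1..<p}. \<phi> (cx (i \<circ> trp q p) x))"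
proof -
  have "act CX (Inr (Aff p)) (cx i x) = ec (E_u (m + n) N B p (E.t i x))"
    unfolding cx_def using assms(1) E.t_in[OF assms(2,3)] by (subst act_ec) (auto simp: carrier_EB act_EB E.E_hecke_def)
  then show ?thesis using E.E_u_t[OF assms(1-3) dual_ec[OF assms(4)]] by (simp add: cx_def)
qed

text \<open>A unit of \<open>q\<close> acts by zero on the coinvariants, so its action on the module
  can be traded, with a sign, for its action on the tensor factors.\<close>

lemma q_cx:
  assumes "(a, b) \<in> Q" "i \<in> E.idx" "x \<in> carrier B" "\<phi> \<in> dual CX"
  shows "\<phi> (cx i (act B (a, b) x)) = - (\<Sum>p\<in>{1..N}. if i p = b then \<phi> (cx (i(p := a)) x) else 0)"
proof -
  have ab: "a \<in> {1..m+n}" "b \<in> {1..m+n}" using assms(1) by auto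
  have t: "E.t i x \<in> carrier EB" using E.t_in[OF assms(2,3)] by (simp add: carrier_EB)
  have "E_gl (m + n) N B (a, b) (E.t i x) \<in> QE" using QE_gen[OF assms(1) t] by (simp add: act_EB)
  moreover have "ec y = \<zero>\<^bsub>quot EB QE\<^esub>" if "y \<in> QE" for y
    using coset_eq_zero_iff[OF vs_EB QE, of y] submoduleD(1)[OF vs_EB QE that] that by (simp add: ec_def)
  ultimately have "\<phi> (ec (E_gl (m + n) N B (a, b) (E.t i x))) = 0"
    using dual_zero[OF vs_CX assms(4)] by (simp add: CX_eq)
  then show ?thesis using E.E_gl_t[OF ab assms(2,3) dual_ec[OF assms(4)]] by (simp add: cx_def eq_neg_iff_add_eq_0 add.commute cong: if_cong)
qed

text \<open>By \<open>q_spanning\<close> the module is reached from \<open>1 \<otimes> W\<close>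
  through letters of \<open>q\<close>, and \<open>q_cx\<close> moves each letter over to the tensor
  factors.\<close>

lemma coinv_spanning:
  assumes S: "submodule S CC CX" and gen: "\<And>i w. i \<in> E.idx \<Longrightarrow> w \<in> carrier W \<Longrightarrow> cx i (box.ie w) \<in> S"
  shows "carrier CX \<subseteq> S"
proof -
  define D where "D = {b \<in> carrier B. \<forall>i\<in>E.idx. b \<in> {b \<in> carrier B. cx i b \<in> S}}"
  have "carrier B \<subseteq> D"
  proof (rule q_spanning)
    show "submodule D CC B"
      unfolding D_def by (intro submodule_INT[OF vB] submodule_preimage[OF vB vs_CX cx_lin S])
    show "box.ie w \<in> D" if "w \<in> carrier W" for w using gen[OF _ that] lin_closed[OF ie_lin that] by (simp add: D_def)
    fix y b assume y: "y \<in> Q" and b: "b \<in> D"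
    obtain c d where y': "y = (c, d)" by fastforce
    have bB: "b \<in> carrier B" and bS: "cx i b \<in> S" if "i \<in> E.idx" for i using b that by (auto simp: D_def)
    have bB: "b \<in> carrier B" using b by (simp add: D_def)
    have cd: "(c, d) \<in> Q" "c \<in> {1..m+n}" using y y' by auto
    have act_in: "act B y b \<in> carrier B" using lin_closed[OF bspec[OF is_moduleD(2)[OF gl_B, simplified, folded G_def]] bB] Q_sub_G y by blast
    have "cx i (act B y b) \<in> S" if i: "i \<in> E.idx" for i
    proof -
      define r where "r = \<ominus>\<^bsub>CX\<^esub> (\<Oplus>\<^bsub>CX\<^esub>p\<in>{p \<in> {1..N}. i p = d}. cx (i(p := c)) b)"
      have ud: "i(p := c) \<in> E.idx" if "p \<in> {p \<in> {1..N}. i p = d}" for p using that E.idx_upd[OF i _ cd(2)] by auto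
      have rS: "r \<in> S" unfolding r_def
        by (intro submoduleD(5)[OF vs_CX S] submodule_finsum[OF vs_CX S] bS ud) auto
      have "cx i (act B y b) = r"
      proof (rule vs_eqI[OF vs_CX cx_in[OF i act_in] submoduleD(1)[OF vs_CX S rS]])
        fix \<phi> assume \<phi>: "\<phi> \<in> dual CX"
        have cl: "cx (i(p := c)) b \<in> carrier CX" if "p \<in> {p \<in> {1..N}. i p = d}" for p by (rule cx_in[OF ud[OF that] bB])
        have "\<phi> r = - (\<Sum>p\<in>{p \<in> {1..N}. i p = d}. \<phi> (cx (i(p := c)) b))"
          unfolding r_def by (subst dual_minus[OF vs_CX \<phi> vs_finsum[OF vs_CX cl]], assumption)
            (subst dual_finsum[OF vs_CX \<phi> cl], auto)
        also have "\<dots> = - (\<Sum>p\<in>{1..N}. if i p = d then \<phi> (cx (i(p := c)) b) else 0)"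
          by (subst sum.inter_filter) auto
        finally show "\<phi> (cx i (act B y b)) = \<phi> r" unfolding y' using q_cx[OF cd(1) i bB \<phi>] by simp
      qed
      then show ?thesis using rS by simp
    qed
    then show "act B y b \<in> D" using act_in by (simp add: D_def)
  qed
  then have cxS: "cx i b \<in> S" if "i \<in> E.idx" "b \<in> carrier B" for i b using that by (auto simp: D_def)
  have "carrier E.T \<subseteq> {x \<in> carrier E.T. ec x \<in> S}"
    by (rule E.T_spanning[OF submodule_preimage[OF E.T vs_CX ec_linT S]]) (use cxS E.t_in in \<open>auto simp: cx_def\<close>)
  then show ?thesis by (auto simp: carrier_CX carrier_EB)
qed

text \<open>
  A map on \<open>T \<otimes> W\<close> extends to the coinvariants: \<open>x \<otimes> y\<^sub>1 \<cdots> y\<^sub>r w\<close> goes where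
  \<open>(-1)\<^sup>r y\<^sub>r \<cdots> y\<^sub>1 x \<otimes> w\<close> goes.
\<close>

context
  fixes Z :: "(complex, 'z, 'l) module_scheme" and H0
  assumes Z: "vs Z" and H0: "\<And>i. i \<in> E.idx \<Longrightarrow> H0 i \<in> linear_maps W Z"
begin

primrec Phi where
  "Phi [] = H0"
| "Phi (y # ys) = (\<lambda>i w. \<ominus>\<^bsub>Z\<^esub> (\<Oplus>\<^bsub>Z\<^esub>p\<in>{1..N}. if i p = snd y then Phi ys (i(p := fst y)) w else \<zero>\<^bsub>Z\<^esub>))"

lemma Phi_lin: "ys \<in> lists Q \<Longrightarrow> i \<in> E.idx \<Longrightarrow> Phi ys i \<in> linear_maps W Z"
proof (induction ys arbitrary: i)
  case (Cons y ys)
  have y: "fst y \<in> {1..m+n}" using Cons.prems by (cases y) auto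
  have "(\<lambda>w. \<Oplus>\<^bsub>Z\<^esub>p\<in>{1..N}. if i p = snd y then Phi ys (i(p := fst y)) w else \<zero>\<^bsub>Z\<^esub>) \<in> linear_maps W Z"
    using Cons E.idx_upd[OF Cons.prems(2) _ y] by (intro lin_finsum[OF W Z] lin_if[OF Z]) auto
  from lin_uminus[OF Z this] show ?case by simp
qed (simp add: H0)

lemma Phi_in: "ys \<in> lists Q \<Longrightarrow> i \<in> E.idx \<Longrightarrow> w \<in> carrier W \<Longrightarrow> Phi ys i w \<in> carrier Z"
  by (rule lin_closed[OF Phi_lin])

lemma dual_Phi_Cons:
  assumes "(a, b) \<in> Q" "ys \<in> lists Q" "i \<in> E.idx" "w \<in> carrier W" "\<phi> \<in> dual Z"
  shows "\<phi> (Phi ((a, b) # ys) i w) = - (\<Sum>p\<in>{1..N}. if i p = b then \<phi> (Phi ys (i(p := a)) w) else 0)"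
proof -
  have a: "a \<in> {1..m+n}" using assms(1) by auto
  have cl: "(if i p = b then Phi ys (i(p := a)) w else \<zero>\<^bsub>Z\<^esub>) \<in> carrier Z" if "p \<in> {1..N}" for p
    using Phi_in[OF assms(2) E.idx_upd[OF assms(3) that a] assms(4)] Z by simp
  have "\<phi> (Phi ((a, b) # ys) i w) = - \<phi> (\<Oplus>\<^bsub>Z\<^esub>p\<in>{1..N}. if i p = b then Phi ys (i(p := a)) w else \<zero>\<^bsub>Z\<^esub>)"
    unfolding Phi.simps fst_conv snd_conv by (rule dual_minus[OF Z assms(5) vs_finsum[OF Z cl]])
  also have "\<phi> (\<Oplus>\<^bsub>Z\<^esub>p\<in>{1..N}. if i p = b then Phi ys (i(p := a)) w else \<zero>\<^bsub>Z\<^esub>) =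
    (\<Sum>p\<in>{1..N}. \<phi> (if i p = b then Phi ys (i(p := a)) w else \<zero>\<^bsub>Z\<^esub>))"
    by (rule dual_finsum[OF Z assms(5) cl]) auto
  also have "\<dots> = (\<Sum>p\<in>{1..N}. if i p = b then \<phi> (Phi ys (i(p := a)) w) else 0)"
    by (intro sum.cong refl) (simp add: dual_zero[OF Z assms(5)])
  finally show ?thesis .
qed

text \<open>Two letters always hit different positions: the first writes an entry above
  \<open>m\<close>, while the next one looks for an entry of at most \<open>m\<close>. Hence the two
  substitutions can be made in either order.\<close>

lemma Phi_swap:
  assumes xs: "xs \<in> lists Q" and y: "y \<in> Q" "y' \<in> Q" and ys: "ys \<in> lists Q" and w: "w \<in> carrier W"
    and i: "i \<in> E.idx"
  shows "Phi (xs @ y # y' # ys) i w = Phi (xs @ y' # y # ys) i w"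
  using xs i
proof (induction xs arbitrary: i)
  case Nil
  obtain a b c d where yy: "y = (a, b)" "y' = (c, d)" by fastforce
  have ne: "a \<noteq> d" "c \<noteq> b" using y yy by auto
  have ac: "a \<in> {1..m+n}" "c \<in> {1..m+n}" using y yy by auto
  have two: "\<phi> (Phi ((a, b) # (c, d) # ys) i w) =
      (\<Sum>p\<in>{1..N}. \<Sum>q\<in>{1..N}. if p \<noteq> q \<and> i p = b \<and> i q = d then \<phi> (Phi ys (i(p := a, q := c)) w) else 0)"
    if \<phi>: "\<phi> \<in> dual Z" and q: "(a, b) \<in> Q" "(c, d) \<in> Q" and ad: "a \<noteq> d" for a b c d \<phi>
  proof -
    have a: "a \<in> {1..m+n}" using q by auto
    have "(if i p = b then \<phi> (Phi ((c, d) # ys) (i(p := a)) w) else 0) =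
      - (\<Sum>q\<in>{1..N}. if p \<noteq> q \<and> i p = b \<and> i q = d then \<phi> (Phi ys (i(p := a, q := c)) w) else 0)" if p: "p \<in> {1..N}" for p
    proof (cases "i p = b")
      case True
      have "\<phi> (Phi ((c, d) # ys) (i(p := a)) w) = - (\<Sum>q\<in>{1..N}. if (i(p := a)) q = d then \<phi> (Phi ys (i(p := a, q := c)) w) else 0)"
        by (rule dual_Phi_Cons[OF q(2) ys E.idx_upd[OF Nil.prems p a] w \<phi>])
      also have "(\<Sum>q\<in>{1..N}. if (i(p := a)) q = d then \<phi> (Phi ys (i(p := a, q := c)) w) else 0) =
        (\<Sum>q\<in>{1..N}. if p \<noteq> q \<and> i p = b \<and> i q = d then \<phi> (Phi ys (i(p := a, q := c)) w) else 0)"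
        using ad True by (intro sum.cong refl) auto
      finally show ?thesis using True by (simp del: Phi.simps fun_upd_apply)
    qed simp
    then show ?thesis
      using dual_Phi_Cons[OF q(1) _ Nil.prems w \<phi>, of "(c, d) # ys"] q(2) ys by (simp add: sum_negf del: Phi.simps Q_iff)
  qed
  have "\<phi> (Phi ((a, b) # (c, d) # ys) i w) = \<phi> (Phi ((c, d) # (a, b) # ys) i w)" if \<phi>: "\<phi> \<in> dual Z" for \<phi>
    unfolding two[OF \<phi> y(1)[unfolded yy] y(2)[unfolded yy] ne(1)] two[OF \<phi> y(2)[unfolded yy] y(1)[unfolded yy] ne(2)]
    by (subst sum.swap) (intro sum.cong refl, auto simp: fun_upd_twist)
  then have "Phi ((a, b) # (c, d) # ys) i w = Phi ((c, d) # (a, b) # ys) i w"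
    using y ys yy Nil.prems w by (intro vs_eqI[OF Z Phi_in Phi_in]) (auto simp del: Phi.simps Q_iff)
  then show ?case by (simp add: yy del: Phi.simps)
next
  case (Cons x xs)
  obtain a b where x: "x = (a, b)" by fastforce
  have a: "a \<in> {1..m+n}" using Cons.hyps x by auto
  have "(\<Oplus>\<^bsub>Z\<^esub>p\<in>{1..N}. if i p = snd x then Phi (xs @ y # y' # ys) (i(p := fst x)) w else \<zero>\<^bsub>Z\<^esub>) =
    (\<Oplus>\<^bsub>Z\<^esub>p\<in>{1..N}. if i p = snd x then Phi (xs @ y' # y # ys) (i(p := fst x)) w else \<zero>\<^bsub>Z\<^esub>)"
    using Cons.IH E.idx_upd[OF Cons.prems _ a] Phi_in[of "xs @ y' # y # ys"] Cons.hyps y ys w Z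
    by (intro abelian_monoid.finsum_cong'[OF abelian_group.axioms(1)[OF vs_ag[OF Z]]]) (auto simp: x simp del: Q_iff)
  then show ?case by simp
qed

text \<open>\<open>Phi_swap\<close> is the statement that the linear extension of \<open>Phi\<close>
  to words kills the generators of \<open>Comm\<close>.\<close>

lemma QM_to_Z:
  assumes i: "i \<in> E.idx"
  shows "\<exists>F\<in>linear_maps QM Z. \<forall>ys\<in>lists Q. \<forall>w\<in>carrier W. F (pq (tq ys w)) = Phi ys i w"
proof -
  obtain F where F: "F \<in> linear_maps MM Z" "\<And>ys w. ys \<in> lists Q \<Longrightarrow> w \<in> carrier W \<Longrightarrow> F (tq ys w) = Phi ys i w"
    using TP_lift[OF W Z, of "lists Q" "\<lambda>ys. Phi ys i"] Phi_lin[OF _ i] unfolding MM_def tq_def by blast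
  have "F c = \<zero>\<^bsub>Z\<^esub>" if c: "c \<in> Comm" for c
  proof (rule subspace_gen_kill[OF MM Z F(1) Comm_gens _ c[unfolded Comm_def]])
    fix r assume "r \<in> {foldr cons_op xs (cons_op y (cons_op y' s) \<ominus>\<^bsub>MM\<^esub> cons_op y' (cons_op y s)) | xs y y' s.
      xs \<in> lists Q \<and> y \<in> Q \<and> y' \<in> Q \<and> s \<in> carrier MM}"
    then obtain xs y y' s where r: "r = foldr cons_op xs (cons_op y (cons_op y' s) \<ominus>\<^bsub>MM\<^esub> cons_op y' (cons_op y s))"
      and xs: "xs \<in> lists Q" and y: "y \<in> Q" "y' \<in> Q" and s: "s \<in> carrier MM" by blast
    note co = cons_ops_lin[OF xs]
    have word: "foldr cons_op xs (tq zs w) = tq (xs @ zs) w" if "zs \<in> lists Q" "w \<in> carrier W" for zs w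
      using xs by (induction xs) (use that in \<open>auto simp: cons_op_tq simp del: Q_iff\<close>)
    have l: "(\<lambda>s. F (foldr cons_op xs (cons_op y (cons_op y' s)))) \<in> linear_maps MM Z" if "y \<in> Q" "y' \<in> Q" for y y'
      by (rule lin_comp[OF lin_comp[OF lin_comp[OF cons_op_lin cons_op_lin] co] F(1)]) (use that in auto)
    have "F (foldr cons_op xs (cons_op y (cons_op y' s))) = F (foldr cons_op xs (cons_op y' (cons_op y s)))"
    proof (rule MM_eqI[OF l[OF y] l[OF y(2,1)] Z _ s])
      fix ys w assume "ys \<in> lists Q" "w \<in> carrier W"
      then show "F (foldr cons_op xs (cons_op y (cons_op y' (tq ys w)))) = F (foldr cons_op xs (cons_op y' (cons_op y (tq ys w))))"
        using y xs Phi_swap[OF xs y _ _ i, of ys w] by (simp add: cons_op_tq word F(2) del: Q_iff)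
    qed
    then show "F r = \<zero>\<^bsub>Z\<^esub>"
      unfolding r using y s F(1) Z
      by (simp add: lin_diff[OF MM MM co] lin_diff[OF MM Z F(1)] cons_op_in lin_closed[OF co] lin_closed[OF F(1)] del: Q_iff)
        (intro vs_eqI[OF Z], auto simp: dual_simps cons_op_in lin_closed[OF co] lin_closed[OF F(1)] simp del: Q_iff)
  qed
  from quot_lift[OF MM Comm Z F(1) this] show ?thesis
    unfolding QM_def pq_def using F(2) tq_in by metis
qed

lemma coinv_lift: "\<exists>H\<in>linear_maps CX Z. \<forall>i\<in>E.idx. \<forall>w\<in>carrier W. H (cx i (box.ie w)) = H0 i w"
proof -
  obtain \<kappa> where k: "\<kappa> \<in> linear_maps B QM" "\<And>w. w \<in> carrier W \<Longrightarrow> \<kappa> (box.ie w) = pq (tq [] w)"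
    "\<And>g b. g \<in> G \<Longrightarrow> b \<in> carrier B \<Longrightarrow> \<kappa> (act B g b) = Rq g (\<kappa> b)" using B_to_QM by blast
  have "\<forall>i\<in>E.idx. \<exists>F. F \<in> linear_maps QM Z \<and> (\<forall>ys\<in>lists Q. \<forall>w\<in>carrier W. F (pq (tq ys w)) = Phi ys i w)"
    using QM_to_Z by blast
  from bchoice[OF this] obtain h where h: "\<And>i. i \<in> E.idx \<Longrightarrow> h i \<in> linear_maps QM Z"
    "\<And>i ys w. i \<in> E.idx \<Longrightarrow> ys \<in> lists Q \<Longrightarrow> w \<in> carrier W \<Longrightarrow> h i (pq (tq ys w)) = Phi ys i w" by blast
  obtain F where F: "F \<in> linear_maps E.T Z" "\<And>i b. i \<in> E.idx \<Longrightarrow> b \<in> carrier B \<Longrightarrow> F (E.t i b) = h i (\<kappa> b)"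
    using TP_lift[OF vB Z, of E.idx "\<lambda>i b. h i (\<kappa> b)"] lin_comp[OF k(1) h(1)] unfolding E.T_def E.t_def by blast
  \<comment> \<open>The sign rule of \<open>Phi\<close>, carried from words to the whole model. It
    makes the two parts of the Leibniz rule cancel, so that \<open>F\<close> vanishes on the image
    of \<open>q\<close>.\<close>
  have hq: "\<phi> (h i (Rq (a, b) x)) = - (\<Sum>p\<in>{1..N}. if i p = b then \<phi> (h (i(p := a)) x) else 0)"
    if q: "(a, b) \<in> Q" and i: "i \<in> E.idx" and x: "x \<in> carrier QM" and \<phi>: "\<phi> \<in> dual Z" for a b i x \<phi>
  proof -
    have a: "a \<in> {1..m+n}" using q by auto
    have abG: "(a, b) \<in> G" using q Q_sub_G by blast
    obtain s where s: "s \<in> carrier MM" "x = pq s" using x by (auto simp: QM_def carrier_quot pq_def)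
    let ?S = "\<lambda>s. (\<Oplus>\<^bsub>Z\<^esub>p\<in>{1..N}. if i p = b then h (i(p := a)) (pq s) else \<zero>\<^bsub>Z\<^esub>)"
    have hl: "(\<lambda>s. if i p = b then h (i(p := a)) (pq s) else \<zero>\<^bsub>Z\<^esub>) \<in> linear_maps MM Z" if "p \<in> {1..N}" for p
      by (rule lin_if[OF Z lin_comp[OF pq_lin h(1)[OF E.idx_upd[OF i that a]]]])
    have "h i (pq (cons_op (a, b) s)) = \<ominus>\<^bsub>Z\<^esub> ?S s"
    proof (rule MM_eqI[OF lin_comp[OF lin_comp[OF cons_op_lin[OF q] pq_lin] h(1)[OF i]] lin_uminus[OF Z lin_finsum[OF MM Z _ hl]] Z _ s(1)])
      fix ys w assume ys: "ys \<in> lists Q" and w: "w \<in> carrier W"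
      have "(\<Oplus>\<^bsub>Z\<^esub>p\<in>{1..N}. if i p = b then h (i(p := a)) (pq (tq ys w)) else \<zero>\<^bsub>Z\<^esub>) =
        (\<Oplus>\<^bsub>Z\<^esub>p\<in>{1..N}. if i p = b then Phi ys (i(p := a)) w else \<zero>\<^bsub>Z\<^esub>)"
        using E.idx_upd[OF i _ a] Phi_in[OF ys _ w] h(2) ys w Z
        by (intro abelian_monoid.finsum_cong'[OF abelian_group.axioms(1)[OF vs_ag[OF Z]]]) auto
      then show "h i (pq (cons_op (a, b) (tq ys w))) = \<ominus>\<^bsub>Z\<^esub> ?S (tq ys w)"
        using q ys w i h(2)[OF i, of "(a, b) # ys" w] by (simp add: cons_op_tq del: Q_iff cong: if_cong)
    qed auto
    then have "\<phi> (h i (Rq (a, b) x)) = \<phi> (\<ominus>\<^bsub>Z\<^esub> ?S s)"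
      using s abG R_Q[OF q s(1)] by (simp add: Rq_pq del: G_iff)
    also have "\<dots> = - \<phi> (?S s)" by (intro dual_minus[OF Z \<phi>] vs_finsum[OF Z] lin_closed[OF hl s(1)])
    also have "\<phi> (?S s) = (\<Sum>p\<in>{1..N}. \<phi> (if i p = b then h (i(p := a)) (pq s) else \<zero>\<^bsub>Z\<^esub>))"
      by (rule dual_finsum[OF Z \<phi> lin_closed[OF hl s(1)]]) auto
    also have "\<dots> = (\<Sum>p\<in>{1..N}. if i p = b then \<phi> (h (i(p := a)) x) else 0)"
      by (intro sum.cong refl) (simp add: dual_zero[OF Z \<phi>] s(2))
    finally show ?thesis .
  qed
  have "F c = \<zero>\<^bsub>Z\<^esub>" if c: "c \<in> QE" for c
  proof (rule subspace_gen_kill[OF vs_EB Z F(1)[folded linear_EB] QE_gens _ c[unfolded QE_def]])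
    fix s assume "s \<in> {act EB (Inl e) x | e x. e \<in> Q \<and> x \<in> carrier EB}"
    then obtain a b x where s: "s = act EB (Inl (a, b)) x" and q: "(a, b) \<in> Q" and x: "x \<in> carrier E.T"
      by (auto simp: carrier_EB)
    have ab: "a \<in> {1..m+n}" "b \<in> {1..m+n}" using q by auto
    have abG: "(a, b) \<in> G" using q Q_sub_G by blast
    have l: "(\<lambda>x. F (E_gl (m + n) N B (a, b) x)) \<in> linear_maps E.T Z" by (rule lin_comp[OF E.E_gl_lin[OF ab] F(1)])
    have "F (E_gl (m + n) N B (a, b) (E.t i y)) = \<zero>\<^bsub>Z\<^esub>" if i: "i \<in> E.idx" and y: "y \<in> carrier B" for i y
    proof (rule vs_eqI[OF Z lin_closed[OF l E.t_in[OF i y]] vs_zero[OF Z]])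
      fix \<phi> assume \<phi>: "\<phi> \<in> dual Z"
      have ky: "\<kappa> y \<in> carrier QM" by (rule lin_closed[OF k(1) y])
      have "\<phi> (F (E_gl (m + n) N B (a, b) (E.t i y))) =
        (\<Sum>p\<in>{1..N}. if i p = b then \<phi> (F (E.t (i(p := a)) y)) else 0) + \<phi> (F (E.t i (act B (a, b) y)))"
        by (rule E.E_gl_t[OF ab i y dual_comp[OF \<phi> F(1)]])
      also have "F (E.t i (act B (a, b) y)) = h i (Rq (a, b) (\<kappa> y))"
        using F(2)[OF i E.e_in[OF ab y]] k(3)[OF abG y] by simp
      also have "(\<Sum>p\<in>{1..N}. if i p = b then \<phi> (F (E.t (i(p := a)) y)) else 0) =
        (\<Sum>p\<in>{1..N}. if i p = b then \<phi> (h (i(p := a)) (\<kappa> y)) else 0)"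
        using E.idx_upd[OF i _ ab(1)] y by (intro sum.cong refl) (simp add: F(2))
      finally show "\<phi> (F (E_gl (m + n) N B (a, b) (E.t i y))) = \<phi> \<zero>\<^bsub>Z\<^esub>"
        using hq[OF q i ky \<phi>] dual_zero[OF Z \<phi>] by simp
    qed
    then have "carrier E.T \<subseteq> {x \<in> carrier E.T. F (E_gl (m + n) N B (a, b) x) \<in> {\<zero>\<^bsub>Z\<^esub>}}"
      by (intro E.T_spanning[OF submodule_preimage[OF E.T Z l submodule_zero[OF Z]]]) (auto simp: E.t_in)
    then show "F s = \<zero>\<^bsub>Z\<^esub>" using x s by (auto simp: act_EB)
  qed
  from quot_lift[OF vs_EB QE Z F(1)[folded linear_EB] this]
  obtain H where H: "H \<in> linear_maps CX Z" "\<And>x. x \<in> carrier EB \<Longrightarrow> H (ec x) = F x"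
    unfolding linear_CX ec_def by blast
  have "H (cx i (box.ie w)) = H0 i w" if i: "i \<in> E.idx" and w: "w \<in> carrier W" for i w
    unfolding cx_def using H(2) F(2) h(2)[OF i, of "[]" w] k(2)[OF w] i w lin_closed[OF ie_lin w] E.t_in[OF i]
    by (simp add: carrier_EB)
  then show ?thesis using H(1) by blast
qed

end

section \<open>Comparison with the induced modules\<close>

abbreviation "IU K \<equiv> U.idx K"
abbreviation "IV K \<equiv> V.idx (N - K)"
abbreviation "TU K \<equiv> U.T K"
abbreviation "TV K \<equiv> V.T (N - K)"
definition "XU K = E_functor m K U"
definition "XV K = twist (- of_nat m) (E_functor n (N - K) V)"
definition "WK K = tensor (TU K) (TV K)"
definition "pp K i u j v = pure_tensor (TU K) (TV K) (U.t K i u) (V.t (N - K) j v)"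
definition "vu K p = (\<lambda>x. E_u n (N - K) V p x \<oplus>\<^bsub>TV K\<^esub> (- of_nat m) \<odot>\<^bsub>TV K\<^esub> x)"
abbreviation "rho K h \<equiv> outer_act m K N (XU K) (XV K) (Inr h)"
abbreviation "gam K e \<equiv> outer_act m K N (XU K) (XV K) (Inl e)"

lemma XU_simps [simp]:
  "carrier (XU K) = carrier (TU K)" "add (XU K) = add (TU K)" "smult (XU K) = smult (TU K)"
  "act (XU K) (Inl e) = E_gl m K U e" "act (XU K) (Inr (Perm w)) = E_perm m K U w" "act (XU K) (Inr (Aff p)) = E_u m K U p"
  by (simp_all add: XU_def E_functor_def U.tens_pow_eq U.T_def)

lemma XV_simps [simp]:
  "carrier (XV K) = carrier (TV K)" "add (XV K) = add (TV K)" "smult (XV K) = smult (TV K)"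
  "act (XV K) (Inl e) = E_gl n (N - K) V e" "act (XV K) (Inr (Perm w)) = E_perm n (N - K) V w" "act (XV K) (Inr (Aff p)) = vu K p"
  by (simp_all add: XV_def twist_def E_functor_def V.tens_pow_eq V.T_def vu_def fun_eq_iff)

lemma tensor_XU_XV: "tensor (XU K) (XV K) = WK K" "tensor_map (XU K) (XV K) = tensor_map (TU K) (TV K)"
  unfolding WK_def by (rule tensor_cong; simp)+

lemma rho_Perm: "rho K (Perm w) = tensor_map (TU K) (TV K) (E_perm m K U (restrict_id w {1..K})) (E_perm n (N - K) V (perm_snd K N w))"
  and rho_Aff: "rho K (Aff p) = (if p \<le> K then tensor_map (TU K) (TV K) (E_u m K U p) (\<lambda>y. y)
    else tensor_map (TU K) (TV K) (\<lambda>x. x) (vu K (p - K)))"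
  and gam_eq: "gam K (a, b) = (if a \<le> m \<and> b \<le> m then tensor_map (TU K) (TV K) (E_gl m K U (a, b)) (\<lambda>y. y)
    else tensor_map (TU K) (TV K) (\<lambda>x. x) (E_gl n (N - K) V (a - m, b - m)))"
  by (auto simp: outer_act_def tensor_XU_XV fun_eq_iff)

lemma vu_lin: "p \<in> {1..N-K} \<Longrightarrow> vu K p \<in> linear_maps (TV K) (TV K)"
  unfolding vu_def by (intro lin_plus V.T V.E_u_lin lin_scale lin_id)

lemma WK: "vs (WK K)"
  unfolding WK_def by (rule vs_tensor[OF U.T V.T])

lemma parabolicE:
  assumes "h \<in> parabolic_gens K N"
  obtains w where "h = Perm w" "w permutes {1..N}" "w ` {1..K} = {1..K}" | p where "h = Aff p" "p \<in> {1..N}"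
  using assms by (auto simp: parabolic_gens_def)

lemma rho_lin: "h \<in> parabolic_gens K N \<Longrightarrow> rho K h \<in> linear_maps (WK K) (WK K)"
proof (elim parabolicE)
  fix w assume w: "h = Perm w" "w permutes {1..N}" "w ` {1..K} = {1..K}"
  show ?thesis unfolding w(1) rho_Perm WK_def
    by (rule tensor_map_lin[OF U.T V.T U.E_perm_lin[OF restrict_id_permutes[OF w(2,3)]] V.E_perm_lin[OF perm_snd_permutes[OF w(2,3)]]])
next
  fix p assume p: "h = Aff p" "p \<in> {1..N}"
  show ?thesis
  proof (cases "p \<le> K")
    case True
    then have "p \<in> {1..K}" using p by auto
    then show ?thesis unfolding p(1) rho_Aff WK_def using True by (simp add: tensor_map_lin[OF U.T V.T U.E_u_lin lin_id])
  next
    case False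
    then have "p - K \<in> {1..N-K}" using p by auto
    from tensor_map_lin[OF U.T V.T lin_id vu_lin[OF this]] show ?thesis unfolding p(1) rho_Aff WK_def using False by simp
  qed
qed

lemma levi_cases:
  assumes "(a, b) \<in> L"
  obtains (1) "a \<in> {1..m}" "b \<in> {1..m}" "a \<le> m" | (2) "a \<in> {m+1..m+n}" "b \<in> {m+1..m+n}" "\<not> a \<le> m" "a - m \<in> {1..n}" "b - m \<in> {1..n}"
  using assms by fastforce

lemma gam_lin: "e \<in> L \<Longrightarrow> gam K e \<in> linear_maps (WK K) (WK K)"
proof -
  assume e: "e \<in> L"
  obtain a b where ab: "e = (a, b)" by fastforce
  from e[unfolded ab] show ?thesis
  proof (cases rule: levi_cases)
    case 1
    then show ?thesis unfolding ab gam_eq WK_def by (simp add: tensor_map_lin[OF U.T V.T U.E_gl_lin lin_id])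
  next
    case 2
    then show ?thesis unfolding ab gam_eq WK_def using tensor_map_lin[OF U.T V.T lin_id V.E_gl_lin[OF 2(4,5)]] by simp
  qed
qed

lemma pt_lin1: "y \<in> carrier (TV K) \<Longrightarrow> (\<lambda>x. pure_tensor (TU K) (TV K) x y) \<in> linear_maps (TU K) (WK K)"
  and pt_lin2: "x \<in> carrier (TU K) \<Longrightarrow> pure_tensor (TU K) (TV K) x \<in> linear_maps (TV K) (WK K)"
  unfolding WK_def by (rule pure_tensor_lin1[OF U.T V.T] pure_tensor_lin2[OF U.T V.T], assumption)+

text \<open>Operators on different tensor factors commute. On the same factor this is the
  commutation of \<open>gl\<close> with the Hecke algebra, and the twist only adds a scalar.\<close>

lemma gam_rho:
  assumes e: "e \<in> L" and h: "h \<in> parabolic_gens K N" and x: "x \<in> carrier (WK K)"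
  shows "gam K e (rho K h x) = rho K h (gam K e x)"
proof -
  obtain a b where ab: "e = (a, b)" by fastforce
  note x' = x[unfolded WK_def]
  have vu_gl: "E_gl n (N - K) V (a, b) (vu K p y) = vu K p (E_gl n (N - K) V (a, b) y)"
    if "a \<in> {1..n}" "b \<in> {1..n}" "p \<in> {1..N-K}" "y \<in> carrier (TV K)" for a b p y
    unfolding vu_def using that lin_closed[OF V.E_u_lin[OF that(3)] that(4)] V.T
    by (simp add: lin_add[OF V.E_gl_lin[OF that(1,2)]] lin_smult[OF V.E_gl_lin[OF that(1,2)]] V.E_gl_u)
  consider (1) "a \<in> {1..m}" "b \<in> {1..m}" "gam K e = tensor_map (TU K) (TV K) (E_gl m K U (a, b)) (\<lambda>y. y)"
    | (2) "a - m \<in> {1..n}" "b - m \<in> {1..n}" "gam K e = tensor_map (TU K) (TV K) (\<lambda>x. x) (E_gl n (N - K) V (a - m, b - m))"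
    using e[unfolded ab] by (cases rule: levi_cases) (simp_all add: ab gam_eq)
  note g = this
  from h show ?thesis
  proof (cases rule: parabolicE)
    case (1 w)
    note w1 = restrict_id_permutes[OF 1(2,3)] and w2 = perm_snd_permutes[OF 1(2,3)]
    from g show ?thesis
    proof cases
      case l: 1
      show ?thesis unfolding 1(1) l(3) rho_Perm
        by (rule tensor_map_commute[OF U.T V.T U.E_gl_lin[OF l(1,2)] U.E_perm_lin[OF w1] lin_id V.E_perm_lin[OF w2] U.E_gl_perm[OF l(1,2) w1] refl x'])
    next
      case l: 2
      show ?thesis unfolding 1(1) l(3) rho_Perm
        by (rule tensor_map_commute[OF U.T V.T lin_id U.E_perm_lin[OF w1] V.E_gl_lin[OF l(1,2)] V.E_perm_lin[OF w2] refl V.E_gl_perm[OF l(1,2) w2] x'])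
    qed
  next
    case (2 p)
    note hp = 2
    consider (1) "p \<in> {1..K}" "rho K h = tensor_map (TU K) (TV K) (E_u m K U p) (\<lambda>y. y)"
      | (2) "p - K \<in> {1..N-K}" "rho K h = tensor_map (TU K) (TV K) (\<lambda>x. x) (vu K (p - K))"
    proof (cases "p \<le> K")
      case True
      then show ?thesis using hp by (intro that(1)) (auto simp: rho_Aff)
    next
      case False
      then have "p - K \<in> {1..N-K}" using hp by auto
      then show ?thesis using hp False by (intro that(2)) (simp_all add: rho_Aff)
    qed
    note r = this
    from g show ?thesis
    proof cases
      case l: 1
      from r show ?thesis
      proof cases
        case r: 1
        show ?thesis unfolding l(3) r(2)
          by (rule tensor_map_commute[OF U.T V.T U.E_gl_lin[OF l(1,2)] U.E_u_lin[OF r(1)] lin_id lin_id U.E_gl_u[OF l(1,2) r(1)] refl x'])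
      next
        case r: 2
        show ?thesis unfolding l(3) r(2)
          by (rule tensor_map_commute[OF U.T V.T U.E_gl_lin[OF l(1,2)] lin_id lin_id vu_lin[OF r(1)] refl refl x'])
      qed
    next
      case l: 2
      from r show ?thesis
      proof cases
        case r: 1
        show ?thesis unfolding l(3) r(2)
          by (rule tensor_map_commute[OF U.T V.T lin_id U.E_u_lin[OF r(1)] V.E_gl_lin[OF l(1,2)] lin_id refl refl x'])
      next
        case r: 2
        show ?thesis unfolding l(3) r(2)
          by (rule tensor_map_commute[OF U.T V.T lin_id lin_id V.E_gl_lin[OF l(1,2)] vu_lin[OF r(1)] refl vu_gl[OF l(1,2) r(1)] x'])
      qed
    qed
  qed
qed

lemma WK_spanning:
  assumes S: "submodule S CC (WK K)"
    and gen: "\<And>i j u v. i \<in> IU K \<Longrightarrow> j \<in> IV K \<Longrightarrow> u \<in> carrier U \<Longrightarrow> v \<in> carrier V \<Longrightarrow> pp K i u j v \<in> S"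
  shows "carrier (WK K) \<subseteq> S"
  unfolding WK_def
proof (rule tensor_spanning[OF U.T V.T S[unfolded WK_def]])
  fix x y assume x: "x \<in> carrier (TU K)" and y: "y \<in> carrier (TV K)"
  let ?p = "pure_tensor (TU K) (TV K)"
  have y': "?p (U.t K i u) y \<in> S" if i: "i \<in> IU K" and u: "u \<in> carrier U" for i u
  proof -
    have "carrier (TV K) \<subseteq> {y \<in> carrier (TV K). ?p (U.t K i u) y \<in> S}"
      by (rule V.T_spanning[OF submodule_preimage[OF V.T WK[unfolded WK_def] pure_tensor_lin2[OF U.T V.T U.t_in[OF i u]] S[unfolded WK_def]]])
        (use gen[OF i _ u] V.t_in in \<open>auto simp: pp_def\<close>)
    then show ?thesis using y by auto
  qed
  have "carrier (TU K) \<subseteq> {x \<in> carrier (TU K). ?p x y \<in> S}"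
    by (rule U.T_spanning[OF submodule_preimage[OF U.T WK[unfolded WK_def] pure_tensor_lin1[OF U.T V.T y] S[unfolded WK_def]]])
      (use y' U.t_in in auto)
  then show "?p x y \<in> S" using x by auto
qed

section \<open>Juxtaposition into the coinvariants and its equivariance\<close>

abbreviation "pUV \<equiv> pure_tensor U V"

lemma pUV_in: "u \<in> carrier U \<Longrightarrow> v \<in> carrier V \<Longrightarrow> pUV u v \<in> carrier W"
  unfolding W_def by (rule pure_tensor_in[OF vU vV])

definition ff where
  "ff K = (SOME f. f \<in> linear_maps (WK K) CX \<and> (\<forall>i\<in>IU K. \<forall>j\<in>IV K. \<forall>u\<in>carrier U. \<forall>v\<in>carrier V.
    f (pp K i u j v) = cx (cat m K N i j) (box.ie (pUV u v))))"

lemma cat_idx: "K \<le> N \<Longrightarrow> i \<in> IU K \<Longrightarrow> j \<in> IV K \<Longrightarrow> cat m K N i j \<in> E.idx"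
  unfolding E.idx_def U.idx_def V.idx_def by (rule cat_in)

lemma ff_spec:
  assumes K: "K \<le> N"
  shows "ff K \<in> linear_maps (WK K) CX \<and> (\<forall>i\<in>IU K. \<forall>j\<in>IV K. \<forall>u\<in>carrier U. \<forall>v\<in>carrier V.
    ff K (pp K i u j v) = cx (cat m K N i j) (box.ie (pUV u v)))"
proof -
  have "bilinear U V CX (\<lambda>u v. cx (cat m K N i j) (box.ie (pUV u v)))" if "i \<in> IU K" "j \<in> IV K" for i j
    unfolding bilinear_def
    by (intro conjI ballI lin_comp[OF _ cx_lin[OF cat_idx[OF K that]]] lin_comp[OF _ ie_lin])
      (auto simp: W_def pure_tensor_lin1[OF vU vV] pure_tensor_lin2[OF vU vV])
  from TP_lift2[OF vU vV vs_CX this, of "IU K" "IV K"]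
  have "\<exists>f. f \<in> linear_maps (WK K) CX \<and> (\<forall>i\<in>IU K. \<forall>j\<in>IV K. \<forall>u\<in>carrier U. \<forall>v\<in>carrier V.
    f (pp K i u j v) = cx (cat m K N i j) (box.ie (pUV u v)))"
    unfolding WK_def pp_def U.T_def V.T_def U.t_def V.t_def Bex_def by simp
  then show ?thesis unfolding ff_def by (rule someI_ex)
qed

lemma ff_lin: "K \<le> N \<Longrightarrow> ff K \<in> linear_maps (WK K) CX"
  and ff_pp: "K \<le> N \<Longrightarrow> i \<in> IU K \<Longrightarrow> j \<in> IV K \<Longrightarrow> u \<in> carrier U \<Longrightarrow> v \<in> carrier V \<Longrightarrow>
    ff K (pp K i u j v) = cx (cat m K N i j) (box.ie (pUV u v))"
  using ff_spec by auto

lemma ieB: "w \<in> carrier W \<Longrightarrow> box.ie w \<in> carrier B"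
  by (rule lin_closed[OF ie_lin])

lemma act_ie_1: "a \<in> {1..m} \<Longrightarrow> b \<in> {1..m} \<Longrightarrow> u \<in> carrier U \<Longrightarrow> v \<in> carrier V \<Longrightarrow>
    act B (a, b) (box.ie (pUV u v)) = box.ie (pUV (act U (a, b) u) v)"
  using box.iact_ie[of "(a, b)" "pUV u v"] by (simp add: act_B pUV_in pa_1)

lemma act_ie_2: "a \<in> {m+1..m+n} \<Longrightarrow> b \<in> {m+1..m+n} \<Longrightarrow> u \<in> carrier U \<Longrightarrow> v \<in> carrier V \<Longrightarrow>
    act B (a, b) (box.ie (pUV u v)) = box.ie (pUV u (act V (a - m, b - m) v))"
  using box.iact_ie[of "(a, b)" "pUV u v"] by (simp add: act_B pUV_in pa_2)

lemma act_ie_3: "a \<in> {1..m} \<Longrightarrow> b \<in> {m+1..m+n} \<Longrightarrow> u \<in> carrier U \<Longrightarrow> v \<in> carrier V \<Longrightarrow>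
    act B (a, b) (box.ie (pUV u v)) = \<zero>\<^bsub>B\<^esub>"
  using box.iact_ie[of "(a, b)" "pUV u v"] lin_zero[OF W vB ie_lin] by (simp add: act_B pUV_in pa_3[folded W_def])

text \<open>A unit of one block finds its column index only among the positions of that block, as
  the entries at the first \<open>K\<close> positions are at most \<open>m\<close> and the others
  exceed \<open>m\<close>. The sum over all \<open>N\<close> positions therefore shrinks to the sum
  on one tensor power.\<close>

lemma ff_gam:
  assumes K: "K \<le> N" and e: "e \<in> L" and x: "x \<in> carrier (WK K)"
  shows "ff K (gam K e x) = act CX (Inl e) (ff K x)"
proof -
  obtain a b where ab: "e = (a, b)" by fastforce
  have act: "act CX (Inl e) \<in> linear_maps CX CX" using act_CX_lin e by blast
  have "carrier (WK K) \<subseteq> {x \<in> carrier (WK K). ff K (gam K e x) = act CX (Inl e) (ff K x)}"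
  proof (rule WK_spanning[OF submodule_equalizer[OF WK vs_CX lin_comp[OF gam_lin[OF e] ff_lin[OF K]] lin_comp[OF ff_lin[OF K] act]]])
    fix i j u v assume i: "i \<in> IU K" and j: "j \<in> IV K" and u: "u \<in> carrier U" and v: "v \<in> carrier V"
    have ti: "U.t K i u \<in> carrier (TU K)" and tj: "V.t (N - K) j v \<in> carrier (TV K)" using U.t_in[OF i u] V.t_in[OF j v] .
    have pin: "pp K i u j v \<in> carrier (WK K)" unfolding pp_def WK_def by (rule pure_tensor_in[OF U.T V.T ti tj])
    let ?c = "cat m K N i j"
    note c = cat_idx[OF K i j]
    have "ff K (gam K e (pp K i u j v)) = act CX (Inl e) (ff K (pp K i u j v))"
    proof (rule vs_eqI[OF vs_CX])
      fix \<phi> assume \<phi>: "\<phi> \<in> dual CX"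
      note rhs = gl_cx[OF e[unfolded ab] c ieB[OF pUV_in[OF u v]] \<phi>]
      from e[unfolded ab] show "\<phi> (ff K (gam K e (pp K i u j v))) = \<phi> (act CX (Inl e) (ff K (pp K i u j v)))"
      proof (cases rule: levi_cases)
        case 1
        have d: "(\<lambda>x. \<phi> (ff K (pure_tensor (TU K) (TV K) x (V.t (N - K) j v)))) \<in> dual (TU K)"
          by (rule dual_comp[OF dual_comp[OF \<phi> ff_lin[OF K]] pt_lin1[OF tj]])
        have "gam K e (pp K i u j v) = pure_tensor (TU K) (TV K) (E_gl m K U (a, b) (U.t K i u)) (V.t (N - K) j v)"
          unfolding ab gam_eq pp_def using 1 by (simp add: tensor_map_pure[OF U.T V.T U.E_gl_lin lin_id ti tj])
        then have "\<phi> (ff K (gam K e (pp K i u j v))) =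
          (\<Sum>p\<in>{1..K}. if i p = b then \<phi> (ff K (pp K (i(p := a)) u j v)) else 0) + \<phi> (ff K (pp K i (act U (a, b) u) j v))"
          using U.E_gl_t[OF 1(1,2) i u d] by (simp add: pp_def cong: if_cong)
        also have "(\<Sum>p\<in>{1..K}. if i p = b then \<phi> (ff K (pp K (i(p := a)) u j v)) else 0) =
          (\<Sum>p\<in>{1..K}. if ?c p = b then \<phi> (cx (?c(p := a)) (box.ie (pUV u v))) else 0)"
          using U.idx_upd[OF i _ 1(1)] by (intro sum.cong refl) (simp add: ff_pp[OF K _ j u v] cat_1 cat_upd1 del: fun_upd_apply)
        also have "\<dots> = (\<Sum>p\<in>{1..N}. if ?c p = b then \<phi> (cx (?c(p := a)) (box.ie (pUV u v))) else 0)"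
        proof -
          have "?c (p + K) \<noteq> b" if "p \<in> {1..N-K}" for p using 1 cat_2[OF K that, of m i j] V.idx_in[OF j that] by auto
          then show ?thesis unfolding sum_split[OF K] by simp
        qed
        also have "\<phi> (ff K (pp K i (act U (a, b) u) j v)) = \<phi> (cx ?c (act B (a, b) (box.ie (pUV u v))))"
          using ff_pp[OF K i j U.e_in[OF 1(1,2) u] v] act_ie_1[OF 1(1,2) u v] by simp
        finally show ?thesis using rhs ff_pp[OF K i j u v] by (simp add: ab)
      next
        case 2
        have d: "(\<lambda>y. \<phi> (ff K (pure_tensor (TU K) (TV K) (U.t K i u) y))) \<in> dual (TV K)"
          by (rule dual_comp[OF dual_comp[OF \<phi> ff_lin[OF K]] pt_lin2[OF ti]])
        have "gam K e (pp K i u j v) = pure_tensor (TU K) (TV K) (U.t K i u) (E_gl n (N - K) V (a - m, b - m) (V.t (N - K) j v))"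
          unfolding ab gam_eq pp_def using 2 tensor_map_pure[OF U.T V.T lin_id V.E_gl_lin[OF 2(4,5)] ti tj] by simp
        then have "\<phi> (ff K (gam K e (pp K i u j v))) =
          (\<Sum>p\<in>{1..N-K}. if j p = b - m then \<phi> (ff K (pp K i u (j(p := a - m)) v)) else 0) + \<phi> (ff K (pp K i u j (act V (a - m, b - m) v)))"
          using V.E_gl_t[OF 2(4,5) j v d] by (simp add: pp_def cong: if_cong)
        also have "(\<Sum>p\<in>{1..N-K}. if j p = b - m then \<phi> (ff K (pp K i u (j(p := a - m)) v)) else 0) =
          (\<Sum>p\<in>{1..N-K}. if ?c (p + K) = b then \<phi> (cx (?c(p + K := a)) (box.ie (pUV u v))) else 0)"
        proof (intro sum.cong refl)
          fix p assume p: "p \<in> {1..N-K}"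
          have "?c(p + K := a) = cat m K N i (j(p := a - m))" using cat_upd2[OF K p, of m i j "a - m"] 2 by simp
          moreover have "?c (p + K) = b \<longleftrightarrow> j p = b - m" using cat_2[OF K p, of m i j] 2 by auto
          ultimately show "(if j p = b - m then \<phi> (ff K (pp K i u (j(p := a - m)) v)) else 0) =
            (if ?c (p + K) = b then \<phi> (cx (?c(p + K := a)) (box.ie (pUV u v))) else 0)"
            using ff_pp[OF K i V.idx_upd[OF j p 2(4)] u v] by simp
        qed
        also have "\<dots> = (\<Sum>p\<in>{1..N}. if ?c p = b then \<phi> (cx (?c(p := a)) (box.ie (pUV u v))) else 0)"
        proof -
          have "?c p \<noteq> b" if "p \<in> {1..K}" for p using 2 cat_1[OF that, of m N i j] U.idx_in[OF i that] by auto
          then show ?thesis unfolding sum_split[OF K] by simp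
        qed
        also have "\<phi> (ff K (pp K i u j (act V (a - m, b - m) v))) = \<phi> (cx ?c (act B (a, b) (box.ie (pUV u v))))"
          using ff_pp[OF K i j u V.e_in[OF 2(4,5) v]] act_ie_2[OF 2(1,2) u v] by simp
        finally show ?thesis using rhs ff_pp[OF K i j u v] by (simp add: ab)
      qed
    qed (use pin lin_closed[OF gam_lin[OF e]] lin_closed[OF ff_lin[OF K]] lin_closed[OF act] in auto)
    then show "pp K i u j v \<in> {x \<in> carrier (WK K). ff K (gam K e x) = act CX (Inl e) (ff K x)}" using pin by simp
  qed
  then show ?thesis using x by auto
qed

lemma ff_rho_Perm:
  assumes K: "K \<le> N" and w: "w permutes {1..N}" "w ` {1..K} = {1..K}"
    and i: "i \<in> IU K" and j: "j \<in> IV K" and u: "u \<in> carrier U" and v: "v \<in> carrier V"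
  shows "rho K (Perm w) (pp K i u j v) = pp K (i \<circ> inv_into UNIV (restrict_id w {1..K})) u (j \<circ> inv_into UNIV (perm_snd K N w)) v"
    "ff K (rho K (Perm w) (pp K i u j v)) = act CX (Inr (Perm w)) (ff K (pp K i u j v))"
proof -
  note w1 = restrict_id_permutes[OF w] and w2 = perm_snd_permutes[OF w]
  show *: "rho K (Perm w) (pp K i u j v) = pp K (i \<circ> inv_into UNIV (restrict_id w {1..K})) u (j \<circ> inv_into UNIV (perm_snd K N w)) v"
    unfolding rho_Perm pp_def tensor_map_pure[OF U.T V.T U.E_perm_lin[OF w1] V.E_perm_lin[OF w2] U.t_in[OF i u] V.t_in[OF j v]]
      U.E_perm_t[OF w1 i u] V.E_perm_t[OF w2 j v] ..
  show "ff K (rho K (Perm w) (pp K i u j v)) = act CX (Inr (Perm w)) (ff K (pp K i u j v))"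
    unfolding * ff_pp[OF K i j u v] perm_cx[OF w(1) cat_idx[OF K i j] ieB[OF pUV_in[OF u v]]]
      ff_pp[OF K U.idx_perm[OF i permutes_inv[OF w1]] V.idx_perm[OF j permutes_inv[OF w2]] u v] cat_perm_inv[OF w K] ..
qed

text \<open>No correction arises at the first \<open>K\<close> positions: the summands of
  \<open>z_p\<close> with \<open>a > m\<close> involve a unit with row at most \<open>m\<close> and
  column above \<open>m\<close>, which kills \<open>1 \<otimes> W\<close>, and the transpositions
  with smaller positions stay inside the first block.\<close>

lemma ff_rho_Aff1:
  assumes K: "K \<le> N" and p: "p \<in> {1..K}" and i: "i \<in> IU K" and j: "j \<in> IV K"
    and u: "u \<in> carrier U" and v: "v \<in> carrier V" and \<phi>: "\<phi> \<in> dual CX"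
  shows "\<phi> (ff K (rho K (Aff p) (pp K i u j v))) = \<phi> (act CX (Inr (Aff p)) (ff K (pp K i u j v)))"
proof -
  let ?c = "cat m K N i j"
  let ?w = "box.ie (pUV u v)"
  note c = cat_idx[OF K i j]
  have pN: "p \<in> {1..N}" using p K by auto
  have ti: "U.t K i u \<in> carrier (TU K)" and tj: "V.t (N - K) j v \<in> carrier (TV K)" using U.t_in[OF i u] V.t_in[OF j v] .
  have d: "(\<lambda>x. \<phi> (ff K (pure_tensor (TU K) (TV K) x (V.t (N - K) j v)))) \<in> dual (TU K)"
    by (rule dual_comp[OF dual_comp[OF \<phi> ff_lin[OF K]] pt_lin1[OF tj]])
  have "rho K (Aff p) (pp K i u j v) = pure_tensor (TU K) (TV K) (E_u m K U p (U.t K i u)) (V.t (N - K) j v)"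
    unfolding rho_Aff pp_def using p by (simp add: tensor_map_pure[OF U.T V.T U.E_u_lin lin_id ti tj])
  then have "\<phi> (ff K (rho K (Aff p) (pp K i u j v))) =
    (\<Sum>a\<in>{1..m}. \<phi> (ff K (pp K (i(p := a)) (act U (i p, a) u) j v))) + (\<Sum>q\<in>{1..<p}. \<phi> (ff K (pp K (i \<circ> trp q p) u j v)))"
    using U.E_u_t[OF p i u d] by (simp add: pp_def cong: if_cong)
  also have "(\<Sum>a\<in>{1..m}. \<phi> (ff K (pp K (i(p := a)) (act U (i p, a) u) j v))) = (\<Sum>a\<in>{1..m}. \<phi> (cx (?c(p := a)) (act B (?c p, a) ?w)))"
    using U.idx_in[OF i p] by (intro sum.cong refl)
      (simp add: ff_pp[OF K U.idx_upd[OF i p] j U.e_in[OF _ _ u] v] act_ie_1[OF _ _ u v] cat_1[OF p] cat_upd1[OF p] del: fun_upd_apply)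
  also have "\<dots> = (\<Sum>a\<in>{1..m+n}. \<phi> (cx (?c(p := a)) (act B (?c p, a) ?w)))"
  proof -
    have "\<phi> (cx (?c(p := a + m)) (act B (?c p, a + m) ?w)) = 0" if a: "a \<in> {1..n}" for a
    proof -
      have "act B (?c p, a + m) ?w = \<zero>\<^bsub>B\<^esub>" using a U.idx_in[OF i p] cat_1[OF p, of m N i j] by (intro act_ie_3[OF _ _ u v]) auto
      moreover have "?c(p := a + m) \<in> E.idx" using a by (intro E.idx_upd[OF c pN]) auto
      ultimately show ?thesis using lin_zero[OF vB vs_CX cx_lin] dual_zero[OF vs_CX \<phi>] by simp
    qed
    then show ?thesis unfolding sum_split[of m "m + n", OF le_add1] by (simp del: fun_upd_apply)
  qed
  also have "(\<Sum>q\<in>{1..<p}. \<phi> (ff K (pp K (i \<circ> trp q p) u j v))) = (\<Sum>q\<in>{1..<p}. \<phi> (cx (?c \<circ> trp q p) ?w))"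
  proof (intro sum.cong refl)
    fix q assume q: "q \<in> {1..<p}"
    have "cat m K N (i \<circ> trp q p) j = ?c \<circ> trp q p" using q p by (auto simp: cat_def fun_eq_iff Transposition.transpose_def)
    then show "\<phi> (ff K (pp K (i \<circ> trp q p) u j v)) = \<phi> (cx (?c \<circ> trp q p) ?w)"
      using ff_pp[OF K U.idx_perm[OF i U.trp_permutes[OF q p]] j u v] by simp
  qed
  finally show ?thesis using u_cx[OF pN c ieB[OF pUV_in[OF u v]] \<phi>] ff_pp[OF K i j u v] by (simp add: fun_upd_def)
qed

text \<open>
  Here the coinvariants enter: for \<open>a \<le> m\<close> the term \<open>e\<^sub>a \<otimes> E\<^bsub>ja\<^esub> v\<close> of \<open>z\<^sub>p\<close> is rewritten as
  \<open>- E\<^bsub>ja\<^esub> e\<^sub>a \<otimes> v\<close>.  The factor \<open>p\<close> itself contributes \<open>-m\<close>, which is the twist, and the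
  other factors cancel the transpositions \<open>\<sigma>\<^bsub>qp\<^esub>\<close> with \<open>q \<le> K\<close>.
\<close>

lemma ff_rho_Aff2:
  assumes K: "K \<le> N" and p: "p \<in> {1..N-K}" and i: "i \<in> IU K" and j: "j \<in> IV K"
    and u: "u \<in> carrier U" and v: "v \<in> carrier V" and \<phi>: "\<phi> \<in> dual CX"
  shows "\<phi> (ff K (rho K (Aff (p + K)) (pp K i u j v))) = \<phi> (act CX (Inr (Aff (p + K))) (ff K (pp K i u j v)))"
proof -
  let ?c = "cat m K N i j"
  let ?w = "box.ie (pUV u v)"
  let ?P = "p + K"
  note c = cat_idx[OF K i j]
  have w: "?w \<in> carrier B" by (rule ieB[OF pUV_in[OF u v]])
  have pN: "?P \<in> {1..N}" using p K by auto
  have cp: "?c ?P = j p + m" by (rule cat_2[OF K p])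
  have jp: "j p \<in> {1..n}" by (rule V.idx_in[OF j p])
  have ti: "U.t K i u \<in> carrier (TU K)" and tj: "V.t (N - K) j v \<in> carrier (TV K)" using U.t_in[OF i u] V.t_in[OF j v] .
  have d: "(\<lambda>y. \<phi> (ff K (pure_tensor (TU K) (TV K) (U.t K i u) y))) \<in> dual (TV K)"
    by (rule dual_comp[OF dual_comp[OF \<phi> ff_lin[OF K]] pt_lin2[OF ti]])
  have "rho K (Aff ?P) (pp K i u j v) = pure_tensor (TU K) (TV K) (U.t K i u) (vu K p (V.t (N - K) j v))"
    unfolding rho_Aff pp_def using p by (simp add: tensor_map_pure[OF U.T V.T lin_id vu_lin ti tj])
  then have "\<phi> (ff K (rho K (Aff ?P) (pp K i u j v))) =
    (\<Sum>a\<in>{1..n}. \<phi> (ff K (pp K i u (j(p := a)) (act V (j p, a) v)))) + (\<Sum>q\<in>{1..<p}. \<phi> (ff K (pp K i u (j \<circ> trp q p) v)))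
      - of_nat m * \<phi> (ff K (pp K i u j v))"
    using V.E_u_t[OF p j v d] lin_closed[OF V.E_u_lin[OF p] tj] tj V.T
    by (simp add: pp_def vu_def dual_add[OF d] dual_smult[OF d])
  also have "(\<Sum>a\<in>{1..n}. \<phi> (ff K (pp K i u (j(p := a)) (act V (j p, a) v)))) =
    (\<Sum>a\<in>{1..n}. \<phi> (cx (?c(?P := a + m)) (act B (?c ?P, a + m) ?w)))"
  proof (intro sum.cong refl)
    fix a assume a: "a \<in> {1..n}"
    have "act B (?c ?P, a + m) ?w = box.ie (pUV u (act V (j p, a) v))"
      using act_ie_2[of "?c ?P" "a + m" u v] cp jp a u v by simp
    then show "\<phi> (ff K (pp K i u (j(p := a)) (act V (j p, a) v))) = \<phi> (cx (?c(?P := a + m)) (act B (?c ?P, a + m) ?w))"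
      using ff_pp[OF K i V.idx_upd[OF j p a] u V.e_in[OF jp a v]] cat_upd2[OF K p] by simp
  qed
  also have "(\<Sum>q\<in>{1..<p}. \<phi> (ff K (pp K i u (j \<circ> trp q p) v))) = (\<Sum>q\<in>{1..<p}. \<phi> (cx (?c \<circ> trp (q + K) ?P) ?w))"
  proof (intro sum.cong refl)
    fix q assume q: "q \<in> {1..<p}"
    have "cat m K N i (j \<circ> trp q p) = ?c \<circ> trp (q + K) ?P" using q p K by (auto simp: cat_def fun_eq_iff Transposition.transpose_def)
    then show "\<phi> (ff K (pp K i u (j \<circ> trp q p) v)) = \<phi> (cx (?c \<circ> trp (q + K) ?P) ?w)"
      using ff_pp[OF K i V.idx_perm[OF j V.trp_permutes[OF q p]] u v] by simp
  qed
  finally have lhs: "\<phi> (ff K (rho K (Aff ?P) (pp K i u j v))) =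
    (\<Sum>a\<in>{1..n}. \<phi> (cx (?c(?P := a + m)) (act B (?c ?P, a + m) ?w))) + (\<Sum>q\<in>{1..<p}. \<phi> (cx (?c \<circ> trp (q + K) ?P) ?w))
      - of_nat m * \<phi> (cx ?c ?w)" using ff_pp[OF K i j u v] by (simp add: fun_upd_def)
  \<comment> \<open>\<open>q_cx\<close> at the index with \<open>a\<close> written at
    \<open>?P\<close>. The summand of \<open>?P\<close> itself restores \<open>?c\<close>; any other
    position holding \<open>a\<close> receives the old entry of \<open>?P\<close>, and the result is
    \<open>?c\<close> with the two positions exchanged.\<close>
  have q1: "\<phi> (cx (?c(?P := a)) (act B (?c ?P, a) ?w)) =
    - \<phi> (cx ?c ?w) - (\<Sum>r\<in>{1..N}-{?P}. if ?c r = a then \<phi> (cx (?c \<circ> trp r ?P) ?w) else 0)" if a: "a \<in> {1..m}" for a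
  proof -
    have Q: "(?c ?P, a) \<in> Q" using a cp jp by simp
    have ca: "?c(?P := a) \<in> E.idx" using a by (intro E.idx_upd[OF c pN]) auto
    have "(\<Sum>r\<in>{1..N}. if (?c(?P := a)) r = a then \<phi> (cx (?c(?P := a, r := ?c ?P)) ?w) else 0) =
      \<phi> (cx ?c ?w) + (\<Sum>r\<in>{1..N}-{?P}. if (?c(?P := a)) r = a then \<phi> (cx (?c(?P := a, r := ?c ?P)) ?w) else 0)"
      using pN by (subst sum.remove[of _ ?P]) auto
    also have "(\<Sum>r\<in>{1..N}-{?P}. if (?c(?P := a)) r = a then \<phi> (cx (?c(?P := a, r := ?c ?P)) ?w) else 0) =
      (\<Sum>r\<in>{1..N}-{?P}. if ?c r = a then \<phi> (cx (?c \<circ> trp r ?P) ?w) else 0)"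
    proof (intro sum.cong refl)
      fix r assume r: "r \<in> {1..N} - {?P}"
      have "?c(?P := a, r := ?c ?P) = ?c \<circ> trp r ?P" if "?c r = a"
        using r that by (auto simp: fun_eq_iff Transposition.transpose_def)
      then show "(if (?c(?P := a)) r = a then \<phi> (cx (?c(?P := a, r := ?c ?P)) ?w) else 0) =
        (if ?c r = a then \<phi> (cx (?c \<circ> trp r ?P) ?w) else 0)" using r by simp
    qed
    finally show ?thesis using q_cx[OF Q ca w \<phi>] by simp
  qed
  have "(\<Sum>a\<in>{1..m}. \<phi> (cx (?c(?P := a)) (act B (?c ?P, a) ?w))) =
    - of_nat m * \<phi> (cx ?c ?w) - (\<Sum>a\<in>{1..m}. \<Sum>r\<in>{1..N}-{?P}. if ?c r = a then \<phi> (cx (?c \<circ> trp r ?P) ?w) else 0)"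
    by (simp add: q1 sum_subtractf del: fun_upd_apply)
  also have "(\<Sum>a\<in>{1..m}. \<Sum>r\<in>{1..N}-{?P}. if ?c r = a then \<phi> (cx (?c \<circ> trp r ?P) ?w) else 0) =
    (\<Sum>r\<in>{1..N}-{?P}. if ?c r \<in> {1..m} then \<phi> (cx (?c \<circ> trp r ?P) ?w) else 0)"
    by (subst sum.swap) (simp add: sum.delta')
  \<comment> \<open>The position \<open>?P\<close> may be readmitted to the sum, since its entry
    exceeds \<open>m\<close>.\<close>
  also have "\<dots> = (\<Sum>r\<in>{1..N}. if ?c r \<in> {1..m} then \<phi> (cx (?c \<circ> trp r ?P) ?w) else 0)"
    using pN cp jp by (subst (2) sum.remove[of _ ?P]) auto
  also have "\<dots> = (\<Sum>r\<in>{1..K}. \<phi> (cx (?c \<circ> trp r ?P) ?w))"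
  proof -
    have "?c r \<in> {1..m}" if "r \<in> {1..K}" for r using cat_1[OF that] U.idx_in[OF i that] by simp
    moreover have "?c (r + K) \<notin> {1..m}" if "r \<in> {1..N-K}" for r using cat_2[OF K that] V.idx_in[OF j that] by simp
    ultimately show ?thesis unfolding sum_split[OF K] by (simp del: atLeastAtMost_iff)
  qed
  finally have S1: "(\<Sum>a\<in>{1..m}. \<phi> (cx (?c(?P := a)) (act B (?c ?P, a) ?w))) =
    - of_nat m * \<phi> (cx ?c ?w) - (\<Sum>r\<in>{1..K}. \<phi> (cx (?c \<circ> trp r ?P) ?w))" .
  \<comment> \<open>The transpositions with the first \<open>K\<close> positions cancel those in
    \<open>S1\<close>. The others are the transpositions of \<open>u_p\<close> on the second tensor
    power, shifted by \<open>K\<close>.\<close>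
  have S3: "(\<Sum>q\<in>{1..<?P}. \<phi> (cx (?c \<circ> trp q ?P) ?w)) =
    (\<Sum>r\<in>{1..K}. \<phi> (cx (?c \<circ> trp r ?P) ?w)) + (\<Sum>q\<in>{1..<p}. \<phi> (cx (?c \<circ> trp (q + K) ?P) ?w))"
  proof -
    have "{1..<?P} = {1..p - 1 + K}" "{1..<p} = {1..p - 1 + K - K}" using p by auto
    then show ?thesis using sum_split[of K "p - 1 + K" "\<lambda>q. \<phi> (cx (?c \<circ> trp q ?P) ?w)"] by simp
  qed
  have "\<phi> (act CX (Inr (Aff ?P)) (cx ?c ?w)) = (\<Sum>a\<in>{1..m}. \<phi> (cx (?c(?P := a)) (act B (?c ?P, a) ?w)))
    + (\<Sum>a\<in>{1..n}. \<phi> (cx (?c(?P := a + m)) (act B (?c ?P, a + m) ?w))) + (\<Sum>q\<in>{1..<?P}. \<phi> (cx (?c \<circ> trp q ?P) ?w))"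
    using u_cx[OF pN c w \<phi>] sum_split[of m "m + n" "\<lambda>a. \<phi> (cx (?c(?P := a)) (act B (?c ?P, a) ?w))"] by simp
  then show ?thesis unfolding S1 S3 ff_pp[OF K i j u v] lhs by simp
qed

lemma ff_rho:
  assumes K: "K \<le> N" and h: "h \<in> parabolic_gens K N" and x: "x \<in> carrier (WK K)"
  shows "ff K (rho K h x) = act CX (Inr h) (ff K x)"
proof -
  have act: "act CX (Inr h) \<in> linear_maps CX CX" using act_CX_lin h parabolic_gens_sub by blast
  have "carrier (WK K) \<subseteq> {x \<in> carrier (WK K). ff K (rho K h x) = act CX (Inr h) (ff K x)}"
  proof (rule WK_spanning[OF submodule_equalizer[OF WK vs_CX lin_comp[OF rho_lin[OF h] ff_lin[OF K]] lin_comp[OF ff_lin[OF K] act]]])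
    fix i j u v assume a: "i \<in> IU K" "j \<in> IV K" "u \<in> carrier U" "v \<in> carrier V"
    have pin: "pp K i u j v \<in> carrier (WK K)" unfolding pp_def WK_def
      by (rule pure_tensor_in[OF U.T V.T U.t_in[OF a(1,3)] V.t_in[OF a(2,4)]])
    have cl: "ff K (rho K h (pp K i u j v)) \<in> carrier CX" "act CX (Inr h) (ff K (pp K i u j v)) \<in> carrier CX"
      using pin lin_closed[OF rho_lin[OF h]] lin_closed[OF ff_lin[OF K]] lin_closed[OF act] by auto
    from h have "ff K (rho K h (pp K i u j v)) = act CX (Inr h) (ff K (pp K i u j v))"
    proof (cases rule: parabolicE)
      case (1 w)
      then show ?thesis using ff_rho_Perm(2)[OF K 1(2,3) a] by simp
    next
      case (2 p)
      show ?thesis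
      proof (rule vs_eqI[OF vs_CX cl])
        fix \<phi> assume \<phi>: "\<phi> \<in> dual CX"
        show "\<phi> (ff K (rho K h (pp K i u j v))) = \<phi> (act CX (Inr h) (ff K (pp K i u j v)))"
        proof (cases "p \<le> K")
          case True
          then show ?thesis using ff_rho_Aff1[OF K _ a \<phi>, of p] 2 by simp
        next
          case False
          then have "p - K \<in> {1..N-K}" using 2 by auto
          from ff_rho_Aff2[OF K this a \<phi>] show ?thesis using 2 False by simp
        qed
      qed
    qed
    then show "pp K i u j v \<in> {x \<in> carrier (WK K). ff K (rho K h x) = act CX (Inr h) (ff K x)}" using pin by simp
  qed
  then show ?thesis using x by auto
qed

section \<open>Maps from the induced modules by Frobenius reciprocity\<close>

abbreviation "HI K \<equiv> ind (hecke_pres N) (parabolic_gens K N) (WK K) (\<lambda>h. rho K h)"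
abbreviation "ha K \<equiv> ind_act (hecke_pres N) (parabolic_gens K N) (WK K) (\<lambda>h. rho K h)"
abbreviation "he K \<equiv> induction.ie (hecke_pres N) (parabolic_gens K N) (WK K) (\<lambda>h. rho K h)"
abbreviation "hm K e \<equiv> ind_map (hecke_pres N) (parabolic_gens K N) (WK K) (\<lambda>h. rho K h) (gam K e)"
definition "Yc K = hecke_ind m K N (XU K) (XV K)"

lemma hind: "induction (hecke_pres N) (parabolic_gens K N) (WK K) (\<lambda>h. rho K h)"
  by (intro induction.intro presented_hecke induction_axioms.intro WK)
    (use parabolic_gens_sub rho_lin in \<open>simp_all\<close>)

lemmas vs_HI = induction.vs_ind[OF hind]
lemmas he_lin = induction.ie_lin[OF hind]
lemmas he_in = induction.ie_in[OF hind]
lemmas ha_he = induction.iact_ie[OF hind]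
lemmas ha_module = induction.ind_is_module[OF hind]

lemma ha_lin: "h \<in> hecke_gens N \<Longrightarrow> ha K h \<in> linear_maps (HI K) (HI K)"
  using induction.iact_lin[OF hind] by simp

lemma hm_lin: "e \<in> L \<Longrightarrow> hm K e \<in> linear_maps (HI K) (HI K)"
  by (rule induction.ind_map_lin[OF hind, OF gam_lin, OF _ gam_rho])

lemma hm_he: "e \<in> L \<Longrightarrow> x \<in> carrier (WK K) \<Longrightarrow> hm K e (he K x) = he K (gam K e x)"
  by (rule induction.ind_map_ie[OF hind, OF gam_lin, OF _ gam_rho])

lemma hm_ha: "e \<in> L \<Longrightarrow> h \<in> hecke_gens N \<Longrightarrow> t \<in> carrier (HI K) \<Longrightarrow> hm K e (ha K h t) = ha K h (hm K e t)"
  by (rule induction.ind_map_iact[OF hind, OF gam_lin, OF _ gam_rho]) simp_all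

lemma Yc_eq: "Yc K = with_act (HI K) (\<lambda>g. case g of Inl e \<Rightarrow> hm K e | Inr h \<Rightarrow> ha K h)"
  by (simp add: Yc_def hecke_ind_def tensor_XU_XV Let_def)

lemma Yc_simps: "carrier (Yc K) = carrier (HI K)" "act (Yc K) (Inl e) = hm K e" "act (Yc K) (Inr h) = ha K h"
  "linear_maps (Yc K) Z = linear_maps (HI K) Z" "linear_maps Z (Yc K) = linear_maps Z (HI K)" "vs (Yc K)"
  by (simp_all add: Yc_eq vs_HI)

lemma act_Yc_lin: "g \<in> Inl ` L \<union> Inr ` hecke_gens N \<Longrightarrow> act (Yc K) g \<in> linear_maps (Yc K) (Yc K)"
  by (auto simp: Yc_simps hm_lin ha_lin simp del: L_iff)

definition FF where
  "FF K = (SOME F. F \<in> linear_maps (HI K) CX \<and> (\<forall>v\<in>carrier (WK K). F (he K v) = ff K v) \<and>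
    (\<forall>g\<in>hecke_gens N. \<forall>t\<in>carrier (HI K). F (ha K g t) = act CX (Inr g) (F t)))"

lemma FF_spec:
  assumes K: "K \<le> N"
  shows "FF K \<in> linear_maps (HI K) CX \<and> (\<forall>v\<in>carrier (WK K). FF K (he K v) = ff K v) \<and>
    (\<forall>g\<in>hecke_gens N. \<forall>t\<in>carrier (HI K). FF K (ha K g t) = act CX (Inr g) (FF K t))"
proof -
  have M: "is_module (hecke_pres N) CX (\<lambda>h. act CX (Inr h))" using CX_bimodule by (simp only: bimodule_def)
  have "\<exists>F\<in>linear_maps (HI K) CX. (\<forall>v\<in>carrier (WK K). F (he K v) = ff K v) \<and>
    (\<forall>g\<in>gens (hecke_pres N). \<forall>t\<in>carrier (HI K). F (ha K g t) = act CX (Inr g) (F t))"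
    by (rule induction.frobenius[OF hind, OF M, OF ff_lin[OF K]]) (rule ff_rho[OF K])
  then have "\<exists>F. F \<in> linear_maps (HI K) CX \<and> (\<forall>v\<in>carrier (WK K). F (he K v) = ff K v) \<and>
    (\<forall>g\<in>hecke_gens N. \<forall>t\<in>carrier (HI K). F (ha K g t) = act CX (Inr g) (F t))"
    unfolding Bex_def hecke_pres_simps .
  then show ?thesis unfolding FF_def by (rule someI_ex)
qed

lemma FF_lin: "K \<le> N \<Longrightarrow> FF K \<in> linear_maps (HI K) CX"
  and FF_he: "K \<le> N \<Longrightarrow> v \<in> carrier (WK K) \<Longrightarrow> FF K (he K v) = ff K v"
  and FF_ha: "K \<le> N \<Longrightarrow> g \<in> hecke_gens N \<Longrightarrow> t \<in> carrier (HI K) \<Longrightarrow> FF K (ha K g t) = act CX (Inr g) (FF K t)"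
  using FF_spec by auto

text \<open>On \<open>1 \<otimes> x\<close> this is \<open>ff_gam\<close>. It spreads to the whole
  induced module because the matrix units commute with the Hecke action on both sides.\<close>

lemma FF_hm:
  assumes K: "K \<le> N" and e: "e \<in> L" and t: "t \<in> carrier (HI K)"
  shows "FF K (hm K e t) = act CX (Inl e) (FF K t)"
proof (rule induction.ind_lin_eqI[OF hind vs_CX lin_comp[OF hm_lin[OF e] FF_lin[OF K]] lin_comp[OF FF_lin[OF K] act_CX_lin] _ _ t])
  show "Inl e \<in> Inl ` L \<union> Inr ` hecke_gens N" using e by blast
  show "FF K (hm K e (he K v)) = act CX (Inl e) (FF K (he K v))" if "v \<in> carrier (WK K)" for v
    by (simp only: hm_he[OF e that] FF_he[OF K that] FF_he[OF K lin_closed[OF gam_lin[OF e] that]] ff_gam[OF K e that])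
  fix g t assume g: "g \<in> gens (hecke_pres N)" and t: "t \<in> carrier (HI K)" and IH: "FF K (hm K e t) = act CX (Inl e) (FF K t)"
  then have g: "g \<in> hecke_gens N" by simp
  have com: "act CX (Inl e) (act CX (Inr g) x) = act CX (Inr g) (act CX (Inl e) x)" if "x \<in> carrier CX" for x
    using CX_bimodule that g e by (auto simp: bimodule_def L_def simp del: L_iff)
  show "FF K (hm K e (ha K g t)) = act CX (Inl e) (FF K (ha K g t))"
    by (simp only: hm_ha[OF e g t] FF_ha[OF K g lin_closed[OF hm_lin[OF e] t]] IH FF_ha[OF K g t] com[OF lin_closed[OF FF_lin[OF K] t]])
qed

lemma FF_act:
  assumes "K \<le> N" "g \<in> Inl ` L \<union> Inr ` hecke_gens N" "t \<in> carrier (HI K)"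
  shows "FF K (act (Yc K) g t) = act CX g (FF K t)"
  using assms by (auto simp: Yc_simps FF_hm FF_ha simp del: L_iff hecke_gens_simps)

section \<open>The map from the direct sum to the coinvariants\<close>

definition "YY = direct_sum {0..N} Yc"
definition "GG f = (\<Oplus>\<^bsub>CX\<^esub>K\<in>{0..N}. FF K (f K))"

lemma vs_YY: "vs YY"
  unfolding YY_def by (rule vs_direct_sum[OF Yc_simps(6)])

lemma YY_in: "f \<in> carrier YY \<Longrightarrow> K \<in> {0..N} \<Longrightarrow> f K \<in> carrier (HI K)"
  by (auto simp: YY_def Yc_simps)

lemma FFc_lin: "K \<in> {0..N} \<Longrightarrow> (\<lambda>f. FF K (f K)) \<in> linear_maps YY CX"
  unfolding YY_def by (rule lin_comp[OF direct_sum_component]) (auto simp: Yc_simps FF_lin)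

lemma GG_lin: "GG \<in> linear_maps YY CX"
  unfolding GG_def[abs_def] by (rule lin_finsum[OF vs_YY vs_CX finite_atLeastAtMost FFc_lin])

lemma dual_GG: "\<phi> \<in> dual CX \<Longrightarrow> f \<in> carrier YY \<Longrightarrow> \<phi> (GG f) = (\<Sum>K\<in>{0..N}. \<phi> (FF K (f K)))"
  unfolding GG_def by (rule dual_finsum[OF vs_CX _ lin_closed[OF FFc_lin]]) auto

lemma act_YY_lin:
  assumes g: "g \<in> Inl ` L \<union> Inr ` hecke_gens N"
  shows "act YY g \<in> linear_maps YY YY"
proof (rule linear_mapsI)
  note l = act_Yc_lin[OF g]
  show "act YY g x \<in> carrier YY" if "x \<in> carrier YY" for x
    using that lin_closed[OF l] by (auto simp: YY_def)
  show "act YY g (x \<oplus>\<^bsub>YY\<^esub> y) = act YY g x \<oplus>\<^bsub>YY\<^esub> act YY g y" if "x \<in> carrier YY" "y \<in> carrier YY" for x y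
    using that lin_add[OF l] by (auto simp: YY_def fun_eq_iff PiE_iff)
  show "act YY g (c \<odot>\<^bsub>YY\<^esub> x) = c \<odot>\<^bsub>YY\<^esub> act YY g x" if "x \<in> carrier YY" for c x
    using that lin_smult[OF l] by (auto simp: YY_def fun_eq_iff PiE_iff)
qed

lemma GG_act:
  assumes g: "g \<in> Inl ` L \<union> Inr ` hecke_gens N" and f: "f \<in> carrier YY"
  shows "GG (act YY g f) = act CX g (GG f)"
proof (rule vs_eqI[OF vs_CX lin_closed[OF GG_lin lin_closed[OF act_YY_lin[OF g] f]] lin_closed[OF act_CX_lin[OF g] lin_closed[OF GG_lin f]]])
  fix \<phi> assume \<phi>: "\<phi> \<in> dual CX"
  have "\<phi> (GG (act YY g f)) = (\<Sum>K\<in>{0..N}. \<phi> (FF K (act YY g f K)))"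
    by (rule dual_GG[OF \<phi> lin_closed[OF act_YY_lin[OF g] f]])
  also have "\<dots> = (\<Sum>K\<in>{0..N}. \<phi> (act CX g (FF K (f K))))"
    using FF_act[OF _ g YY_in[OF f]] by (intro sum.cong refl) (simp add: YY_def)
  also have "\<dots> = \<phi> (act CX g (GG f))"
    by (rule dual_GG[OF dual_comp[OF \<phi> act_CX_lin[OF g]] f, symmetric])
  finally show "\<phi> (GG (act YY g f)) = \<phi> (act CX g (GG f))" .
qed

abbreviation "inc K \<equiv> injection {0..N} Yc K"

lemma inc_lin: "K \<in> {0..N} \<Longrightarrow> inc K \<in> linear_maps (HI K) YY"
  using injection_lin[of "{0..N}" Yc K] by (simp add: Yc_simps YY_def)

lemma GG_inc:
  assumes k: "k \<in> {0..N}" and x: "x \<in> carrier (HI k)"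
  shows "GG (inc k x) = FF k x"
proof (rule vs_eqI[OF vs_CX lin_closed[OF GG_lin lin_closed[OF inc_lin[OF k] x]]])
  show "FF k x \<in> carrier CX" using k x by (intro lin_closed[OF FF_lin]) auto
  fix \<phi> assume \<phi>: "\<phi> \<in> dual CX"
  have "\<phi> (GG (inc k x)) = (\<Sum>K\<in>{0..N}. \<phi> (FF K (inc k x K)))"
    by (rule dual_GG[OF \<phi> lin_closed[OF inc_lin[OF k] x]])
  also have "\<dots> = (\<Sum>K\<in>{0..N}. if K = k then \<phi> (FF k x) else 0)"
  proof (intro sum.cong refl)
    fix K assume K: "K \<in> {0..N}"
    then have "FF K \<zero>\<^bsub>Yc K\<^esub> = \<zero>\<^bsub>CX\<^esub>" by (intro lin_zero[OF Yc_simps(6) vs_CX]) (simp add: Yc_simps FF_lin)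
    then show "\<phi> (FF K (inc k x K)) = (if K = k then \<phi> (FF k x) else 0)"
      using K dual_zero[OF vs_CX \<phi>] by (simp add: injection_def)
  qed
  finally show "\<phi> (GG (inc k x)) = \<phi> (FF k x)" using k by simp
qed

text \<open>\<open>sh i\<close> is an arbitrary representative of the coset that belongs to \<open>lo i\<close>.\<close>

definition "lo i = {p \<in> {1..N}. i p \<le> m}"
definition "sz i = card (lo i)"
definition "sh i = (SOME w. w permutes {1..N} \<and> w ` {1..sz i} = lo i)"
definition "lft i = (\<lambda>p\<in>{1..sz i}. i (sh i p))"
definition "rgt i = (\<lambda>p\<in>{1..N - sz i}. i (sh i (p + sz i)) - m)"

lemma sh: "sh i permutes {1..N}" "sh i ` {1..sz i} = lo i"
proof -
  have "\<exists>w. w permutes {1..N} \<and> w ` {1..sz i} = lo i"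
    unfolding sz_def by (rule exists_perm_onto) (auto simp: lo_def)
  from someI_ex[OF this] show "sh i permutes {1..N}" "sh i ` {1..sz i} = lo i" unfolding sh_def by auto
qed

lemma sz_le: "sz i \<le> N"
  using card_mono[of "{1..N}" "{p \<in> {1..N}. i p \<le> m}"] by (simp add: sz_def lo_def subset_iff)

lemma sh_lo: "p \<in> {1..sz i} \<Longrightarrow> sh i p \<in> {1..N} \<and> i (sh i p) \<le> m"
  using sh(2)[of i] unfolding lo_def by blast

lemma sh_hi:
  assumes "p \<in> {sz i + 1..N}" shows "sh i p \<in> {1..N} \<and> \<not> i (sh i p) \<le> m"
proof -
  have "sh i p \<in> {1..N}" using permutes_in_image[OF sh(1), of i p] assms by auto
  moreover have "sh i p \<notin> lo i"
  proof
    assume "sh i p \<in> lo i"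
    then obtain q where "q \<in> {1..sz i}" "sh i q = sh i p" using sh(2)[of i] by (metis imageE)
    then show False using injD[OF permutes_inj[OF sh(1)[of i]], of q p] assms by auto
  qed
  ultimately show ?thesis by (auto simp: lo_def)
qed

lemma lft_in: "i \<in> E.idx \<Longrightarrow> lft i \<in> IU (sz i)"
  unfolding U.idx_def lft_def
proof (rule restrict_PiE_iff[THEN iffD2], rule ballI)
  fix p assume i: "i \<in> E.idx" and p: "p \<in> {1..sz i}"
  show "i (sh i p) \<in> {1..m}" using sh_lo[OF p] E.idx_in[OF i, of "sh i p"] by auto
qed

lemma rgt_in: "i \<in> E.idx \<Longrightarrow> rgt i \<in> IV (sz i)"
  unfolding V.idx_def rgt_def
proof (rule restrict_PiE_iff[THEN iffD2], rule ballI)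
  fix p assume i: "i \<in> E.idx" and p: "p \<in> {1..N - sz i}"
  then have "p + sz i \<in> {sz i + 1..N}" by auto
  from sh_hi[OF this] show "i (sh i (p + sz i)) - m \<in> {1..n}" using E.idx_in[OF i, of "sh i (p + sz i)"] by auto
qed

text \<open>\<open>sh i\<close> carries the first \<open>sz i\<close> positions onto those with
  entries at most \<open>m\<close>, so reading \<open>i\<close> along \<open>sh i\<close> gives a
  juxtaposition.\<close>

lemma cat_lft_rgt:
  assumes i: "i \<in> E.idx" shows "cat m (sz i) N (lft i) (rgt i) = i \<circ> sh i"
proof
  fix p
  consider "p \<in> {1..sz i}" | "p \<in> {sz i + 1..N}" | "p \<notin> {1..N}" by fastforce
  then show "cat m (sz i) N (lft i) (rgt i) p = (i \<circ> sh i) p"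
  proof cases
    case 1
    then show ?thesis by (simp add: cat_def lft_def)
  next
    case 2
    then show ?thesis using sh_hi[OF 2] by (auto simp: cat_def rgt_def)
  next
    case 3
    then show ?thesis using permutes_not_in[OF sh(1) 3] sz_le[of i] i by (auto simp: cat_def E.idx_def PiE_iff extensional_def)
  qed
qed

section \<open>Vectors of the induced modules attached to multi-indices\<close>

lemma pp_in: "i \<in> IU K \<Longrightarrow> j \<in> IV K \<Longrightarrow> u \<in> carrier U \<Longrightarrow> v \<in> carrier V \<Longrightarrow> pp K i u j v \<in> carrier (WK K)"
  unfolding pp_def WK_def by (intro pure_tensor_in U.T V.T U.t_in V.t_in)

lemma pp_lin1: "i \<in> IU K \<Longrightarrow> j \<in> IV K \<Longrightarrow> v \<in> carrier V \<Longrightarrow> (\<lambda>u. pp K i u j v) \<in> linear_maps U (WK K)"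
  unfolding pp_def by (rule lin_comp[OF _ pt_lin1[OF V.t_in]]) (simp_all add: U.t_def U.T_def tp_lin[OF vU])

lemma pp_lin2: "i \<in> IU K \<Longrightarrow> j \<in> IV K \<Longrightarrow> u \<in> carrier U \<Longrightarrow> (\<lambda>v. pp K i u j v) \<in> linear_maps V (WK K)"
  unfolding pp_def by (rule lin_comp[OF _ pt_lin2[OF U.t_in]]) (simp_all add: V.t_def V.T_def tp_lin[OF vV])

lemma FF_ha_pp:
  assumes K: "K \<le> N" and w: "w permutes {1..N}" and a: "i \<in> IU K" "j \<in> IV K" "u \<in> carrier U" "v \<in> carrier V"
  shows "FF K (ha K (Perm w) (he K (pp K i u j v))) = cx (cat m K N i j \<circ> inv_into UNIV w) (box.ie (pUV u v))"
proof -
  have g: "Perm w \<in> hecke_gens N" using w by simp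
  show ?thesis
    by (simp only: FF_ha[OF K g he_in[OF pp_in[OF a]]] FF_he[OF K pp_in[OF a]] ff_pp[OF K a]
      perm_cx[OF w cat_idx[OF K a(1,2)] ieB[OF pUV_in[OF a(3,4)]]])
qed

text \<open>The candidate for the preimage of the class of
  \<open>e_i \<otimes> u \<otimes> v\<close>. It yields surjectivity and also defines the inverse
  map.\<close>

definition "hs i u v = ha (sz i) (Perm (sh i)) (he (sz i) (pp (sz i) (lft i) u (rgt i) v))"

lemma hs_lin1: "i \<in> E.idx \<Longrightarrow> v \<in> carrier V \<Longrightarrow> (\<lambda>u. hs i u v) \<in> linear_maps U (HI (sz i))"
  and hs_lin2: "i \<in> E.idx \<Longrightarrow> u \<in> carrier U \<Longrightarrow> hs i u \<in> linear_maps V (HI (sz i))"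
  unfolding hs_def using sh(1)[of i]
  by (auto intro!: lin_comp[OF lin_comp[OF _ he_lin] ha_lin] pp_lin1 pp_lin2 lft_in rgt_in)

lemma FF_hs:
  assumes i: "i \<in> E.idx" and uv: "u \<in> carrier U" "v \<in> carrier V"
  shows "FF (sz i) (hs i u v) = cx i (box.ie (pUV u v))"
  unfolding hs_def FF_ha_pp[OF sz_le sh(1) lft_in[OF i] rgt_in[OF i] uv] cat_lft_rgt[OF i] comp_assoc
    permutes_inv_o(1)[OF sh(1)] by simp

lemma GG_surj: "GG ` carrier YY = carrier CX"
proof
  show "GG ` carrier YY \<subseteq> carrier CX" using lin_closed[OF GG_lin] by auto
  note S = submodule_image[OF vs_YY vs_CX GG_lin]
  show "carrier CX \<subseteq> GG ` carrier YY"
  proof (rule coinv_spanning[OF S])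
    fix i w assume i: "i \<in> E.idx" and w: "w \<in> carrier W"
    have "carrier W \<subseteq> {w \<in> carrier W. cx i (box.ie w) \<in> GG ` carrier YY}"
    proof (rule tensor_spanning[OF vU vV, folded W_def, OF submodule_preimage[OF W vs_CX lin_comp[OF ie_lin cx_lin[OF i]] S]])
      fix u v assume uv: "u \<in> carrier U" "v \<in> carrier V"
      have k: "sz i \<in> {0..N}" using sz_le by simp
      note h = lin_closed[OF hs_lin2[OF i uv(1)] uv(2)]
      have "cx i (box.ie (pUV u v)) = GG (inc (sz i) (hs i u v))" unfolding GG_inc[OF k h] by (rule FF_hs[OF i uv, symmetric])
      then show "pUV u v \<in> {w \<in> carrier W. cx i (box.ie w) \<in> GG ` carrier YY}"
        using lin_closed[OF inc_lin[OF k] h] pUV_in[OF uv] by auto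
    qed
    then show "cx i (box.ie w) \<in> GG ` carrier YY" using w by auto
  qed
qed

text \<open>Independence of the chosen representative. Both \<open>w\<close> and
  \<open>sh i0\<close> carry \<open>{1..K}\<close> onto \<open>lo i0\<close>, so they differ by a
  permutation \<open>s\<close> from the parabolic subgroup; \<open>s\<close> crosses the tensor sign
  and turns the pair \<open>i\<close>, \<open>j\<close> into the pair attached to
  \<open>i0\<close>.\<close>

lemma hs_cat:
  assumes K: "K \<le> N" and w: "w permutes {1..N}" and a: "i \<in> IU K" "j \<in> IV K" and uv: "u \<in> carrier U" "v \<in> carrier V"
    and i0: "i0 = cat m K N i j \<circ> inv_into UNIV w"
  shows "i0 \<in> E.idx" "sz i0 = K" "hs i0 u v = ha K (Perm w) (he K (pp K i u j v))"
proof -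
  show i0': "i0 \<in> E.idx" unfolding i0 by (rule E.idx_perm[OF cat_idx[OF K a] permutes_inv[OF w]])
  have "cat m K N i j p \<le> m \<longleftrightarrow> p \<in> {1..K}" if "p \<in> {1..N}" for p
  proof (cases "p \<in> {1..K}")
    case True
    then show ?thesis using cat_1[OF True, of m N i j] U.idx_in[OF a(1) True] by simp
  next
    case False
    then have "p - K \<in> {1..N-K}" "p - K + K = p" using that by auto
    then show ?thesis using cat_2[OF K, of "p - K" m i j] V.idx_in[OF a(2), of "p - K"] False by simp
  qed
  note cat_le = this
  have lo: "lo i0 = w ` {1..K}"
  proof
    show "lo i0 \<subseteq> w ` {1..K}"
    proof
      fix p assume p: "p \<in> lo i0"
      then have "inv_into UNIV w p \<in> {1..N}" using permutes_in_image[OF permutes_inv[OF w], of p] by (auto simp: lo_def)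
      then have "inv_into UNIV w p \<in> {1..K}" using cat_le p by (auto simp: lo_def i0)
      then show "p \<in> w ` {1..K}" using permutes_inverses(1)[OF w, of p] by (metis imageI)
    qed
    show "w ` {1..K} \<subseteq> lo i0"
    proof
      fix p assume "p \<in> w ` {1..K}"
      then obtain q where q: "q \<in> {1..K}" "p = w q" by blast
      then have "q \<in> {1..N}" using K by auto
      moreover from this have "p \<in> {1..N}" using permutes_in_image[OF w] q(2) by blast
      ultimately show "p \<in> lo i0" using cat_le[of q] q permutes_inverses(2)[OF w, of q] by (simp add: lo_def i0)
    qed
  qed
  show sz: "sz i0 = K" unfolding sz_def lo using card_image[OF inj_on_subset[OF permutes_inj[OF w]], of "{1..K}"] by simp
  note s0 = sh[of i0, unfolded sz lo]
  define s where "s = inv_into UNIV (sh i0) \<circ> w"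
  have s: "s permutes {1..N}" unfolding s_def by (rule permutes_compose[OF w permutes_inv[OF s0(1)]])
  have sK: "s ` {1..K} = {1..K}"
    unfolding s_def image_comp[symmetric] s0(2)[symmetric] unfolding image_comp permutes_inv_o(2)[OF s0(1)] by simp
  have ws: "w = sh i0 \<circ> s" unfolding s_def comp_assoc[symmetric] permutes_inv_o(1)[OF s0(1)] by simp
  let ?i = "i \<circ> inv_into UNIV (restrict_id s {1..K})" and ?j = "j \<circ> inv_into UNIV (perm_snd K N s)"
  have ij: "?i \<in> IU K" "?j \<in> IV K"
    using U.idx_perm[OF a(1) permutes_inv[OF restrict_id_permutes[OF s sK]]] V.idx_perm[OF a(2) permutes_inv[OF perm_snd_permutes[OF s sK]]] .
  have "cat m K N ?i ?j = cat m K N i j \<circ> inv_into UNIV s" by (rule cat_perm_inv[OF s sK K])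
  also have "inv_into UNIV s = inv_into UNIV w \<circ> sh i0"
    unfolding s_def using o_inv_distrib[OF permutes_bij[OF permutes_inv[OF s0(1)]] permutes_bij[OF w]] permutes_inv_inv[OF s0(1)] by simp
  also have "cat m K N i j \<circ> (inv_into UNIV w \<circ> sh i0) = cat m K N (lft i0) (rgt i0)"
    using cat_lft_rgt[OF i0'] unfolding sz by (simp add: i0 comp_assoc)
  finally have c: "cat m K N ?i ?j = cat m K N (lft i0) (rgt i0)" .
  note lr = lft_in[OF i0', unfolded sz] rgt_in[OF i0', unfolded sz]
  \<comment> \<open>A juxtaposition determines its two parts, so the pair moved by \<open>s\<close>
    is the standard one.\<close>
  have e: "?i = lft i0" "?j = rgt i0"
    using cat_inj[OF c K] ij lr unfolding U.idx_def V.idx_def by blast+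
  have sP: "Perm s \<in> parabolic_gens K N" using s sK by (auto simp: parabolic_gens_def)
  note x = pp_in[OF a uv]
  have "ha K (Perm w) (he K (pp K i u j v)) = ha K (Perm (sh i0)) (ha K (Perm s) (he K (pp K i u j v)))"
    unfolding hecke_relation(2)[OF ha_module he_in[OF x] s0(1) s] ws[symmetric] ..
  also have "\<dots> = hs i0 u v"
    unfolding ha_he[OF sP x] ff_rho_Perm(1)[OF K s sK a uv] e hs_def sz ..
  finally show "hs i0 u v = ha K (Perm w) (he K (pp K i u j v))" by simp
qed

text \<open>The left inverse sends the class of \<open>e_i \<otimes> u \<otimes> v\<close> to
  \<open>hs i u v\<close>; by \<open>coinv_lift\<close> any family of linear maps on
  \<open>W\<close> is allowed. That it undoes \<open>FF K\<close> is checked on the vectors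
  \<open>w \<otimes> x\<close> with \<open>w\<close> a permutation, which span the induced module
  whether or not they are independent beyond the relation of cosets.\<close>

lemma GG_retraction: "\<exists>H\<in>linear_maps CX YY. \<forall>f\<in>carrier YY. H (GG f) = f"
proof -
  have k: "sz i \<in> {0..N}" for i using sz_le by simp
  have "\<exists>F. F \<in> linear_maps W YY \<and> (\<forall>u\<in>carrier U. \<forall>v\<in>carrier V. F (pUV u v) = inc (sz i) (hs i u v))" if i: "i \<in> E.idx" for i
  proof -
    have "bilinear U V YY (\<lambda>u v. inc (sz i) (hs i u v))"
      unfolding bilinear_def by (intro conjI ballI lin_comp[OF _ inc_lin[OF k]] hs_lin1 hs_lin2 i)
    from tensor_lift[OF vU vV vs_YY this] show ?thesis unfolding W_def by blast
  qed
  then have "\<forall>i\<in>E.idx. \<exists>F. F \<in> linear_maps W YY \<and> (\<forall>u\<in>carrier U. \<forall>v\<in>carrier V. F (pUV u v) = inc (sz i) (hs i u v))"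
    by blast
  from bchoice[OF this] obtain H0 where H0: "\<And>i. i \<in> E.idx \<Longrightarrow> H0 i \<in> linear_maps W YY"
    "\<And>i u v. i \<in> E.idx \<Longrightarrow> u \<in> carrier U \<Longrightarrow> v \<in> carrier V \<Longrightarrow> H0 i (pUV u v) = inc (sz i) (hs i u v)" by blast
  obtain H where H: "H \<in> linear_maps CX YY" "\<And>i w. i \<in> E.idx \<Longrightarrow> w \<in> carrier W \<Longrightarrow> H (cx i (box.ie w)) = H0 i w"
    using coinv_lift[of YY H0, OF vs_YY H0(1)] by blast
  have HFF: "H (FF K t) = inc K t" if K: "K \<in> {0..N}" and t: "t \<in> carrier (HI K)" for K t
  proof -
    have KN: "K \<le> N" using K by simp
    note FH = lin_comp[OF FF_lin[OF KN] H(1)]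
    have "carrier (HI K) \<subseteq> {t \<in> carrier (HI K). H (FF K t) = inc K t}"
    proof (rule hecke_ind_spanning[OF hind submodule_equalizer[OF vs_HI vs_YY FH inc_lin[OF K]]])
      fix w x assume w: "w permutes {1..N}" and x: "x \<in> carrier (WK K)"
      have g: "Perm w \<in> hecke_gens N" using w by simp
      note hl = lin_comp[OF he_lin[of K] ha_lin[OF g, of K]]
      have "carrier (WK K) \<subseteq> {x \<in> carrier (WK K). H (FF K (ha K (Perm w) (he K x))) = inc K (ha K (Perm w) (he K x))}"
      proof (rule WK_spanning[OF submodule_equalizer[OF WK vs_YY lin_comp[OF hl FH] lin_comp[OF hl inc_lin[OF K]]]])
        fix i j u v assume a: "i \<in> IU K" "j \<in> IV K" and uv: "u \<in> carrier U" "v \<in> carrier V"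
        note c = hs_cat[OF KN w a uv refl]
        have "H (FF K (ha K (Perm w) (he K (pp K i u j v)))) = inc K (ha K (Perm w) (he K (pp K i u j v)))"
          unfolding FF_ha_pp[OF KN w a uv] H(2)[OF c(1) pUV_in[OF uv]] H0(2)[OF c(1) uv] c(2,3) ..
        then show "pp K i u j v \<in> {x \<in> carrier (WK K). H (FF K (ha K (Perm w) (he K x))) = inc K (ha K (Perm w) (he K x))}"
          using pp_in[OF a uv] by simp
      qed
      then show "ha K (Perm w) (he K x) \<in> {t \<in> carrier (HI K). H (FF K t) = inc K t}"
        using x lin_closed[OF hl x] by auto
    qed
    then show ?thesis using t by auto
  qed
  have "H (GG f) = f" if f: "f \<in> carrier YY" for f
  proof (rule PiE_ext[of _ "{0..N}" "\<lambda>K. carrier (Yc K)"])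
    show "H (GG f) \<in> (\<Pi>\<^sub>E K\<in>{0..N}. carrier (Yc K))" using lin_closed[OF H(1) lin_closed[OF GG_lin f]] by (simp add: YY_def)
    show "f \<in> (\<Pi>\<^sub>E K\<in>{0..N}. carrier (Yc K))" using f by (simp add: YY_def)
    fix k assume k: "k \<in> {0..N}"
    have comp: "(\<lambda>x. x k) \<in> linear_maps YY (Yc k)" unfolding YY_def by (rule direct_sum_component[OF k])
    show "H (GG f) k = f k"
    proof (rule vs_eqI[OF Yc_simps(6) lin_closed[OF comp lin_closed[OF H(1) lin_closed[OF GG_lin f]]] lin_closed[OF comp f]])
      fix \<phi> assume \<phi>: "\<phi> \<in> dual (Yc k)"
      have "\<phi> (H (GG f) k) = (\<Sum>K\<in>{0..N}. \<phi> (H (FF K (f K)) k))"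
        by (rule dual_GG[OF dual_comp[OF \<phi> lin_comp[OF H(1) comp]] f])
      also have "\<dots> = (\<Sum>K\<in>{0..N}. if K = k then \<phi> (f k) else 0)"
        using k dual_zero[OF Yc_simps(6) \<phi>] by (intro sum.cong refl) (auto simp: HFF[OF _ YY_in[OF f]] injection_def)
      finally show "\<phi> (H (GG f) k) = \<phi> (f k)" using k by simp
    qed
  qed
  then show ?thesis using H(1) by blast
qed

section \<open>The isomorphism of bimodules\<close>

lemma GG_inj_on: "inj_on GG (carrier YY)"
  using GG_retraction by (metis inj_on_inverseI)

text \<open>All relations hold in the coinvariants and are pulled back along the injective
  equivariant map \<open>GG\<close>.\<close>

lemma YY_bimodule: "bimodule m n N YY"
  unfolding bimodule_def
proof (intro conjI ballI)
  note C = CX_bimodule[unfolded bimodule_def]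
  show "is_module (gl_pres (levi_units m n)) YY (\<lambda>e. act YY (Inl e))"
    by (rule presented.is_module_transfer[OF presented_gl[OF trans_L[unfolded L_def]] C[THEN conjunct1] vs_YY _ GG_lin GG_inj_on])
      (auto simp: L_def[symmetric] GG_act act_YY_lin simp del: L_iff)
  show "is_module (hecke_pres N) YY (\<lambda>h. act YY (Inr h))"
    by (rule presented.is_module_transfer[OF presented_hecke C[THEN conjunct2, THEN conjunct1] vs_YY _ GG_lin GG_inj_on])
      (auto simp: GG_act act_YY_lin simp del: hecke_gens_simps)
  fix e h x assume e: "e \<in> levi_units m n" and h: "h \<in> hecke_gens N" and x: "x \<in> carrier YY"
  have g: "Inl e \<in> Inl ` L \<union> Inr ` hecke_gens N" "Inr h \<in> Inl ` L \<union> Inr ` hecke_gens N" using e h by (auto simp: L_def simp del: L_iff)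
  note in_YY = lin_closed[OF act_YY_lin]
  have "GG (act YY (Inl e) (act YY (Inr h) x)) = GG (act YY (Inr h) (act YY (Inl e) x))"
    using C e h lin_closed[OF GG_lin x] by (simp only: GG_act[OF g(1) in_YY[OF g(2) x]] GG_act[OF g(2) in_YY[OF g(1) x]]
      GG_act[OF g(1) x] GG_act[OF g(2) x])
  then show "act YY (Inl e) (act YY (Inr h) x) = act YY (Inr h) (act YY (Inl e) x)"
    by (rule inj_onD[OF GG_inj_on _ in_YY[OF g(1) in_YY[OF g(2) x]] in_YY[OF g(2) in_YY[OF g(1) x]]])
qed

text \<open>Surjectivity of \<open>GG\<close> makes its left inverse two-sided, and the inverse of
  an equivariant bijection is equivariant.\<close>

lemma CX_YY: "bimodule_equivalent m n N CX YY"
  unfolding bimodule_equivalent_def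
proof (intro conjI CX_bimodule YY_bimodule)
  obtain H where H: "H \<in> linear_maps CX YY" "\<And>f. f \<in> carrier YY \<Longrightarrow> H (GG f) = f" using GG_retraction by blast
  have inv: "GG (H x) = x" if "x \<in> carrier CX" for x
    using that H(2) unfolding GG_surj[symmetric] by auto
  have "bij_betw H (carrier CX) (carrier YY)"
    by (rule bij_betw_byWitness[of _ GG]) (use H inv lin_closed[OF H(1)] lin_closed[OF GG_lin] in auto)
  moreover have "H (act CX g x) = act YY g (H x)" if g: "g \<in> Inl ` L \<union> Inr ` hecke_gens N" and x: "x \<in> carrier CX" for g x
  proof -
    note h = lin_closed[OF H(1) x]
    have "H (act CX g x) = H (GG (act YY g (H x)))" unfolding GG_act[OF g h] inv[OF x] ..
    then show ?thesis using H(2)[OF lin_closed[OF act_YY_lin[OF g] h]] by simp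
  qed
  ultimately show "\<exists>h\<in>linear_maps CX YY. bij_betw h (carrier CX) (carrier YY) \<and>
      (\<forall>g\<in>Inl ` levi_units m n \<union> Inr ` hecke_gens N. \<forall>x\<in>carrier CX. h (act CX g x) = act YY g (h x))"
    unfolding L_def[symmetric] using H(1) by blast
qed

end

theorem theorem1p3:
  fixes m n N :: nat
    and U :: "(nat \<times> nat, 'u) rep"
    and V :: "(nat \<times> nat, 'v) rep"
  assumes "m > 0" and "n > 0" and "N > 0"
    and "gl_module m U" and "gl_module n V"
  shows "bimodule_equivalent m n N
    (coinvariants m n (E_functor (m + n) N (box m n U V)))
    (direct_sum {0..N} (\<lambda>K.
       hecke_ind m K N (E_functor m K U) (twist (- of_nat m) (E_functor n (N - K) V))))"
proof -
  interpret gl_coinv m n U V N by unfold_locales (use assms in auto)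
  show ?thesis
    using CX_YY unfolding CX_def EB_def B_def YY_def Yc_def[abs_def] XU_def XV_def .
qed
end
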